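(* Let $\Lambda$ be a basic finite dimensional algebra over a field $k$, let $n\ge 1$, and let $P$ be a simple projective $\Lambda$-module satisfying $\operatorname{Ext}^i_\Lambda(D\Lambda,P)=0$ for all $0\le i<n$. Write $\Lambda=P\oplus Q$ as $\Lambda$-modules, and let $T:=(\tau_n^-P)\oplus Q$ be the weak $n$-APR tilting module associated with $P$. Then $T$ is a tilting $\Lambda$-module with $\operatorname{pd}_\Lambda T=n$.
   Context: All modules are finite dimensional left modules, $D=\operatorname{Hom}_k(-,k)$. For $n\ge1$, $\tau_n^- := \operatorname{Tr}\,\Omega^{n-1} D$, where $\operatorname{Tr}$ is the Auslander–Bridger transpose and $\Omega$ the syzygy (computed with minimal projective resolutions). Explicitly, if $0\to P\to I_0\to I_1\to\cdots$ is a minimal injective resolution, then $\tau_n^-P$ is the cokernel of $(DI_{n-1})^*\to (DI_n)^*$, with $(-)^*=\operatorname{Hom}_{\Lambda^{\mathrm{op}}}(-,\Lambda)$. A tilting $\Lambda$-module is a module $T$ of finite projective dimension with $\operatorname{Ext}^i_\Lambda(T,T)=0$ for all $i>0$ and admitting an exact sequence $0\to\Lambda\to T_0\to\cdots\to T_m\to0$ with all $T_i\in\operatorname{add}T$. *)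

theory Defs
  imports "HOL-Library.Extended_Nat" "HOL-Algebra.AbelCoset" "HOL-Algebra.Module"
begin

section \<open>Algebras and left modules\<close>

text \<open>
  A \<open>k\<close>-algebra is a record of type \<^typ>\<open>('k, 'a) module\<close>: its ring fields give the (in general
  noncommutative) ring and \<^const>\<open>smult\<close> gives the \<open>k\<close>-action. A left module over it is a record of type
  \<^typ>\<open>('a, 'm) module\<close>, whose ring multiplication and unit are meaningless and ignored. The library
  locale \<^locale>\<open>module\<close> requires commutative scalars and is therefore used only over the ground field.
\<close>

definition finite_dim :: "'k ring \<Rightarrow> ('k, 'v) module \<Rightarrow> bool" where
  "finite_dim K V \<longleftrightarrow> (\<exists>B. finite B \<and> B \<subseteq> carrier V \<and>
     (\<forall>v\<in>carrier V. \<exists>c\<in>B \<rightarrow> carrier K. v = (\<Oplus>\<^bsub>V\<^esub>b\<in>B. c b \<odot>\<^bsub>V\<^esub> b)))"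

locale fin_dim_algebra = K?: field K + V?: module K A + A?: ring A
  for K :: "'k ring" (structure) and A :: "('k, 'a) module" (structure) +
  assumes smult_mult_left: "\<lbrakk>c \<in> carrier K; x \<in> carrier A; y \<in> carrier A\<rbrakk> \<Longrightarrow>
      (c \<odot>\<^bsub>A\<^esub> x) \<otimes>\<^bsub>A\<^esub> y = c \<odot>\<^bsub>A\<^esub> (x \<otimes>\<^bsub>A\<^esub> y)"
    and smult_mult_right: "\<lbrakk>c \<in> carrier K; x \<in> carrier A; y \<in> carrier A\<rbrakk> \<Longrightarrow>
      x \<otimes>\<^bsub>A\<^esub> (c \<odot>\<^bsub>A\<^esub> y) = c \<odot>\<^bsub>A\<^esub> (x \<otimes>\<^bsub>A\<^esub> y)"
    and finite_dim_algebra: "finite_dim K A"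

definition opp :: "('k, 'a) module \<Rightarrow> ('k, 'a) module" where
  "opp A = A\<lparr>monoid.mult := \<lambda>x y. y \<otimes>\<^bsub>A\<^esub> x\<rparr>"

locale left_module = R?: ring R + M?: abelian_group M
  for R :: "('a, 'x) ring_scheme" (structure) and M :: "('a, 'm) module" (structure) +
  assumes smult_closed: "\<lbrakk>a \<in> carrier R; x \<in> carrier M\<rbrakk> \<Longrightarrow> a \<odot>\<^bsub>M\<^esub> x \<in> carrier M"
    and smult_l_distr: "\<lbrakk>a \<in> carrier R; b \<in> carrier R; x \<in> carrier M\<rbrakk> \<Longrightarrow>
      (a \<oplus>\<^bsub>R\<^esub> b) \<odot>\<^bsub>M\<^esub> x = a \<odot>\<^bsub>M\<^esub> x \<oplus>\<^bsub>M\<^esub> b \<odot>\<^bsub>M\<^esub> x"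
    and smult_r_distr: "\<lbrakk>a \<in> carrier R; x \<in> carrier M; y \<in> carrier M\<rbrakk> \<Longrightarrow>
      a \<odot>\<^bsub>M\<^esub> (x \<oplus>\<^bsub>M\<^esub> y) = a \<odot>\<^bsub>M\<^esub> x \<oplus>\<^bsub>M\<^esub> a \<odot>\<^bsub>M\<^esub> y"
    and smult_assoc: "\<lbrakk>a \<in> carrier R; b \<in> carrier R; x \<in> carrier M\<rbrakk> \<Longrightarrow>
      (a \<otimes>\<^bsub>R\<^esub> b) \<odot>\<^bsub>M\<^esub> x = a \<odot>\<^bsub>M\<^esub> (b \<odot>\<^bsub>M\<^esub> x)"
    and smult_one: "x \<in> carrier M \<Longrightarrow> \<one>\<^bsub>R\<^esub> \<odot>\<^bsub>M\<^esub> x = x"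

definition make_module ::
    "'m set \<Rightarrow> 'm \<Rightarrow> ('m \<Rightarrow> 'm \<Rightarrow> 'm) \<Rightarrow> ('a \<Rightarrow> 'm \<Rightarrow> 'm) \<Rightarrow> ('a, 'm) module" where
  "make_module C z p s =
     \<lparr>carrier = C, monoid.mult = undefined, one = undefined, ring.zero = z, add = p, smult = s\<rparr>"

definition regular :: "('a, 'x) ring_scheme \<Rightarrow> ('a, 'a) module" where
  "regular R = make_module (carrier R) \<zero>\<^bsub>R\<^esub> (add R) (monoid.mult R)"

definition restrict_scalars :: "('k, 'a) module \<Rightarrow> ('a, 'm) module \<Rightarrow> ('k, 'm) module" where
  "restrict_scalars A M =
     make_module (carrier M) \<zero>\<^bsub>M\<^esub> (add M) (\<lambda>c x. (c \<odot>\<^bsub>A\<^esub> \<one>\<^bsub>A\<^esub>) \<odot>\<^bsub>M\<^esub> x)"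

definition fin_dim_module :: "'k ring \<Rightarrow> ('k, 'a) module \<Rightarrow> ('a, 'm) module \<Rightarrow> bool" where
  "fin_dim_module K A M \<longleftrightarrow> left_module A M \<and> finite_dim K (restrict_scalars A M)"

definition zero_module :: "('a, 'm) module \<Rightarrow> bool" where
  "zero_module M \<longleftrightarrow> carrier M = {\<zero>\<^bsub>M\<^esub>}"

text \<open>Homomorphisms are extensional functions, so that equality of homomorphisms is equality in HOL.\<close>

definition mod_hom ::
    "('a, 'x) ring_scheme \<Rightarrow> ('a, 'm) module \<Rightarrow> ('a, 'n) module \<Rightarrow> ('m \<Rightarrow> 'n) set" where
  "mod_hom R M N = {f \<in> carrier M \<rightarrow>\<^sub>E carrier N.
     (\<forall>x\<in>carrier M. \<forall>y\<in>carrier M. f (x \<oplus>\<^bsub>M\<^esub> y) = f x \<oplus>\<^bsub>N\<^esub> f y) \<and>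
     (\<forall>a\<in>carrier R. \<forall>x\<in>carrier M. f (a \<odot>\<^bsub>M\<^esub> x) = a \<odot>\<^bsub>N\<^esub> f x)}"

definition mod_iso ::
    "('a, 'x) ring_scheme \<Rightarrow> ('a, 'm) module \<Rightarrow> ('a, 'n) module \<Rightarrow> bool" where
  "mod_iso R M N \<longleftrightarrow> (\<exists>f\<in>mod_hom R M N. bij_betw f (carrier M) (carrier N))"

definition direct_sum :: "('a, 'm) module \<Rightarrow> ('a, 'n) module \<Rightarrow> ('a, 'm \<times> 'n) module" where
  "direct_sum M N = make_module (carrier M \<times> carrier N) (\<zero>\<^bsub>M\<^esub>, \<zero>\<^bsub>N\<^esub>)
     (\<lambda>(x, y) (x', y'). (x \<oplus>\<^bsub>M\<^esub> x', y \<oplus>\<^bsub>N\<^esub> y')) (\<lambda>a (x, y). (a \<odot>\<^bsub>M\<^esub> x, a \<odot>\<^bsub>N\<^esub> y))"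

definition direct_sum_upto :: "nat \<Rightarrow> (nat \<Rightarrow> ('a, 'm) module) \<Rightarrow> ('a, nat \<Rightarrow> 'm) module" where
  "direct_sum_upto m M = make_module (\<Pi>\<^sub>E i\<in>{..<m}. carrier (M i)) (\<lambda>i\<in>{..<m}. \<zero>\<^bsub>M i\<^esub>)
     (\<lambda>x y. \<lambda>i\<in>{..<m}. x i \<oplus>\<^bsub>M i\<^esub> y i) (\<lambda>a x. \<lambda>i\<in>{..<m}. a \<odot>\<^bsub>M i\<^esub> x i)"

definition quotient_module :: "('a, 'm) module \<Rightarrow> 'm set \<Rightarrow> ('a, 'm set) module" where
  "quotient_module M H = make_module (a_rcosets\<^bsub>M\<^esub> H) H (set_add M)
     (\<lambda>a C. \<Union>x\<in>C. H +>\<^bsub>M\<^esub> (a \<odot>\<^bsub>M\<^esub> x))"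

text \<open>A complement of a summand of \<open>M\<close> can always be taken inside \<open>M\<close>, hence with the same carrier type.\<close>

definition direct_summand ::
    "('a, 'x) ring_scheme \<Rightarrow> ('a, 'n) module \<Rightarrow> ('a, 'm) module \<Rightarrow> bool" where
  "direct_summand R N M \<longleftrightarrow> left_module R N \<and>
     (\<exists>N' :: ('a, 'm) module. left_module R N' \<and> mod_iso R (direct_sum N N') M)"

definition in_add :: "('a, 'x) ring_scheme \<Rightarrow> ('a, 'm) module \<Rightarrow> ('a, 'n) module \<Rightarrow> bool" where
  "in_add R T N \<longleftrightarrow> (\<exists>m. direct_summand R N (direct_sum_upto m (\<lambda>_. T)))"

definition simple_module :: "('a, 'x) ring_scheme \<Rightarrow> ('a, 'm) module \<Rightarrow> bool" where
  "simple_module R M \<longleftrightarrow> left_module R M \<and> \<not> zero_module M \<and>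
     (\<forall>H. submodule H R M \<longrightarrow> H = {\<zero>\<^bsub>M\<^esub>} \<or> H = carrier M)"

definition indecomposable_module :: "('a, 'x) ring_scheme \<Rightarrow> ('a, 'm) module \<Rightarrow> bool" where
  "indecomposable_module R M \<longleftrightarrow> left_module R M \<and> \<not> zero_module M \<and>
     (\<forall>(X :: ('a, 'm) module) (Y :: ('a, 'm) module). left_module R X \<and> left_module R Y \<and>
        mod_iso R (direct_sum X Y) M \<longrightarrow> zero_module X \<or> zero_module Y)"

text \<open>
  Basic: the regular module is a direct sum of pairwise non-isomorphic indecomposable modules. The
  summands are isomorphic to left ideals, so carriers in \<open>'a\<close> suffice.
\<close>

definition basic_algebra :: "('a, 'x) ring_scheme \<Rightarrow> bool" where
  "basic_algebra R \<longleftrightarrow> (\<exists>m (M :: nat \<Rightarrow> ('a, 'a) module).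
     (\<forall>i<m. indecomposable_module R (M i)) \<and>
     (\<forall>i<m. \<forall>j<m. i \<noteq> j \<longrightarrow> \<not> mod_iso R (M i) (M j)) \<and>
     mod_iso R (regular R) (direct_sum_upto m M))"


section \<open>Projective resolutions, projective dimension and Ext\<close>

text \<open>Finitely generated projective modules: direct summands of some \<open>\<Lambda>\<^sup>m\<close>.\<close>

definition projective_module :: "('a, 'x) ring_scheme \<Rightarrow> ('a, 'm) module \<Rightarrow> bool" where
  "projective_module R P \<longleftrightarrow> in_add R (regular R) P"

text \<open>
  \<open>\<dots> \<rightarrow> P 2 \<rightarrow> P 1 \<rightarrow> P 0 \<rightarrow> X \<rightarrow> 0\<close> with differentials \<open>d i : P (i + 1) \<rightarrow> P i\<close> and augmentation \<open>e\<close>.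
  Whenever projective modules are quantified over, carriers in \<^typ>\<open>nat \<Rightarrow> 'a\<close> lose no generality,
  since every finitely generated projective module is isomorphic to a submodule of some \<open>\<Lambda>\<^sup>m\<close>.
\<close>

definition projective_resolution ::
    "('a, 'x) ring_scheme \<Rightarrow> ('a, 'm) module \<Rightarrow> (nat \<Rightarrow> ('a, nat \<Rightarrow> 'a) module) \<Rightarrow>
     (nat \<Rightarrow> (nat \<Rightarrow> 'a) \<Rightarrow> (nat \<Rightarrow> 'a)) \<Rightarrow> ((nat \<Rightarrow> 'a) \<Rightarrow> 'm) \<Rightarrow> bool" where
  "projective_resolution R X P d e \<longleftrightarrow>
     (\<forall>i. projective_module R (P i)) \<and>
     e \<in> mod_hom R (P 0) X \<and> (\<forall>i. d i \<in> mod_hom R (P (Suc i)) (P i)) \<and>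
     e ` carrier (P 0) = carrier X \<and>
     d 0 ` carrier (P (Suc 0)) = a_kernel (P 0) X e \<and>
     (\<forall>i. d (Suc i) ` carrier (P (Suc (Suc i))) = a_kernel (P (Suc i)) (P i) (d i))"

definition proj_dim :: "('a, 'x) ring_scheme \<Rightarrow> ('a, 'm) module \<Rightarrow> enat" where
  "proj_dim R X = Inf {enat n | n. \<exists>P d e. projective_resolution R X P d e \<and>
     (\<forall>i>n. zero_module (P i))}"

definition hom_module ::
    "('k, 'a) module \<Rightarrow> ('a, 'm) module \<Rightarrow> ('a, 'n) module \<Rightarrow> ('k, 'm \<Rightarrow> 'n) module" where
  "hom_module A M N = make_module (mod_hom A M N) (\<lambda>x\<in>carrier M. \<zero>\<^bsub>N\<^esub>)
     (\<lambda>f g. \<lambda>x\<in>carrier M. f x \<oplus>\<^bsub>N\<^esub> g x)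
     (\<lambda>c f. \<lambda>x\<in>carrier M. (c \<odot>\<^bsub>A\<^esub> \<one>\<^bsub>A\<^esub>) \<odot>\<^bsub>N\<^esub> f x)"

definition ext_cocycles where
  "ext_cocycles A P d Y i =
     {f \<in> mod_hom A (P i) Y. \<forall>x\<in>carrier (P (Suc i)). f (d i x) = \<zero>\<^bsub>Y\<^esub>}"

primrec ext_coboundaries where
  "ext_coboundaries A P d Y 0 = {\<lambda>x\<in>carrier (P 0). \<zero>\<^bsub>Y\<^esub>}"
| "ext_coboundaries A P d Y (Suc i) =
     (\<lambda>g. compose (carrier (P (Suc i))) g (d i)) ` mod_hom A (P i) Y"

text \<open>
  \<open>Ext\<^sup>i\<^sub>A(X, Y)\<close> as a \<open>k\<close>-vector space: the \<open>i\<close>-th cohomology of \<open>Hom\<^sub>A(P, Y)\<close> for a chosen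
  projective resolution \<open>P\<close> of \<open>X\<close>.
\<close>

definition Ext :: "('k, 'a) module \<Rightarrow> nat \<Rightarrow> ('a, 'm) module \<Rightarrow> ('a, 'n) module \<Rightarrow>
    ('k, ((nat \<Rightarrow> 'a) \<Rightarrow> 'n) set) module" where
  "Ext A i X Y = (let (P, d, e) = (SOME (P, d, e). projective_resolution A X P d e) in
     quotient_module ((hom_module A (P i) Y)\<lparr>carrier := ext_cocycles A P d Y i\<rparr>)
       (ext_coboundaries A P d Y i))"


section \<open>Tilting modules\<close>

text \<open>
  The finite sequence \<open>0 \<rightarrow> \<Lambda> \<rightarrow> T\<^sub>0 \<rightarrow> \<dots> \<rightarrow> T\<^sub>m \<rightarrow> 0\<close> is continued by zero modules, which makes exactness
  uniform. Members of \<open>add T\<close> are isomorphic to submodules of some \<open>T\<^sup>r\<close>, so carriers in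
  \<^typ>\<open>nat \<Rightarrow> 't\<close> suffice.
\<close>

definition has_add_coresolution :: "('a, 'x) ring_scheme \<Rightarrow> ('a, 't) module \<Rightarrow> bool" where
  "has_add_coresolution R T \<longleftrightarrow>
     (\<exists>m (Ts :: nat \<Rightarrow> ('a, nat \<Rightarrow> 't) module) u g.
        (\<forall>i. in_add R T (Ts i)) \<and> (\<forall>i>m. zero_module (Ts i)) \<and>
        u \<in> mod_hom R (regular R) (Ts 0) \<and> (\<forall>i. g i \<in> mod_hom R (Ts i) (Ts (Suc i))) \<and>
        inj_on u (carrier (regular R)) \<and>
        u ` carrier (regular R) = a_kernel (Ts 0) (Ts (Suc 0)) (g 0) \<and>
        (\<forall>i. g i ` carrier (Ts i) = a_kernel (Ts (Suc i)) (Ts (Suc (Suc i))) (g (Suc i))))"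

definition tilting_module :: "'k ring \<Rightarrow> ('k, 'a) module \<Rightarrow> ('a, 't) module \<Rightarrow> bool" where
  "tilting_module K A T \<longleftrightarrow> fin_dim_module K A T \<and> proj_dim A T \<noteq> \<infinity> \<and>
     (\<forall>i>0. zero_module (Ext A i T T)) \<and> has_add_coresolution A T"


section \<open>Dualities, syzygy, transpose and the higher inverse Auslander--Reiten translation\<close>

text \<open>Right \<open>A\<close>-modules are left \<open>opp A\<close>-modules. \<open>k_dual K A M = Hom\<^sub>k(M, k)\<close> is a left
  \<open>opp A\<close>-module via \<open>(a \<cdot> f)(x) = f (a \<cdot> x)\<close>.\<close>

definition k_dual :: "'k ring \<Rightarrow> ('k, 'a) module \<Rightarrow> ('a, 'm) module \<Rightarrow> ('a, 'm \<Rightarrow> 'k) module" where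
  "k_dual K A M = make_module (mod_hom K (restrict_scalars A M) (regular K))
     (\<lambda>x\<in>carrier M. \<zero>\<^bsub>K\<^esub>) (\<lambda>f g. \<lambda>x\<in>carrier M. f x \<oplus>\<^bsub>K\<^esub> g x)
     (\<lambda>a f. \<lambda>x\<in>carrier M. f (a \<odot>\<^bsub>M\<^esub> x))"

text \<open>\<open>A_dual A M = Hom\<^sub>A(M, A)\<close>, a left \<open>opp A\<close>-module via \<open>(a \<cdot> f)(x) = f x \<cdot> a\<close>.\<close>

definition A_dual :: "('k, 'a) module \<Rightarrow> ('a, 'm) module \<Rightarrow> ('a, 'm \<Rightarrow> 'a) module" where
  "A_dual A M = make_module (mod_hom A M (regular A))
     (\<lambda>x\<in>carrier M. \<zero>\<^bsub>A\<^esub>) (\<lambda>f g. \<lambda>x\<in>carrier M. f x \<oplus>\<^bsub>A\<^esub> g x)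
     (\<lambda>a f. \<lambda>x\<in>carrier M. f x \<otimes>\<^bsub>A\<^esub> a)"

definition is_projective_cover ::
    "('a, 'x) ring_scheme \<Rightarrow> ('a, 'm) module \<Rightarrow> ('a, 'p) module \<Rightarrow> ('p \<Rightarrow> 'm) \<Rightarrow> bool" where
  "is_projective_cover R M P p \<longleftrightarrow> projective_module R P \<and> p \<in> mod_hom R P M \<and>
     p ` carrier P = carrier M \<and>
     (\<forall>H. submodule H R P \<and> H <+>\<^bsub>P\<^esub> a_kernel P M p = carrier P \<longrightarrow> H = carrier P)"

definition projective_cover :: "('a, 'x) ring_scheme \<Rightarrow> ('a, 'm) module \<Rightarrow>
    ('a, nat \<Rightarrow> 'a) module \<times> ((nat \<Rightarrow> 'a) \<Rightarrow> 'm)" where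
  "projective_cover R M = (SOME (P, p). is_projective_cover R M P p)"

definition syzygy :: "('a, 'x) ring_scheme \<Rightarrow> ('a, 'm) module \<Rightarrow> ('a, nat \<Rightarrow> 'a) module" where
  "syzygy R M = (let (P, p) = projective_cover R M in P\<lparr>carrier := a_kernel P M p\<rparr>)"

text \<open>
  \<open>Tr M\<close> is the cokernel of \<open>P\<^sub>0\<^sup>* \<rightarrow> P\<^sub>1\<^sup>*\<close>, where \<open>P\<^sub>1 \<rightarrow> P\<^sub>0 \<rightarrow> M \<rightarrow> 0\<close> is the minimal projective
  presentation obtained from projective covers of \<open>M\<close> and of \<open>\<Omega> M\<close>. It is a left \<open>opp A\<close>-module.
\<close>

definition transpose_module ::
    "('k, 'a) module \<Rightarrow> ('a, 'm) module \<Rightarrow> ('a, ((nat \<Rightarrow> 'a) \<Rightarrow> 'a) set) module" where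
  "transpose_module A M =
     (let (P0, p0) = projective_cover A M; (P1, p1) = projective_cover A (syzygy A M) in
      quotient_module (A_dual A P1)
        ((\<lambda>f. compose (carrier P1) f p1) ` carrier (A_dual A P0)))"

text \<open>
  \<open>\<tau>\<^sub>n\<^sup>- M = Tr \<Omega>\<^sup>n\<^sup>-\<^sup>1 D M\<close> for \<open>n \<ge> 1\<close>. The case distinction is only forced by typing: \<open>\<Omega>\<close> changes the
  carrier type the first time it is applied.
\<close>

definition tau_minus ::
    "'k ring \<Rightarrow> ('k, 'a) module \<Rightarrow> nat \<Rightarrow> ('a, 'm) module \<Rightarrow> ('a, ((nat \<Rightarrow> 'a) \<Rightarrow> 'a) set) module"
  where
  "tau_minus K A n M =
     (case n - 1 of
        0 \<Rightarrow> transpose_module (opp A) (k_dual K A M)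
      | Suc j \<Rightarrow> transpose_module (opp A)
          ((syzygy (opp A) ^^ j) (syzygy (opp A) (k_dual K A M))))"

end

theory Submission
  imports Defs
begin

text \<open>
  Let \<open>R\<close> be a minimal projective resolution of the right module \<open>DP\<close> and \<open>P\<^sub>i = Hom(R\<^sub>i, \<Lambda>)\<close>. Computing
  \<open>Ext\<close> from either variable, in the form of bilinear forms on \<open>Z\<^sub>a \<times> R\<^sub>b\<close> for a projective resolution \<open>Z\<close> of \<open>D\<Lambda>\<close>,
  turns the vanishing of \<open>Ext\<^sup>i(D\<Lambda>, P)\<close> for \<open>i < n\<close> into exactness of \<open>0 \<rightarrow> P\<^sub>0 \<rightarrow> \<dots> \<rightarrow> P\<^sub>n \<rightarrow> \<tau> \<rightarrow> 0\<close>, where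
  \<open>\<tau> = \<tau>\<^sub>n\<^sup>- P\<close>. As \<open>\<Lambda>\<close> is basic, \<open>Hom(Q, P) = 0\<close>, so the idempotent of \<open>Q\<close> annihilates \<open>P\<close> and \<open>DP\<close>, and by minimality
  of \<open>R\<close> one gets \<open>P\<^sub>0 \<cong> P\<close> and \<open>Hom(P\<^sub>i, P) = 0\<close>, that is \<open>P\<^sub>i \<in> add Q\<close>, for \<open>i > 0\<close>. Hence the sequence is
  a projective resolution of \<open>\<tau>\<close>, which cannot be shortened because the identity of \<open>P\<close> does not factor through \<open>P\<^sub>1\<close>,
  and adding \<open>Q = Q\<close> to it gives the coresolution of \<open>\<Lambda>\<close> in \<open>add T\<close>.

  A map \<open>P\<^sub>i \<rightarrow> Q \<subseteq> \<Lambda>\<close> is evaluation at an element of \<open>R\<^sub>i\<close>, so exactness of \<open>R\<close> yields \<open>Ext\<^sup>j(\<tau>, Q) = 0\<close>, hence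
  \<open>Ext\<^sup>j(\<tau>, P\<^sub>i) = 0\<close> for \<open>i, j > 0\<close>. Dimension shifting along the sequence then reduces \<open>Ext\<^sup>j(\<tau>, \<tau>)\<close> to
  \<open>Ext\<^sup>j\<^sup>+\<^sup>n(\<tau>, P\<^sub>0)\<close>, which vanishes since the resolution has length \<open>n\<close>.
\<close>

subsection \<open>Left modules and linear maps\<close>

text \<open>The hypothesis is about Ext(D\<Lambda>, P), computed from a projective resolution of
  D\<Lambda>, whereas \<tau> is built from a resolution of DP. The bridge is the balance of Ext.
  Forms make it symmetric: maps Z_a \<rightarrow> P are forms on Z_a x DP, and maps R_b
  \<rightarrow> \<Lambda> are forms on D\<Lambda> x R_b. Exactness of a resolution passes to forms
  because k is injective over itself and projective modules are flat.

  Simplicity of P makes \<open>e\<^sub>P \<Lambda> e\<^sub>P\<close> a division ring, and Hom(Q, P)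
  = 0 becomes the triangular shape \<open>e\<^sub>Q \<Lambda> e\<^sub>P = 0\<close>. With minimality
  of R these force R_i \<open>e\<^sub>P\<close> = 0 for i > 0, from which Hom(P_i, P) = 0 is read
  off.

  \<open>Ext\<close> selects a resolution and \<open>proj_dim\<close> ranges over resolutions, in
  both cases with one fixed carrier type. Vanishing of Ext is therefore stated for an arbitrary
  given resolution (\<open>ext_zero\<close>) and shown to be independent of it. There is no
  dimension count: chain arguments run on a bounded, strictly monotone measure of
  submodules.\<close>

lemma left_moduleI:
  assumes "ring R"
    and "\<zero>\<^bsub>M\<^esub> \<in> carrier M"
    and "\<And>x y. \<lbrakk>x \<in> carrier M; y \<in> carrier M\<rbrakk> \<Longrightarrow> x \<oplus>\<^bsub>M\<^esub> y \<in> carrier M"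
    and "\<And>x y z. \<lbrakk>x \<in> carrier M; y \<in> carrier M; z \<in> carrier M\<rbrakk> \<Longrightarrow>
      (x \<oplus>\<^bsub>M\<^esub> y) \<oplus>\<^bsub>M\<^esub> z = x \<oplus>\<^bsub>M\<^esub> (y \<oplus>\<^bsub>M\<^esub> z)"
    and "\<And>x y. \<lbrakk>x \<in> carrier M; y \<in> carrier M\<rbrakk> \<Longrightarrow> x \<oplus>\<^bsub>M\<^esub> y = y \<oplus>\<^bsub>M\<^esub> x"
    and "\<And>x. x \<in> carrier M \<Longrightarrow> \<zero>\<^bsub>M\<^esub> \<oplus>\<^bsub>M\<^esub> x = x"
    and "\<And>x. x \<in> carrier M \<Longrightarrow> \<zero>\<^bsub>R\<^esub> \<odot>\<^bsub>M\<^esub> x = \<zero>\<^bsub>M\<^esub>"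
    and "\<And>a x. \<lbrakk>a \<in> carrier R; x \<in> carrier M\<rbrakk> \<Longrightarrow> a \<odot>\<^bsub>M\<^esub> x \<in> carrier M"
    and "\<And>a b x. \<lbrakk>a \<in> carrier R; b \<in> carrier R; x \<in> carrier M\<rbrakk> \<Longrightarrow>
      (a \<oplus>\<^bsub>R\<^esub> b) \<odot>\<^bsub>M\<^esub> x = a \<odot>\<^bsub>M\<^esub> x \<oplus>\<^bsub>M\<^esub> b \<odot>\<^bsub>M\<^esub> x"
    and "\<And>a x y. \<lbrakk>a \<in> carrier R; x \<in> carrier M; y \<in> carrier M\<rbrakk> \<Longrightarrow>
      a \<odot>\<^bsub>M\<^esub> (x \<oplus>\<^bsub>M\<^esub> y) = a \<odot>\<^bsub>M\<^esub> x \<oplus>\<^bsub>M\<^esub> a \<odot>\<^bsub>M\<^esub> y"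
    and "\<And>a b x. \<lbrakk>a \<in> carrier R; b \<in> carrier R; x \<in> carrier M\<rbrakk> \<Longrightarrow>
      (a \<otimes>\<^bsub>R\<^esub> b) \<odot>\<^bsub>M\<^esub> x = a \<odot>\<^bsub>M\<^esub> (b \<odot>\<^bsub>M\<^esub> x)"
    and "\<And>x. x \<in> carrier M \<Longrightarrow> \<one>\<^bsub>R\<^esub> \<odot>\<^bsub>M\<^esub> x = x"
  shows "left_module R M"
proof -
  interpret R: ring R by fact
  have "abelian_group M"
  proof (rule abelian_groupI)
    \<comment> \<open>The additive inverse of x is (-1) x; this is why the rule asks for 0 x = 0 in
      place of inverses.\<close>
    fix x assume x: "x \<in> carrier M"
    have "(\<ominus>\<^bsub>R\<^esub> \<one>\<^bsub>R\<^esub>) \<odot>\<^bsub>M\<^esub> x \<oplus>\<^bsub>M\<^esub> x = ((\<ominus>\<^bsub>R\<^esub> \<one>\<^bsub>R\<^esub>) \<oplus>\<^bsub>R\<^esub> \<one>\<^bsub>R\<^esub>) \<odot>\<^bsub>M\<^esub> x"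
      using x assms by simp
    also have "\<dots> = \<zero>\<^bsub>M\<^esub>" using x assms by (simp add: R.l_neg)
    finally show "\<exists>y\<in>carrier M. y \<oplus>\<^bsub>M\<^esub> x = \<zero>\<^bsub>M\<^esub>" using x assms(8) by blast
  qed (use assms in auto)
  then show ?thesis unfolding left_module_def left_module_axioms_def using assms by auto
qed

context left_module
begin

lemma smult_zero_left [simp]: "x \<in> carrier M \<Longrightarrow> \<zero>\<^bsub>R\<^esub> \<odot>\<^bsub>M\<^esub> x = \<zero>\<^bsub>M\<^esub>"
  by (metis M.add.l_cancel_one M.zero_closed R.r_zero R.zero_closed smult_closed smult_l_distr)

lemma smult_zero_right [simp]: "a \<in> carrier R \<Longrightarrow> a \<odot>\<^bsub>M\<^esub> \<zero>\<^bsub>M\<^esub> = \<zero>\<^bsub>M\<^esub>"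
  by (metis M.add.l_cancel_one M.l_zero M.zero_closed smult_closed smult_r_distr)

lemma smult_minus_one: "x \<in> carrier M \<Longrightarrow> (\<ominus>\<^bsub>R\<^esub> \<one>\<^bsub>R\<^esub>) \<odot>\<^bsub>M\<^esub> x = \<ominus>\<^bsub>M\<^esub> x"
  by (metis M.minus_equality R.add.inv_closed R.l_neg R.one_closed smult_closed smult_l_distr
      smult_one smult_zero_left)

lemma smult_minus_right: "\<lbrakk>a \<in> carrier R; x \<in> carrier M\<rbrakk> \<Longrightarrow> a \<odot>\<^bsub>M\<^esub> (\<ominus>\<^bsub>M\<^esub> x) = \<ominus>\<^bsub>M\<^esub> (a \<odot>\<^bsub>M\<^esub> x)"
  by (metis M.add.inv_closed M.l_neg M.minus_equality smult_closed smult_r_distr smult_zero_right)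

lemma submoduleI':
  assumes "H \<subseteq> carrier M" "\<zero>\<^bsub>M\<^esub> \<in> H" "\<And>x y. \<lbrakk>x \<in> H; y \<in> H\<rbrakk> \<Longrightarrow> x \<oplus>\<^bsub>M\<^esub> y \<in> H"
    "\<And>a x. \<lbrakk>a \<in> carrier R; x \<in> H\<rbrakk> \<Longrightarrow> a \<odot>\<^bsub>M\<^esub> x \<in> H"
  shows "submodule H R M"
proof -
  have "\<ominus>\<^bsub>M\<^esub> x \<in> H" if "x \<in> H" for x
    using that assms smult_minus_one[of x] by (metis R.add.inv_closed R.one_closed subsetD)
  then show ?thesis
    using assms by unfold_locales (auto simp: a_inv_def)
qed

lemma submoduleD:
  assumes "submodule H R M"
  shows "H \<subseteq> carrier M" "\<zero>\<^bsub>M\<^esub> \<in> H" "\<And>x y. \<lbrakk>x \<in> H; y \<in> H\<rbrakk> \<Longrightarrow> x \<oplus>\<^bsub>M\<^esub> y \<in> H"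
    "\<And>a x. \<lbrakk>a \<in> carrier R; x \<in> H\<rbrakk> \<Longrightarrow> a \<odot>\<^bsub>M\<^esub> x \<in> H"
    "\<And>x. x \<in> H \<Longrightarrow> \<ominus>\<^bsub>M\<^esub> x \<in> H" "\<And>x y. \<lbrakk>x \<in> H; y \<in> H\<rbrakk> \<Longrightarrow> x \<ominus>\<^bsub>M\<^esub> y \<in> H"
proof -
  interpret H: submodule H R M by fact
  show 1: "H \<subseteq> carrier M" "\<zero>\<^bsub>M\<^esub> \<in> H" "\<And>x y. \<lbrakk>x \<in> H; y \<in> H\<rbrakk> \<Longrightarrow> x \<oplus>\<^bsub>M\<^esub> y \<in> H"
    "\<And>a x. \<lbrakk>a \<in> carrier R; x \<in> H\<rbrakk> \<Longrightarrow> a \<odot>\<^bsub>M\<^esub> x \<in> H"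
    using H.subset H.one_closed H.m_closed by auto
  show 2: "\<And>x. x \<in> H \<Longrightarrow> \<ominus>\<^bsub>M\<^esub> x \<in> H" using H.m_inv_closed by (simp add: a_inv_def)
  show "\<And>x y. \<lbrakk>x \<in> H; y \<in> H\<rbrakk> \<Longrightarrow> x \<ominus>\<^bsub>M\<^esub> y \<in> H" using 1 2 by (simp add: a_minus_def)
qed

lemma left_module_sub:
  assumes "submodule H R M" shows "left_module R (M\<lparr>carrier := H\<rparr>)"
  using submoduleD[OF assms]
  by (intro left_moduleI)
    (auto simp: subset_iff M.a_assoc smult_l_distr smult_r_distr smult_assoc smult_one R.ring_axioms
      intro: M.a_comm)

lemma submodule_carrier: "submodule (carrier M) R M"
  by (rule submoduleI') (auto simp: smult_closed)

lemma submodule_zero: "submodule {\<zero>\<^bsub>M\<^esub>} R M"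
  by (rule submoduleI') auto

lemma submodule_Inter:
  assumes "\<And>H. H \<in> \<H> \<Longrightarrow> submodule H R M" "\<H> \<noteq> {}"
  shows "submodule (\<Inter>\<H>) R M"
proof (rule submoduleI')
  show "\<Inter>\<H> \<subseteq> carrier M" using submoduleD(1)[OF assms(1)] assms(2) by blast
qed (auto simp: submoduleD[OF assms(1)])

end

lemma make_module_simps [simp]:
  "carrier (make_module C z p s) = C" "\<zero>\<^bsub>make_module C z p s\<^esub> = z"
  "add (make_module C z p s) = p" "smult (make_module C z p s) = s"
  by (simp_all add: make_module_def)

lemma left_moduleD:
  assumes "left_module R M" shows "ring R" "abelian_group M"
  using assms by (simp_all add: left_module_def)

lemma left_module_regular: "ring R \<Longrightarrow> left_module R (regular R)"
proof -
  assume "ring R"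
  then interpret ring R .
  show ?thesis
    by (rule left_moduleI) (auto simp: regular_def add.m_assoc m_assoc l_distr r_distr \<open>ring R\<close> intro: a_comm)
qed

lemma left_module_direct_sum:
  assumes "left_module R M" "left_module R N" shows "left_module R (direct_sum M N)"
proof -
  interpret M: left_module R M by fact
  interpret N: left_module R N by fact
  show ?thesis
    using left_moduleD(1)[OF assms(1)]
    by (intro left_moduleI)
      (auto simp: direct_sum_def M.M.a_assoc N.M.a_assoc M.smult_closed N.smult_closed M.smult_l_distr N.smult_l_distr
        M.smult_r_distr N.smult_r_distr M.smult_assoc N.smult_assoc M.smult_one N.smult_one left_moduleD
        assms(1) intro: M.M.a_comm N.M.a_comm)
qed

lemma left_module_direct_sum_upto:
  assumes "\<And>i. i < m \<Longrightarrow> left_module R (M i)" "ring R" shows "left_module R (direct_sum_upto m M)"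
proof -
  note d = direct_sum_upto_def
  have ag: "abelian_group (M i)" if "i < m" for i using assms(1) that left_module_def by blast
  note ag' = abelian_group.axioms(1)[OF ag]
  note l = left_module.smult_closed[OF assms(1)] left_module.smult_l_distr[OF assms(1)]
    left_module.smult_r_distr[OF assms(1)] left_module.smult_assoc[OF assms(1)]
    left_module.smult_one[OF assms(1)] left_module.smult_zero_left[OF assms(1)]
    abelian_monoid.a_closed[OF ag'] abelian_monoid.a_assoc[OF ag'] abelian_monoid.zero_closed[OF ag']
    abelian_monoid.l_zero[OF ag']
  have p: "x i \<in> carrier (M i)" if "x \<in> (\<Pi>\<^sub>E i\<in>{..<m}. carrier (M i))" "i < m" for x i
    using that by (auto simp: PiE_iff)
  have x: "(\<lambda>i\<in>{..<m}. x i) = x" if "x \<in> (\<Pi>\<^sub>E i\<in>{..<m}. carrier (M i))" for x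
    using that by (auto simp: PiE_def extensional_restrict)
  have z: "(\<lambda>i\<in>{..<m}. \<zero>\<^bsub>M i\<^esub> \<oplus>\<^bsub>M i\<^esub> x i) = x" "(\<lambda>i\<in>{..<m}. \<one>\<^bsub>R\<^esub> \<odot>\<^bsub>M i\<^esub> x i) = x"
    if "x \<in> (\<Pi>\<^sub>E i\<in>{..<m}. carrier (M i))" for x
    by (subst (2) x[OF that, symmetric], rule restrict_ext, simp add: l p[OF that])+
  show ?thesis
    by (rule left_moduleI)
      (auto simp: d l p z \<open>ring R\<close> ring.ring_simprules[OF \<open>ring R\<close>] intro!: restrict_ext
        intro: abelian_monoid.a_comm[OF ag'] cong: restrict_cong)
qed

text \<open>Members of \<open>mod_hom\<close> are extensional, which composites and pointwise sums
  written as lambda terms are not. Here values outside the carrier are arbitrary;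
  \<open>mod_hom_lin\<close> and \<open>lin_restrict\<close> pass between the two notions.\<close>

definition lin where
  "lin R M N f \<longleftrightarrow> (\<forall>x\<in>carrier M. f x \<in> carrier N) \<and>
     (\<forall>x\<in>carrier M. \<forall>y\<in>carrier M. f (x \<oplus>\<^bsub>M\<^esub> y) = f x \<oplus>\<^bsub>N\<^esub> f y) \<and>
     (\<forall>a\<in>carrier R. \<forall>x\<in>carrier M. f (a \<odot>\<^bsub>M\<^esub> x) = a \<odot>\<^bsub>N\<^esub> f x)"

lemma linI:
  assumes "\<And>x. x \<in> carrier M \<Longrightarrow> f x \<in> carrier N"
    "\<And>x y. \<lbrakk>x \<in> carrier M; y \<in> carrier M\<rbrakk> \<Longrightarrow> f (x \<oplus>\<^bsub>M\<^esub> y) = f x \<oplus>\<^bsub>N\<^esub> f y"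
    "\<And>a x. \<lbrakk>a \<in> carrier R; x \<in> carrier M\<rbrakk> \<Longrightarrow> f (a \<odot>\<^bsub>M\<^esub> x) = a \<odot>\<^bsub>N\<^esub> f x"
  shows "lin R M N f"
  using assms by (simp add: lin_def)

lemma lin_closed: "lin R M N f \<Longrightarrow> x \<in> carrier M \<Longrightarrow> f x \<in> carrier N"
  and lin_add: "lin R M N f \<Longrightarrow> x \<in> carrier M \<Longrightarrow> y \<in> carrier M \<Longrightarrow> f (x \<oplus>\<^bsub>M\<^esub> y) = f x \<oplus>\<^bsub>N\<^esub> f y"
  and lin_smult: "lin R M N f \<Longrightarrow> a \<in> carrier R \<Longrightarrow> x \<in> carrier M \<Longrightarrow> f (a \<odot>\<^bsub>M\<^esub> x) = a \<odot>\<^bsub>N\<^esub> f x"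
  by (simp_all add: lin_def)

lemma lin_zero:
  assumes "lin R M N f" "left_module R M" "left_module R N" shows "f \<zero>\<^bsub>M\<^esub> = \<zero>\<^bsub>N\<^esub>"
proof -
  interpret M: left_module R M by fact
  interpret N: left_module R N by fact
  have "f (\<zero>\<^bsub>R\<^esub> \<odot>\<^bsub>M\<^esub> \<zero>\<^bsub>M\<^esub>) = \<zero>\<^bsub>R\<^esub> \<odot>\<^bsub>N\<^esub> f \<zero>\<^bsub>M\<^esub>"
    by (rule lin_smult[OF assms(1)]) auto
  then show ?thesis using lin_closed[OF assms(1), of "\<zero>\<^bsub>M\<^esub>"] by simp
qed

lemma lin_neg:
  assumes "lin R M N f" "left_module R M" "left_module R N" "x \<in> carrier M"
  shows "f (\<ominus>\<^bsub>M\<^esub> x) = \<ominus>\<^bsub>N\<^esub> f x"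
proof -
  interpret M: left_module R M by fact
  interpret N: left_module R N by fact
  show ?thesis
    using lin_smult[OF assms(1), of "\<ominus>\<^bsub>R\<^esub> \<one>\<^bsub>R\<^esub>" x] lin_closed[OF assms(1,4)] assms(4)
    by (simp add: M.smult_minus_one N.smult_minus_one)
qed

lemma lin_minus:
  assumes "lin R M N f" "left_module R M" "left_module R N" "x \<in> carrier M" "y \<in> carrier M"
  shows "f (x \<ominus>\<^bsub>M\<^esub> y) = f x \<ominus>\<^bsub>N\<^esub> f y"
proof -
  interpret M: left_module R M by fact
  show ?thesis using assms lin_add[OF assms(1), of x "\<ominus>\<^bsub>M\<^esub> y"] lin_neg[OF assms(1-3,5)] by (simp add: a_minus_def)
qed

lemma lin_comp: "lin R M N f \<Longrightarrow> lin R N L g \<Longrightarrow> lin R M L (\<lambda>x. g (f x))"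
  by (simp add: lin_def)

lemma lin_id: "lin R M M (\<lambda>x. x)"
  by (simp add: lin_def)

lemma lin_zero_map: "left_module R N \<Longrightarrow> lin R M N (\<lambda>x. \<zero>\<^bsub>N\<^esub>)"
proof -
  assume "left_module R N"
  then interpret left_module R N .
  show ?thesis by (rule linI) auto
qed

lemma lin_add_map:
  assumes "lin R M N f" "lin R M N g" "left_module R N" shows "lin R M N (\<lambda>x. f x \<oplus>\<^bsub>N\<^esub> g x)"
proof -
  interpret N: left_module R N by fact
  show ?thesis using assms(1,2)
    by (intro linI) (auto simp: lin_def N.smult_r_distr N.M.a_ac)
qed

lemma lin_minus_map:
  assumes "lin R M N f" "lin R M N g" "left_module R N" shows "lin R M N (\<lambda>x. f x \<ominus>\<^bsub>N\<^esub> g x)"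
proof -
  interpret N: left_module R N by fact
  show ?thesis using assms(1,2)
    by (intro linI) (auto simp: lin_def N.smult_r_distr N.M.a_ac N.M.minus_add N.smult_minus_right a_minus_def)
qed

lemma mod_hom_lin: "f \<in> mod_hom R M N \<Longrightarrow> lin R M N f"
  by (auto simp: mod_hom_def lin_def)

lemma lin_restrict: "lin R M N f \<Longrightarrow> left_module R M \<Longrightarrow> restrict f (carrier M) \<in> mod_hom R M N"
proof -
  assume "left_module R M" "lin R M N f"
  then interpret left_module R M by simp
  show ?thesis using \<open>lin R M N f\<close> by (auto simp: mod_hom_def lin_def smult_closed)
qed

lemma mod_hom_eqI:
  "f \<in> mod_hom R M N \<Longrightarrow> g \<in> mod_hom R M N \<Longrightarrow> (\<And>x. x \<in> carrier M \<Longrightarrow> f x = g x) \<Longrightarrow> f = g"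
  by (auto simp: mod_hom_def intro: PiE_ext)

lemma submodule_vimage:
  assumes "lin R M N f" "left_module R M" "left_module R N" "submodule H R N"
  shows "submodule {x \<in> carrier M. f x \<in> H} R M"
proof -
  interpret M: left_module R M by fact
  interpret N: left_module R N by fact
  show ?thesis using N.submoduleD[OF assms(4)] lin_zero[OF assms(1-3)] assms(1)
    by (intro M.submoduleI') (auto simp: lin_def M.smult_closed)
qed

lemma submodule_kernel:
  assumes "lin R M N f" "left_module R M" "left_module R N"
  shows "submodule {x \<in> carrier M. f x = \<zero>\<^bsub>N\<^esub>} R M"
  using submodule_vimage[OF assms left_module.submodule_zero[OF assms(3)]] by simp

lemma submodule_image:
  assumes "lin R M N f" "left_module R M" "left_module R N" "submodule H R M"
  shows "submodule (f ` H) R N"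
proof -
  interpret M: left_module R M by fact
  interpret N: left_module R N by fact
  note H = M.submoduleD[OF assms(4)]
  show ?thesis
  proof (rule N.submoduleI')
    show "\<zero>\<^bsub>N\<^esub> \<in> f ` H" using lin_zero[OF assms(1-3)] H(2) by (metis imageI)
    show "x \<oplus>\<^bsub>N\<^esub> y \<in> f ` H" if "x \<in> f ` H" "y \<in> f ` H" for x y
      using that lin_add[OF assms(1)] H by (smt (verit) image_iff subset_iff)
    show "a \<odot>\<^bsub>N\<^esub> x \<in> f ` H" if "a \<in> carrier R" "x \<in> f ` H" for a x
      using that lin_smult[OF assms(1)] H by (smt (verit) image_iff subset_iff)
  qed (use H lin_closed[OF assms(1)] in auto)
qed

text \<open>Recursion on the length gives equations that hold for every f, whereas those of
  \<open>finsum\<close> are tied to finite index sets and to functions into the carrier.\<close>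

primrec msum :: "('a, 'm) module \<Rightarrow> (nat \<Rightarrow> 'm) \<Rightarrow> nat \<Rightarrow> 'm" where
  "msum M f 0 = \<zero>\<^bsub>M\<^esub>"
| "msum M f (Suc n) = msum M f n \<oplus>\<^bsub>M\<^esub> f n"

lemma msum_cong: "(\<And>i. i < n \<Longrightarrow> f i = g i) \<Longrightarrow> msum M f n = msum M g n"
  by (induct n) auto

lemma msum_mem:
  "left_module R M \<Longrightarrow> submodule H R M \<Longrightarrow> (\<And>i. i < n \<Longrightarrow> f i \<in> H) \<Longrightarrow> msum M f n \<in> H"
  by (induct n) (auto simp: left_module.submoduleD)

lemma msum_closed:
  assumes "left_module R M" "\<And>i. i < n \<Longrightarrow> f i \<in> carrier M" shows "msum M f n \<in> carrier M"
  using msum_mem[OF assms(1) left_module.submodule_carrier[OF assms(1)]] assms(2) by blast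

lemma lin_msum:
  assumes "lin R M N h" "left_module R M" "left_module R N" "\<And>i. i < n \<Longrightarrow> f i \<in> carrier M"
  shows "h (msum M f n) = msum N (\<lambda>i. h (f i)) n"
  using assms(4)
proof (induct n)
  case 0 then show ?case by (simp add: lin_zero[OF assms(1-3)])
next
  case (Suc n)
  then show ?case
    using lin_add[OF assms(1), of "msum M f n" "f n"] msum_closed[OF assms(2), of n f] by simp
qed

lemma msum_delta:
  assumes "left_module R M" "x \<in> carrier M"
  shows "msum M (\<lambda>i. if i = j then x else \<zero>\<^bsub>M\<^esub>) n = (if j < n then x else \<zero>\<^bsub>M\<^esub>)"
proof -
  interpret M: left_module R M by fact
  show ?thesis using assms(2) by (induct n) auto
qed

lemma msum_add_distrib:
  assumes "left_module R M" "\<And>i. i < n \<Longrightarrow> f i \<in> carrier M" "\<And>i. i < n \<Longrightarrow> g i \<in> carrier M"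
  shows "msum M (\<lambda>i. f i \<oplus>\<^bsub>M\<^esub> g i) n = msum M f n \<oplus>\<^bsub>M\<^esub> msum M g n"
proof -
  interpret M: left_module R M by fact
  show ?thesis using assms(2,3)
  proof (induct n)
    case (Suc n)
    then show ?case using msum_closed[OF assms(1), of n f] msum_closed[OF assms(1), of n g]
      by (simp add: M.M.a_ac)
  qed simp
qed

lemma lin_msum_map:
  assumes "\<And>i. i < n \<Longrightarrow> lin R M N (f i)" "left_module R N"
  shows "lin R M N (\<lambda>x. msum N (\<lambda>i. f i x) n)"
  using assms(1) by (induct n) (auto intro: lin_zero_map[OF assms(2)] lin_add_map[OF _ _ assms(2)])

lemma direct_sum_upto_simps:
  "carrier (direct_sum_upto m M) = (\<Pi>\<^sub>E i\<in>{..<m}. carrier (M i))"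
  "\<zero>\<^bsub>direct_sum_upto m M\<^esub> = (\<lambda>i\<in>{..<m}. \<zero>\<^bsub>M i\<^esub>)"
  "x \<oplus>\<^bsub>direct_sum_upto m M\<^esub> y = (\<lambda>i\<in>{..<m}. x i \<oplus>\<^bsub>M i\<^esub> y i)"
  "a \<odot>\<^bsub>direct_sum_upto m M\<^esub> x = (\<lambda>i\<in>{..<m}. a \<odot>\<^bsub>M i\<^esub> x i)"
  by (simp_all add: direct_sum_upto_def)

lemma direct_sum_simps:
  "carrier (direct_sum M N) = carrier M \<times> carrier N"
  "\<zero>\<^bsub>direct_sum M N\<^esub> = (\<zero>\<^bsub>M\<^esub>, \<zero>\<^bsub>N\<^esub>)"
  "x \<oplus>\<^bsub>direct_sum M N\<^esub> y = (fst x \<oplus>\<^bsub>M\<^esub> fst y, snd x \<oplus>\<^bsub>N\<^esub> snd y)"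
  "a \<odot>\<^bsub>direct_sum M N\<^esub> x = (a \<odot>\<^bsub>M\<^esub> fst x, a \<odot>\<^bsub>N\<^esub> snd x)"
  by (simp_all add: direct_sum_def case_prod_beta)

lemma mod_iso_lin:
  assumes "mod_iso R M N"
  obtains f where "lin R M N f" "bij_betw f (carrier M) (carrier N)"
  using assms unfolding mod_iso_def by (meson mod_hom_lin)

lemma lin_mod_iso:
  assumes "lin R M N f" "bij_betw f (carrier M) (carrier N)" "left_module R M"
  shows "mod_iso R M N"
proof -
  have "bij_betw (restrict f (carrier M)) (carrier M) (carrier N)"
    using assms(2) by (subst bij_betw_cong[of _ _ f]) auto
  then show ?thesis using lin_restrict[OF assms(1,3)] unfolding mod_iso_def by blast
qed

lemma lin_inv_into:
  assumes "lin R M N f" "bij_betw f (carrier M) (carrier N)" "left_module R M"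
  shows "lin R N M (inv_into (carrier M) f)"
proof -
  interpret M: left_module R M by fact
  let ?g = "inv_into (carrier M) f"
  have g: "?g y \<in> carrier M" "f (?g y) = y" if "y \<in> carrier N" for y
    using that assms(2) by (auto simp: bij_betw_def inv_into_into f_inv_into_f)
  have inj: "\<And>x. x \<in> carrier M \<Longrightarrow> ?g (f x) = x" using assms(2) by (simp add: bij_betw_def)
  show ?thesis
  proof (rule linI)
    fix x y assume "x \<in> carrier N" "y \<in> carrier N"
    then show "?g (x \<oplus>\<^bsub>N\<^esub> y) = ?g x \<oplus>\<^bsub>M\<^esub> ?g y"
      using lin_add[OF assms(1), of "?g x" "?g y"] g inj[of "?g x \<oplus>\<^bsub>M\<^esub> ?g y"] by simp
  next
    fix a x assume "a \<in> carrier R" "x \<in> carrier N"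
    then show "?g (a \<odot>\<^bsub>N\<^esub> x) = a \<odot>\<^bsub>M\<^esub> ?g x"
      using lin_smult[OF assms(1), of a "?g x"] g inj[of "a \<odot>\<^bsub>M\<^esub> ?g x"] by (simp add: M.smult_closed)
  qed (use g in auto)
qed

subsection \<open>The modules in \<open>add T\<close> and projective modules\<close>

lemma msum_append:
  assumes "left_module R M" "\<And>i. i < m + n \<Longrightarrow> f i \<in> carrier M"
  shows "msum M f (m + n) = msum M f m \<oplus>\<^bsub>M\<^esub> msum M (\<lambda>i. f (m + i)) n"
proof -
  interpret M: left_module R M by fact
  show ?thesis using assms(2)
  proof (induct n)
    case 0 then show ?case using msum_closed[OF assms(1), of m f] by simp
  next
    case (Suc n)
    then show ?case
      using msum_closed[OF assms(1), of m f] msum_closed[OF assms(1), of n "\<lambda>i. f (m + i)"]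
      by (simp add: M.M.a_assoc)
  qed
qed

lemma msum_zero: "left_module R M \<Longrightarrow> msum M (\<lambda>i. \<zero>\<^bsub>M\<^esub>) n = \<zero>\<^bsub>M\<^esub>"
proof -
  assume "left_module R M"
  then interpret M: left_module R M .
  show ?thesis by (induct n) auto
qed

text \<open>For \<open>j \<ge> m\<close> this is the zero map, so that linearity holds without a
  bound on j.\<close>

definition upto_inj :: "nat \<Rightarrow> (nat \<Rightarrow> ('a, 'm) module) \<Rightarrow> nat \<Rightarrow> 'm \<Rightarrow> (nat \<Rightarrow> 'm)" where
  "upto_inj m M j t = (\<lambda>i\<in>{..<m}. if i = j then t else \<zero>\<^bsub>M i\<^esub>)"

abbreviation pow_module :: "nat \<Rightarrow> ('a, 'm) module \<Rightarrow> ('a, nat \<Rightarrow> 'm) module" where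
  "pow_module m T \<equiv> direct_sum_upto m (\<lambda>_. T)"

lemma left_module_pow: "left_module R T \<Longrightarrow> left_module R (pow_module m T)"
  by (rule left_module_direct_sum_upto) (auto simp: left_moduleD)

lemma lin_upto_inj:
  assumes M: "\<And>i. i < m \<Longrightarrow> left_module R (M i)" shows "lin R (M j) (direct_sum_upto m M) (upto_inj m M j)"
proof -
  have z: "\<zero>\<^bsub>M i\<^esub> \<in> carrier (M i)" "\<zero>\<^bsub>M i\<^esub> \<oplus>\<^bsub>M i\<^esub> \<zero>\<^bsub>M i\<^esub> = \<zero>\<^bsub>M i\<^esub>" "a \<in> carrier R \<Longrightarrow> a \<odot>\<^bsub>M i\<^esub> \<zero>\<^bsub>M i\<^esub> = \<zero>\<^bsub>M i\<^esub>"
    if "i < m" for i a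
  proof -
    interpret left_module R "M i" by (rule M[OF that])
    show "\<zero>\<^bsub>M i\<^esub> \<in> carrier (M i)" "\<zero>\<^bsub>M i\<^esub> \<oplus>\<^bsub>M i\<^esub> \<zero>\<^bsub>M i\<^esub> = \<zero>\<^bsub>M i\<^esub>" "a \<in> carrier R \<Longrightarrow> a \<odot>\<^bsub>M i\<^esub> \<zero>\<^bsub>M i\<^esub> = \<zero>\<^bsub>M i\<^esub>"
      by simp_all
  qed
  show ?thesis by (rule linI) (auto simp: direct_sum_upto_simps upto_inj_def fun_eq_iff z)
qed

lemma lin_proj: "j < m \<Longrightarrow> lin R (direct_sum_upto m M) (M j) (\<lambda>x. x j)"
  by (rule linI) (auto simp: direct_sum_upto_simps)

lemma msum_upto_component:
  "i < m \<Longrightarrow> msum (direct_sum_upto m M) f n i = msum (M i) (\<lambda>j. f j i) n"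
  by (induct n) (auto simp: direct_sum_upto_simps)

lemma upto_decomp:
  assumes M: "\<And>i. i < m \<Longrightarrow> left_module R (M i)" and R: "ring R" and x: "x \<in> carrier (direct_sum_upto m M)"
  shows "msum (direct_sum_upto m M) (\<lambda>j. upto_inj m M j (x j)) m = x"
proof -
  have P: "left_module R (direct_sum_upto m M)" by (rule left_module_direct_sum_upto[OF M R])
  have xj: "x j \<in> carrier (M j)" if "j < m" for j using lin_closed[OF lin_proj x] that by simp
  have c: "msum (direct_sum_upto m M) (\<lambda>j. upto_inj m M j (x j)) m \<in> carrier (direct_sum_upto m M)"
    by (rule msum_closed[OF P]) (rule lin_closed[OF lin_upto_inj[OF M] xj])
  show ?thesis
  proof (rule PiE_ext)
    fix i assume i: "i \<in> {..<m}"
    have "msum (direct_sum_upto m M) (\<lambda>j. upto_inj m M j (x j)) m i = msum (M i) (\<lambda>j. if j = i then x i else \<zero>\<^bsub>M i\<^esub>) m"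
      using i by (subst msum_upto_component) (auto simp: upto_inj_def intro!: msum_cong)
    then show "msum (direct_sum_upto m M) (\<lambda>j. upto_inj m M j (x j)) m i = x i"
      using i xj msum_delta[OF M] by simp
  qed (use c x in \<open>simp_all add: direct_sum_upto_simps\<close>)
qed

lemmas pow_decomp = upto_decomp[where M = "\<lambda>_. T" for T, OF _ left_moduleD(1)]

text \<open>The identity of N factors through \<open>T\<^sup>m\<close>, written out in components.
  In this form membership in add T mentions no complement and hence no carrier type for one.\<close>

definition add_data where
  "add_data R T N m \<phi> \<psi> \<longleftrightarrow> (\<forall>j<m. lin R N T (\<phi> j) \<and> lin R T N (\<psi> j)) \<and>
     (\<forall>x\<in>carrier N. msum N (\<lambda>j. \<psi> j (\<phi> j x)) m = x)"

lemma lin_tuple: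
  assumes "\<And>j. j < m \<Longrightarrow> lin R N T (\<phi> j)"
  shows "lin R N (pow_module m T) (\<lambda>x. \<lambda>i\<in>{..<m}. \<phi> i x)"
  using assms by (intro linI) (auto simp: direct_sum_upto_simps lin_def intro!: restrict_ext)

lemma in_add_iff:
  fixes T :: "('a, 't) module" and N :: "('a, 'n) module"
  assumes T: "left_module R T"
  shows "in_add R T N \<longleftrightarrow> left_module R N \<and> (\<exists>m \<phi> \<psi>. add_data R T N m \<phi> \<psi>)"
proof
  assume "in_add R T N"
  then obtain m and N' :: "('a, nat \<Rightarrow> 't) module" where N: "left_module R N" "left_module R N'"
    and iso: "mod_iso R (direct_sum N N') (pow_module m T)"
    unfolding in_add_def direct_summand_def by blast
  interpret N: left_module R N by fact
  interpret N': left_module R N' by fact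
  have D: "left_module R (direct_sum N N')" by (rule left_module_direct_sum[OF N])
  have P: "left_module R (pow_module m T)" by (rule left_module_pow) fact
  from mod_iso_lin[OF iso] obtain f where f: "lin R (direct_sum N N') (pow_module m T) f"
    and bij: "bij_betw f (carrier (direct_sum N N')) (carrier (pow_module m T))" .
  define g where "g = inv_into (carrier (direct_sum N N')) f"
  have g: "lin R (pow_module m T) (direct_sum N N') g" unfolding g_def by (rule lin_inv_into[OF f bij D])
  have gf: "g (f z) = z" if "z \<in> carrier (direct_sum N N')" for z
    using bij that by (simp add: g_def bij_betw_def)
  define s where "s x = fst (g x)" for x
  have s: "lin R (pow_module m T) N s"
    unfolding s_def by (rule lin_comp[OF g]) (rule linI, auto simp: direct_sum_simps)
  have i: "lin R N (pow_module m T) (\<lambda>x. f (x, \<zero>\<^bsub>N'\<^esub>))"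
    by (rule lin_comp[OF _ f]) (rule linI, auto simp: direct_sum_simps)
  have "add_data R T N m (\<lambda>j x. f (x, \<zero>\<^bsub>N'\<^esub>) j) (\<lambda>j t. s (upto_inj m (\<lambda>_. T) j t))"
    unfolding add_data_def
  proof (intro conjI allI impI ballI)
    fix j assume j: "j < m"
    show "lin R N T (\<lambda>x. f (x, \<zero>\<^bsub>N'\<^esub>) j)" by (rule lin_comp[OF i lin_proj[OF j]])
    show "lin R T N (\<lambda>t. s (upto_inj m (\<lambda>_. T) j t))" by (rule lin_comp[OF lin_upto_inj[OF T] s])
  next
    fix x assume x: "x \<in> carrier N"
    let ?y = "f (x, \<zero>\<^bsub>N'\<^esub>)"
    have y: "?y \<in> carrier (pow_module m T)" by (rule lin_closed[OF i x])
    have "msum N (\<lambda>j. s (upto_inj m (\<lambda>_. T) j (?y j))) m = s (msum (pow_module m T) (\<lambda>j. upto_inj m (\<lambda>_. T) j (?y j)) m)"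
      by (rule lin_msum[OF s P N(1), symmetric])
        (rule lin_closed[OF lin_upto_inj[OF T]], rule lin_closed[OF lin_proj y])
    also have "\<dots> = s ?y" by (simp add: pow_decomp[OF T T y])
    also have "\<dots> = x" using gf[of "(x, \<zero>\<^bsub>N'\<^esub>)"] x by (simp add: s_def direct_sum_simps)
    finally show "msum N (\<lambda>j. s (upto_inj m (\<lambda>_. T) j (?y j))) m = x" .
  qed
  then show "left_module R N \<and> (\<exists>m \<phi> \<psi>. add_data R T N m \<phi> \<psi>)" using N(1) by blast
next
  assume "left_module R N \<and> (\<exists>m \<phi> \<psi>. add_data R T N m \<phi> \<psi>)"
  then obtain m \<phi> \<psi> where N: "left_module R N" and "add_data R T N m \<phi> \<psi>" by blast
  then have lin: "\<And>j. j < m \<Longrightarrow> lin R N T (\<phi> j)" "\<And>j. j < m \<Longrightarrow> lin R T N (\<psi> j)"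
    and sum: "\<And>x. x \<in> carrier N \<Longrightarrow> msum N (\<lambda>j. \<psi> j (\<phi> j x)) m = x"
    unfolding add_data_def by auto
  interpret N: left_module R N by fact
  let ?P = "pow_module m T"
  have P: "left_module R ?P" by (rule left_module_pow) fact
  interpret P: left_module R ?P by fact
  define r where "r x = (\<lambda>i\<in>{..<m}. \<phi> i x)" for x
  define s where "s y = msum N (\<lambda>j. \<psi> j (y j)) m" for y
  have r: "lin R N ?P r" unfolding r_def by (rule lin_tuple) (rule lin(1))
  have s: "lin R ?P N s" unfolding s_def
    by (rule lin_msum_map[OF _ N]) (rule lin_comp[OF lin_proj lin(2)])
  have sr: "s (r x) = x" if "x \<in> carrier N" for x
    using sum[OF that] unfolding s_def r_def by (simp cong: msum_cong)
  \<comment> \<open>The complement is the kernel of the retraction s. It lies inside the power of T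
    and so has the carrier type that \<open>direct_summand\<close> prescribes.\<close>
  define S where "S = {y \<in> carrier ?P. s y = \<zero>\<^bsub>N\<^esub>}"
  have S: "submodule S R ?P" unfolding S_def by (rule submodule_kernel[OF s P N])
  let ?N' = "?P\<lparr>carrier := S\<rparr>"
  have N': "left_module R ?N'" by (rule P.left_module_sub[OF S])
  have D: "left_module R (direct_sum N ?N')" by (rule left_module_direct_sum[OF N N'])
  let ?f = "\<lambda>z. r (fst z) \<oplus>\<^bsub>?P\<^esub> snd z"
  have f: "lin R (direct_sum N ?N') ?P ?f"
    by (rule lin_add_map[OF _ _ P], rule lin_comp[OF _ r]; rule linI)
      (auto simp: direct_sum_simps S_def)
  have sm: "s (x \<oplus>\<^bsub>?P\<^esub> y) = s x \<oplus>\<^bsub>N\<^esub> s y" "s (x \<ominus>\<^bsub>?P\<^esub> y) = s x \<ominus>\<^bsub>N\<^esub> s y"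
    if "x \<in> carrier ?P" "y \<in> carrier ?P" for x y
    using that lin_add[OF s] lin_minus[OF s P N] by auto
  note rc = lin_closed[OF r] and sc = lin_closed[OF s]
  have "bij_betw ?f (carrier (direct_sum N ?N')) (carrier ?P)"
  proof (rule bij_betwI[where g = "\<lambda>y. (s y, y \<ominus>\<^bsub>?P\<^esub> r (s y))"])
    show "?f \<in> carrier (direct_sum N ?N') \<rightarrow> carrier ?P" using lin_closed[OF f] by blast
    show "(\<lambda>y. (s y, y \<ominus>\<^bsub>?P\<^esub> r (s y))) \<in> carrier ?P \<rightarrow> carrier (direct_sum N ?N')"
      by (auto simp: direct_sum_simps S_def sc rc sm sr N.M.r_neg a_minus_def[of N])
    fix z assume "z \<in> carrier (direct_sum N ?N')"
    then show "(s (?f z), ?f z \<ominus>\<^bsub>?P\<^esub> r (s (?f z))) = z"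
      by (auto simp: direct_sum_simps(1) S_def sm rc sr a_minus_def P.M.a_ac P.M.r_neg2 P.M.r_neg)
  next
    fix y assume "y \<in> carrier ?P"
    then show "?f (s y, y \<ominus>\<^bsub>?P\<^esub> r (s y)) = y"
      by (simp add: rc sc a_minus_def P.M.a_ac P.M.r_neg2 P.M.r_neg)
  qed
  then have "mod_iso R (direct_sum N ?N') ?P" by (rule lin_mod_iso[OF f _ D])
  then show "in_add R T N" unfolding in_add_def direct_summand_def using N N' by blast
qed

lemma in_add_left_module: "in_add R T N \<Longrightarrow> left_module R N"
  unfolding in_add_def direct_summand_def by blast

lemma in_add_retract:
  assumes T: "left_module R T" and N: "in_add R T N" and N': "left_module R N'"
    and f: "lin R N' N f" and g: "lin R N N' g" and gf: "\<And>x. x \<in> carrier N' \<Longrightarrow> g (f x) = x"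
  shows "in_add R T N'"
proof -
  note NM = in_add_left_module[OF N]
  from N obtain m \<phi> \<psi> where "add_data R T N m \<phi> \<psi>" unfolding in_add_iff[OF T] by blast
  then have lin: "\<And>j. j < m \<Longrightarrow> lin R N T (\<phi> j)" "\<And>j. j < m \<Longrightarrow> lin R T N (\<psi> j)"
    and sum: "\<And>x. x \<in> carrier N \<Longrightarrow> msum N (\<lambda>j. \<psi> j (\<phi> j x)) m = x"
    unfolding add_data_def by auto
  have "add_data R T N' m (\<lambda>j x. \<phi> j (f x)) (\<lambda>j t. g (\<psi> j t))"
    unfolding add_data_def
  proof (intro conjI allI impI ballI)
    fix x assume x: "x \<in> carrier N'"
    have "msum N' (\<lambda>j. g (\<psi> j (\<phi> j (f x)))) m = g (msum N (\<lambda>j. \<psi> j (\<phi> j (f x))) m)"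
      by (rule lin_msum[OF g NM N', symmetric]) (rule lin_closed[OF lin(2) lin_closed[OF lin(1) lin_closed[OF f x]]])
    then show "msum N' (\<lambda>j. g (\<psi> j (\<phi> j (f x)))) m = x" by (simp add: sum lin_closed[OF f x] gf x)
  qed (auto intro: lin_comp[OF f] lin_comp[OF _ g] lin)
  then show ?thesis unfolding in_add_iff[OF T] using N' by blast
qed

lemma in_add_refl: assumes T: "left_module R T" shows "in_add R T T"
proof -
  interpret T: left_module R T by fact
  have "add_data R T T (Suc 0) (\<lambda>_ x. x) (\<lambda>_ x. x)" by (auto simp: add_data_def lin_id)
  then show ?thesis unfolding in_add_iff[OF T] using T by blast
qed

lemmas in_add_summand = in_add_retract[OF _ in_add_refl]

lemma in_add_zero:
  assumes "left_module R T" "left_module R N" "zero_module N" shows "in_add R T N"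
proof -
  interpret N: left_module R N by fact
  have "add_data R T N 0 undefined undefined" using assms(3) by (auto simp: add_data_def zero_module_def)
  then show ?thesis unfolding in_add_iff[OF assms(1)] using assms(2) by blast
qed

section \<open>Binary direct sums\<close>

lemma lin_fst: "lin R (direct_sum M N) M fst"
  and lin_snd: "lin R (direct_sum M N) N snd"
  by (auto intro!: linI simp: direct_sum_simps)

lemma lin_inl:
  assumes "left_module R N" shows "lin R M (direct_sum M N) (\<lambda>x. (x, \<zero>\<^bsub>N\<^esub>))"
proof -
  interpret N: left_module R N by fact
  show ?thesis by (auto intro!: linI simp: direct_sum_simps)
qed

lemma lin_inr:
  assumes "left_module R M" shows "lin R N (direct_sum M N) (\<lambda>x. (\<zero>\<^bsub>M\<^esub>, x))"
proof -
  interpret M: left_module R M by fact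
  show ?thesis by (auto intro!: linI simp: direct_sum_simps)
qed

lemma lin_pair:
  "lin R L M f \<Longrightarrow> lin R L N g \<Longrightarrow> lin R L (direct_sum M N) (\<lambda>x. (f x, g x))"
  by (auto intro!: linI simp: direct_sum_simps lin_def)

lemma in_add_direct_sum:
  assumes T: "left_module R T" and M: "in_add R T M" and N: "in_add R T N"
  shows "in_add R T (direct_sum M N)"
proof -
  note MM = in_add_left_module[OF M] and NM = in_add_left_module[OF N]
  have D: "left_module R (direct_sum M N)" by (rule left_module_direct_sum[OF MM NM])
  interpret M: left_module R M by fact
  interpret N: left_module R N by fact
  from M obtain m \<phi> \<psi> where "add_data R T M m \<phi> \<psi>" unfolding in_add_iff[OF T] by blast
  then have l1: "\<And>j. j < m \<Longrightarrow> lin R M T (\<phi> j)" "\<And>j. j < m \<Longrightarrow> lin R T M (\<psi> j)"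
    and s1: "\<And>x. x \<in> carrier M \<Longrightarrow> msum M (\<lambda>j. \<psi> j (\<phi> j x)) m = x"
    unfolding add_data_def by auto
  from N obtain m' \<phi>' \<psi>' where "add_data R T N m' \<phi>' \<psi>'" unfolding in_add_iff[OF T] by blast
  then have l2: "\<And>j. j < m' \<Longrightarrow> lin R N T (\<phi>' j)" "\<And>j. j < m' \<Longrightarrow> lin R T N (\<psi>' j)"
    and s2: "\<And>x. x \<in> carrier N \<Longrightarrow> msum N (\<lambda>j. \<psi>' j (\<phi>' j x)) m' = x"
    unfolding add_data_def by auto
  \<comment> \<open>The two families are concatenated: indices below m serve M, and those from m on,
    shifted back by m, serve N.\<close>
  let ?p = "\<lambda>j x. if j < m then \<phi> j (fst x) else \<phi>' (j - m) (snd x)"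
  let ?q = "\<lambda>j t. if j < m then (\<psi> j t, \<zero>\<^bsub>N\<^esub>) else (\<zero>\<^bsub>M\<^esub>, \<psi>' (j - m) t)"
  have p: "lin R (direct_sum M N) T (?p j)" if "j < m + m'" for j
  proof (cases "j < m")
    case True
    then show ?thesis using lin_comp[OF lin_fst l1(1)[OF True]] by simp
  next
    case False
    then have "j - m < m'" using that by simp
    then show ?thesis using lin_comp[OF lin_snd l2(1)] False by simp
  qed
  have q: "lin R T (direct_sum M N) (?q j)" if "j < m + m'" for j
  proof (cases "j < m")
    case True
    then show ?thesis using lin_comp[OF l1(2)[OF True] lin_inl[OF NM]] by simp
  next
    case False
    then have "j - m < m'" using that by simp
    then show ?thesis using lin_comp[OF l2(2) lin_inr[OF MM]] False by simp
  qed
  have "add_data R T (direct_sum M N) (m + m') ?p ?q"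
    unfolding add_data_def
  proof (intro conjI allI impI ballI p q)
    fix x assume "x \<in> carrier (direct_sum M N)"
    then obtain y z where x: "x = (y, z)" "y \<in> carrier M" "z \<in> carrier N" by (auto simp: direct_sum_simps)
    have "msum (direct_sum M N) (\<lambda>j. ?q j (?p j x)) (m + m') =
      msum (direct_sum M N) (\<lambda>j. (\<psi> j (\<phi> j y), \<zero>\<^bsub>N\<^esub>)) m \<oplus>\<^bsub>direct_sum M N\<^esub>
      msum (direct_sum M N) (\<lambda>j. (\<zero>\<^bsub>M\<^esub>, \<psi>' j (\<phi>' j z))) m'"
      by (subst msum_append[OF D]) (auto simp: \<open>x \<in> _\<close> x lin_closed[OF q] lin_closed[OF p] direct_sum_simps lin_closed[OF l1(1)] lin_closed[OF l2(1)] lin_closed[OF l1(2)] lin_closed[OF l2(2)] cong: msum_cong)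
    also have "msum (direct_sum M N) (\<lambda>j. (\<psi> j (\<phi> j y), \<zero>\<^bsub>N\<^esub>)) m = (y, \<zero>\<^bsub>N\<^esub>)"
      using lin_msum[OF lin_inl[OF NM] MM D, of m "\<lambda>j. \<psi> j (\<phi> j y)"] s1 x lin_closed[OF l1(1)] lin_closed[OF l1(2)] by simp
    also have "msum (direct_sum M N) (\<lambda>j. (\<zero>\<^bsub>M\<^esub>, \<psi>' j (\<phi>' j z))) m' = (\<zero>\<^bsub>M\<^esub>, z)"
      using lin_msum[OF lin_inr[OF MM] NM D, of m' "\<lambda>j. \<psi>' j (\<phi>' j z)"] s2 x lin_closed[OF l2(1)] lin_closed[OF l2(2)] by simp
    finally show "msum (direct_sum M N) (\<lambda>j. ?q j (?p j x)) (m + m') = x"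
      using x by (simp add: direct_sum_simps)
  qed
  then show ?thesis unfolding in_add_iff[OF T] using D by blast
qed

text \<open>Replaces an object of \<open>add T\<close> by a copy inside some \<open>T\<^sup>m\<close>, to fit a prescribed carrier type.\<close>

lemma in_add_transport:
  fixes T :: "('a, 't) module" and N :: "('a, 'n) module"
  assumes T: "left_module R T" and N: "in_add R T N"
  shows "\<exists>(N' :: ('a, nat \<Rightarrow> 't) module) h h'. in_add R T N' \<and> lin R N N' h \<and> lin R N' N h' \<and>
    (\<forall>x\<in>carrier N. h' (h x) = x) \<and> (\<forall>y\<in>carrier N'. h (h' y) = y)"
proof -
  note NM = in_add_left_module[OF N]
  from N obtain m \<phi> \<psi> where "add_data R T N m \<phi> \<psi>" unfolding in_add_iff[OF T] by blast
  then have lin: "\<And>j. j < m \<Longrightarrow> lin R N T (\<phi> j)" "\<And>j. j < m \<Longrightarrow> lin R T N (\<psi> j)"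
    and sum: "\<And>x. x \<in> carrier N \<Longrightarrow> msum N (\<lambda>j. \<psi> j (\<phi> j x)) m = x"
    unfolding add_data_def by auto
  let ?P = "pow_module m T"
  have P: "left_module R ?P" by (rule left_module_pow) fact
  interpret P: left_module R ?P by fact
  interpret N: left_module R N by fact
  define r where "r x = (\<lambda>i\<in>{..<m}. \<phi> i x)" for x
  define s where "s y = msum N (\<lambda>j. \<psi> j (y j)) m" for y
  have r: "lin R N ?P r" unfolding r_def by (rule lin_tuple) (rule lin(1))
  have s: "lin R ?P N s" unfolding s_def
    by (rule lin_msum_map[OF _ NM]) (rule lin_comp[OF lin_proj lin(2)])
  have sr: "s (r x) = x" if "x \<in> carrier N" for x
    using sum[OF that] unfolding s_def r_def by (simp cong: msum_cong)
  let ?N' = "?P\<lparr>carrier := r ` carrier N\<rparr>"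
  have H: "submodule (r ` carrier N) R ?P" by (rule submodule_image[OF r NM P N.submodule_carrier])
  have N': "left_module R ?N'" by (rule P.left_module_sub[OF H])
  have r': "lin R N ?N' r" using r by (auto simp: lin_def)
  have s': "lin R ?N' N s" using s P.submoduleD(1)[OF H] by (auto simp: lin_def subset_iff)
  have rs: "r (s y) = y" if "y \<in> carrier ?N'" for y using that sr by auto
  show ?thesis
    by (rule exI[of _ ?N'], rule exI[of _ r], rule exI[of _ s])
      (use in_add_retract[OF T N N' s' r' rs] r' s' sr rs in auto)
qed

text \<open>A map out of the regular module is multiplication of the argument with the image of 1,
  so the maps \<Lambda> \<rightarrow> P of \<open>add_data\<close> become elements u j of P.\<close>

lemma projective_dual_basis:
  assumes "ring R" "projective_module R P"
  shows "\<exists>m u \<phi>. (\<forall>j<m. u j \<in> carrier P \<and> lin R P (regular R) (\<phi> j)) \<and>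
    (\<forall>x\<in>carrier P. msum P (\<lambda>j. \<phi> j x \<odot>\<^bsub>P\<^esub> u j) m = x)"
proof -
  interpret R: ring R by fact
  have A: "left_module R (regular R)" by (rule left_module_regular) fact
  from assms(2) obtain m \<phi> \<psi> where "add_data R (regular R) P m \<phi> \<psi>" and P: "left_module R P"
    unfolding projective_module_def in_add_iff[OF A] by blast
  then have lin: "\<And>j. j < m \<Longrightarrow> lin R P (regular R) (\<phi> j)" "\<And>j. j < m \<Longrightarrow> lin R (regular R) P (\<psi> j)"
    and sum: "\<And>x. x \<in> carrier P \<Longrightarrow> msum P (\<lambda>j. \<psi> j (\<phi> j x)) m = x"
    unfolding add_data_def by auto
  have "\<psi> j (\<phi> j x) = \<phi> j x \<odot>\<^bsub>P\<^esub> \<psi> j \<one>\<^bsub>R\<^esub>" if "j < m" "x \<in> carrier P" for j x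
    using lin_smult[OF lin(2)[OF that(1)], of "\<phi> j x" "\<one>\<^bsub>R\<^esub>"] lin_closed[OF lin(1) that(2)] that(1)
    by (simp add: regular_def)
  then have "msum P (\<lambda>j. \<phi> j x \<odot>\<^bsub>P\<^esub> \<psi> j \<one>\<^bsub>R\<^esub>) m = x" if "x \<in> carrier P" for x
    using sum[OF that] that msum_cong[of m "\<lambda>j. \<phi> j x \<odot>\<^bsub>P\<^esub> \<psi> j \<one>\<^bsub>R\<^esub>" "\<lambda>j. \<psi> j (\<phi> j x)" P] by simp
  moreover have "\<psi> j \<one>\<^bsub>R\<^esub> \<in> carrier P" if "j < m" for j
    using lin_closed[OF lin(2)[OF that], of "\<one>\<^bsub>R\<^esub>"] by (simp add: regular_def)
  ultimately show ?thesis
    by (intro exI[of _ m] exI[of _ "\<lambda>j. \<psi> j \<one>\<^bsub>R\<^esub>"] exI[of _ \<phi>]) (simp add: lin(1))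
qed

lemma lin_smult_elem:
  assumes "left_module R M" "u \<in> carrier M" shows "lin R (regular R) M (\<lambda>a. a \<odot>\<^bsub>M\<^esub> u)"
proof -
  interpret M: left_module R M by fact
  show ?thesis using assms(2)
    by (intro linI) (auto simp: regular_def M.smult_closed M.smult_l_distr M.smult_assoc)
qed

lemma projectiveI:
  assumes P: "left_module R P" and "\<And>j. j < m \<Longrightarrow> u j \<in> carrier P" "\<And>j. j < m \<Longrightarrow> lin R P (regular R) (\<phi> j)"
    "\<And>x. x \<in> carrier P \<Longrightarrow> msum P (\<lambda>j. \<phi> j x \<odot>\<^bsub>P\<^esub> u j) m = x"
  shows "projective_module R P"
proof -
  have A: "left_module R (regular R)" by (rule left_module_regular[OF left_moduleD(1)[OF P]])
  have "add_data R (regular R) P m \<phi> (\<lambda>j a. a \<odot>\<^bsub>P\<^esub> u j)"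
    using assms by (simp add: add_data_def lin_smult_elem)
  then show ?thesis unfolding projective_module_def in_add_iff[OF A] using P by blast
qed

lemma projective_left_module: "projective_module R P \<Longrightarrow> left_module R P"
  unfolding projective_module_def by (rule in_add_left_module)

text \<open>Choose preimages under g of the f (u j) for a dual basis u, \<phi> and combine them with
  the coefficients \<phi> j x. Asking only that f lands in the image of g lets g be a differential,
  whose image is the next kernel.\<close>

lemma projective_lift:
  assumes P: "projective_module R P" and Y: "left_module R Y" and Z: "left_module R Z"
    and f: "lin R P Z f" and g: "lin R Y Z g"
    and im: "\<And>x. x \<in> carrier P \<Longrightarrow> f x \<in> g ` carrier Y"
  shows "\<exists>h. lin R P Y h \<and> (\<forall>x\<in>carrier P. g (h x) = f x)"
proof -
  note R = left_moduleD(1)[OF Y] and PM = projective_left_module[OF P]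
  interpret PM: left_module R P by fact
  interpret Y: left_module R Y by fact
  obtain m u \<phi> where u: "\<And>j. j < m \<Longrightarrow> u j \<in> carrier P"
    and \<phi>: "\<And>j. j < m \<Longrightarrow> lin R P (regular R) (\<phi> j)"
    and s: "\<And>x. x \<in> carrier P \<Longrightarrow> msum P (\<lambda>j. \<phi> j x \<odot>\<^bsub>P\<^esub> u j) m = x"
    using projective_dual_basis[OF R P] by blast
  have "\<forall>j. \<exists>y. j < m \<longrightarrow> y \<in> carrier Y \<and> g y = f (u j)" using im u by (metis imageE)
  then obtain y where y: "\<And>j. j < m \<Longrightarrow> y j \<in> carrier Y" "\<And>j. j < m \<Longrightarrow> g (y j) = f (u j)" by metis
  have \<phi>c: "\<phi> j x \<in> carrier R" if "j < m" "x \<in> carrier P" for j x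
    using lin_closed[OF \<phi> that(2)] that(1) by (simp add: regular_def)
  let ?h = "\<lambda>x. msum Y (\<lambda>j. \<phi> j x \<odot>\<^bsub>Y\<^esub> y j) m"
  have "lin R P Y ?h" by (rule lin_msum_map[OF _ Y]) (rule lin_comp[OF \<phi> lin_smult_elem[OF Y y(1)]])
  moreover have "g (?h x) = f x" if x: "x \<in> carrier P" for x
  proof -
    have "g (?h x) = msum Z (\<lambda>j. g (\<phi> j x \<odot>\<^bsub>Y\<^esub> y j)) m"
      by (rule lin_msum[OF g Y Z]) (simp add: Y.smult_closed \<phi>c x y)
    also have "\<dots> = msum Z (\<lambda>j. f (\<phi> j x \<odot>\<^bsub>P\<^esub> u j)) m"
      by (rule msum_cong) (simp add: lin_smult[OF f] lin_smult[OF g] \<phi>c x y u)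
    also have "\<dots> = f (msum P (\<lambda>j. \<phi> j x \<odot>\<^bsub>P\<^esub> u j) m)"
      by (rule lin_msum[OF f PM Z, symmetric]) (simp add: PM.smult_closed \<phi>c x u)
    finally show ?thesis by (simp add: s x)
  qed
  ultimately show ?thesis by blast
qed

subsection \<open>Projective resolutions and Ext\<close>

lemma (in abelian_group) minus_eq_zeroD: "\<lbrakk>a \<in> carrier G; b \<in> carrier G; a \<ominus> b = \<zero>\<rbrakk> \<Longrightarrow> a = b"
  by (metis a_minus_def add.inv_closed add.inv_equality add.inv_inv)

lemma (in abelian_group) minus_minus_eq_zeroD:
  "\<lbrakk>a \<in> carrier G; b \<in> carrier G; c \<in> carrier G; (a \<ominus> b) \<ominus> c = \<zero>\<rbrakk> \<Longrightarrow> a = b \<oplus> c"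
  using minus_eq_zeroD[of a "b \<oplus> c"] by (simp add: a_minus_def minus_add a_assoc)

text \<open>The terms may have any carrier type and the maps need not be extensional, so sums of
  complexes and complexes of dual modules qualify as they are.\<close>

definition is_res where
  "is_res R X P d e \<longleftrightarrow> left_module R X \<and> (\<forall>i. projective_module R (P i)) \<and>
     lin R (P 0) X e \<and> (\<forall>i. lin R (P (Suc i)) (P i) (d i)) \<and>
     e ` carrier (P 0) = carrier X \<and>
     d 0 ` carrier (P (Suc 0)) = {x \<in> carrier (P 0). e x = \<zero>\<^bsub>X\<^esub>} \<and>
     (\<forall>i. d (Suc i) ` carrier (P (Suc (Suc i))) = {x \<in> carrier (P (Suc i)). d i x = \<zero>\<^bsub>P i\<^esub>})"

text \<open>Vanishing of \<open>Ext\<close> in degree \<open>i + 1\<close>, expressed through a given resolution.\<close>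

definition ext_zero where
  "ext_zero R P d Y i \<longleftrightarrow> (\<forall>f. lin R (P (Suc i)) Y f \<longrightarrow>
     (\<forall>x\<in>carrier (P (Suc (Suc i))). f (d (Suc i) x) = \<zero>\<^bsub>Y\<^esub>) \<longrightarrow>
     (\<exists>g. lin R (P i) Y g \<and> (\<forall>x\<in>carrier (P (Suc i)). f x = g (d i x))))"

lemma ext_zeroD:
  assumes "ext_zero R P d Y i" "lin R (P (Suc i)) Y f"
    "\<forall>x\<in>carrier (P (Suc (Suc i))). f (d (Suc i) x) = \<zero>\<^bsub>Y\<^esub>"
  shows "\<exists>g. lin R (P i) Y g \<and> (\<forall>x\<in>carrier (P (Suc i)). f x = g (d i x))"
  using assms unfolding ext_zero_def by blast

lemma is_resD:
  assumes "is_res R X P d e"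
  shows "left_module R X" "projective_module R (P i)" "left_module R (P i)"
    "lin R (P 0) X e" "lin R (P (Suc i)) (P i) (d i)"
    "e ` carrier (P 0) = carrier X"
    "d 0 ` carrier (P (Suc 0)) = {x \<in> carrier (P 0). e x = \<zero>\<^bsub>X\<^esub>}"
    "d (Suc i) ` carrier (P (Suc (Suc i))) = {x \<in> carrier (P (Suc i)). d i x = \<zero>\<^bsub>P i\<^esub>}"
  using assms projective_left_module unfolding is_res_def by auto

lemma is_res_dd:
  assumes "is_res R X P d e"
  shows "x \<in> carrier (P (Suc (Suc i))) \<Longrightarrow> d i (d (Suc i) x) = \<zero>\<^bsub>P i\<^esub>"
    and "x \<in> carrier (P (Suc 0)) \<Longrightarrow> e (d 0 x) = \<zero>\<^bsub>X\<^esub>"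
  using is_resD(7,8)[OF assms] by blast+

lemma projective_resolution_is_res:
  "projective_resolution R X P d e \<Longrightarrow> left_module R X \<Longrightarrow> is_res R X P d e"
  unfolding projective_resolution_def is_res_def by (simp add: mod_hom_lin a_kernel_def')

lemma chain_map_exists:
  assumes r: "is_res R X P d e" and r': "is_res R X P' d' e'"
  shows "\<exists>\<phi>. \<forall>i. lin R (P i) (P' i) (\<phi> i) \<and>
    (\<forall>x\<in>carrier (P (Suc i)). d' i (\<phi> (Suc i) x) = \<phi> i (d i x)) \<and>
    (\<forall>x\<in>carrier (P 0). e' (\<phi> 0 x) = e x)"
proof -
  note D = is_resD[OF r] and D' = is_resD[OF r']
  \<comment> \<open>Besides linearity the invariant records that f (d i x) is a boundary, which is
    what the next lift needs; thus each map is chosen from its predecessor alone.\<close>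
  let ?good = "\<lambda>i f. lin R (P i) (P' i) f \<and> (\<forall>x\<in>carrier (P (Suc i)). f (d i x) \<in> d' i ` carrier (P' (Suc i)))
    \<and> (i = 0 \<longrightarrow> (\<forall>x\<in>carrier (P 0). e' (f x) = e x))"
  let ?rel = "\<lambda>i f f'. \<forall>x\<in>carrier (P (Suc i)). d' i (f' x) = f (d i x)"
  have "\<exists>\<phi>. \<forall>i. ?good i (\<phi> i) \<and> ?rel i (\<phi> i) (\<phi> (Suc i))"
  proof (rule dependent_nat_choice)
    have "e x \<in> e' ` carrier (P' 0)" if "x \<in> carrier (P 0)" for x
      using lin_closed[OF D(4) that] D'(6) by simp
    from projective_lift[OF D(2) D'(3) D'(1) D(4) D'(4) this]
    obtain f where f: "lin R (P 0) (P' 0) f" "\<And>x. x \<in> carrier (P 0) \<Longrightarrow> e' (f x) = e x"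
      by blast
    have "f (d 0 x) \<in> d' 0 ` carrier (P' (Suc 0))" if "x \<in> carrier (P (Suc 0))" for x
      using that unfolding D'(7) by (auto simp: lin_closed[OF f(1)] lin_closed[OF D(5)] f is_res_dd[OF r])
    then show "\<exists>f. ?good 0 f" using f by blast
  next
    fix f i assume f: "?good i f"
    then have lf: "lin R (P i) (P' i) f" by blast
    have "f (d i x) \<in> d' i ` carrier (P' (Suc i))" if "x \<in> carrier (P (Suc i))" for x
      using f that by simp
    from projective_lift[OF D(2) D'(3) D'(3) lin_comp[OF D(5) lf] D'(5) this]
    obtain f' where f': "lin R (P (Suc i)) (P' (Suc i)) f'"
      "\<And>x. x \<in> carrier (P (Suc i)) \<Longrightarrow> d' i (f' x) = f (d i x)" by blast
    have "f' (d (Suc i) x) \<in> d' (Suc i) ` carrier (P' (Suc (Suc i)))" if "x \<in> carrier (P (Suc (Suc i)))" for x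
      using that unfolding D'(8)
      by (auto simp: lin_closed[OF f'(1)] lin_closed[OF D(5)] f' is_res_dd[OF r] lin_zero[OF lf D(3) D'(3)])
    then show "\<exists>f'. ?good (Suc i) f' \<and> ?rel i f f'" using f' by blast
  qed
  then obtain \<phi> where g: "\<forall>i. ?good i (\<phi> i) \<and> ?rel i (\<phi> i) (\<phi> (Suc i))" ..
  show ?thesis
  proof (rule exI[of _ \<phi>], rule allI)
    fix i show "lin R (P i) (P' i) (\<phi> i) \<and> (\<forall>x\<in>carrier (P (Suc i)). d' i (\<phi> (Suc i) x) = \<phi> i (d i x)) \<and>
        (\<forall>x\<in>carrier (P 0). e' (\<phi> 0 x) = e x)"
      using spec[OF g, of i] spec[OF g, of 0] by simp
  qed
qed

text \<open>Comparison maps \<phi> : P \<rightarrow> P' and \<psi> : P' \<rightarrow> P lift the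
  identity of X. A cocycle f on P' yields a coboundary f \<phi> on P, so f \<phi> \<psi> is a
  coboundary on P', and f differs from it by a coboundary since \<phi> \<psi> is homotopic to the
  identity.\<close>

lemma ext_zero_independent:
  assumes r: "is_res R X P d e" and r': "is_res R X P' d' e'" and Y: "left_module R Y"
    and z: "ext_zero R P d Y i"
  shows "ext_zero R P' d' Y i"
proof -
  note D' = is_resD[OF r']
  obtain \<phi> where \<phi>: "\<And>i. lin R (P i) (P' i) (\<phi> i)"
      "\<And>i x. x \<in> carrier (P (Suc i)) \<Longrightarrow> d' i (\<phi> (Suc i) x) = \<phi> i (d i x)"
      "\<And>x. x \<in> carrier (P 0) \<Longrightarrow> e' (\<phi> 0 x) = e x"
  proof -
    from chain_map_exists[OF r r'] obtain f where g: "\<forall>i. lin R (P i) (P' i) (f i) \<and>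
        (\<forall>x\<in>carrier (P (Suc i)). d' i (f (Suc i) x) = f i (d i x)) \<and>
        (\<forall>x\<in>carrier (P 0). e' (f 0 x) = e x)" ..
    show thesis by (rule that[of f]) (use spec[OF g] in simp_all)
  qed
  obtain \<psi> where \<psi>: "\<And>i. lin R (P' i) (P i) (\<psi> i)"
      "\<And>i x. x \<in> carrier (P' (Suc i)) \<Longrightarrow> d i (\<psi> (Suc i) x) = \<psi> i (d' i x)"
      "\<And>x. x \<in> carrier (P' 0) \<Longrightarrow> e (\<psi> 0 x) = e' x"
  proof -
    from chain_map_exists[OF r' r] obtain f where g: "\<forall>i. lin R (P' i) (P i) (f i) \<and>
        (\<forall>x\<in>carrier (P' (Suc i)). d i (f (Suc i) x) = f i (d' i x)) \<and>
        (\<forall>x\<in>carrier (P' 0). e (f 0 x) = e' x)" ..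
    show thesis by (rule that[of f]) (use spec[OF g] in simp_all)
  qed
  define \<chi> where "\<chi> i x = \<phi> i (\<psi> i x)" for i x
  have \<chi>: "\<And>i. lin R (P' i) (P' i) (\<chi> i)" unfolding \<chi>_def by (rule lin_comp[OF \<psi>(1) \<phi>(1)])
  have \<chi>d: "d' i (\<chi> (Suc i) x) = \<chi> i (d' i x)" if "x \<in> carrier (P' (Suc i))" for i x
    using that by (simp add: \<chi>_def \<phi> \<psi> lin_closed[OF \<psi>(1)])
  have \<chi>e: "e' (\<chi> 0 x) = e' x" if "x \<in> carrier (P' 0)" for x
    using that by (simp add: \<chi>_def \<phi> \<psi> lin_closed[OF \<psi>(1)])
  note cl = lin_closed[OF \<chi>] lin_closed[OF D'(5)]
  have sub: "\<And>x y. x \<in> carrier (P' i) \<Longrightarrow> y \<in> carrier (P' i) \<Longrightarrow> x \<ominus>\<^bsub>P' i\<^esub> y \<in> carrier (P' i)" for i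
    by (rule abelian_group.minus_closed[OF left_moduleD(2)[OF D'(3)]])
  have self: "\<And>x. x \<in> carrier (P' i) \<Longrightarrow> x \<ominus>\<^bsub>P' i\<^esub> x = \<zero>\<^bsub>P' i\<^esub>" for i
    by (simp add: a_minus_def abelian_group.r_neg[OF left_moduleD(2)[OF D'(3)]])
  have szero: "\<And>x. x \<in> carrier (P' i) \<Longrightarrow> x \<ominus>\<^bsub>P' i\<^esub> \<zero>\<^bsub>P' i\<^esub> = x" for i
  proof -
    fix x assume x: "x \<in> carrier (P' i)"
    interpret left_module R "P' i" by (rule D'(3))
    show "x \<ominus>\<^bsub>P' i\<^esub> \<zero>\<^bsub>P' i\<^esub> = x" using x by (simp add: a_minus_def)
  qed
  \<comment> \<open>A homotopy satisfies id - \<chi> = d' h + h' d' with h' one degree lower, and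
    composing with \<open>d' i\<close> kills the last term. The equation that remains does not
    mention h' and so has the same shape in degree 0.\<close>
  have htpy: "\<exists>h. lin R (P' i) (P' (Suc i)) h \<and>
      (\<forall>x\<in>carrier (P' (Suc i)). d' i (h (d' i x)) = d' i x \<ominus>\<^bsub>P' i\<^esub> \<chi> i (d' i x))" for i
  proof (induct i)
    case 0
    interpret X: left_module R X by (rule D'(1))
    have l: "lin R (P' 0) (P' 0) (\<lambda>x. x \<ominus>\<^bsub>P' 0\<^esub> \<chi> 0 x)" by (rule lin_minus_map[OF lin_id \<chi> D'(3)])
    have "x \<ominus>\<^bsub>P' 0\<^esub> \<chi> 0 x \<in> d' 0 ` carrier (P' (Suc 0))" if x: "x \<in> carrier (P' 0)" for x
      unfolding D'(7) using x lin_closed[OF D'(4)]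
      by (simp add: sub cl lin_minus[OF D'(4) D'(3) D'(1)] \<chi>e a_minus_def[of X] X.M.r_neg)
    from projective_lift[OF D'(2) D'(3) D'(3) l D'(5) this]
    obtain h where "lin R (P' 0) (P' (Suc 0)) h" "\<And>x. x \<in> carrier (P' 0) \<Longrightarrow> d' 0 (h x) = x \<ominus>\<^bsub>P' 0\<^esub> \<chi> 0 x"
      by blast
    then show ?case using cl by blast
  next
    case (Suc i)
    then obtain h where h: "lin R (P' i) (P' (Suc i)) h"
      "\<And>x. x \<in> carrier (P' (Suc i)) \<Longrightarrow> d' i (h (d' i x)) = d' i x \<ominus>\<^bsub>P' i\<^esub> \<chi> i (d' i x)" by blast
    let ?u = "\<lambda>x. (x \<ominus>\<^bsub>P' (Suc i)\<^esub> \<chi> (Suc i) x) \<ominus>\<^bsub>P' (Suc i)\<^esub> h (d' i x)"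
    have l: "lin R (P' (Suc i)) (P' (Suc i)) ?u"
      by (rule lin_minus_map[OF lin_minus_map[OF lin_id \<chi> D'(3)] lin_comp[OF D'(5) h(1)] D'(3)])
    have "?u x \<in> d' (Suc i) ` carrier (P' (Suc (Suc i)))" if x: "x \<in> carrier (P' (Suc i))" for x
      unfolding D'(8) using x
      by (simp add: sub cl lin_closed[OF h(1)] lin_minus[OF D'(5) D'(3) D'(3)] h(2) \<chi>d self)
    from projective_lift[OF D'(2) D'(3) D'(3) l D'(5) this]
    obtain k where k: "lin R (P' (Suc i)) (P' (Suc (Suc i))) k"
      "\<And>x. x \<in> carrier (P' (Suc i)) \<Longrightarrow> d' (Suc i) (k x) = ?u x" by blast
    then show ?case
      using cl by (intro exI[of _ k])
        (simp add: is_res_dd[OF r'] lin_zero[OF h(1) D'(3) D'(3)] sub szero)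
  qed
  show ?thesis unfolding ext_zero_def
  proof (intro allI impI)
    fix f assume f: "lin R (P' (Suc i)) Y f"
      and c: "\<forall>x\<in>carrier (P' (Suc (Suc i))). f (d' (Suc i) x) = \<zero>\<^bsub>Y\<^esub>"
    interpret Y: left_module R Y by fact
    have "\<forall>x\<in>carrier (P (Suc (Suc i))). f (\<phi> (Suc i) (d (Suc i) x)) = \<zero>\<^bsub>Y\<^esub>"
      using c \<phi>(2)[symmetric] lin_closed[OF \<phi>(1)] by auto
    then obtain g where g: "lin R (P i) Y g" "\<And>x. x \<in> carrier (P (Suc i)) \<Longrightarrow> f (\<phi> (Suc i) x) = g (d i x)"
      using z lin_comp[OF \<phi>(1) f] unfolding ext_zero_def by blast
    obtain h where h: "lin R (P' i) (P' (Suc i)) h"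
      "\<And>x. x \<in> carrier (P' (Suc i)) \<Longrightarrow> d' i (h (d' i x)) = d' i x \<ominus>\<^bsub>P' i\<^esub> \<chi> i (d' i x)" using htpy by blast
    have "f x = g (\<psi> i (d' i x)) \<oplus>\<^bsub>Y\<^esub> f (h (d' i x))" if x: "x \<in> carrier (P' (Suc i))" for x
    proof -
      let ?u = "(x \<ominus>\<^bsub>P' (Suc i)\<^esub> \<chi> (Suc i) x) \<ominus>\<^bsub>P' (Suc i)\<^esub> h (d' i x)"
      have "?u \<in> d' (Suc i) ` carrier (P' (Suc (Suc i)))"
        unfolding D'(8) using x
        by (simp add: sub cl lin_closed[OF h(1)] lin_minus[OF D'(5) D'(3) D'(3)] h(2) \<chi>d self)
      then have "f ?u = \<zero>\<^bsub>Y\<^esub>" using c by auto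
      then have "(f x \<ominus>\<^bsub>Y\<^esub> f (\<chi> (Suc i) x)) \<ominus>\<^bsub>Y\<^esub> f (h (d' i x)) = \<zero>\<^bsub>Y\<^esub>"
        using x by (simp add: lin_minus[OF f D'(3) Y] sub cl lin_closed[OF h(1)])
      moreover have "f (\<chi> (Suc i) x) = g (\<psi> i (d' i x))"
        using x by (simp add: \<chi>_def g(2) lin_closed[OF \<psi>(1)] \<psi>(2))
      moreover have "f x \<in> carrier Y" "g (\<psi> i (d' i x)) \<in> carrier Y" "f (h (d' i x)) \<in> carrier Y"
        using x by (auto intro!: lin_closed[OF f] lin_closed[OF g(1)] lin_closed[OF h(1)] lin_closed[OF \<psi>(1)] cl)
      ultimately show ?thesis using Y.M.minus_minus_eq_zeroD by simp
    qed
    moreover have "lin R (P' i) Y (\<lambda>y. g (\<psi> i y) \<oplus>\<^bsub>Y\<^esub> f (h y))"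
      by (rule lin_add_map[OF lin_comp[OF \<psi>(1) g(1)] lin_comp[OF h(1) f] Y])
    ultimately show "\<exists>g. lin R (P' i) Y g \<and> (\<forall>x\<in>carrier (P' (Suc i)). f x = g (d' i x))" by blast
  qed
qed

text \<open>Leads from arbitrary carrier types to the one fixed in
  \<open>projective_resolution\<close>. Zero terms stay zero, so the length is preserved.\<close>

lemma transport_resolution:
  fixes P :: "nat \<Rightarrow> ('a, 'p) module"
  assumes r: "is_res R X P d e"
  shows "\<exists>P' d' e'. projective_resolution R X P' d' e' \<and> (\<forall>i. zero_module (P i) \<longrightarrow> zero_module (P' i))"
proof -
  note D = is_resD[OF r]
  have A: "left_module R (regular R)" by (rule left_module_regular[OF left_moduleD(1)[OF D(1)]])
  have "\<forall>i. \<exists>N h h'. projective_module R N \<and> lin R (P i) N h \<and> lin R N (P i) h' \<and>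
    (\<forall>x\<in>carrier (P i). h' (h x) = x) \<and> (\<forall>y\<in>carrier (N :: ('a, nat \<Rightarrow> 'a) module). h (h' y) = y)"
    using in_add_transport[OF A D(2)[unfolded projective_module_def]] unfolding projective_module_def by metis
  then obtain N :: "nat \<Rightarrow> ('a, nat \<Rightarrow> 'a) module" and h h' where N: "\<And>i. projective_module R (N i)"
    and h: "\<And>i. lin R (P i) (N i) (h i)" and h': "\<And>i. lin R (N i) (P i) (h' i)"
    and hh: "\<And>i x. x \<in> carrier (P i) \<Longrightarrow> h' i (h i x) = x" "\<And>i y. y \<in> carrier (N i) \<Longrightarrow> h i (h' i y) = y"
    by metis
  note NM = projective_left_module[OF N]
  let ?d = "\<lambda>i. restrict (\<lambda>y. h i (d i (h' (Suc i) y))) (carrier (N (Suc i)))"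
  let ?e = "restrict (\<lambda>y. e (h' 0 y)) (carrier (N 0))"
  note hc = lin_closed[OF h] and hc' = lin_closed[OF h'] and dc = lin_closed[OF D(5)]
  have img: "h' i ` carrier (N i) = carrier (P i)" for i
  proof
    show "carrier (P i) \<subseteq> h' i ` carrier (N i)" using hh(1)[symmetric] hc by blast
  qed (use hc' in blast)
  have z: "h i y = \<zero>\<^bsub>N i\<^esub> \<longleftrightarrow> y = \<zero>\<^bsub>P i\<^esub>" if "y \<in> carrier (P i)" for i y
    using that hh lin_zero[OF h D(3) NM] lin_zero[OF h' NM D(3)] by metis
  have "projective_resolution R X N ?d ?e"
    unfolding projective_resolution_def a_kernel_def'
  proof (intro conjI allI N)
    show "?e \<in> mod_hom R (N 0) X" by (rule lin_restrict[OF lin_comp[OF h' D(4)] NM])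
    show "?d i \<in> mod_hom R (N (Suc i)) (N i)" for i
      by (rule lin_restrict[OF lin_comp[OF lin_comp[OF h' D(5)] h] NM])
    show "?e ` carrier (N 0) = carrier X" using D(6) img[of 0] by (simp add: image_image[symmetric])
    have im: "?d i ` carrier (N (Suc i)) = h i ` d i ` carrier (P (Suc i))" for i
      unfolding img[of "Suc i", symmetric] by (simp add: image_image)
    show "?d 0 ` carrier (N (Suc 0)) = {x \<in> carrier (N 0). ?e x = \<zero>\<^bsub>X\<^esub>}"
      unfolding im D(7) using hc hc' hh by (force simp: image_iff)
    show "?d (Suc i) ` carrier (N (Suc (Suc i))) = {x \<in> carrier (N (Suc i)). ?d i x = \<zero>\<^bsub>N i\<^esub>}" for i
      unfolding im D(8) using hc hc' hh dc by (force simp: image_iff z)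
  qed
  moreover have "zero_module (N i)" if "zero_module (P i)" for i
  proof -
    have "h i y = \<zero>\<^bsub>N i\<^esub>" if "y \<in> carrier (P i)" for y
      using that \<open>zero_module (P i)\<close> z unfolding zero_module_def by blast
    moreover have "\<zero>\<^bsub>N i\<^esub> \<in> carrier (N i)"
      using abelian_group.axioms(1)[OF left_moduleD(2)[OF NM]] by (rule abelian_monoid.zero_closed)
    moreover have "y = \<zero>\<^bsub>N i\<^esub>" if "y \<in> carrier (N i)" for y
      using calculation(1)[OF hc'[OF that]] hh(2)[OF that] by simp
    ultimately show ?thesis unfolding zero_module_def by blast
  qed
  ultimately show ?thesis by blast
qed

lemma ext_zero_trivial:
  assumes "left_module R (P i)" "left_module R (P (Suc i))" "left_module R Y" "lin R (P (Suc i)) (P i) (d i)" "zero_module (P (Suc i))"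
  shows "ext_zero R P d Y i"
proof -
  have "f x = \<zero>\<^bsub>Y\<^esub>" if "lin R (P (Suc i)) Y f" "x \<in> carrier (P (Suc i))" for f x
    using lin_zero[OF that(1) assms(2,3)] that(2) assms(5) by (simp add: zero_module_def)
  then show ?thesis unfolding ext_zero_def using lin_zero_map[OF assms(3)] by metis
qed

lemma proj_dim_le:
  assumes "is_res R X P d e" "\<And>i. i > n \<Longrightarrow> zero_module (P i)" shows "proj_dim R X \<le> enat n"
proof -
  obtain P' d' e' where "projective_resolution R X P' d' e'" "\<forall>i>n. zero_module (P' i)"
    using transport_resolution[OF assms(1)] assms(2) by blast
  then show ?thesis unfolding proj_dim_def by (intro Inf_lower) blast
qed

text \<open>A resolution with no terms beyond some m \<le> n would give vanishing in degree n + 1,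
  the degree that the index n of \<open>ext_zero\<close> stands for, and by independence also on the
  given resolution.\<close>

lemma proj_dim_ge:
  assumes r: "is_res R X P d e" and Y: "left_module R Y" and nz: "\<not> ext_zero R P d Y n"
  shows "enat (Suc n) \<le> proj_dim R X"
  unfolding proj_dim_def
proof (rule Inf_greatest, clarify)
  fix m P' d' e' assume r': "projective_resolution R X P' d' e'" and z: "\<forall>i>m. zero_module (P' i)"
  have r'': "is_res R X P' d' e'" by (rule projective_resolution_is_res[OF r' is_resD(1)[OF r]])
  note D = is_resD[OF r'']
  show "enat (Suc n) \<le> enat m"
  proof (rule ccontr)
    assume "\<not> ?thesis"
    then have "ext_zero R P' d' Y n" using z by (intro ext_zero_trivial D Y) simp
    then show False using ext_zero_independent[OF r'' r Y] nz by blast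
  qed
qed

section \<open>Additivity of Ext in both arguments and dimension shifting\<close>

lemma ext_zero_direct_sum_right:
  assumes "ext_zero R P d Y i" "ext_zero R P d Z i"
  shows "ext_zero R P d (direct_sum Y Z) i"
  unfolding ext_zero_def
proof (intro allI impI)
  fix f assume f: "lin R (P (Suc i)) (direct_sum Y Z) f"
    and c: "\<forall>x\<in>carrier (P (Suc (Suc i))). f (d (Suc i) x) = \<zero>\<^bsub>direct_sum Y Z\<^esub>"
  obtain g where "lin R (P i) Y g" "\<forall>x\<in>carrier (P (Suc i)). fst (f x) = g (d i x)"
    using assms(1) lin_comp[OF f lin_fst] c unfolding ext_zero_def by (auto simp: direct_sum_simps)
  moreover obtain h where "lin R (P i) Z h" "\<forall>x\<in>carrier (P (Suc i)). snd (f x) = h (d i x)"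
    using assms(2) lin_comp[OF f lin_snd] c unfolding ext_zero_def by (auto simp: direct_sum_simps)
  ultimately show "\<exists>g. lin R (P i) (direct_sum Y Z) g \<and> (\<forall>x\<in>carrier (P (Suc i)). f x = g (d i x))"
    by (intro exI[of _ "\<lambda>x. (g x, h x)"]) (auto intro: lin_pair prod_eqI)
qed

text \<open>A cocycle with values in N is sent to T by each \<phi> j and bounded there; the \<psi> j
  recombine the bounding maps.\<close>

lemma ext_zero_in_add:
  assumes T: "left_module R T" and N: "in_add R T N" and P: "left_module R (P (Suc i))"
    and z: "ext_zero R P d T i"
  shows "ext_zero R P d N i"
proof -
  note NM = in_add_left_module[OF N]
  from N obtain m \<phi> \<psi> where "add_data R T N m \<phi> \<psi>" unfolding in_add_iff[OF T] by blast
  then have lin: "\<And>j. j < m \<Longrightarrow> lin R N T (\<phi> j)" "\<And>j. j < m \<Longrightarrow> lin R T N (\<psi> j)"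
    and sum: "\<And>x. x \<in> carrier N \<Longrightarrow> msum N (\<lambda>j. \<psi> j (\<phi> j x)) m = x"
    unfolding add_data_def by auto
  show ?thesis unfolding ext_zero_def
  proof (intro allI impI)
    fix f assume f: "lin R (P (Suc i)) N f"
      and c: "\<forall>x\<in>carrier (P (Suc (Suc i))). f (d (Suc i) x) = \<zero>\<^bsub>N\<^esub>"
    have "\<forall>j. \<exists>g. j < m \<longrightarrow> lin R (P i) T g \<and> (\<forall>x\<in>carrier (P (Suc i)). \<phi> j (f x) = g (d i x))"
      using z lin_comp[OF f lin(1)] c lin_zero[OF lin(1) NM T] unfolding ext_zero_def by metis
    then obtain g where g: "\<And>j. j < m \<Longrightarrow> lin R (P i) T (g j)"
      "\<And>j x. j < m \<Longrightarrow> x \<in> carrier (P (Suc i)) \<Longrightarrow> \<phi> j (f x) = g j (d i x)" by metis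
    have "lin R (P i) N (\<lambda>y. msum N (\<lambda>j. \<psi> j (g j y)) m)"
      by (rule lin_msum_map[OF lin_comp[OF g(1) lin(2)] NM])
    moreover have "f x = msum N (\<lambda>j. \<psi> j (g j (d i x))) m" if "x \<in> carrier (P (Suc i))" for x
      using sum[OF lin_closed[OF f that]] g(2) that by (simp cong: msum_cong)
    ultimately show "\<exists>g. lin R (P i) N g \<and> (\<forall>x\<in>carrier (P (Suc i)). f x = g (d i x))" by blast
  qed
qed

text \<open>A chase through the piece Ext(X, Y) \<rightarrow> Ext(X, Z) \<rightarrow> Ext(X, ker p)
  of the long exact sequence. A cocycle with values in Z lifts to Y; the lift composed with the
  differential is a cocycle with values in ker p, one degree higher; subtracting the map that bounds
  it turns the lift into a cocycle.\<close>

lemma ext_zero_shift: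
  assumes r: "is_res R X P d e" and Y: "left_module R Y" and Z: "left_module R Z"
    and p: "lin R Y Z p" "p ` carrier Y = carrier Z"
    and z: "ext_zero R P d Y i" "ext_zero R P d (Y\<lparr>carrier := {y \<in> carrier Y. p y = \<zero>\<^bsub>Z\<^esub>}\<rparr>) (Suc i)"
  shows "ext_zero R P d Z i"
  unfolding ext_zero_def
proof (intro allI impI)
  note D = is_resD[OF r]
  interpret Y: left_module R Y by fact
  fix f assume f: "lin R (P (Suc i)) Z f"
    and c: "\<forall>x\<in>carrier (P (Suc (Suc i))). f (d (Suc i) x) = \<zero>\<^bsub>Z\<^esub>"
  have "f x \<in> p ` carrier Y" if "x \<in> carrier (P (Suc i))" for x
    using lin_closed[OF f that] p(2) by simp
  from projective_lift[OF D(2) Y Z f p(1) this]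
  obtain f' where f': "lin R (P (Suc i)) Y f'" "\<And>x. x \<in> carrier (P (Suc i)) \<Longrightarrow> p (f' x) = f x" by blast
  let ?K = "Y\<lparr>carrier := {y \<in> carrier Y. p y = \<zero>\<^bsub>Z\<^esub>}\<rparr>"
  have l: "lin R (P (Suc (Suc i))) ?K (\<lambda>x. f' (d (Suc i) x))"
    using lin_comp[OF D(5) f'(1)] f'(2) c lin_closed[OF D(5)] by (auto simp: lin_def)
  have c2: "\<forall>x\<in>carrier (P (Suc (Suc (Suc i)))). f' (d (Suc i) (d (Suc (Suc i)) x)) = \<zero>\<^bsub>?K\<^esub>"
    by (simp add: is_res_dd[OF r] lin_zero[OF f'(1) D(3) Y])
  from ext_zeroD[OF z(2) l c2] obtain g where g: "lin R (P (Suc i)) ?K g"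
    "\<And>x. x \<in> carrier (P (Suc (Suc i))) \<Longrightarrow> f' (d (Suc i) x) = g (d (Suc i) x)"
    by blast
  have gY: "lin R (P (Suc i)) Y g" using g(1) by (auto simp: lin_def)
  have gk: "p (g x) = \<zero>\<^bsub>Z\<^esub>" if "x \<in> carrier (P (Suc i))" for x using lin_closed[OF g(1) that] by simp
  have l2: "lin R (P (Suc i)) Y (\<lambda>x. f' x \<ominus>\<^bsub>Y\<^esub> g x)" by (rule lin_minus_map[OF f'(1) gY Y])
  have c3: "\<forall>x\<in>carrier (P (Suc (Suc i))). f' (d (Suc i) x) \<ominus>\<^bsub>Y\<^esub> g (d (Suc i) x) = \<zero>\<^bsub>Y\<^esub>"
    using g(2) lin_closed[OF gY] lin_closed[OF D(5)] by (simp add: a_minus_def Y.M.r_neg)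
  from ext_zeroD[OF z(1) l2 c3] obtain h where h: "lin R (P i) Y h"
    "\<And>x. x \<in> carrier (P (Suc i)) \<Longrightarrow> f' x \<ominus>\<^bsub>Y\<^esub> g x = h (d i x)"
    by blast
  interpret Z: left_module R Z by fact
  have "f x = p (h (d i x))" if x: "x \<in> carrier (P (Suc i))" for x
    using h(2)[OF x, symmetric] x lin_closed[OF f x]
    by (simp add: lin_minus[OF p(1) Y Z] lin_closed[OF f'(1)] lin_closed[OF gY] f'(2) gk a_minus_def[of Z])
  then show "\<exists>g. lin R (P i) Z g \<and> (\<forall>x\<in>carrier (P (Suc i)). f x = g (d i x))"
    using lin_comp[OF h(1) p(1)] by blast
qed

lemma is_res_direct_sum:
  assumes r: "is_res R X P d e" and r': "is_res R X' P' d' e'"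
  shows "is_res R (direct_sum X X') (\<lambda>i. direct_sum (P i) (P' i))
    (\<lambda>i z. (d i (fst z), d' i (snd z))) (\<lambda>z. (e (fst z), e' (snd z)))"
proof -
  note D = is_resD[OF r] and D' = is_resD[OF r']
  have A: "left_module R (regular R)" by (rule left_module_regular[OF left_moduleD(1)[OF D(1)]])
  have im: "(\<lambda>z. (f (fst z), g (snd z))) ` (B \<times> C) = f ` B \<times> g ` C"
    for f :: "'x \<Rightarrow> 'y" and g :: "'z \<Rightarrow> 'w" and B C
    by force
  have l: "lin R (direct_sum M N) (direct_sum M' N') (\<lambda>z. (f (fst z), g (snd z)))"
    if "lin R M M' f" "lin R N N' g" for M N M' N' f g
    by (rule lin_pair[OF lin_comp[OF lin_fst that(1)] lin_comp[OF lin_snd that(2)]])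
  show ?thesis
    unfolding is_res_def
  proof (intro conjI allI)
    show "left_module R (direct_sum X X')" by (rule left_module_direct_sum[OF D(1) D'(1)])
    show "projective_module R (direct_sum (P i) (P' i))" for i
      using D(2) D'(2) unfolding projective_module_def by (rule in_add_direct_sum[OF A])
  qed (auto simp: l D(4,5) D'(4,5) direct_sum_simps im D(6-8) D'(6-8))
qed

lemma ext_zero_direct_sum_left:
  assumes P: "left_module R (P i)" "left_module R (P (Suc i))" "left_module R (P (Suc (Suc i)))"
    and P': "left_module R (P' i)" "left_module R (P' (Suc i))" "left_module R (P' (Suc (Suc i)))"
    and d: "lin R (P (Suc i)) (P i) (d i)" "lin R (P (Suc (Suc i))) (P (Suc i)) (d (Suc i))"
    and d': "lin R (P' (Suc i)) (P' i) (d' i)" "lin R (P' (Suc (Suc i))) (P' (Suc i)) (d' (Suc i))"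
    and Y: "left_module R Y"
    and z: "ext_zero R P d Y i" "ext_zero R P' d' Y i"
  shows "ext_zero R (\<lambda>i. direct_sum (P i) (P' i)) (\<lambda>i z. (d i (fst z), d' i (snd z))) Y i"
  unfolding ext_zero_def
proof (intro allI impI)
  fix f assume f: "lin R (direct_sum (P (Suc i)) (P' (Suc i))) Y f"
    and c: "\<forall>x\<in>carrier (direct_sum (P (Suc (Suc i))) (P' (Suc (Suc i)))).
      f (d (Suc i) (fst x), d' (Suc i) (snd x)) = \<zero>\<^bsub>Y\<^esub>"
  interpret A: left_module R "P (Suc (Suc i))" by fact
  interpret B: left_module R "P' (Suc (Suc i))" by fact
  interpret A1: left_module R "P (Suc i)" by fact
  interpret B1: left_module R "P' (Suc i)" by fact
  have 1: "\<forall>x\<in>carrier (P (Suc (Suc i))). f (d (Suc i) x, \<zero>\<^bsub>P' (Suc i)\<^esub>) = \<zero>\<^bsub>Y\<^esub>"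
  proof
    fix x assume x: "x \<in> carrier (P (Suc (Suc i)))"
    show "f (d (Suc i) x, \<zero>\<^bsub>P' (Suc i)\<^esub>) = \<zero>\<^bsub>Y\<^esub>"
      using bspec[OF c, of "(x, \<zero>\<^bsub>P' (Suc (Suc i))\<^esub>)"] x lin_zero[OF d'(2) P'(3,2)] by (simp add: direct_sum_simps)
  qed
  from ext_zeroD[OF z(1) lin_comp[OF lin_inl[OF P'(2)] f] 1]
  obtain g where g: "lin R (P i) Y g" "\<And>x. x \<in> carrier (P (Suc i)) \<Longrightarrow> f (x, \<zero>\<^bsub>P' (Suc i)\<^esub>) = g (d i x)" by blast
  have 2: "\<forall>x\<in>carrier (P' (Suc (Suc i))). f (\<zero>\<^bsub>P (Suc i)\<^esub>, d' (Suc i) x) = \<zero>\<^bsub>Y\<^esub>"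
  proof
    fix x assume x: "x \<in> carrier (P' (Suc (Suc i)))"
    show "f (\<zero>\<^bsub>P (Suc i)\<^esub>, d' (Suc i) x) = \<zero>\<^bsub>Y\<^esub>"
      using bspec[OF c, of "(\<zero>\<^bsub>P (Suc (Suc i))\<^esub>, x)"] x lin_zero[OF d(2) P(3,2)] by (simp add: direct_sum_simps)
  qed
  from ext_zeroD[OF z(2) lin_comp[OF lin_inr[OF P(2)] f] 2]
  obtain h where h: "lin R (P' i) Y h" "\<And>x. x \<in> carrier (P' (Suc i)) \<Longrightarrow> f (\<zero>\<^bsub>P (Suc i)\<^esub>, x) = h (d' i x)" by blast
  have "f x = g (d i (fst x)) \<oplus>\<^bsub>Y\<^esub> h (d' i (snd x))" if x: "x \<in> carrier (direct_sum (P (Suc i)) (P' (Suc i)))" for x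
  proof -
    obtain a b where ab: "x = (a, b)" "a \<in> carrier (P (Suc i))" "b \<in> carrier (P' (Suc i))"
      using x by (auto simp: direct_sum_simps)
    show ?thesis using lin_add[OF f, of "(a, \<zero>\<^bsub>P' (Suc i)\<^esub>)" "(\<zero>\<^bsub>P (Suc i)\<^esub>, b)"] ab g(2) h(2)
      by (simp add: direct_sum_simps)
  qed
  then show "\<exists>g. lin R (direct_sum (P i) (P' i)) Y g \<and>
      (\<forall>x\<in>carrier (direct_sum (P (Suc i)) (P' (Suc i))). f x = g (d i (fst x), d' i (snd x)))"
    by (intro exI[of _ "\<lambda>z. g (fst z) \<oplus>\<^bsub>Y\<^esub> h (snd z)"])
      (auto intro: lin_add_map[OF lin_comp[OF lin_fst g(1)] lin_comp[OF lin_snd h(1)] Y])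
qed

lemma zero_submodule_simps:
  assumes "left_module R M"
  shows "left_module R (M\<lparr>carrier := {\<zero>\<^bsub>M\<^esub>}\<rparr>)" "zero_module (M\<lparr>carrier := {\<zero>\<^bsub>M\<^esub>}\<rparr>)"
  using left_module.left_module_sub[OF assms left_module.submodule_zero[OF assms]]
  by (simp_all add: zero_module_def)

lemma is_res_projective:
  assumes Q: "projective_module R Q"
  shows "is_res R Q (\<lambda>i. if i = 0 then Q else Q\<lparr>carrier := {\<zero>\<^bsub>Q\<^esub>}\<rparr>) (\<lambda>i x. \<zero>\<^bsub>Q\<^esub>) (\<lambda>x. x)"
proof -
  note QM = projective_left_module[OF Q]
  interpret Q: left_module R Q by fact
  note z = zero_submodule_simps[OF QM]
  have A: "left_module R (regular R)" by (rule left_module_regular[OF Q.R.ring_axioms])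
  have "projective_module R (Q\<lparr>carrier := {\<zero>\<^bsub>Q\<^esub>}\<rparr>)"
    unfolding projective_module_def by (rule in_add_zero[OF A z])
  moreover have "lin R (Q\<lparr>carrier := {\<zero>\<^bsub>Q\<^esub>}\<rparr>) Q (\<lambda>x. \<zero>\<^bsub>Q\<^esub>)" by (rule lin_zero_map[OF QM])
  moreover have "lin R (Q\<lparr>carrier := {\<zero>\<^bsub>Q\<^esub>}\<rparr>) (Q\<lparr>carrier := {\<zero>\<^bsub>Q\<^esub>}\<rparr>) (\<lambda>x. \<zero>\<^bsub>Q\<^esub>)"
    using lin_zero_map[OF z(1)] by simp
  ultimately show ?thesis unfolding is_res_def using Q QM by (auto simp: lin_id)
qed

text \<open>The resolution in the conclusion is the one that \<open>Ext\<close> selects with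
  \<open>SOME\<close>; all others are reached through \<open>ext_zero_independent\<close>. Cocycles
  in degree 0 are the maps X \<rightarrow> Y, composed with the augmentation, and the degree 0
  coboundaries consist of zero alone.\<close>

lemma ext_zero_Ext:
  fixes A :: "('k, 'a) module" and X :: "('a, 'm) module" and Y :: "('a, 'n) module"
  assumes X: "left_module A X" and Y: "left_module A Y"
    and ex: "\<exists>P d e. projective_resolution A X P d e"
  shows "\<exists>P d e. projective_resolution A X P d e \<and>
    (\<forall>i. zero_module (Ext A (Suc i) X Y) \<longleftrightarrow> ext_zero A P d Y i) \<and>
    (zero_module (Ext A 0 X Y) \<longrightarrow> (\<forall>f. lin A (P 0) Y f \<longrightarrow>
       (\<forall>x\<in>carrier (P (Suc 0)). f (d 0 x) = \<zero>\<^bsub>Y\<^esub>) \<longrightarrow> (\<forall>x\<in>carrier (P 0). f x = \<zero>\<^bsub>Y\<^esub>)))"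
proof -
  interpret Y: left_module A Y by fact
  obtain P d e where eq: "(SOME (P, d, e). projective_resolution A X P d e) = (P, d, e)"
    by (metis prod_cases3)
  have res: "projective_resolution A X P d e"
    using someI_ex[of "\<lambda>(P, d, e). projective_resolution A X P d e"] ex unfolding eq by auto
  note D = is_resD[OF projective_resolution_is_res[OF res X]]
  note dd = is_res_dd[OF projective_resolution_is_res[OF res X]]
  define V where "V i = (hom_module A (P i) Y)\<lparr>carrier := ext_cocycles A P d Y i\<rparr>" for i
  define B where "B i = ext_coboundaries A P d Y i" for i
  have E: "Ext A i X Y = quotient_module (V i) (B i)" for i
    unfolding Ext_def eq V_def B_def by simp
  have zq: "zero_module (quotient_module (V i) (B i)) \<longleftrightarrow> (a_rcosets\<^bsub>V i\<^esub> (B i)) = {B i}" for i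
    by (simp add: zero_module_def quotient_module_def)
  have coset: "(B i +>\<^bsub>V i\<^esub> f) = (\<lambda>b. \<lambda>x\<in>carrier (P i). b x \<oplus>\<^bsub>Y\<^esub> f x) ` B i" for i f
    unfolding a_r_coset_def r_coset_def by (auto simp: V_def hom_module_def)
  have rc: "(a_rcosets\<^bsub>V i\<^esub> (B i)) = (\<lambda>f. B i +>\<^bsub>V i\<^esub> f) ` ext_cocycles A P d Y i" for i
    unfolding A_RCOSETS_def RCOSETS_def a_r_coset_def by (auto simp: V_def)
  have z0: "(\<lambda>x\<in>carrier (P i). \<zero>\<^bsub>Y\<^esub>) \<in> B i" for i
  proof (cases i)
    case (Suc j)
    have "(\<lambda>x\<in>carrier (P (Suc j)). \<zero>\<^bsub>Y\<^esub>) =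
      compose (carrier (P (Suc j))) (restrict (\<lambda>x. \<zero>\<^bsub>Y\<^esub>) (carrier (P j))) (d j)"
      using lin_closed[OF D(5)] by (auto simp: compose_def)
    then show ?thesis using Suc lin_restrict[OF lin_zero_map[OF Y] D(3)] by (auto simp: B_def)
  qed (simp add: B_def)
  have ZB: "zero_module (Ext A i X Y) \<Longrightarrow> f \<in> ext_cocycles A P d Y i \<Longrightarrow> f \<in> B i" for i f
  proof -
    assume "zero_module (Ext A i X Y)" and f: "f \<in> ext_cocycles A P d Y i"
    then have "(B i +>\<^bsub>V i\<^esub> f) = B i" unfolding E zq rc by blast
    then have "(\<lambda>x\<in>carrier (P i). (\<lambda>x\<in>carrier (P i). \<zero>\<^bsub>Y\<^esub>) x \<oplus>\<^bsub>Y\<^esub> f x) \<in> B i"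
      unfolding coset using z0 by blast
    moreover have "(\<lambda>x\<in>carrier (P i). (\<lambda>x\<in>carrier (P i). \<zero>\<^bsub>Y\<^esub>) x \<oplus>\<^bsub>Y\<^esub> f x) = f"
      using f by (auto simp: ext_cocycles_def mod_hom_def PiE_iff fun_eq_iff restrict_def extensional_def)
    ultimately show ?thesis by simp
  qed
  have mh: "f \<in> mod_hom A (P i) Y \<Longrightarrow> g \<in> mod_hom A (P i) Y \<Longrightarrow>
      (\<lambda>x\<in>carrier (P i). f x \<oplus>\<^bsub>Y\<^esub> g x) \<in> mod_hom A (P i) Y \<and>
      (\<lambda>x\<in>carrier (P i). f x \<ominus>\<^bsub>Y\<^esub> g x) \<in> mod_hom A (P i) Y" for f g i
    using lin_restrict[OF lin_add_map[OF mod_hom_lin mod_hom_lin Y] D(3)]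
      lin_restrict[OF lin_minus_map[OF mod_hom_lin mod_hom_lin Y] D(3)] by blast
  have Suc_iff: "zero_module (Ext A (Suc i) X Y) \<longleftrightarrow> ext_zero A P d Y i" for i
  proof
    assume z: "zero_module (Ext A (Suc i) X Y)"
    show "ext_zero A P d Y i" unfolding ext_zero_def
    proof (intro allI impI)
      fix f assume f: "lin A (P (Suc i)) Y f"
        and c: "\<forall>x\<in>carrier (P (Suc (Suc i))). f (d (Suc i) x) = \<zero>\<^bsub>Y\<^esub>"
      have "restrict f (carrier (P (Suc i))) \<in> ext_cocycles A P d Y (Suc i)"
        unfolding ext_cocycles_def using c lin_restrict[OF f D(3)] lin_closed[OF D(5)] by simp
      from ZB[OF z this] obtain g where "g \<in> mod_hom A (P i) Y"
        "restrict f (carrier (P (Suc i))) = compose (carrier (P (Suc i))) g (d i)" by (auto simp: B_def)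
      then show "\<exists>g. lin A (P i) Y g \<and> (\<forall>x\<in>carrier (P (Suc i)). f x = g (d i x))"
        by (intro exI[of _ g]) (auto simp: mod_hom_lin compose_def fun_eq_iff restrict_def; metis)
    qed
  next
    assume z: "ext_zero A P d Y i"
    \<comment> \<open>Once cocycles and coboundaries coincide, the subgroup itself is the only
      coset.\<close>
    have ZeqB: "ext_cocycles A P d Y (Suc i) = B (Suc i)"
    proof (intro equalityI subsetI)
      fix f assume f: "f \<in> ext_cocycles A P d Y (Suc i)"
      then have m: "f \<in> mod_hom A (P (Suc i)) Y" by (simp add: ext_cocycles_def)
      from f have "\<forall>x\<in>carrier (P (Suc (Suc i))). f (d (Suc i) x) = \<zero>\<^bsub>Y\<^esub>" by (simp add: ext_cocycles_def)
      from ext_zeroD[OF z mod_hom_lin[OF m] this] obtain g where g: "lin A (P i) Y g"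
        "\<And>x. x \<in> carrier (P (Suc i)) \<Longrightarrow> f x = g (d i x)" by blast
      have "f = compose (carrier (P (Suc i))) (restrict g (carrier (P i))) (d i)"
        using m g(2) lin_closed[OF D(5)] by (auto simp: compose_def mod_hom_def PiE_iff extensional_def)
      then show "f \<in> B (Suc i)" using lin_restrict[OF g(1) D(3)] by (auto simp: B_def)
    next
      fix f assume "f \<in> B (Suc i)"
      then obtain g where g: "g \<in> mod_hom A (P i) Y" "f = compose (carrier (P (Suc i))) g (d i)"
        by (auto simp: B_def)
      note l = mod_hom_lin[OF g(1)]
      have "f \<in> mod_hom A (P (Suc i)) Y"
        using lin_restrict[OF lin_comp[OF D(5) l] D(3)] g(2) by (simp add: compose_def restrict_def)
      then show "f \<in> ext_cocycles A P d Y (Suc i)"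
        using g(2) lin_closed[OF D(5)] dd(1) lin_zero[OF l D(3) Y]
        by (simp add: ext_cocycles_def compose_def)
    qed
    have "(B (Suc i) +>\<^bsub>V (Suc i)\<^esub> f) = B (Suc i)" if f: "f \<in> B (Suc i)" for f
    proof -
      have fm: "f \<in> mod_hom A (P (Suc i)) Y" if "f \<in> B (Suc i)" for f
        using that unfolding ZeqB[symmetric] by (simp add: ext_cocycles_def)
      have fc: "f (d (Suc i) x) = \<zero>\<^bsub>Y\<^esub>" if "f \<in> B (Suc i)" "x \<in> carrier (P (Suc (Suc i)))" for f x
        using that unfolding ZeqB[symmetric] by (simp add: ext_cocycles_def)
      have fY: "f x \<in> carrier Y" if "f \<in> B (Suc i)" "x \<in> carrier (P (Suc i))" for f x
        using lin_closed[OF mod_hom_lin[OF fm]] that by blast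
      have s: "(\<lambda>x\<in>carrier (P (Suc i)). b x \<oplus>\<^bsub>Y\<^esub> f x) \<in> B (Suc i)"
         "(\<lambda>x\<in>carrier (P (Suc i)). b x \<ominus>\<^bsub>Y\<^esub> f x) \<in> B (Suc i)" if "b \<in> B (Suc i)" for b
        using mh[OF fm[OF that] fm[OF f]] lin_closed[OF D(5)] unfolding ZeqB[symmetric] ext_cocycles_def
        by (auto simp: fc that f a_minus_def)
      show ?thesis unfolding coset
      proof (intro equalityI subsetI)
        fix b assume b: "b \<in> B (Suc i)"
        have "b = (\<lambda>x\<in>carrier (P (Suc i)). (\<lambda>x\<in>carrier (P (Suc i)). b x \<ominus>\<^bsub>Y\<^esub> f x) x \<oplus>\<^bsub>Y\<^esub> f x)"
          using fm[OF b] fY[OF b] fY[OF f]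
          by (auto simp: fun_eq_iff mod_hom_def PiE_iff extensional_def a_minus_def Y.M.a_assoc Y.M.l_neg)
        then show "b \<in> (\<lambda>b. \<lambda>x\<in>carrier (P (Suc i)). b x \<oplus>\<^bsub>Y\<^esub> f x) ` B (Suc i)" using s(2)[OF b] by blast
      qed (use s in blast)
    qed
    then show "zero_module (Ext A (Suc i) X Y)" unfolding E zq rc ZeqB using z0 by blast
  qed
  have "\<forall>x\<in>carrier (P 0). f x = \<zero>\<^bsub>Y\<^esub>" if z: "zero_module (Ext A 0 X Y)" and f: "lin A (P 0) Y f"
    and c: "\<forall>x\<in>carrier (P (Suc 0)). f (d 0 x) = \<zero>\<^bsub>Y\<^esub>" for f
  proof -
    have "restrict f (carrier (P 0)) \<in> ext_cocycles A P d Y 0"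
      unfolding ext_cocycles_def using c lin_restrict[OF f D(3)] lin_closed[OF D(5)] by simp
    from ZB[OF z this] have "restrict f (carrier (P 0)) = (\<lambda>x\<in>carrier (P 0). \<zero>\<^bsub>Y\<^esub>)" by (simp add: B_def)
    then show ?thesis by (metis restrict_apply')
  qed
  then show ?thesis using res Suc_iff by (intro exI[of _ P] exI[of _ d] exI[of _ e]) simp
qed

lemma zero_module_Ext:
  fixes A :: "('k, 'a) module" and X :: "('a, 'm) module" and Y :: "('a, 'n) module"
  assumes r: "is_res A X P d e" and Y: "left_module A Y" and z: "ext_zero A P d Y i"
  shows "zero_module (Ext A (Suc i) X Y)"
proof -
  note X = is_resD(1)[OF r]
  have ex: "\<exists>P d e. projective_resolution A X P d e" using transport_resolution[OF r] by blast
  from ext_zero_Ext[OF X Y ex] obtain P' d' e' where r': "projective_resolution A X P' d' e'"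
    and iff: "zero_module (Ext A (Suc i) X Y) \<longleftrightarrow> ext_zero A P' d' Y i" by blast
  show ?thesis unfolding iff
    by (rule ext_zero_independent[OF r projective_resolution_is_res[OF r' X] Y z])
qed

subsection \<open>Finite generation and linear algebra\<close>

text \<open>Generation is tested against submodules instead of through linear combinations, so that
  one notion serves modules over \<Lambda> and vector spaces over k.\<close>

definition fg where
  "fg R M \<longleftrightarrow> (\<exists>B. finite B \<and> B \<subseteq> carrier M \<and> (\<forall>H. submodule H R M \<longrightarrow> B \<subseteq> H \<longrightarrow> H = carrier M))"

lemma fg_image:
  assumes M: "left_module R M" and N: "left_module R N" and f: "lin R M N f" "f ` carrier M = carrier N"
    and g: "fg R M"
  shows "fg R N"
proof -
  from g obtain B where B: "finite B" "B \<subseteq> carrier M"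
    "\<forall>H. submodule H R M \<longrightarrow> B \<subseteq> H \<longrightarrow> H = carrier M" unfolding fg_def by (elim exE conjE)
  show ?thesis unfolding fg_def
  proof (intro exI[of _ "f ` B"] conjI allI impI)
    fix H assume H: "submodule H R N" "f ` B \<subseteq> H"
    have "{x \<in> carrier M. f x \<in> H} = carrier M"
      by (rule B(3)[rule_format, OF submodule_vimage[OF f(1) M N H(1)]]) (use H B(1,2) in auto)
    then have "x \<in> carrier M \<Longrightarrow> f x \<in> H" for x by (metis (mono_tags, lifting) mem_Collect_eq)
    then have "f ` carrier M \<subseteq> H" by blast
    then show "H = carrier N" unfolding f(2) using left_module.submoduleD(1)[OF N H(1)] by (rule equalityI[rotated])
  qed (use B(1,2) lin_closed[OF f(1)] in auto)
qed

lemma fg_direct_sum: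
  assumes M: "left_module R M" and N: "left_module R N" and g: "fg R M" "fg R N"
  shows "fg R (direct_sum M N)"
proof -
  interpret M: left_module R M by fact
  interpret N: left_module R N by fact
  note D = left_module_direct_sum[OF M N]
  from g(1) obtain B where B: "finite B" "B \<subseteq> carrier M"
    "\<forall>H. submodule H R M \<longrightarrow> B \<subseteq> H \<longrightarrow> H = carrier M" unfolding fg_def by (elim exE conjE)
  from g(2) obtain C where C: "finite C" "C \<subseteq> carrier N"
    "\<forall>H. submodule H R N \<longrightarrow> C \<subseteq> H \<longrightarrow> H = carrier N" unfolding fg_def by (elim exE conjE)
  let ?i = "\<lambda>x. (x, \<zero>\<^bsub>N\<^esub>)" and ?j = "\<lambda>y. (\<zero>\<^bsub>M\<^esub>, y)"
  show ?thesis unfolding fg_def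
  proof (intro exI[of _ "?i ` B \<union> ?j ` C"] conjI allI impI)
    fix H assume H: "submodule H R (direct_sum M N)" "?i ` B \<union> ?j ` C \<subseteq> H"
    have 1: "{x \<in> carrier M. ?i x \<in> H} = carrier M"
      by (rule B(3)[rule_format, OF submodule_vimage[OF lin_inl[OF N] M D H(1)]]) (use H B(1,2) in auto)
    have 2: "{x \<in> carrier N. ?j x \<in> H} = carrier N"
      by (rule C(3)[rule_format, OF submodule_vimage[OF lin_inr[OF M] N D H(1)]]) (use H C(1,2) in auto)
    have "(x, y) \<in> H" if "x \<in> carrier M" "y \<in> carrier N" for x y
    proof -
      have "x \<in> {x \<in> carrier M. ?i x \<in> H}" "y \<in> {y \<in> carrier N. ?j y \<in> H}" unfolding 1 2 by (fact that)+
      then show ?thesis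
        using left_module.submoduleD(3)[OF D H(1), of "?i x" "?j y"] that by (simp add: direct_sum_simps)
    qed
    then show "H = carrier (direct_sum M N)"
      using left_module.submoduleD(1)[OF D H(1)] by (auto simp: direct_sum_simps)
  qed (use B(1,2) C(1,2) in \<open>auto simp: direct_sum_simps\<close>)
qed

lemma fg_projective: assumes "projective_module R P" shows "fg R P"
proof -
  note PM = projective_left_module[OF assms]
  interpret P: left_module R P by fact
  obtain m u \<phi> where u: "\<And>j. j < m \<Longrightarrow> u j \<in> carrier P"
    and \<phi>: "\<And>j. j < m \<Longrightarrow> lin R P (regular R) (\<phi> j)"
    and s: "\<And>x. x \<in> carrier P \<Longrightarrow> msum P (\<lambda>j. \<phi> j x \<odot>\<^bsub>P\<^esub> u j) m = x"
    using projective_dual_basis[OF P.R.ring_axioms assms] by blast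
  have \<phi>c: "\<phi> j x \<in> carrier R" if "j < m" "x \<in> carrier P" for j x
    using lin_closed[OF \<phi> that(2)] that(1) by (simp add: regular_def)
  show ?thesis unfolding fg_def
  proof (intro exI[of _ "u ` {..<m}"] conjI allI impI)
    fix H assume H: "submodule H R P" "u ` {..<m} \<subseteq> H"
    have "x \<in> H" if x: "x \<in> carrier P" for x
    proof -
      have "msum P (\<lambda>j. \<phi> j x \<odot>\<^bsub>P\<^esub> u j) m \<in> H"
        by (rule msum_mem[OF PM H(1)]) (use H \<phi>c x P.submoduleD(4)[OF H(1)] in auto)
      then show ?thesis by (simp add: s[OF x])
    qed
    then show "H = carrier P" using P.submoduleD(1)[OF H(1)] by blast
  qed (use u in auto)
qed

section \<open>Linear algebra over the ground field\<close>

lemma left_module_imp_module: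
  assumes "cring K" "left_module K V" shows "module K V"
proof -
  interpret left_module K V by fact
  show ?thesis by (rule moduleI) (auto simp: assms M.abelian_group_axioms smult_closed smult_l_distr smult_r_distr smult_assoc smult_one)
qed

text \<open>The linear combinations of a generating set form a submodule that contains it, hence
  exhaust V; conversely a submodule containing B contains all its linear combinations.\<close>

lemma finite_dim_iff_fg:
  assumes K: "field K" and V: "left_module K V"
  shows "finite_dim K V \<longleftrightarrow> fg K V"
proof -
  interpret K: field K by fact
  interpret V: left_module K V by fact
  interpret VM: module K V by (rule left_module_imp_module[OF K.cring_axioms V])
  have mem: "finsum V f B \<in> H" if "submodule H K V" "finite B" "\<And>b. b \<in> B \<Longrightarrow> f b \<in> H" for f B H
    using that(2,3)
  proof (induct B)
    case (insert b B)
    then have "f \<in> B \<rightarrow> carrier V" "f b \<in> carrier V" using V.submoduleD(1)[OF that(1)] by auto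
    then show ?case using insert V.submoduleD(3)[OF that(1)] by simp
  qed (use V.submoduleD(2)[OF that(1)] in simp)
  show ?thesis
  proof
    assume "finite_dim K V"
    then obtain B where B: "finite B" "B \<subseteq> carrier V"
      "\<And>v. v \<in> carrier V \<Longrightarrow> \<exists>c\<in>B \<rightarrow> carrier K. v = (\<Oplus>\<^bsub>V\<^esub>b\<in>B. c b \<odot>\<^bsub>V\<^esub> b)" unfolding finite_dim_def by blast
    show "fg K V" unfolding fg_def
    proof (intro exI[of _ B] conjI allI impI)
      fix H assume H: "submodule H K V" "B \<subseteq> H"
      have "v \<in> H" if v: "v \<in> carrier V" for v
      proof -
        obtain c where c: "c \<in> B \<rightarrow> carrier K" "v = (\<Oplus>\<^bsub>V\<^esub>b\<in>B. c b \<odot>\<^bsub>V\<^esub> b)" using B(3)[OF v] by blast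
        show ?thesis unfolding c(2) by (rule mem[OF H(1) B(1)]) (use H c V.submoduleD(4)[OF H(1)] in auto)
      qed
      then show "H = carrier V" using V.submoduleD(1)[OF H(1)] by blast
    qed (use B(1,2) in auto)
  next
    assume "fg K V"
    then obtain B where B: "finite B" "B \<subseteq> carrier V"
      "\<forall>H. submodule H K V \<longrightarrow> B \<subseteq> H \<longrightarrow> H = carrier V" unfolding fg_def by (elim exE conjE)
    define S where "S = {(\<Oplus>\<^bsub>V\<^esub>b\<in>B. c b \<odot>\<^bsub>V\<^esub> b) | c. c \<in> B \<rightarrow> carrier K}"
    have cl: "(\<lambda>b. c b \<odot>\<^bsub>V\<^esub> b) \<in> B \<rightarrow> carrier V" if "c \<in> B \<rightarrow> carrier K" for c
      using that B(2) V.smult_closed by (auto simp: Pi_iff)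
    have S: "submodule S K V"
    proof (rule V.submoduleI')
      show "S \<subseteq> carrier V" using cl by (auto simp: S_def)
      have "\<zero>\<^bsub>V\<^esub> = (\<Oplus>\<^bsub>V\<^esub>b\<in>B. \<zero>\<^bsub>K\<^esub> \<odot>\<^bsub>V\<^esub> b)"
        by (rule V.M.add.finprod_one_eqI[symmetric]) (use B(1,2) in auto)
      then show "\<zero>\<^bsub>V\<^esub> \<in> S" by (auto simp: S_def)
    next
      fix x y assume "x \<in> S" "y \<in> S"
      then obtain c c' where c: "c \<in> B \<rightarrow> carrier K" "x = (\<Oplus>\<^bsub>V\<^esub>b\<in>B. c b \<odot>\<^bsub>V\<^esub> b)"
        "c' \<in> B \<rightarrow> carrier K" "y = (\<Oplus>\<^bsub>V\<^esub>b\<in>B. c' b \<odot>\<^bsub>V\<^esub> b)" by (auto simp: S_def)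
      have "x \<oplus>\<^bsub>V\<^esub> y = (\<Oplus>\<^bsub>V\<^esub>b\<in>B. c b \<odot>\<^bsub>V\<^esub> b \<oplus>\<^bsub>V\<^esub> c' b \<odot>\<^bsub>V\<^esub> b)"
        unfolding c(2,4) by (rule V.M.finsum_addf[symmetric]) (use cl c in auto)
      also have "\<dots> = (\<Oplus>\<^bsub>V\<^esub>b\<in>B. (c b \<oplus>\<^bsub>K\<^esub> c' b) \<odot>\<^bsub>V\<^esub> b)"
        by (rule V.M.finsum_cong') (use c cl B(2) in \<open>auto simp: Pi_iff V.smult_l_distr subset_iff V.smult_closed\<close>)
      finally show "x \<oplus>\<^bsub>V\<^esub> y \<in> S" unfolding S_def using c by (auto intro!: exI[of _ "\<lambda>b. c b \<oplus>\<^bsub>K\<^esub> c' b"])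
    next
      fix a x assume a: "a \<in> carrier K" and "x \<in> S"
      then obtain c where c: "c \<in> B \<rightarrow> carrier K" "x = (\<Oplus>\<^bsub>V\<^esub>b\<in>B. c b \<odot>\<^bsub>V\<^esub> b)" by (auto simp: S_def)
      have "a \<odot>\<^bsub>V\<^esub> x = (\<Oplus>\<^bsub>V\<^esub>b\<in>B. a \<odot>\<^bsub>V\<^esub> (c b \<odot>\<^bsub>V\<^esub> b))"
        unfolding c(2) by (rule VM.finsum_smult_ldistr[OF B(1) a cl[OF c(1)]])
      also have "\<dots> = (\<Oplus>\<^bsub>V\<^esub>b\<in>B. (a \<otimes>\<^bsub>K\<^esub> c b) \<odot>\<^bsub>V\<^esub> b)"
        by (rule V.M.finsum_cong') (use c a cl B(2) in \<open>auto simp: Pi_iff V.smult_assoc subset_iff V.smult_closed\<close>)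
      finally show "a \<odot>\<^bsub>V\<^esub> x \<in> S" unfolding S_def using c a by (auto intro!: exI[of _ "\<lambda>b. a \<otimes>\<^bsub>K\<^esub> c b"])
    qed
    have "B \<subseteq> S"
    proof
      fix b assume b: "b \<in> B"
      have "(\<Oplus>\<^bsub>V\<^esub>b'\<in>B. (if b = b' then \<one>\<^bsub>K\<^esub> else \<zero>\<^bsub>K\<^esub>) \<odot>\<^bsub>V\<^esub> b') = (\<Oplus>\<^bsub>V\<^esub>b'\<in>B. if b = b' then b' else \<zero>\<^bsub>V\<^esub>)"
        by (rule V.M.finsum_cong') (use B(2) in \<open>auto simp: V.smult_one subset_iff\<close>)
      also have "\<dots> = b" by (rule V.M.add.finprod_singleton[of b B "\<lambda>x. x"]) (use b B in auto)
      finally show "b \<in> S" unfolding S_def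
        by (intro CollectI exI[of _ "\<lambda>b'. if b = b' then \<one>\<^bsub>K\<^esub> else \<zero>\<^bsub>K\<^esub>"]) auto
    qed
    from B(3)[rule_format, OF S this] show "finite_dim K V" unfolding finite_dim_def
      using B(1,2) by (intro exI[of _ B]) (auto simp: S_def)
  qed
qed

lemma regular_simps:
  "carrier (regular R) = carrier R" "\<zero>\<^bsub>regular R\<^esub> = \<zero>\<^bsub>R\<^esub>" "add (regular R) = add R" "smult (regular R) = monoid.mult R"
  by (simp_all add: regular_def)

text \<open>A generating set of \<open>V\<close> modulo \<open>U\<close> of least cardinality is a basis of \<open>V/U\<close>.\<close>

lemma relative_basis:
  assumes K: "field K" and V: "left_module K V" and g: "fg K V" and U: "submodule U K V"
  shows "\<exists>m b \<phi>. (\<forall>j<m. b j \<in> carrier V \<and> lin K V (regular K) (\<phi> j) \<and> (\<forall>u\<in>U. \<phi> j u = \<zero>\<^bsub>K\<^esub>)) \<and>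
    (\<forall>i<m. \<forall>j<m. \<phi> i (b j) = (if i = j then \<one>\<^bsub>K\<^esub> else \<zero>\<^bsub>K\<^esub>)) \<and>
    (\<forall>x\<in>carrier V. x \<ominus>\<^bsub>V\<^esub> msum V (\<lambda>j. \<phi> j x \<odot>\<^bsub>V\<^esub> b j) m \<in> U)"
proof -
  interpret K: field K by fact
  interpret V: left_module K V by fact
  note UD = V.submoduleD[OF U]
  define gen where "gen S \<longleftrightarrow> finite S \<and> S \<subseteq> carrier V \<and>
    (\<forall>H. submodule H K V \<longrightarrow> U \<union> S \<subseteq> H \<longrightarrow> H = carrier V)" for S
  obtain S0 where "gen S0" using g unfolding fg_def gen_def by (meson Un_subset_iff)
  from ex_has_least_nat[of gen, OF this, of card] obtain S where S: "gen S"
    and min: "\<And>S'. gen S' \<Longrightarrow> card S \<le> card S'" by blast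
  from S have finS: "finite S" and SV: "S \<subseteq> carrier V" by (simp_all add: gen_def)
  from S have genS: "H = carrier V" if "submodule H K V" "U \<union> S \<subseteq> H" for H
    using that unfolding gen_def by (elim conjE allE[of _ H]) simp
  \<comment> \<open>C b is the span of U and of all generators except b. Minimality keeps b out of
    it, so V is the direct sum of the line through b and C b, and \<psi> b below is the coordinate
    along b.\<close>
  define C where "C b = \<Inter>{H. submodule H K V \<and> U \<union> (S - {b}) \<subseteq> H}" for b
  have C: "submodule (C b) K V" for b unfolding C_def
    by (rule V.submodule_Inter) (use V.submodule_carrier UD(1) SV in auto)
  note CD = V.submoduleD[OF C]
  have CS: "U \<union> (S - {b}) \<subseteq> C b" for b unfolding C_def by blast
  have nC: "b \<notin> C b" if b: "b \<in> S" for b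
  proof
    assume bC: "b \<in> C b"
    have "gen (S - {b})" unfolding gen_def
    proof (intro conjI allI impI)
      fix H assume H: "submodule H K V" "U \<union> (S - {b}) \<subseteq> H"
      then have "b \<in> H" using bC unfolding C_def by blast
      then show "H = carrier V" using H(2) by (intro genS[OF H(1)]) blast
    qed (use finS SV in auto)
    from min[OF this] show False using finS b by (meson card_Diff1_less not_le)
  qed
  have ex: "\<exists>c\<in>carrier K. \<exists>u\<in>C b. x = c \<odot>\<^bsub>V\<^esub> b \<oplus>\<^bsub>V\<^esub> u" if b: "b \<in> S" and x: "x \<in> carrier V" for b x
  proof -
    have bV: "b \<in> carrier V" using b SV by blast
    let ?H = "{x \<in> carrier V. \<exists>c\<in>carrier K. \<exists>u\<in>C b. x = c \<odot>\<^bsub>V\<^esub> b \<oplus>\<^bsub>V\<^esub> u}"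
    have CV: "u \<in> carrier V" if "u \<in> C b" for u using that CD(1) by blast
    have CH: "u \<in> ?H" if "u \<in> C b" for u
      using that CV bV by (auto intro!: bexI[of _ "\<zero>\<^bsub>K\<^esub>"] bexI[of _ u])
    have "submodule ?H K V"
    proof (rule V.submoduleI')
      show "\<zero>\<^bsub>V\<^esub> \<in> ?H" by (rule CH[OF CD(2)])
    next
      fix x y assume "x \<in> ?H" "y \<in> ?H"
      then obtain c c' u u' where "c \<in> carrier K" "c' \<in> carrier K" "u \<in> C b" "u' \<in> C b"
        "x = c \<odot>\<^bsub>V\<^esub> b \<oplus>\<^bsub>V\<^esub> u" "y = c' \<odot>\<^bsub>V\<^esub> b \<oplus>\<^bsub>V\<^esub> u'" by blast
      then show "x \<oplus>\<^bsub>V\<^esub> y \<in> ?H"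
        using bV CV CD(3)[of u b u'] V.smult_closed
        by (intro CollectI conjI bexI[of _ "c \<oplus>\<^bsub>K\<^esub> c'"] bexI[of _ "u \<oplus>\<^bsub>V\<^esub> u'"]) (auto simp: V.smult_l_distr V.M.a_ac)
    next
      fix a x assume a: "a \<in> carrier K" and "x \<in> ?H"
      then obtain c u where "c \<in> carrier K" "u \<in> C b" "x = c \<odot>\<^bsub>V\<^esub> b \<oplus>\<^bsub>V\<^esub> u" by blast
      then show "a \<odot>\<^bsub>V\<^esub> x \<in> ?H"
        using a bV CV CD(4)[of a u b] V.smult_closed
        by (intro CollectI conjI bexI[of _ "a \<otimes>\<^bsub>K\<^esub> c"] bexI[of _ "a \<odot>\<^bsub>V\<^esub> u"]) (auto simp: V.smult_r_distr V.smult_assoc)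
    qed auto
    moreover have "b \<in> ?H" using bV CD(2)
      by (auto intro!: bexI[of _ "\<one>\<^bsub>K\<^esub>"] bexI[of _ "\<zero>\<^bsub>V\<^esub>"] simp: V.smult_one)
    moreover have "U \<union> (S - {b}) \<subseteq> ?H" using CH CS by blast
    ultimately have "?H = carrier V" by (intro genS) auto
    then show ?thesis using x by blast
  qed
  have uniq: "c = c'" if b: "b \<in> S" and c: "c \<in> carrier K" "c' \<in> carrier K" "u \<in> C b" "u' \<in> C b"
    "c \<odot>\<^bsub>V\<^esub> b \<oplus>\<^bsub>V\<^esub> u = c' \<odot>\<^bsub>V\<^esub> b \<oplus>\<^bsub>V\<^esub> u'" for b c c' u u'
  proof (rule ccontr)
    assume ne: "c \<noteq> c'"
    have bV: "b \<in> carrier V" using b SV by blast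
    have uV: "u \<in> carrier V" "u' \<in> carrier V" using c CD(1) by blast+
    have nz: "c \<ominus>\<^bsub>K\<^esub> c' \<noteq> \<zero>\<^bsub>K\<^esub>" using ne c(1,2) K.minus_eq_zeroD by blast
    have u: "c \<ominus>\<^bsub>K\<^esub> c' \<in> Units K" using nz c(1,2) by (simp add: K.field_Units)
    have cb: "c \<odot>\<^bsub>V\<^esub> b = c' \<odot>\<^bsub>V\<^esub> b \<oplus>\<^bsub>V\<^esub> (u' \<ominus>\<^bsub>V\<^esub> u)"
    proof -
      have "c \<odot>\<^bsub>V\<^esub> b = c \<odot>\<^bsub>V\<^esub> b \<oplus>\<^bsub>V\<^esub> u \<ominus>\<^bsub>V\<^esub> u"
        using c(1) bV uV V.smult_closed by (simp add: a_minus_def V.M.a_assoc V.M.r_neg)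
      then show ?thesis unfolding c(5)
        using c(2) bV uV V.smult_closed by (simp add: a_minus_def V.M.a_assoc)
    qed
    have "(c \<ominus>\<^bsub>K\<^esub> c') \<odot>\<^bsub>V\<^esub> b = u' \<ominus>\<^bsub>V\<^esub> u"
    proof -
      have "(c \<ominus>\<^bsub>K\<^esub> c') \<odot>\<^bsub>V\<^esub> b \<oplus>\<^bsub>V\<^esub> c' \<odot>\<^bsub>V\<^esub> b = c \<odot>\<^bsub>V\<^esub> b"
        using c(1,2) bV by (simp add: V.smult_l_distr[symmetric] a_minus_def K.a_assoc K.l_neg)
      also have "\<dots> = (u' \<ominus>\<^bsub>V\<^esub> u) \<oplus>\<^bsub>V\<^esub> c' \<odot>\<^bsub>V\<^esub> b"
        unfolding cb using c bV uV V.smult_closed by (simp add: V.M.a_comm)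
      finally show ?thesis using c(1,2) bV uV V.smult_closed by (simp add: V.M.add.right_cancel)
    qed
    then have "(c \<ominus>\<^bsub>K\<^esub> c') \<odot>\<^bsub>V\<^esub> b \<in> C b" using CD(6)[OF c(4,3)] by simp
    from CD(4)[OF K.Units_inv_closed[OF u] this] have "b \<in> C b"
      using u c(1,2) bV by (simp add: V.smult_assoc[symmetric] V.smult_one)
    then show False using nC[OF b] by blast
  qed
  define \<psi> where "\<psi> b x = (THE c. c \<in> carrier K \<and> (\<exists>u\<in>C b. x = c \<odot>\<^bsub>V\<^esub> b \<oplus>\<^bsub>V\<^esub> u))" for b x
  have \<psi>eq: "\<psi> b (c \<odot>\<^bsub>V\<^esub> b \<oplus>\<^bsub>V\<^esub> u) = c" if "b \<in> S" "c \<in> carrier K" "u \<in> C b" for b c u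
    unfolding \<psi>_def using uniq[OF that(1)] that by (intro the_equality) blast+
  have \<psi>lin: "lin K V (regular K) (\<psi> b)" if b: "b \<in> S" for b
  proof -
    have bV: "b \<in> carrier V" using b SV by blast
    have CV: "u \<in> carrier V" if "u \<in> C b" for u using that CD(1) by blast
    show ?thesis
    proof (rule linI)
      fix x assume "x \<in> carrier V"
      then show "\<psi> b x \<in> carrier (regular K)" using ex[OF b] \<psi>eq[OF b] by (metis regular_simps(1))
    next
      fix x y assume "x \<in> carrier V" "y \<in> carrier V"
      then obtain c c' u u' where c: "c \<in> carrier K" "c' \<in> carrier K" "u \<in> C b" "u' \<in> C b"
        and xy: "x = c \<odot>\<^bsub>V\<^esub> b \<oplus>\<^bsub>V\<^esub> u" "y = c' \<odot>\<^bsub>V\<^esub> b \<oplus>\<^bsub>V\<^esub> u'" using ex[OF b] by metis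
      have "x \<oplus>\<^bsub>V\<^esub> y = (c \<oplus>\<^bsub>K\<^esub> c') \<odot>\<^bsub>V\<^esub> b \<oplus>\<^bsub>V\<^esub> (u \<oplus>\<^bsub>V\<^esub> u')"
        using c xy bV CV V.smult_closed by (auto simp: V.smult_l_distr V.M.a_ac)
      then show "\<psi> b (x \<oplus>\<^bsub>V\<^esub> y) = \<psi> b x \<oplus>\<^bsub>regular K\<^esub> \<psi> b y"
        using c xy CD(3) by (simp add: \<psi>eq[OF b] regular_simps)
    next
      fix a x assume a: "a \<in> carrier K" and "x \<in> carrier V"
      then obtain c u where c: "c \<in> carrier K" "u \<in> C b" and x: "x = c \<odot>\<^bsub>V\<^esub> b \<oplus>\<^bsub>V\<^esub> u" using ex[OF b] by metis
      have "a \<odot>\<^bsub>V\<^esub> x = (a \<otimes>\<^bsub>K\<^esub> c) \<odot>\<^bsub>V\<^esub> b \<oplus>\<^bsub>V\<^esub> (a \<odot>\<^bsub>V\<^esub> u)"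
        using c x a bV CV V.smult_closed by (auto simp: V.smult_r_distr V.smult_assoc)
      then show "\<psi> b (a \<odot>\<^bsub>V\<^esub> x) = a \<odot>\<^bsub>regular K\<^esub> \<psi> b x"
        using c x a CD(4) by (simp add: \<psi>eq[OF b] regular_simps)
    qed
  qed
  have \<psi>C: "\<psi> b u = \<zero>\<^bsub>K\<^esub>" if "b \<in> S" "u \<in> C b" for b u
    using \<psi>eq[OF that(1) K.zero_closed that(2)] that SV CD(1) by (auto simp: subset_iff)
  have \<psi>b: "\<psi> b b = \<one>\<^bsub>K\<^esub>" if "b \<in> S" for b
    using \<psi>eq[OF that K.one_closed CD(2)] that SV by (auto simp: V.smult_one)
  obtain h where h: "bij_betw h {0..<card S} S" using ex_bij_betw_nat_finite[OF finS] by blast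
  let ?m = "card S"
  have hS: "h j \<in> S" if "j < ?m" for j using h that by (auto simp: bij_betw_def)
  have hV: "h j \<in> carrier V" if "j < ?m" for j using hS[OF that] SV by blast
  have hinj: "h i = h j \<longleftrightarrow> i = j" if "i < ?m" "j < ?m" for i j
    using h that by (auto simp: bij_betw_def inj_on_def)
  have delta: "\<psi> (h i) (h j) = (if i = j then \<one>\<^bsub>K\<^esub> else \<zero>\<^bsub>K\<^esub>)" if "i < ?m" "j < ?m" for i j
  proof (cases "i = j")
    case False
    then have "h j \<in> C (h i)" using CS hS hinj that by blast
    then show ?thesis using \<psi>C[OF hS[OF that(1)]] False by simp
  qed (use \<psi>b hS that in simp)
  \<comment> \<open>The x whose remainder lies in U form a submodule; it contains U and S, hence is
    V.\<close>
  let ?E = "\<lambda>x. x \<ominus>\<^bsub>V\<^esub> msum V (\<lambda>j. \<psi> (h j) x \<odot>\<^bsub>V\<^esub> h j) ?m"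
  have Elin: "lin K V V ?E"
    by (rule lin_minus_map[OF lin_id lin_msum_map[OF _ V] V])
      (rule lin_comp[OF \<psi>lin lin_smult_elem[OF V]], auto simp: hS hV)
  have "{x \<in> carrier V. ?E x \<in> U} = carrier V"
  proof (rule genS[OF submodule_vimage[OF Elin V V U]])
    have "?E u \<in> U" if u: "u \<in> U" for u
    proof -
      have uC: "u \<in> C b" for b using CS u by blast
      have "msum V (\<lambda>j. \<psi> (h j) u \<odot>\<^bsub>V\<^esub> h j) ?m = msum V (\<lambda>j. \<zero>\<^bsub>V\<^esub>) ?m"
        by (rule msum_cong) (simp add: \<psi>C[OF hS uC] hV)
      then show ?thesis using u UD by (simp add: msum_zero[OF V] a_minus_def subset_iff)
    qed
    moreover have "?E b \<in> U" if b: "b \<in> S" for b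
    proof -
      obtain k where k: "k < ?m" "b = h k" using h b unfolding bij_betw_def by (metis imageE atLeastLessThan_iff)
      have "msum V (\<lambda>j. \<psi> (h j) b \<odot>\<^bsub>V\<^esub> h j) ?m = msum V (\<lambda>j. if j = k then b else \<zero>\<^bsub>V\<^esub>) ?m"
        by (rule msum_cong) (auto simp: k delta hV V.smult_one)
      also have "\<dots> = b" using k by (subst msum_delta[OF V]) (auto simp: hV)
      finally show ?thesis using hV[OF k(1)] k(2) UD(2) by (simp add: a_minus_def V.M.r_neg)
    qed
    ultimately show "U \<union> S \<subseteq> {x \<in> carrier V. ?E x \<in> U}" using UD(1) SV by blast
  qed
  then have "\<forall>x\<in>carrier V. ?E x \<in> U" by blast
  moreover have "\<forall>j<?m. h j \<in> carrier V \<and> lin K V (regular K) (\<psi> (h j)) \<and> (\<forall>u\<in>U. \<psi> (h j) u = \<zero>\<^bsub>K\<^esub>)"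
    using hV \<psi>lin hS \<psi>C CS by blast
  ultimately show ?thesis using delta
    by (intro exI[of _ ?m] exI[of _ h] exI[of _ "\<lambda>j. \<psi> (h j)"]) simp
qed

lemma lin_inj_onI:
  assumes f: "lin R M N f" and M: "left_module R M" and N: "left_module R N"
    and k: "\<And>x. x \<in> carrier M \<Longrightarrow> f x = \<zero>\<^bsub>N\<^esub> \<Longrightarrow> x = \<zero>\<^bsub>M\<^esub>"
  shows "inj_on f (carrier M)"
proof (rule inj_onI)
  interpret M: left_module R M by fact
  interpret N: left_module R N by fact
  fix x y assume xy: "x \<in> carrier M" "y \<in> carrier M" "f x = f y"
  have "f (x \<ominus>\<^bsub>M\<^esub> y) = \<zero>\<^bsub>N\<^esub>"
    using xy lin_closed[OF f xy(2)] by (simp add: lin_minus[OF f M N] a_minus_def[of N] N.M.r_neg)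
  have "x \<ominus>\<^bsub>M\<^esub> y = \<zero>\<^bsub>M\<^esub>" by (rule k[OF M.M.minus_closed[OF xy(1,2)]]) fact
  then show "x = y" by (rule M.M.minus_eq_zeroD[OF xy(1,2)])
qed

lemma dual_basis:
  assumes K: "field K" and V: "left_module K V" and g: "fg K V"
  shows "\<exists>m b \<phi>. (\<forall>j<m. b j \<in> carrier V \<and> lin K V (regular K) (\<phi> j)) \<and>
    (\<forall>i<m. \<forall>j<m. \<phi> i (b j) = (if i = j then \<one>\<^bsub>K\<^esub> else \<zero>\<^bsub>K\<^esub>)) \<and>
    (\<forall>x\<in>carrier V. msum V (\<lambda>j. \<phi> j x \<odot>\<^bsub>V\<^esub> b j) m = x)"
proof -
  interpret V: left_module K V by fact
  obtain m b \<phi> where 1: "\<forall>j<m. b j \<in> carrier V \<and> lin K V (regular K) (\<phi> j) \<and> (\<forall>u\<in>{\<zero>\<^bsub>V\<^esub>}. \<phi> j u = \<zero>\<^bsub>K\<^esub>)"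
    and 2: "\<forall>i<m. \<forall>j<m. \<phi> i (b j) = (if i = j then \<one>\<^bsub>K\<^esub> else \<zero>\<^bsub>K\<^esub>)"
    and 3: "\<forall>x\<in>carrier V. x \<ominus>\<^bsub>V\<^esub> msum V (\<lambda>j. \<phi> j x \<odot>\<^bsub>V\<^esub> b j) m \<in> {\<zero>\<^bsub>V\<^esub>}"
    using relative_basis[OF K V g V.submodule_zero] by (elim exE conjE)
  have "msum V (\<lambda>j. \<phi> j x \<odot>\<^bsub>V\<^esub> b j) m = x" if x: "x \<in> carrier V" for x
  proof -
    have "\<phi> j x \<in> carrier K" if "j < m" for j
      using 1 that x lin_closed by (fastforce simp: regular_simps)
    then have "msum V (\<lambda>j. \<phi> j x \<odot>\<^bsub>V\<^esub> b j) m \<in> carrier V"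
      using 1 by (intro msum_closed[OF V] V.smult_closed) auto
    from V.M.minus_eq_zeroD[OF x this] show ?thesis using 3 x by simp
  qed
  then show ?thesis using 1 2 by (intro exI[of _ m] exI[of _ b] exI[of _ \<phi>]) simp
qed

text \<open>Subtracting from x its components along a basis of V/U leaves an element of U, and
  changes nothing if x is in U.\<close>

lemma projection_onto_subspace:
  assumes K: "field K" and V: "left_module K V" and g: "fg K V" and U: "submodule U K V"
  shows "\<exists>E. lin K V V E \<and> (\<forall>x\<in>carrier V. E x \<in> U) \<and> (\<forall>u\<in>U. E u = u)"
proof -
  interpret V: left_module K V by fact
  obtain m b \<phi> where 1: "\<forall>j<m. b j \<in> carrier V \<and> lin K V (regular K) (\<phi> j) \<and> (\<forall>u\<in>U. \<phi> j u = \<zero>\<^bsub>K\<^esub>)"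
    and 3: "\<forall>x\<in>carrier V. x \<ominus>\<^bsub>V\<^esub> msum V (\<lambda>j. \<phi> j x \<odot>\<^bsub>V\<^esub> b j) m \<in> U"
    using relative_basis[OF K V g U] by (elim exE conjE)
  let ?E = "\<lambda>x. x \<ominus>\<^bsub>V\<^esub> msum V (\<lambda>j. \<phi> j x \<odot>\<^bsub>V\<^esub> b j) m"
  have "lin K V V ?E"
    by (rule lin_minus_map[OF lin_id lin_msum_map[OF _ V] V])
      (rule lin_comp[OF _ lin_smult_elem[OF V]], use 1 in auto)
  moreover have "?E u = u" if u: "u \<in> U" for u
  proof -
    have "msum V (\<lambda>j. \<phi> j u \<odot>\<^bsub>V\<^esub> b j) m = msum V (\<lambda>j. \<zero>\<^bsub>V\<^esub>) m"
      by (rule msum_cong) (use 1 u in auto)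
    then show ?thesis using u V.submoduleD(1)[OF U] by (simp add: msum_zero[OF V] a_minus_def subset_iff)
  qed
  ultimately show ?thesis using 3 by (intro exI[of _ ?E]) simp
qed

text \<open>A subspace is the image of a projection, and images of finitely generated spaces are
  finitely generated.\<close>

lemma fg_subspace:
  assumes K: "field K" and V: "left_module K V" and g: "fg K V" and U: "submodule U K V"
  shows "fg K (V\<lparr>carrier := U\<rparr>)"
proof -
  interpret V: left_module K V by fact
  obtain E where E: "lin K V V E" "\<forall>x\<in>carrier V. E x \<in> U" "\<forall>u\<in>U. E u = u"
    using projection_onto_subspace[OF K V g U] by (elim exE conjE)
  show ?thesis
  proof (rule fg_image[OF V V.left_module_sub[OF U] _ _ g])
    show "lin K V (V\<lparr>carrier := U\<rparr>) E" using E(1,2) by (simp add: lin_def)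
    have "U \<subseteq> E ` carrier V"
    proof
      fix u assume u: "u \<in> U"
      then have "E u = u" "u \<in> carrier V" using E(3) V.submoduleD(1)[OF U] by auto
      then show "u \<in> E ` carrier V" by (metis imageI)
    qed
    then show "E ` carrier V = carrier (V\<lparr>carrier := U\<rparr>)" using E(2) by auto
  qed
qed

text \<open>Injectivity of k as a vector space: f descends to the image of d and is extended to W by
  a projection onto that image.\<close>

lemma functional_factor:
  assumes K: "field K" and V: "left_module K V" and W: "left_module K W" and g: "fg K W"
    and d: "lin K V W d" and f: "lin K V (regular K) f"
    and ker: "\<And>x. x \<in> carrier V \<Longrightarrow> d x = \<zero>\<^bsub>W\<^esub> \<Longrightarrow> f x = \<zero>\<^bsub>K\<^esub>"
  shows "\<exists>h. lin K W (regular K) h \<and> (\<forall>x\<in>carrier V. h (d x) = f x)"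
proof -
  interpret K: field K by fact
  interpret V: left_module K V by fact
  interpret W: left_module K W by fact
  have KM: "left_module K (regular K)" by (rule left_module_regular[OF K.ring_axioms])
  have U: "submodule (d ` carrier V) K W" by (rule submodule_image[OF d V W V.submodule_carrier])
  obtain E where E: "lin K W W E" "\<forall>x\<in>carrier W. E x \<in> d ` carrier V" "\<forall>u\<in>d ` carrier V. E u = u"
    using projection_onto_subspace[OF K W g U] by (elim exE conjE)
  have feq: "f x = f y" if "x \<in> carrier V" "y \<in> carrier V" "d x = d y" for x y
  proof -
    have "d (x \<ominus>\<^bsub>V\<^esub> y) = \<zero>\<^bsub>W\<^esub>"
      using that lin_closed[OF d that(2)] by (simp add: lin_minus[OF d V W] a_minus_def[of W] W.M.r_neg)
    then have "f x \<ominus>\<^bsub>regular K\<^esub> f y = \<zero>\<^bsub>regular K\<^esub>"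
      using ker[of "x \<ominus>\<^bsub>V\<^esub> y"] that lin_minus[OF f V KM] by (simp add: regular_simps)
    then show ?thesis
      using abelian_group.minus_eq_zeroD[OF left_moduleD(2)[OF KM]] lin_closed[OF f] that by blast
  qed
  have "\<forall>w. \<exists>x. w \<in> carrier W \<longrightarrow> x \<in> carrier V \<and> d x = E w" using E(2) by (metis imageE)
  then obtain s where s: "\<forall>w. w \<in> carrier W \<longrightarrow> s w \<in> carrier V \<and> d (s w) = E w" by (rule choice[THEN exE])
  have "lin K W (regular K) (\<lambda>w. f (s w))"
  proof (rule linI)
    fix x y assume xy: "x \<in> carrier W" "y \<in> carrier W"
    have "f (s (x \<oplus>\<^bsub>W\<^esub> y)) = f (s x \<oplus>\<^bsub>V\<^esub> s y)"
      by (rule feq) (use s xy in \<open>auto simp: lin_add[OF d] lin_add[OF E(1)]\<close>)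
    then show "f (s (x \<oplus>\<^bsub>W\<^esub> y)) = f (s x) \<oplus>\<^bsub>regular K\<^esub> f (s y)" using s xy by (simp add: lin_add[OF f])
  next
    fix a x assume ax: "a \<in> carrier K" "x \<in> carrier W"
    have "f (s (a \<odot>\<^bsub>W\<^esub> x)) = f (a \<odot>\<^bsub>V\<^esub> s x)"
      by (rule feq) (use s ax in \<open>auto simp: lin_smult[OF d] lin_smult[OF E(1)] V.smult_closed W.smult_closed\<close>)
    then show "f (s (a \<odot>\<^bsub>W\<^esub> x)) = a \<odot>\<^bsub>regular K\<^esub> f (s x)" using s ax by (simp add: lin_smult[OF f])
  qed (use s lin_closed[OF f] in simp)
  moreover have "f (s (d x)) = f x" if "x \<in> carrier V" for x
    by (rule feq) (use s E(3) that lin_closed[OF d that] in auto)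
  ultimately show ?thesis by (intro exI[of _ "\<lambda>w. f (s w)"]) simp
qed

text \<open>A substitute for dimension: the set of leading indices of the elements of a subspace, with respect to a basis.\<close>

lemma subspace_rank:
  assumes K: "field K" and V: "left_module K V" and g: "fg K V"
  shows "\<exists>\<mu> m. (\<forall>H. submodule H K V \<longrightarrow> \<mu> H \<le> (m::nat)) \<and>
    (\<forall>H H'. submodule H K V \<longrightarrow> submodule H' K V \<longrightarrow> H \<subset> H' \<longrightarrow> \<mu> H < \<mu> H')"
proof -
  interpret K: field K by fact
  interpret V: left_module K V by fact
  have KM: "left_module K (regular K)" by (rule left_module_regular[OF K.ring_axioms])
  interpret KM: left_module K "regular K" by (rule KM)
  have KMr: "c \<oplus>\<^bsub>K\<^esub> \<ominus>\<^bsub>regular K\<^esub> c = \<zero>\<^bsub>K\<^esub>" if "c \<in> carrier K" for c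
    using KM.M.r_neg[of c] that by (simp add: regular_simps)
  have KM0: "\<ominus>\<^bsub>regular K\<^esub> \<zero>\<^bsub>K\<^esub> = \<zero>\<^bsub>K\<^esub>"
    using KM.M.minus_equality[of "\<zero>\<^bsub>K\<^esub>" "\<zero>\<^bsub>K\<^esub>"] by (simp add: regular_simps)
  obtain m b \<phi> where 1: "\<forall>j<m. b j \<in> carrier V \<and> lin K V (regular K) (\<phi> j)"
    and 3: "\<forall>x\<in>carrier V. msum V (\<lambda>j. \<phi> j x \<odot>\<^bsub>V\<^esub> b j) m = x"
    using dual_basis[OF K V g] by (elim exE conjE)
  have \<phi>: "lin K V (regular K) (\<phi> j)" if "j < m" for j using 1 that by simp
  have bV: "b j \<in> carrier V" if "j < m" for j using 1 that by simp
  define J where "J H = {i. i < m \<and> (\<exists>h\<in>H. \<phi> i h = \<one>\<^bsub>K\<^esub> \<and> (\<forall>j. i < j \<longrightarrow> j < m \<longrightarrow> \<phi> j h = \<zero>\<^bsub>K\<^esub>))}" for H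
  have fin: "finite (J H)" for H unfolding J_def by simp
  have le: "card (J H) \<le> m" for H
    using card_mono[of "{..<m}" "J H"] unfolding J_def by auto
  have eq: "H' \<subseteq> H" if H: "submodule H K V" "submodule H' K V" "H \<subseteq> H'" "J H' \<subseteq> J H" for H H'
  proof
    note HD = V.submoduleD[OF H(1)] and HD' = V.submoduleD[OF H(2)]
    \<comment> \<open>Elimination from the top: i bounds the indices at which x may have nonzero
      coefficients. If the coefficient just below the bound is nonzero, its index is leading in H'
      and therefore in H, and a multiple of an element of H clears it.\<close>
    have main: "i \<le> m \<Longrightarrow> x \<in> H' \<Longrightarrow> (\<forall>j. i \<le> j \<longrightarrow> j < m \<longrightarrow> \<phi> j x = \<zero>\<^bsub>K\<^esub>) \<Longrightarrow> x \<in> H" for i x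
    proof (induct i arbitrary: x)
      case 0
      then have xV: "x \<in> carrier V" using HD'(1) by blast
      have "msum V (\<lambda>j. \<phi> j x \<odot>\<^bsub>V\<^esub> b j) m = msum V (\<lambda>j. \<zero>\<^bsub>V\<^esub>) m"
        by (rule msum_cong) (use 0 bV in auto)
      then show ?case using 3 xV HD(2) by (simp add: msum_zero[OF V])
    next
      case (Suc i)
      then have xV: "x \<in> carrier V" and im: "i < m" using HD'(1) by auto
      have c: "\<phi> i x \<in> carrier K" using lin_closed[OF \<phi>[OF im] xV] by (simp add: regular_simps)
      show ?case
      proof (cases "\<phi> i x = \<zero>\<^bsub>K\<^esub>")
        case True
        have "\<phi> j x = \<zero>\<^bsub>K\<^esub>" if "i \<le> j" "j < m" for j
          using Suc(4) True that by (cases "i = j") auto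
        then show ?thesis using im by (intro Suc(1)[OF _ Suc(3)]) auto
      next
        case False
        then have u: "\<phi> i x \<in> Units K" using c by (simp add: K.field_Units)
        note ic = K.Units_inv_closed[OF u]
        let ?y = "inv\<^bsub>K\<^esub> \<phi> i x \<odot>\<^bsub>V\<^esub> x"
        have "i \<in> J H'" unfolding J_def
        proof (intro CollectI conjI im bexI[of _ ?y] allI impI)
          show "\<phi> i ?y = \<one>\<^bsub>K\<^esub>" using u ic xV by (simp add: lin_smult[OF \<phi>[OF im]] regular_simps)
          show "\<phi> j ?y = \<zero>\<^bsub>K\<^esub>" if "i < j" "j < m" for j
            using Suc(4) that ic xV by (simp add: lin_smult[OF \<phi>[OF that(2)]] regular_simps)
        qed (rule HD'(4)[OF ic Suc(3)])
        then obtain h where h: "h \<in> H" "\<phi> i h = \<one>\<^bsub>K\<^esub>" "\<And>j. i < j \<Longrightarrow> j < m \<Longrightarrow> \<phi> j h = \<zero>\<^bsub>K\<^esub>"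
          using H(4) unfolding J_def by blast
        have hV: "h \<in> carrier V" using h HD(1) by blast
        let ?z = "x \<ominus>\<^bsub>V\<^esub> \<phi> i x \<odot>\<^bsub>V\<^esub> h"
        have hz: "\<phi> i x \<odot>\<^bsub>V\<^esub> h \<in> H" by (rule HD(4)[OF c h(1)])
        have "?z \<in> H"
        proof (rule Suc(1))
          show "i \<le> m" using im by simp
          show "?z \<in> H'" using HD'(6)[OF Suc(3)] hz H(3) by blast
          show "\<forall>j. i \<le> j \<longrightarrow> j < m \<longrightarrow> \<phi> j ?z = \<zero>\<^bsub>K\<^esub>"
          proof (intro allI impI)
            fix j assume j: "i \<le> j" "j < m"
            have "\<phi> j ?z = \<phi> j x \<oplus>\<^bsub>K\<^esub> \<ominus>\<^bsub>regular K\<^esub> (\<phi> i x \<otimes>\<^bsub>K\<^esub> \<phi> j h)"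
              using xV hV c by (simp add: lin_minus[OF \<phi>[OF j(2)] V KM] lin_smult[OF \<phi>[OF j(2)]] V.smult_closed a_minus_def[of "regular K"] regular_simps)
            moreover have "\<phi> j x \<in> carrier (regular K)" by (rule lin_closed[OF \<phi>[OF j(2)] xV])
            ultimately show "\<phi> j ?z = \<zero>\<^bsub>K\<^esub>"
              using Suc(4) j h c KMr KM0 by (cases "i = j") (auto simp: regular_simps)
          qed
        qed
        then have "?z \<oplus>\<^bsub>V\<^esub> \<phi> i x \<odot>\<^bsub>V\<^esub> h \<in> H" using HD(3) hz by blast
        then show ?thesis using xV hV c V.smult_closed by (simp add: a_minus_def V.M.a_assoc V.M.l_neg)
      qed
    qed
    fix x assume "x \<in> H'"
    then show "x \<in> H" by (intro main[of m]) auto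
  qed
  show ?thesis
  proof (intro exI[of _ "\<lambda>H. card (J H)"] exI[of _ m] conjI allI impI le)
    fix H H' assume H: "submodule H K V" "submodule H' K V" "H \<subset> H'"
    have "J H \<subseteq> J H'" using H(3) unfolding J_def by blast
    moreover have "\<not> J H' \<subseteq> J H" using eq[OF H(1,2)] H(3) by blast
    ultimately show "card (J H) < card (J H')" by (intro psubset_card_mono fin) blast
  qed
qed

subsection \<open>Projective covers, minimal resolutions and duality\<close>

lemma restrict_scalars_simps:
  "carrier (restrict_scalars A M) = carrier M" "\<zero>\<^bsub>restrict_scalars A M\<^esub> = \<zero>\<^bsub>M\<^esub>"
  "add (restrict_scalars A M) = add M" "c \<odot>\<^bsub>restrict_scalars A M\<^esub> x = (c \<odot>\<^bsub>A\<^esub> \<one>\<^bsub>A\<^esub>) \<odot>\<^bsub>M\<^esub> x"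
  by (simp_all add: restrict_scalars_def)

context fin_dim_algebra
begin

lemma algebra_is_ring: "ring A" by (rule A.ring_axioms)
lemma ground_field: "field K" by (rule K.field_axioms)

lemma left_module_algebra: "left_module A (regular A)"
  by (rule left_module_regular[OF algebra_is_ring])

lemma left_module_ground_field: "left_module K (regular K)"
  by (rule left_module_regular[OF K.ring_axioms])

lemma left_module_KA: "left_module K A"
  by (rule left_moduleI)
    (auto simp: K.ring_axioms V.M.a_assoc V.smult_l_distr V.smult_r_distr V.smult_assoc1 intro: V.M.a_comm)

lemma fg_KA: "fg K A"
  using finite_dim_algebra finite_dim_iff_fg[OF ground_field left_module_KA] by simp

lemma scalar_closed: "c \<in> carrier K \<Longrightarrow> c \<odot>\<^bsub>A\<^esub> \<one>\<^bsub>A\<^esub> \<in> carrier A"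
  by (rule V.smult_closed) simp_all

lemma scalar_mult: "c \<in> carrier K \<Longrightarrow> x \<in> carrier A \<Longrightarrow> (c \<odot>\<^bsub>A\<^esub> \<one>\<^bsub>A\<^esub>) \<otimes>\<^bsub>A\<^esub> x = c \<odot>\<^bsub>A\<^esub> x"
  by (simp add: smult_mult_left)

lemma left_module_restrict_scalars:
  assumes "left_module A M" shows "left_module K (restrict_scalars A M)"
proof -
  interpret M: left_module A M by fact
  have 2: "(c \<otimes>\<^bsub>K\<^esub> c') \<odot>\<^bsub>A\<^esub> \<one>\<^bsub>A\<^esub> = (c \<odot>\<^bsub>A\<^esub> \<one>\<^bsub>A\<^esub>) \<otimes>\<^bsub>A\<^esub> (c' \<odot>\<^bsub>A\<^esub> \<one>\<^bsub>A\<^esub>)" if "c \<in> carrier K" "c' \<in> carrier K" for c c'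
    using that by (simp add: scalar_mult scalar_closed V.smult_assoc1)
  show ?thesis
    by (rule left_moduleI)
      (auto simp: restrict_scalars_simps K.ring_axioms scalar_closed M.smult_closed V.smult_l_distr
        M.smult_l_distr M.smult_r_distr M.smult_assoc 2 M.smult_one M.M.a_assoc intro: M.M.a_comm)
qed

lemma lin_restrict_scalars: "lin A M N f \<Longrightarrow> lin K (restrict_scalars A M) (restrict_scalars A N) f"
  by (simp add: lin_def restrict_scalars_simps scalar_closed)

lemma submodule_restrict_scalars:
  assumes "left_module A M" "submodule H A M" shows "submodule H K (restrict_scalars A M)"
  using left_module.submoduleD[OF assms]
  by (intro left_module.submoduleI'[OF left_module_restrict_scalars[OF assms(1)]])
    (auto simp: restrict_scalars_simps scalar_closed)

lemma fg_restrict_iff: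
  assumes M: "left_module A M" shows "fg K (restrict_scalars A M) \<longleftrightarrow> fg A M"
proof
  assume "fg K (restrict_scalars A M)"
  then show "fg A M" unfolding fg_def restrict_scalars_simps(1) using submodule_restrict_scalars[OF M] by meson
next
  interpret M: left_module A M by fact
  note R = left_module_restrict_scalars[OF M]
  assume "fg A M"
  then obtain B where B: "finite B" "B \<subseteq> carrier M"
    "\<forall>H. submodule H A M \<longrightarrow> B \<subseteq> H \<longrightarrow> H = carrier M" unfolding fg_def by (elim exE conjE)
  obtain C where C: "finite C" "C \<subseteq> carrier A"
    "\<forall>H. submodule H K A \<longrightarrow> C \<subseteq> H \<longrightarrow> H = carrier A" using fg_KA unfolding fg_def by (elim exE conjE)
  \<comment> \<open>Products of the generators of A over K with the generators of M over A.\<close>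
  let ?S = "(\<lambda>(c, b). c \<odot>\<^bsub>M\<^esub> b) ` (C \<times> B)"
  show "fg K (restrict_scalars A M)" unfolding fg_def
  proof (intro exI[of _ ?S] conjI allI impI)
    fix H assume H: "submodule H K (restrict_scalars A M)" "?S \<subseteq> H"
    note HD = left_module.submoduleD[OF R H(1), unfolded restrict_scalars_simps]
    have ab: "a \<odot>\<^bsub>M\<^esub> b \<in> H" if a: "a \<in> carrier A" and b: "b \<in> B" for a b
    proof -
      have bM: "b \<in> carrier M" using b B(2) by blast
      have "lin K A (restrict_scalars A M) (\<lambda>a. a \<odot>\<^bsub>M\<^esub> b)"
        using bM by (intro linI) (auto simp: restrict_scalars_simps M.smult_closed M.smult_l_distr
          M.smult_assoc[symmetric] scalar_closed scalar_mult)
      from C(3)[rule_format, OF submodule_vimage[OF this left_module_KA R H(1)]]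
      have "{a \<in> carrier A. a \<odot>\<^bsub>M\<^esub> b \<in> H} = carrier A" using H(2) C(2) b by auto
      then show ?thesis using a by (metis (mono_tags, lifting) mem_Collect_eq)
    qed
    \<comment> \<open>The largest A-submodule of M inside the subspace H. It contains the generators
      B, hence is M.\<close>
    let ?H = "{x \<in> carrier M. \<forall>a\<in>carrier A. a \<odot>\<^bsub>M\<^esub> x \<in> H}"
    have "submodule ?H A M"
      by (rule M.submoduleI') (use HD in \<open>auto simp: M.smult_r_distr M.smult_closed M.smult_assoc[symmetric]\<close>)
    from B(3)[rule_format, OF this] have *: "?H = carrier M" using ab B(2) by blast
    have "x \<in> H" if "x \<in> carrier M" for x
    proof -
      have "x \<in> ?H" unfolding * by fact
      then have "\<one>\<^bsub>A\<^esub> \<odot>\<^bsub>M\<^esub> x \<in> H" by blast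
      then show ?thesis using that by (simp add: M.smult_one)
    qed
    then show "H = carrier (restrict_scalars A M)" unfolding restrict_scalars_simps using HD(1) by (intro equalityI subsetI) auto
  qed (use B(1,2) C(1,2) M.smult_closed in \<open>auto simp: restrict_scalars_simps\<close>)
qed

lemma fin_dim_module_iff: "fin_dim_module K A M \<longleftrightarrow> left_module A M \<and> fg A M"
  unfolding fin_dim_module_def
  using fg_restrict_iff finite_dim_iff_fg[OF ground_field left_module_restrict_scalars] by blast

text \<open>Over A finite generation amounts to finite dimension over K, which passes to
  subspaces.\<close>

lemma fg_submodule:
  assumes M: "left_module A M" and g: "fg A M" and H: "submodule H A M"
  shows "fg A (M\<lparr>carrier := H\<rparr>)"
proof -
  have eq: "restrict_scalars A (M\<lparr>carrier := H\<rparr>) = (restrict_scalars A M)\<lparr>carrier := H\<rparr>"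
    by (simp add: restrict_scalars_def make_module_def)
  have "fg K ((restrict_scalars A M)\<lparr>carrier := H\<rparr>)"
    by (rule fg_subspace[OF ground_field left_module_restrict_scalars[OF M]])
      (use g fg_restrict_iff[OF M] submodule_restrict_scalars[OF M H] in auto)
  then show ?thesis unfolding eq[symmetric] fg_restrict_iff[OF left_module.left_module_sub[OF M H]] .
qed

text \<open>A substitute for length: it provides minimal submodules and makes ascending chains
  stationary.\<close>

lemma submodule_rank:
  assumes M: "left_module A M" and g: "fg A M"
  shows "\<exists>\<mu> m. (\<forall>H. submodule H A M \<longrightarrow> \<mu> H \<le> (m::nat)) \<and>
    (\<forall>H H'. submodule H A M \<longrightarrow> submodule H' A M \<longrightarrow> H \<subset> H' \<longrightarrow> \<mu> H < \<mu> H')"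
proof -
  have g': "fg K (restrict_scalars A M)" using fg_restrict_iff[OF M] g by simp
  obtain \<mu> m where 1: "\<forall>H. submodule H K (restrict_scalars A M) \<longrightarrow> \<mu> H \<le> (m::nat)"
    and 2: "\<forall>H H'. submodule H K (restrict_scalars A M) \<longrightarrow> submodule H' K (restrict_scalars A M) \<longrightarrow>
      H \<subset> H' \<longrightarrow> \<mu> H < \<mu> H'"
    using subspace_rank[OF ground_field left_module_restrict_scalars[OF M] g'] by (elim exE conjE)
  show ?thesis
    using 1 2 submodule_restrict_scalars[OF M] by (intro exI[of _ \<mu>] exI[of _ m]) simp
qed

text \<open>The kernels of the iterates form a bounded chain, so those of \<open>f ^^ n\<close> and
  \<open>f ^^ Suc n\<close> agree for some n. Write x as the image of some y under
  \<open>f ^^ n\<close>; then f x = 0 puts y into the second kernel, hence into the first.\<close>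

lemma surj_endo_inj:
  assumes M: "left_module A M" and g: "fg A M" and f: "lin A M M f" and s: "f ` carrier M = carrier M"
    and x: "x \<in> carrier M" "f x = \<zero>\<^bsub>M\<^esub>"
  shows "x = \<zero>\<^bsub>M\<^esub>"
proof -
  interpret M: left_module A M by fact
  obtain \<mu> m where 1: "\<forall>H. submodule H A M \<longrightarrow> \<mu> H \<le> (m::nat)"
    and 2: "\<forall>H H'. submodule H A M \<longrightarrow> submodule H' A M \<longrightarrow> H \<subset> H' \<longrightarrow> \<mu> H < \<mu> H'"
    using submodule_rank[OF M g] by (elim exE conjE)
  have fn: "lin A M M (f ^^ n)" for n
  proof (induct n)
    case 0 then show ?case using lin_id[of A M] by (simp add: id_def)
  next
    case (Suc n) then show ?case using lin_comp[OF Suc f] by (simp add: comp_def)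
  qed
  have sn: "(f ^^ n) ` carrier M = carrier M" for n
    proof (induct n)
    case (Suc n) then show ?case using s by (metis funpow.simps(2) image_comp)
  qed simp
  let ?K = "\<lambda>n. {x \<in> carrier M. (f ^^ n) x = \<zero>\<^bsub>M\<^esub>}"
  have K: "submodule (?K n) A M" for n by (rule submodule_kernel[OF fn M M])
  have inc: "?K n \<subseteq> ?K (Suc n)" for n using lin_zero[OF f M M] by auto
  have "\<exists>n. ?K n = ?K (Suc n)"
  proof (rule ccontr)
    assume "\<nexists>n. ?K n = ?K (Suc n)"
    then have "?K n \<subset> ?K (Suc n)" for n using inc by blast
    then have lt: "\<mu> (?K n) < \<mu> (?K (Suc n))" for n using 2[rule_format, OF K K] by blast
    have "n \<le> \<mu> (?K n)" for n
    proof (induct n)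
      case (Suc n) then show ?case using lt[of n] by linarith
    qed simp
    then show False using 1[rule_format, OF K[of "Suc m"]] by (meson Suc_n_not_le_n order_trans)
  qed
  then obtain n where n: "?K n = ?K (Suc n)" by blast
  obtain y where y: "y \<in> carrier M" "x = (f ^^ n) y" using x(1) sn[of n] by blast
  then have "y \<in> ?K (Suc n)" using x(2) by simp
  then have "y \<in> ?K n" using n by blast
  then show ?thesis using y(2) by simp
qed

lemma free_cover:
  assumes M: "left_module A M" and g: "fg A M"
  shows "\<exists>m q. lin A (pow_module m (regular A)) M q \<and> q ` carrier (pow_module m (regular A)) = carrier M"
proof -
  interpret M: left_module A M by fact
  from g obtain B where B: "finite B" "B \<subseteq> carrier M"
    "\<forall>H. submodule H A M \<longrightarrow> B \<subseteq> H \<longrightarrow> H = carrier M" unfolding fg_def by (elim exE conjE)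
  obtain h where h: "bij_betw h {0..<card B} B" using ex_bij_betw_nat_finite[OF B(1)] by blast
  let ?m = "card B"
  have hM: "h j \<in> carrier M" if "j < ?m" for j using h that B(2) by (auto simp: bij_betw_def)
  let ?P = "pow_module ?m (regular A)"
  note P = left_module_pow[OF left_module_algebra, of ?m]
  let ?q = "\<lambda>t. msum M (\<lambda>j. t j \<odot>\<^bsub>M\<^esub> h j) ?m"
  have q: "lin A ?P M ?q"
    by (rule lin_msum_map[OF _ M], rule lin_comp[OF lin_proj lin_smult_elem[OF M hM]])
  have "?q ` carrier ?P = carrier M"
  proof (rule B(3)[rule_format, OF submodule_image[OF q P M left_module.submodule_carrier[OF P]]])
    show "B \<subseteq> ?q ` carrier ?P"
    proof
      fix b assume "b \<in> B"
      then obtain k where k: "k < ?m" "b = h k" using h unfolding bij_betw_def by (metis imageE atLeastLessThan_iff)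
      have c: "upto_inj ?m (\<lambda>_. regular A) k \<one>\<^bsub>A\<^esub> \<in> carrier ?P"
        by (rule lin_closed[OF lin_upto_inj[OF left_module_algebra]]) (simp add: regular_simps)
      have "?q (upto_inj ?m (\<lambda>_. regular A) k \<one>\<^bsub>A\<^esub>) = msum M (\<lambda>j. if j = k then b else \<zero>\<^bsub>M\<^esub>) ?m"
        by (rule msum_cong) (auto simp: upto_inj_def k hM M.smult_one regular_simps)
      also have "\<dots> = b" using k hM by (subst msum_delta[OF M]) auto
      finally have "?q (upto_inj ?m (\<lambda>_. regular A) k \<one>\<^bsub>A\<^esub>) = b" .
      then show "b \<in> ?q ` carrier ?P" using imageI[OF c, of ?q] by simp
    qed
  qed
  then show ?thesis using q by blast
qed

lemma free_projective: "projective_module A (pow_module m (regular A))"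
proof -
  note P = left_module_pow[OF left_module_algebra, of m]
  have "add_data A (regular A) (pow_module m (regular A)) m (\<lambda>j x. x j) (upto_inj m (\<lambda>_. regular A))"
    unfolding add_data_def using lin_proj lin_upto_inj[OF left_module_algebra] pow_decomp[OF left_module_algebra left_module_algebra] by blast
  then show ?thesis unfolding projective_module_def in_add_iff[OF left_module_algebra] using P by blast
qed

text \<open>Take \<open>H\<close> minimal among the submodules of a free cover that still map onto \<open>M\<close>. Lifting the cover to
  \<open>H\<close> gives an endomorphism of \<open>H\<close> which is onto by minimality, hence bijective; so \<open>H\<close> is a retract.\<close>

lemma projective_cover_exists:
  assumes M: "left_module A M" and g: "fg A M"
  shows "\<exists>(P :: ('a, nat \<Rightarrow> 'a) module) p. is_projective_cover A M P p"
proof -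
  interpret M: left_module A M by fact
  obtain m q where q: "lin A (pow_module m (regular A)) M q"
    and qs: "q ` carrier (pow_module m (regular A)) = carrier M" using free_cover[OF M g] by (elim exE conjE)
  let ?F = "pow_module m (regular A)"
  note Fp = free_projective[of m] and F = left_module_pow[OF left_module_algebra, of m]
  interpret F: left_module A ?F by fact
  have Fg: "fg A ?F" by (rule fg_projective[OF Fp])
  obtain \<mu> k where mu: "\<forall>H H'. submodule H A ?F \<longrightarrow> submodule H' A ?F \<longrightarrow> H \<subset> H' \<longrightarrow> \<mu> H < (\<mu> H' :: nat)"
    using submodule_rank[OF F Fg] by (elim exE conjE)
  define onto where "onto H \<longleftrightarrow> submodule H A ?F \<and> q ` H = carrier M" for H
  have "onto (carrier ?F)" using F.submodule_carrier qs by (simp add: onto_def)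
  from ex_has_least_nat[of onto, OF this, of \<mu>] obtain H where H: "onto H"
    and least: "\<And>H'. onto H' \<Longrightarrow> \<mu> H \<le> \<mu> H'" by blast
  have HF: "submodule H A ?F" and qH: "q ` H = carrier M" using H by (simp_all add: onto_def)
  note HD = F.submoduleD[OF HF]
  have min: "H' = H" if "H' \<subseteq> H" "submodule H' A ?F" "q ` H' = carrier M" for H'
  proof (rule ccontr)
    assume "H' \<noteq> H"
    then have "\<mu> H' < \<mu> H" using that mu HF by blast
    then show False using least[of H'] that by (simp add: onto_def)
  qed
  let ?P = "?F\<lparr>carrier := H\<rparr>"
  have P: "left_module A ?P" by (rule F.left_module_sub[OF HF])
  have subP: "submodule H' A ?F" if "submodule H' A ?P" for H'
    using left_module.submoduleD[OF P that] HD(1) by (intro F.submoduleI') auto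
  have qP: "lin A ?P M q" using q HD(1) by (auto simp: lin_def subset_iff)
  have incl: "lin A ?P ?F (\<lambda>x. x)" using HD(1) by (auto simp: lin_def)
  have "q x \<in> q ` carrier ?P" if "x \<in> carrier ?F" for x using that qs qH by auto
  from projective_lift[OF Fp P M q qP this]
  obtain l where l: "lin A ?F ?P l" "\<And>x. x \<in> carrier ?F \<Longrightarrow> q (l x) = q x" by blast
  have lP: "lin A ?P ?P l" by (rule lin_comp[OF incl l(1)])
  have img: "l ` H = H"
  proof (rule min)
    show "l ` H \<subseteq> H" using lin_closed[OF lP] by auto
    have "submodule (l ` carrier ?P) A ?P" by (rule submodule_image[OF lP P P left_module.submodule_carrier[OF P]])
    then show "submodule (l ` H) A ?F" using subP by simp
    have "q ` l ` H = q ` H" unfolding image_image using l(2) HD(1) by (intro image_cong) auto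
    then show "q ` l ` H = carrier M" using qH by simp
  qed
  have gP: "fg A ?P" by (rule fg_submodule[OF F Fg HF])
  have "l ` carrier ?P = carrier ?P" by (simp add: img)
  from lin_inj_onI[OF lP P P surj_endo_inj[OF P gP lP this]] have inj: "inj_on l H" by simp
  let ?r = "\<lambda>x. inv_into (carrier ?P) l (l x)"
  have bij: "bij_betw l (carrier ?P) (carrier ?P)" using inj img by (simp add: bij_betw_def)
  have r: "lin A ?F ?P ?r" by (rule lin_comp[OF l(1) lin_inv_into[OF lP bij P]])
  have "projective_module A ?P"
    unfolding projective_module_def
    by (rule in_add_retract[OF left_module_algebra Fp[unfolded projective_module_def] P incl r]) (simp add: inj inv_into_f_f)
  moreover have "restrict q H \<in> mod_hom A ?P M" using lin_restrict[OF qP P] by simp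
  moreover have "H' = H" if H': "submodule H' A ?P" and s: "H' <+>\<^bsub>?P\<^esub> a_kernel ?P M (restrict q H) = H" for H'
  proof (rule min)
    note D = left_module.submoduleD[OF P H']
    show 1: "H' \<subseteq> H" using D(1) by simp
    show "submodule H' A ?F" by (rule subP[OF H'])
    show "q ` H' = carrier M"
    proof
      show "q ` H' \<subseteq> carrier M" using 1 qH by blast
      show "carrier M \<subseteq> q ` H'"
      proof
        fix y assume "y \<in> carrier M"
        then obtain x where x: "x \<in> H" "y = q x" using qH by blast
        then have "x \<in> H' <+>\<^bsub>?P\<^esub> a_kernel ?P M (restrict q H)" using s by blast
        then obtain a b where "a \<in> H'" "b \<in> H" "q b = \<zero>\<^bsub>M\<^esub>" "x = a \<oplus>\<^bsub>?F\<^esub> b"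
          by (auto simp: set_add_def set_mult_def a_kernel_def')
        then have "q x = q a" using lin_add[OF qP, of a b] 1 lin_closed[OF qP, of a] by auto
        then show "y \<in> q ` H'" using x \<open>a \<in> H'\<close> by blast
      qed
    qed
  qed
  ultimately have "is_projective_cover A M ?P (restrict q H)"
    unfolding is_projective_cover_def using qH by auto
  then show ?thesis by blast
qed

end

section \<open>The opposite algebra and the choice of projective covers\<close>

lemma opp_simps [simp]:
  "carrier (opp A) = carrier A" "\<zero>\<^bsub>opp A\<^esub> = \<zero>\<^bsub>A\<^esub>" "\<one>\<^bsub>opp A\<^esub> = \<one>\<^bsub>A\<^esub>" "add (opp A) = add A"
  "smult (opp A) = smult A" "x \<otimes>\<^bsub>opp A\<^esub> y = y \<otimes>\<^bsub>A\<^esub> x" "opp (opp A) = A"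
  by (simp_all add: opp_def)

lemma restrict_scalars_opp [simp]: "restrict_scalars (opp A) M = restrict_scalars A M"
  by (simp add: restrict_scalars_def)

lemma msum_restrict_scalars: "msum (restrict_scalars A M) f n = msum M f n"
  by (induct n) (simp_all add: restrict_scalars_simps)

context fin_dim_algebra
begin

lemma opp_algebra: "fin_dim_algebra K (opp A)"
proof -
  have "abelian_group (opp A)"
    by (rule abelian_groupI) (auto simp: V.M.a_assoc intro: V.M.a_comm V.M.l_neg)
  moreover have "ring (opp A)"
    by (rule ringI[OF calculation]) (auto intro!: monoidI simp: A.m_assoc A.l_distr A.r_distr)
  moreover have "module K (opp A)"
    by (rule moduleI) (auto simp: K.cring_axioms \<open>abelian_group (opp A)\<close> V.smult_l_distr V.smult_r_distr V.smult_assoc1)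
  moreover have "finite_dim K (opp A)"
    using finite_dim_algebra by (simp add: finite_dim_def finsum_def)
  ultimately show ?thesis
    by (intro fin_dim_algebra.intro fin_dim_algebra_axioms.intro)
      (auto simp: K.field_axioms smult_mult_left smult_mult_right)
qed

lemma projective_cover:
  assumes "left_module A M" "fg A M"
  shows "is_projective_cover A M (fst (projective_cover A M)) (snd (projective_cover A M))"
proof -
  have "case projective_cover A M of (P, p) \<Rightarrow> is_projective_cover A M P p"
    unfolding projective_cover_def by (rule someI_ex) (use projective_cover_exists[OF assms] in auto)
  then show ?thesis by (simp add: case_prod_beta)
qed

lemma projective_cover_minimal:
  assumes c: "is_projective_cover A M P p" and M: "left_module A M"
    and H: "submodule H A P" and im: "p ` H = carrier M"
  shows "H = carrier P"
proof -
  have p: "lin A P M p" and P: "left_module A P"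
    and min: "H <+>\<^bsub>P\<^esub> a_kernel P M p = carrier P \<longrightarrow> H = carrier P"
    using c H projective_left_module unfolding is_projective_cover_def by (auto simp: mod_hom_lin)
  interpret P: left_module A P by fact
  interpret M: left_module A M by fact
  note HD = P.submoduleD[OF H]
  have "x \<in> H <+>\<^bsub>P\<^esub> a_kernel P M p" if x: "x \<in> carrier P" for x
  proof -
    obtain h where h: "h \<in> H" "p x = p h" using im lin_closed[OF p x] by (metis imageE)
    then have hP: "h \<in> carrier P" using HD(1) by blast
    have "p (x \<ominus>\<^bsub>P\<^esub> h) = \<zero>\<^bsub>M\<^esub>"
      using x h lin_closed[OF p hP] by (simp add: lin_minus[OF p P M] hP a_minus_def[of M] M.M.r_neg)
    then have "x \<ominus>\<^bsub>P\<^esub> h \<in> a_kernel P M p" using x hP by (simp add: a_kernel_def')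
    moreover have "x = h \<oplus>\<^bsub>P\<^esub> (x \<ominus>\<^bsub>P\<^esub> h)" using x hP by (simp add: a_minus_def P.M.a_lcomm[of h x] P.M.r_neg)
    ultimately show ?thesis using h(1) unfolding set_add_def set_mult_def by auto
  qed
  moreover have "H <+>\<^bsub>P\<^esub> a_kernel P M p \<subseteq> carrier P"
    using HD(1) unfolding set_add_def set_mult_def by (auto simp: a_kernel_def' subset_iff)
  ultimately show ?thesis using min by blast
qed

end

text \<open>\<open>msyz A M i\<close> is \<open>\<Omega>\<^sup>i\<^sup>+\<^sup>1 M\<close>; the shift keeps all syzygies of one type.\<close>

definition msyz where "msyz A M i = (syzygy A ^^ i) (syzygy A M)"
definition mres where
  "mres A M i = (case i of 0 \<Rightarrow> fst (projective_cover A M) | Suc j \<Rightarrow> fst (projective_cover A (msyz A M j)))"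
text \<open>The covering map of a syzygy is already the differential, because the syzygy is carried
  by a subset of the preceding term.\<close>

definition mdiff where "mdiff A M i = snd (projective_cover A (msyz A M i))"
definition maug where "maug A M = snd (projective_cover A M)"

lemma mres_simps:
  "mres A M 0 = fst (projective_cover A M)" "mres A M (Suc i) = fst (projective_cover A (msyz A M i))"
  by (simp_all add: mres_def)

lemma msyz_simps:
  "msyz A M 0 = (mres A M 0)\<lparr>carrier := {x \<in> carrier (mres A M 0). maug A M x = \<zero>\<^bsub>M\<^esub>}\<rparr>"
  "msyz A M (Suc i) = (mres A M (Suc i))\<lparr>carrier := {x \<in> carrier (mres A M (Suc i)). mdiff A M i x = \<zero>\<^bsub>msyz A M i\<^esub>}\<rparr>"
  by (simp_all add: msyz_def mres_simps maug_def mdiff_def syzygy_def case_prod_beta a_kernel_def')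

lemma msyz_zero: "\<zero>\<^bsub>msyz A M i\<^esub> = \<zero>\<^bsub>mres A M i\<^esub>"
  by (cases i) (simp_all add: msyz_simps)

context fin_dim_algebra
begin

lemma msyz_fg:
  assumes "left_module A M" "fg A M" shows "left_module A (msyz A M i) \<and> fg A (msyz A M i)"
proof -
  have step: "left_module A (P\<lparr>carrier := {x \<in> carrier P. p x = \<zero>\<^bsub>N\<^esub>}\<rparr>) \<and>
      fg A (P\<lparr>carrier := {x \<in> carrier P. p x = \<zero>\<^bsub>N\<^esub>}\<rparr>)"
    if "is_projective_cover A N P p" "left_module A N" for N :: "('a, 'c) module" and P :: "('a, nat \<Rightarrow> 'a) module" and p
  proof -
    have p: "lin A P N p" and Pp: "projective_module A P"
      using that unfolding is_projective_cover_def by (auto simp: mod_hom_lin)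
    note P = projective_left_module[OF Pp]
    note H = submodule_kernel[OF p P that(2)]
    show ?thesis using left_module.left_module_sub[OF P H] fg_submodule[OF P fg_projective[OF Pp] H] by blast
  qed
  show ?thesis
  proof (induct i)
    case 0
    show ?case unfolding msyz_simps mres_simps maug_def
      by (rule step[OF projective_cover[OF assms] assms(1)])
  next
    case (Suc i)
    show ?case unfolding msyz_simps(2) mres_simps mdiff_def
      by (rule step[OF projective_cover]) (use Suc in auto)
  qed
qed

lemma mres_covers:
  assumes M: "left_module A M" "fg A M"
  shows "is_projective_cover A M (mres A M 0) (maug A M)"
    "is_projective_cover A (msyz A M i) (mres A M (Suc i)) (mdiff A M i)"
  using projective_cover[OF M] projective_cover msyz_fg[OF M, of i] unfolding mres_simps maug_def mdiff_def by auto

lemma minimal_resolution: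
  assumes M: "left_module A M" "fg A M"
  shows "is_res A M (mres A M) (mdiff A M) (maug A M)"
proof -
  note c = mres_covers[OF M]
  have p0: "projective_module A (mres A M 0)" "lin A (mres A M 0) M (maug A M)"
    "maug A M ` carrier (mres A M 0) = carrier M"
    using c(1) unfolding is_projective_cover_def by (auto simp: mod_hom_lin)
  have p1: "projective_module A (mres A M (Suc i))" "lin A (mres A M (Suc i)) (msyz A M i) (mdiff A M i)"
    "mdiff A M i ` carrier (mres A M (Suc i)) = carrier (msyz A M i)" for i
    using c(2)[of i] unfolding is_projective_cover_def by (auto simp: mod_hom_lin)
  have P: "projective_module A (mres A M i)" for i using p0(1) p1(1) by (cases i) auto
  have l: "lin A (mres A M (Suc i)) (mres A M i) (mdiff A M i)" for i
    using p1(2)[of i] by (cases i) (auto simp: lin_def msyz_simps)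
  show ?thesis unfolding is_res_def
    using M(1) P p0 l p1(3) by (auto simp: msyz_simps msyz_zero)
qed

lemma mres_minimal:
  assumes M: "left_module A M" "fg A M"
  shows "submodule H A (mres A M 0) \<Longrightarrow> maug A M ` H = carrier M \<Longrightarrow> H = carrier (mres A M 0)"
    "submodule H A (mres A M (Suc i)) \<Longrightarrow> mdiff A M i ` H = mdiff A M i ` carrier (mres A M (Suc i)) \<Longrightarrow>
      H = carrier (mres A M (Suc i))"
proof -
  note c = mres_covers[OF M]
  show "submodule H A (mres A M 0) \<Longrightarrow> maug A M ` H = carrier M \<Longrightarrow> H = carrier (mres A M 0)"
    by (rule projective_cover_minimal[OF c(1) M(1)])
  have "mdiff A M i ` carrier (mres A M (Suc i)) = carrier (msyz A M i)"
    using c(2)[of i] unfolding is_projective_cover_def by auto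
  then show "submodule H A (mres A M (Suc i)) \<Longrightarrow> mdiff A M i ` H = mdiff A M i ` carrier (mres A M (Suc i)) \<Longrightarrow>
      H = carrier (mres A M (Suc i))"
    using projective_cover_minimal[OF c(2)[of i]] msyz_fg[OF M, of i] by simp
qed

lemma projective_resolution_exists:
  assumes "left_module A M" "fg A M" shows "\<exists>P d e. projective_resolution A M P d e"
  using transport_resolution[OF minimal_resolution[OF assms]] by blast

section \<open>The duality Hom(-, k)\<close>

lemma k_dual_simps:
  "carrier (k_dual K A N) = mod_hom K (restrict_scalars A N) (regular K)"
  "\<zero>\<^bsub>k_dual K A N\<^esub> = (\<lambda>x\<in>carrier N. \<zero>\<^bsub>K\<^esub>)"
  "f \<oplus>\<^bsub>k_dual K A N\<^esub> g = (\<lambda>x\<in>carrier N. f x \<oplus>\<^bsub>K\<^esub> g x)"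
  "a \<odot>\<^bsub>k_dual K A N\<^esub> f = (\<lambda>x\<in>carrier N. f (a \<odot>\<^bsub>N\<^esub> x))"
  by (simp_all add: k_dual_def)

lemma k_dual_lin: "f \<in> carrier (k_dual K A N) \<Longrightarrow> lin K (restrict_scalars A N) (regular K) f"
  by (simp add: k_dual_simps mod_hom_lin)

lemma k_dual_closed: "f \<in> carrier (k_dual K A N) \<Longrightarrow> x \<in> carrier N \<Longrightarrow> f x \<in> carrier K"
  using lin_closed[OF k_dual_lin] by (simp add: restrict_scalars_simps regular_simps)

lemma k_dualI:
  "left_module A N \<Longrightarrow> lin K (restrict_scalars A N) (regular K) f \<Longrightarrow> restrict f (carrier N) \<in> carrier (k_dual K A N)"
  using lin_restrict[OF _ left_module_restrict_scalars] by (simp add: k_dual_simps restrict_scalars_simps)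

lemma scalar_central:
  "c \<in> carrier K \<Longrightarrow> a \<in> carrier A \<Longrightarrow> a \<otimes>\<^bsub>A\<^esub> (c \<odot>\<^bsub>A\<^esub> \<one>\<^bsub>A\<^esub>) = (c \<odot>\<^bsub>A\<^esub> \<one>\<^bsub>A\<^esub>) \<otimes>\<^bsub>A\<^esub> a"
  by (simp add: smult_mult_left smult_mult_right)

lemma lin_action:
  assumes N: "left_module A N" and a: "a \<in> carrier A"
  shows "lin K (restrict_scalars A N) (restrict_scalars A N) (\<lambda>x. a \<odot>\<^bsub>N\<^esub> x)"
proof -
  interpret N: left_module A N by fact
  show ?thesis using a
    by (intro linI) (auto simp: restrict_scalars_simps N.smult_closed N.smult_r_distr N.smult_assoc[symmetric]
      scalar_closed scalar_central)
qed

lemma k_dual_ext: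
  "f \<in> carrier (k_dual K A N) \<Longrightarrow> (\<lambda>x\<in>carrier N. f x) = f"
  by (auto simp: k_dual_simps mod_hom_def restrict_scalars_simps PiE_iff extensional_restrict)

lemma left_module_k_dual:
  assumes N: "left_module A N" shows "left_module (opp A) (k_dual K A N)"
proof -
  interpret N: left_module A N by fact
  have KR: "left_module K (restrict_scalars A N)" by (rule left_module_restrict_scalars[OF N])
  interpret O: fin_dim_algebra K "opp A" by (rule opp_algebra)
  let ?D = "k_dual K A N"
  have add: "f \<oplus>\<^bsub>?D\<^esub> g \<in> carrier ?D" if "f \<in> carrier ?D" "g \<in> carrier ?D" for f g
    using k_dualI[OF N lin_add_map[OF k_dual_lin[OF that(1)] k_dual_lin[OF that(2)] left_module_ground_field]]
    by (simp add: k_dual_simps(3) regular_simps)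
  have zero: "\<zero>\<^bsub>?D\<^esub> \<in> carrier ?D"
    using k_dualI[OF N lin_zero_map[OF left_module_ground_field]] by (simp add: k_dual_simps(2) regular_simps)
  have sm: "a \<odot>\<^bsub>?D\<^esub> f \<in> carrier ?D" if "a \<in> carrier A" "f \<in> carrier ?D" for a f
    using k_dualI[OF N lin_comp[OF lin_action[OF N that(1)] k_dual_lin[OF that(2)]]]
    by (simp add: k_dual_simps(4))
  have cl: "f x \<in> carrier K" if "f \<in> carrier ?D" "x \<in> carrier N" for f x using k_dual_closed that .
  note s = k_dual_simps(2-4)
  have fadd: "f (x \<oplus>\<^bsub>N\<^esub> y) = f x \<oplus>\<^bsub>K\<^esub> f y" if "f \<in> carrier ?D" "x \<in> carrier N" "y \<in> carrier N" for f x y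
    using lin_add[OF k_dual_lin[OF that(1)]] that by (simp add: restrict_scalars_simps regular_simps)
  have fzero: "f \<zero>\<^bsub>N\<^esub> = \<zero>\<^bsub>K\<^esub>" if "f \<in> carrier ?D" for f
    using lin_zero[OF k_dual_lin[OF that] KR left_module_ground_field] by (simp add: restrict_scalars_simps regular_simps)
  have z: "(\<lambda>x\<in>carrier N. \<zero>\<^bsub>K\<^esub> \<oplus>\<^bsub>K\<^esub> f x) = f" "(\<lambda>x\<in>carrier N. f (\<one>\<^bsub>A\<^esub> \<odot>\<^bsub>N\<^esub> x)) = f" if "f \<in> carrier ?D" for f
    by (subst (2) k_dual_ext[OF that, symmetric], rule restrict_ext, simp add: cl that N.smult_one)+
  show ?thesis
  proof (rule left_moduleI)
    show "ring (opp A)" by (rule O.algebra_is_ring)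
  qed (auto simp: add zero sm, auto simp: s cl N.smult_closed k_dual_ext N.smult_one fadd fzero z K.add.m_assoc N.smult_l_distr N.smult_r_distr
      N.smult_assoc intro!: restrict_ext K.a_comm cong: restrict_cong)
qed

lemma k_dual_msum:
  "x \<in> carrier N \<Longrightarrow> msum (k_dual K A N) f n x = msum (regular K) (\<lambda>j. f j x) n"
  by (induct n) (simp_all add: k_dual_simps regular_simps)

text \<open>A k-basis of N and its dual basis. Both expansions are written with the scalars c 1
  acting through A, so that they can be pushed through A-linear maps.\<close>

lemma dual_basis_module:
  assumes N: "left_module A N" and g: "fg A N"
  shows "\<exists>m b \<theta>. (\<forall>j<m. b j \<in> carrier N \<and> \<theta> j \<in> carrier (k_dual K A N)) \<and>
    (\<forall>x\<in>carrier N. msum N (\<lambda>j. (\<theta> j x \<odot>\<^bsub>A\<^esub> \<one>\<^bsub>A\<^esub>) \<odot>\<^bsub>N\<^esub> b j) m = x) \<and>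
    (\<forall>\<theta>'\<in>carrier (k_dual K A N). msum (k_dual K A N) (\<lambda>j. (\<theta>' (b j) \<odot>\<^bsub>A\<^esub> \<one>\<^bsub>A\<^esub>) \<odot>\<^bsub>k_dual K A N\<^esub> \<theta> j) m = \<theta>')"
proof -
  interpret N: left_module A N by fact
  have KR: "left_module K (restrict_scalars A N)" by (rule left_module_restrict_scalars[OF N])
  have g': "fg K (restrict_scalars A N)" using fg_restrict_iff[OF N] g by simp
  obtain m b \<phi> where 1: "\<forall>j<m. b j \<in> carrier (restrict_scalars A N) \<and> lin K (restrict_scalars A N) (regular K) (\<phi> j)"
    and 2: "\<forall>x\<in>carrier (restrict_scalars A N). msum (restrict_scalars A N) (\<lambda>j. \<phi> j x \<odot>\<^bsub>restrict_scalars A N\<^esub> b j) m = x"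
    using dual_basis[OF ground_field KR g'] by (elim exE conjE)
  define \<theta> where "\<theta> j = restrict (\<phi> j) (carrier N)" for j
  interpret D: left_module "opp A" "k_dual K A N" by (rule left_module_k_dual[OF N])
  have b: "b j \<in> carrier N" if "j < m" for j using 1 that by (simp add: restrict_scalars_simps)
  have \<theta>: "\<theta> j \<in> carrier (k_dual K A N)" if "j < m" for j unfolding \<theta>_def using 1 that by (intro k_dualI[OF N]) simp
  have s: "msum N (\<lambda>j. (\<theta> j x \<odot>\<^bsub>A\<^esub> \<one>\<^bsub>A\<^esub>) \<odot>\<^bsub>N\<^esub> b j) m = x" if "x \<in> carrier N" for x
    using 2 that by (simp add: restrict_scalars_simps msum_restrict_scalars \<theta>_def)
  have "msum (k_dual K A N) (\<lambda>j. (f (b j) \<odot>\<^bsub>A\<^esub> \<one>\<^bsub>A\<^esub>) \<odot>\<^bsub>k_dual K A N\<^esub> \<theta> j) m = f" (is "?L = f")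
    if f: "f \<in> carrier (k_dual K A N)" for f
  proof -
    have fc: "f (b j) \<odot>\<^bsub>A\<^esub> \<one>\<^bsub>A\<^esub> \<in> carrier A" if "j < m" for j
      using scalar_closed[OF k_dual_closed[OF f b[OF that]]] .
    have L: "?L \<in> carrier (k_dual K A N)"
      by (rule msum_closed[OF D.left_module_axioms]) (use fc \<theta> D.smult_closed in simp)
    have scal: "g ((c \<odot>\<^bsub>A\<^esub> \<one>\<^bsub>A\<^esub>) \<odot>\<^bsub>N\<^esub> x) = c \<otimes>\<^bsub>K\<^esub> g x"
      if "g \<in> carrier (k_dual K A N)" "c \<in> carrier K" "x \<in> carrier N" for g c x
      using lin_smult[OF k_dual_lin[OF that(1)] that(2)] that by (simp add: restrict_scalars_simps regular_simps)
    have "?L x = f x" if x: "x \<in> carrier N" for x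
    proof -
      have "?L x = msum (regular K) (\<lambda>j. f (b j) \<otimes>\<^bsub>K\<^esub> \<theta> j x) m"
        unfolding k_dual_msum[OF x]
        by (rule msum_cong) (use x b \<theta> k_dual_closed[OF f] scal in \<open>simp add: k_dual_simps(4)\<close>)
      also have "\<dots> = msum (regular K) (\<lambda>j. f ((\<theta> j x \<odot>\<^bsub>A\<^esub> \<one>\<^bsub>A\<^esub>) \<odot>\<^bsub>N\<^esub> b j)) m"
        by (rule msum_cong) (use x b k_dual_closed[OF \<theta>] k_dual_closed[OF f] scal[OF f] in \<open>simp add: K.m_comm\<close>)
      also have "\<dots> = f (msum (restrict_scalars A N) (\<lambda>j. (\<theta> j x \<odot>\<^bsub>A\<^esub> \<one>\<^bsub>A\<^esub>) \<odot>\<^bsub>N\<^esub> b j) m)"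
        by (rule lin_msum[OF k_dual_lin[OF f] KR left_module_ground_field, symmetric])
          (use x b k_dual_closed[OF \<theta>] scalar_closed N.smult_closed in \<open>simp add: restrict_scalars_simps\<close>)
      finally show ?thesis using s[OF x] by (simp add: msum_restrict_scalars)
    qed
    moreover have "?L \<in> mod_hom K (restrict_scalars A N) (regular K)" "f \<in> mod_hom K (restrict_scalars A N) (regular K)"
      using L f by (simp_all add: k_dual_simps(1))
    ultimately show ?thesis by (intro mod_hom_eqI) (auto simp: restrict_scalars_simps)
  qed
  then show ?thesis using b \<theta> s by (intro exI[of _ m] exI[of _ b] exI[of _ \<theta>]) simp
qed

lemma fg_k_dual:
  assumes N: "left_module A N" and g: "fg A N" shows "fg (opp A) (k_dual K A N)"
proof -
  interpret D: left_module "opp A" "k_dual K A N" by (rule left_module_k_dual[OF N])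
  obtain m b \<theta> where 1: "\<forall>j<m. b j \<in> carrier N \<and> \<theta> j \<in> carrier (k_dual K A N)"
    and 2: "\<forall>\<theta>'\<in>carrier (k_dual K A N). msum (k_dual K A N) (\<lambda>j. (\<theta>' (b j) \<odot>\<^bsub>A\<^esub> \<one>\<^bsub>A\<^esub>) \<odot>\<^bsub>k_dual K A N\<^esub> \<theta> j) m = \<theta>'"
    using dual_basis_module[OF N g] by (elim exE conjE)
  show ?thesis unfolding fg_def
  proof (intro exI[of _ "\<theta> ` {..<m}"] conjI allI impI)
    fix H assume H: "submodule H (opp A) (k_dual K A N)" "\<theta> ` {..<m} \<subseteq> H"
    have "f \<in> H" if f: "f \<in> carrier (k_dual K A N)" for f
    proof -
      have "msum (k_dual K A N) (\<lambda>j. (f (b j) \<odot>\<^bsub>A\<^esub> \<one>\<^bsub>A\<^esub>) \<odot>\<^bsub>k_dual K A N\<^esub> \<theta> j) m \<in> H"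
        by (rule msum_mem[OF D.left_module_axioms H(1)])
          (use H 1 scalar_closed[OF k_dual_closed[OF f]] D.submoduleD(4)[OF H(1)] in auto)
      then show ?thesis using 2 f by simp
    qed
    then show "H = carrier (k_dual K A N)" using D.submoduleD(1)[OF H(1)] by (intro equalityI subsetI) auto
  qed (use 1 in auto)
qed

lemma k_dual_separates:
  assumes N: "left_module A N" and g: "fg A N" and xy: "x \<in> carrier N" "y \<in> carrier N"
    and eq: "\<And>\<theta>. \<theta> \<in> carrier (k_dual K A N) \<Longrightarrow> \<theta> x = \<theta> y"
  shows "x = y"
proof -
  obtain m b \<theta> where 1: "\<forall>j<m. b j \<in> carrier N \<and> \<theta> j \<in> carrier (k_dual K A N)"
    and 2: "\<forall>x\<in>carrier N. msum N (\<lambda>j. (\<theta> j x \<odot>\<^bsub>A\<^esub> \<one>\<^bsub>A\<^esub>) \<odot>\<^bsub>N\<^esub> b j) m = x"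
    using dual_basis_module[OF N g] by (elim exE conjE)
  have th: "\<theta> j x = \<theta> j y" if "j < m" for j by (rule eq) (use 1 that in simp)
  have "msum N (\<lambda>j. (\<theta> j x \<odot>\<^bsub>A\<^esub> \<one>\<^bsub>A\<^esub>) \<odot>\<^bsub>N\<^esub> b j) m = msum N (\<lambda>j. (\<theta> j y \<odot>\<^bsub>A\<^esub> \<one>\<^bsub>A\<^esub>) \<odot>\<^bsub>N\<^esub> b j) m"
    by (rule msum_cong) (simp add: th)
  then show ?thesis using 2 xy by simp
qed

end

subsection \<open>Balanced forms and the symmetry of Ext\<close>

text \<open>Bilinear forms \<open>\<beta> : Z \<times> W \<rightarrow> k\<close> with \<open>\<beta>(a z, w) = \<beta>(z, a w)\<close>, i.e. functionals on the tensor product of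
  a left module \<open>Z\<close> and a right module \<open>W\<close>. Unlike \<open>Hom\<close> they are symmetric in the two sides.\<close>

definition bal where
  "bal K A Z W \<beta> \<longleftrightarrow> (\<forall>z\<in>carrier Z. \<forall>w\<in>carrier W. \<beta> z w \<in> carrier K) \<and>
     (\<forall>z\<in>carrier Z. \<forall>z'\<in>carrier Z. \<forall>w\<in>carrier W. \<beta> (z \<oplus>\<^bsub>Z\<^esub> z') w = \<beta> z w \<oplus>\<^bsub>K\<^esub> \<beta> z' w) \<and>
     (\<forall>z\<in>carrier Z. \<forall>w\<in>carrier W. \<forall>w'\<in>carrier W. \<beta> z (w \<oplus>\<^bsub>W\<^esub> w') = \<beta> z w \<oplus>\<^bsub>K\<^esub> \<beta> z w') \<and>
     (\<forall>a\<in>carrier A. \<forall>z\<in>carrier Z. \<forall>w\<in>carrier W. \<beta> (a \<odot>\<^bsub>Z\<^esub> z) w = \<beta> z (a \<odot>\<^bsub>W\<^esub> w)) \<and>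
     (\<forall>c\<in>carrier K. \<forall>z\<in>carrier Z. \<forall>w\<in>carrier W. \<beta> ((c \<odot>\<^bsub>A\<^esub> \<one>\<^bsub>A\<^esub>) \<odot>\<^bsub>Z\<^esub> z) w = c \<otimes>\<^bsub>K\<^esub> \<beta> z w)"

lemma balD:
  assumes "bal K A Z W \<beta>"
  shows "\<And>z w. z \<in> carrier Z \<Longrightarrow> w \<in> carrier W \<Longrightarrow> \<beta> z w \<in> carrier K"
    "\<And>z z' w. z \<in> carrier Z \<Longrightarrow> z' \<in> carrier Z \<Longrightarrow> w \<in> carrier W \<Longrightarrow> \<beta> (z \<oplus>\<^bsub>Z\<^esub> z') w = \<beta> z w \<oplus>\<^bsub>K\<^esub> \<beta> z' w"
    "\<And>z w w'. z \<in> carrier Z \<Longrightarrow> w \<in> carrier W \<Longrightarrow> w' \<in> carrier W \<Longrightarrow> \<beta> z (w \<oplus>\<^bsub>W\<^esub> w') = \<beta> z w \<oplus>\<^bsub>K\<^esub> \<beta> z w'"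
    "\<And>a z w. a \<in> carrier A \<Longrightarrow> z \<in> carrier Z \<Longrightarrow> w \<in> carrier W \<Longrightarrow> \<beta> (a \<odot>\<^bsub>Z\<^esub> z) w = \<beta> z (a \<odot>\<^bsub>W\<^esub> w)"
    "\<And>c z w. c \<in> carrier K \<Longrightarrow> z \<in> carrier Z \<Longrightarrow> w \<in> carrier W \<Longrightarrow>
       \<beta> ((c \<odot>\<^bsub>A\<^esub> \<one>\<^bsub>A\<^esub>) \<odot>\<^bsub>Z\<^esub> z) w = c \<otimes>\<^bsub>K\<^esub> \<beta> z w"
  using assms unfolding bal_def by simp_all

context fin_dim_algebra
begin

text \<open>\<open>bal\<close> asks for k-linearity in the first variable; moving the scalar c 1
  across gives it in the second.\<close>

lemma bal_flip: "bal K A Z W \<beta> \<Longrightarrow> bal K (opp A) W Z (\<lambda>w z. \<beta> z w)"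
  unfolding bal_def by (simp add: scalar_closed) (metis scalar_closed)

lemma bal_unflip: "bal K (opp A) W Z \<beta> \<Longrightarrow> bal K A Z W (\<lambda>z w. \<beta> w z)"
  using fin_dim_algebra.bal_flip[OF opp_algebra, of W Z \<beta>] by simp

lemma bal_comp_left:
  assumes b: "bal K A Z W \<beta>" and d: "lin A Z' Z d"
  shows "bal K A Z' W (\<lambda>z w. \<beta> (d z) w)"
  unfolding bal_def
proof (intro conjI ballI)
  show "\<beta> (d (a \<odot>\<^bsub>Z'\<^esub> z)) w = \<beta> (d z) (a \<odot>\<^bsub>W\<^esub> w)" if "a \<in> carrier A" "z \<in> carrier Z'" "w \<in> carrier W" for a z w
    using that by (simp add: lin_smult[OF d] balD(4)[OF b] lin_closed[OF d])
  show "\<beta> (d ((c \<odot>\<^bsub>A\<^esub> \<one>\<^bsub>A\<^esub>) \<odot>\<^bsub>Z'\<^esub> z)) w = c \<otimes>\<^bsub>K\<^esub> \<beta> (d z) w"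
    if "c \<in> carrier K" "z \<in> carrier Z'" "w \<in> carrier W" for c z w
    using that by (simp add: lin_smult[OF d] balD(5)[OF b] lin_closed[OF d] scalar_closed)
qed (simp_all add: lin_add[OF d] balD(1-3)[OF b] lin_closed[OF d])

lemma bal_comp_right:
  "bal K A Z W \<beta> \<Longrightarrow> lin (opp A) W' W d \<Longrightarrow> bal K A Z W' (\<lambda>z w. \<beta> z (d w))"
  by (rule bal_unflip) (rule fin_dim_algebra.bal_comp_left[OF opp_algebra bal_flip])

lemma bal_lin_left:
  "bal K A Z W \<beta> \<Longrightarrow> w \<in> carrier W \<Longrightarrow> lin K (restrict_scalars A Z) (regular K) (\<lambda>z. \<beta> z w)"
  by (intro linI) (simp_all add: restrict_scalars_simps regular_simps balD(1,2,5))

lemma bal_lin_right: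
  "bal K A Z W \<beta> \<Longrightarrow> z \<in> carrier Z \<Longrightarrow> lin K (restrict_scalars A W) (regular K) (\<lambda>w. \<beta> z w)"
  using fin_dim_algebra.bal_lin_left[OF opp_algebra bal_flip] by simp

lemma bal_diff:
  assumes b: "bal K A Z W \<beta>" and c: "bal K A Z W \<gamma>" and Z: "left_module A Z" and W: "left_module (opp A) W"
  shows "bal K A Z W (\<lambda>z w. \<beta> z w \<ominus>\<^bsub>K\<^esub> \<gamma> z w)"
proof -
  interpret Z: left_module A Z by fact
  interpret W: left_module "opp A" W by fact
  have eq: "a \<ominus>\<^bsub>regular K\<^esub> b = a \<ominus>\<^bsub>K\<^esub> b" for a b
    by (simp add: a_minus_def a_inv_def m_inv_def regular_simps)
  have l: "lin K (restrict_scalars A Z) (regular K) (\<lambda>z. \<beta> z w \<ominus>\<^bsub>K\<^esub> \<gamma> z w)" if "w \<in> carrier W" for w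
    using lin_minus_map[OF bal_lin_left[OF b that] bal_lin_left[OF c that] left_module_ground_field] unfolding eq .
  have r: "lin K (restrict_scalars A W) (regular K) (\<lambda>w. \<beta> z w \<ominus>\<^bsub>K\<^esub> \<gamma> z w)" if "z \<in> carrier Z" for z
    using lin_minus_map[OF bal_lin_right[OF b that] bal_lin_right[OF c that] left_module_ground_field] unfolding eq .
  show ?thesis unfolding bal_def
    using lin_closed[OF l] lin_add[OF l] lin_add[OF r] lin_smult[OF l] balD(4)[OF b] balD(4)[OF c]
    by (simp add: restrict_scalars_simps regular_simps)
qed

text \<open>For projective W the functor D(- \<otimes> W) is exact. For a dual basis u, \<phi> of W
  each functional \<beta>(-, u j) descends along d, since k is injective over itself, and \<phi>
  assembles the resulting functionals into a form on Y x W.\<close>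

lemma bal_factor_left:
  assumes Z: "left_module A Z" and Y: "left_module A Y" and g: "fg A Y" and d: "lin A Z Y d"
    and W: "projective_module (opp A) W" and b: "bal K A Z W \<beta>"
    and ker: "\<And>z w. z \<in> carrier Z \<Longrightarrow> w \<in> carrier W \<Longrightarrow> d z = \<zero>\<^bsub>Y\<^esub> \<Longrightarrow> \<beta> z w = \<zero>\<^bsub>K\<^esub>"
  shows "\<exists>\<gamma>. bal K A Y W \<gamma> \<and> (\<forall>z\<in>carrier Z. \<forall>w\<in>carrier W. \<gamma> (d z) w = \<beta> z w)"
proof -
  interpret O: fin_dim_algebra K "opp A" by (rule opp_algebra)
  interpret Z: left_module A Z by fact
  interpret Y: left_module A Y by fact
  note WM = projective_left_module[OF W]
  interpret W: left_module "opp A" W by fact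
  have KY: "left_module K (restrict_scalars A Y)" by (rule left_module_restrict_scalars[OF Y])
  have KZ: "left_module K (restrict_scalars A Z)" by (rule left_module_restrict_scalars[OF Z])
  have KW: "left_module K (restrict_scalars A W)" using O.left_module_restrict_scalars[OF WM] by simp
  have gY: "fg K (restrict_scalars A Y)" using fg_restrict_iff[OF Y] g by simp
  obtain m u \<phi> where u\<phi>: "\<forall>j<m. u j \<in> carrier W \<and> lin (opp A) W (regular (opp A)) (\<phi> j)"
    and s: "\<forall>w\<in>carrier W. msum W (\<lambda>j. \<phi> j w \<odot>\<^bsub>W\<^esub> u j) m = w"
    using projective_dual_basis[OF O.algebra_is_ring W] by (elim exE conjE)
  have u: "u j \<in> carrier W" and \<phi>: "lin (opp A) W (regular (opp A)) (\<phi> j)" if "j < m" for j using u\<phi> that by auto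
  have \<phi>c: "\<phi> j w \<in> carrier A" if "j < m" "w \<in> carrier W" for j w
    using lin_closed[OF \<phi> that(2)] that(1) by (simp add: regular_simps)
  have \<phi>a: "\<phi> j (a \<odot>\<^bsub>W\<^esub> w) = \<phi> j w \<otimes>\<^bsub>A\<^esub> a" if "j < m" "w \<in> carrier W" "a \<in> carrier A" for j w a
    using lin_smult[OF \<phi>[OF that(1)], of a w] that by (simp add: regular_simps)
  have \<phi>add: "\<phi> j (w \<oplus>\<^bsub>W\<^esub> w') = \<phi> j w \<oplus>\<^bsub>A\<^esub> \<phi> j w'" if "j < m" "w \<in> carrier W" "w' \<in> carrier W" for j w w'
    using lin_add[OF \<phi>[OF that(1)], of w w'] that by (simp add: regular_simps)
  have "\<exists>h. lin K (restrict_scalars A Y) (regular K) h \<and> (\<forall>z\<in>carrier Z. h (d z) = \<beta> z (u j))" if "j < m" for j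
    using functional_factor[OF ground_field KZ KY gY lin_restrict_scalars[OF d] bal_lin_left[OF b u[OF that]]]
      ker[OF _ u[OF that]] by (simp add: restrict_scalars_simps)
  then have "\<forall>j. \<exists>h. j < m \<longrightarrow> lin K (restrict_scalars A Y) (regular K) h \<and> (\<forall>z\<in>carrier Z. h (d z) = \<beta> z (u j))"
    by blast
  then obtain \<gamma>' where \<gamma>': "\<forall>j. j < m \<longrightarrow> lin K (restrict_scalars A Y) (regular K) (\<gamma>' j) \<and>
    (\<forall>z\<in>carrier Z. \<gamma>' j (d z) = \<beta> z (u j))" by (rule choice[THEN exE])
  have \<gamma>l: "lin K (restrict_scalars A Y) (regular K) (\<gamma>' j)" if "j < m" for j using \<gamma>' that by blast
  have \<gamma>c: "\<gamma>' j y \<in> carrier K" if "j < m" "y \<in> carrier Y" for j y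
    using lin_closed[OF \<gamma>l] that by (simp add: restrict_scalars_simps regular_simps)
  have \<gamma>add: "\<gamma>' j (y \<oplus>\<^bsub>Y\<^esub> y') = \<gamma>' j y \<oplus>\<^bsub>K\<^esub> \<gamma>' j y'" if "j < m" "y \<in> carrier Y" "y' \<in> carrier Y" for j y y'
    using lin_add[OF \<gamma>l] that by (simp add: restrict_scalars_simps regular_simps)
  define \<gamma> where "\<gamma> y w = msum (regular K) (\<lambda>j. \<gamma>' j (\<phi> j w \<odot>\<^bsub>Y\<^esub> y)) m" for y w
  have left: "lin K (restrict_scalars A Y) (regular K) (\<lambda>y. \<gamma> y w)" if "w \<in> carrier W" for w
    unfolding \<gamma>_def by (rule lin_msum_map[OF lin_comp[OF lin_action[OF Y \<phi>c] \<gamma>l] left_module_ground_field]) (use that in auto)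
  have "bal K A Y W \<gamma>" unfolding bal_def
  proof (intro conjI ballI)
    show "\<gamma> y w \<in> carrier K" if "y \<in> carrier Y" "w \<in> carrier W" for y w
      using lin_closed[OF left] that by (simp add: restrict_scalars_simps regular_simps)
    show "\<gamma> (y \<oplus>\<^bsub>Y\<^esub> y') w = \<gamma> y w \<oplus>\<^bsub>K\<^esub> \<gamma> y' w" if "y \<in> carrier Y" "y' \<in> carrier Y" "w \<in> carrier W" for y y' w
      using lin_add[OF left] that by (simp add: restrict_scalars_simps regular_simps)
    show "\<gamma> ((c \<odot>\<^bsub>A\<^esub> \<one>\<^bsub>A\<^esub>) \<odot>\<^bsub>Y\<^esub> y) w = c \<otimes>\<^bsub>K\<^esub> \<gamma> y w" if "c \<in> carrier K" "y \<in> carrier Y" "w \<in> carrier W" for c y w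
      using lin_smult[OF left] that by (simp add: restrict_scalars_simps regular_simps)
    show "\<gamma> y (w \<oplus>\<^bsub>W\<^esub> w') = \<gamma> y w \<oplus>\<^bsub>K\<^esub> \<gamma> y w'" if "y \<in> carrier Y" "w \<in> carrier W" "w' \<in> carrier W" for y w w'
    proof -
      have "\<gamma> y (w \<oplus>\<^bsub>W\<^esub> w') = msum (regular K) (\<lambda>j. \<gamma>' j (\<phi> j w \<odot>\<^bsub>Y\<^esub> y) \<oplus>\<^bsub>regular K\<^esub> \<gamma>' j (\<phi> j w' \<odot>\<^bsub>Y\<^esub> y)) m"
        unfolding \<gamma>_def by (rule msum_cong)
          (use that in \<open>simp add: \<phi>add \<phi>c Y.smult_l_distr \<gamma>add Y.smult_closed regular_simps\<close>)
      also have "\<dots> = \<gamma> y w \<oplus>\<^bsub>regular K\<^esub> \<gamma> y w'" unfolding \<gamma>_def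
        by (rule msum_add_distrib[OF left_module_ground_field]) (use that \<gamma>c \<phi>c Y.smult_closed in \<open>auto simp: regular_simps\<close>)
      finally show ?thesis by (simp add: regular_simps)
    qed
    show "\<gamma> (a \<odot>\<^bsub>Y\<^esub> y) w = \<gamma> y (a \<odot>\<^bsub>W\<^esub> w)" if "a \<in> carrier A" "y \<in> carrier Y" "w \<in> carrier W" for a y w
      unfolding \<gamma>_def by (rule msum_cong) (use that in \<open>simp add: \<phi>a \<phi>c Y.smult_assoc\<close>)
  qed
  moreover have "\<gamma> (d z) w = \<beta> z w" if z: "z \<in> carrier Z" and w: "w \<in> carrier W" for z w
  proof -
    have "\<gamma> (d z) w = msum (regular K) (\<lambda>j. \<beta> z (\<phi> j w \<odot>\<^bsub>W\<^esub> u j)) m"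
      unfolding \<gamma>_def
    proof (rule msum_cong)
      fix j assume j: "j < m"
      have "\<gamma>' j (\<phi> j w \<odot>\<^bsub>Y\<^esub> d z) = \<gamma>' j (d (\<phi> j w \<odot>\<^bsub>Z\<^esub> z))" by (simp add: lin_smult[OF d] \<phi>c j w z)
      also have "\<dots> = \<beta> (\<phi> j w \<odot>\<^bsub>Z\<^esub> z) (u j)" using \<gamma>' j Z.smult_closed[OF \<phi>c[OF j w] z] by blast
      finally show "\<gamma>' j (\<phi> j w \<odot>\<^bsub>Y\<^esub> d z) = \<beta> z (\<phi> j w \<odot>\<^bsub>W\<^esub> u j)" by (simp add: balD(4)[OF b] \<phi>c j w z u)
    qed
    also have "\<dots> = \<beta> z (msum (restrict_scalars A W) (\<lambda>j. \<phi> j w \<odot>\<^bsub>W\<^esub> u j) m)"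
      by (rule lin_msum[OF bal_lin_right[OF b z] KW left_module_ground_field, symmetric])
        (use \<phi>c w u W.smult_closed in \<open>simp add: restrict_scalars_simps\<close>)
    finally show ?thesis using s w by (simp add: msum_restrict_scalars)
  qed
  ultimately show ?thesis by blast
qed

lemma bal_factor_right:
  assumes Z: "projective_module A Z" and W: "left_module (opp A) W" and Y: "left_module (opp A) Y"
    and g: "fg (opp A) Y" and d: "lin (opp A) W Y d" and b: "bal K A Z W \<beta>"
    and ker: "\<And>z w. z \<in> carrier Z \<Longrightarrow> w \<in> carrier W \<Longrightarrow> d w = \<zero>\<^bsub>Y\<^esub> \<Longrightarrow> \<beta> z w = \<zero>\<^bsub>K\<^esub>"
  shows "\<exists>\<gamma>. bal K A Z Y \<gamma> \<and> (\<forall>z\<in>carrier Z. \<forall>w\<in>carrier W. \<gamma> z (d w) = \<beta> z w)"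
proof -
  have Z': "projective_module (opp (opp A)) Z" using Z by simp
  obtain \<gamma> where "bal K (opp A) Y Z \<gamma>" "\<forall>w\<in>carrier W. \<forall>z\<in>carrier Z. \<gamma> (d w) z = \<beta> z w"
    using fin_dim_algebra.bal_factor_left[OF opp_algebra W Y g d Z' bal_flip[OF b] ker] by blast
  then show ?thesis using bal_unflip by blast
qed

text \<open>\<open>Hom(Z, N) = D(Z \<otimes> DN)\<close>, with \<open>DN\<close> presented as a quotient of \<open>W\<close>.\<close>

lemma bal_represent:
  assumes Z: "left_module A Z" and N: "left_module A N" and g: "fg A N"
    and W: "left_module (opp A) W" and e: "lin (opp A) W (k_dual K A N) e"
    and es: "e ` carrier W = carrier (k_dual K A N)" and b: "bal K A Z W \<beta>"
    and ker: "\<And>z w. z \<in> carrier Z \<Longrightarrow> w \<in> carrier W \<Longrightarrow> e w = \<zero>\<^bsub>k_dual K A N\<^esub> \<Longrightarrow> \<beta> z w = \<zero>\<^bsub>K\<^esub>"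
  shows "\<exists>f. lin A Z N f \<and> (\<forall>z\<in>carrier Z. \<forall>w\<in>carrier W. \<beta> z w = e w (f z))"
proof -
  interpret O: fin_dim_algebra K "opp A" by (rule opp_algebra)
  let ?D = "k_dual K A N"
  have D: "left_module (opp A) ?D" by (rule left_module_k_dual[OF N])
  interpret Z: left_module A Z by fact
  interpret N: left_module A N by fact
  interpret W: left_module "opp A" W by fact
  interpret D: left_module "opp A" ?D by fact
  have KW: "left_module K (restrict_scalars A W)" using O.left_module_restrict_scalars[OF W] by simp
  have KN: "left_module K (restrict_scalars A N)" by (rule left_module_restrict_scalars[OF N])
  obtain m v \<theta> where 1: "\<forall>j<m. v j \<in> carrier N \<and> \<theta> j \<in> carrier ?D"
    and 3: "\<forall>\<theta>'\<in>carrier ?D. msum ?D (\<lambda>j. (\<theta>' (v j) \<odot>\<^bsub>A\<^esub> \<one>\<^bsub>A\<^esub>) \<odot>\<^bsub>?D\<^esub> \<theta> j) m = \<theta>'"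
    using dual_basis_module[OF N g] by (elim exE conjE)
  have v: "v j \<in> carrier N" and \<theta>: "\<theta> j \<in> carrier ?D" if "j < m" for j using 1 that by auto
  have "\<forall>j. \<exists>w. j < m \<longrightarrow> w \<in> carrier W \<and> e w = \<theta> j" using \<theta> es by (metis imageE)
  then obtain w where w': "\<forall>j. j < m \<longrightarrow> w j \<in> carrier W \<and> e (w j) = \<theta> j" by (rule choice[THEN exE])
  have w: "w j \<in> carrier W" "e (w j) = \<theta> j" if "j < m" for j using w' that by auto
  \<comment> \<open>As w j is a preimage of \<theta> j, the equation \<beta> z w = e w (f z)
    prescribes \<theta> j (f z) = \<beta> z (w j), and the expansion of f z along the v j leaves
    this one candidate.\<close>
  define f where "f z = msum N (\<lambda>j. (\<beta> z (w j) \<odot>\<^bsub>A\<^esub> \<one>\<^bsub>A\<^esub>) \<odot>\<^bsub>N\<^esub> v j) m" for z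
  have \<beta>c: "\<beta> z (w j) \<odot>\<^bsub>A\<^esub> \<one>\<^bsub>A\<^esub> \<in> carrier A" if "z \<in> carrier Z" "j < m" for z j
    using scalar_closed[OF balD(1)[OF b that(1) w(1)[OF that(2)]]] .
  have fN: "f z \<in> carrier N" if "z \<in> carrier Z" for z
    unfolding f_def by (rule msum_closed[OF N]) (use that v \<beta>c N.smult_closed in simp)
  have main: "\<beta> z x = e x (f z)" if z: "z \<in> carrier Z" and x: "x \<in> carrier W" for z x
  proof -
    let ?\<theta> = "e x"
    have T: "?\<theta> \<in> carrier ?D" by (rule lin_closed[OF e x])
    have sc: "?\<theta> (v j) \<odot>\<^bsub>A\<^esub> \<one>\<^bsub>A\<^esub> \<in> carrier A" if "j < m" for j
      using scalar_closed[OF k_dual_closed[OF T v[OF that]]] .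
    \<comment> \<open>x' is a combination of the w j with the same image as x under e. By the kernel
      hypothesis \<beta> z agrees at x and x', and at x' it can be expanded.\<close>
    define x' where "x' = msum W (\<lambda>j. (?\<theta> (v j) \<odot>\<^bsub>A\<^esub> \<one>\<^bsub>A\<^esub>) \<odot>\<^bsub>W\<^esub> w j) m"
    have x': "x' \<in> carrier W" unfolding x'_def
      by (rule msum_closed[OF W]) (use sc w W.smult_closed in simp)
    have "e x' = msum ?D (\<lambda>j. e ((?\<theta> (v j) \<odot>\<^bsub>A\<^esub> \<one>\<^bsub>A\<^esub>) \<odot>\<^bsub>W\<^esub> w j)) m"
      unfolding x'_def by (rule lin_msum[OF e W D]) (use sc w W.smult_closed in simp)
    also have "\<dots> = msum ?D (\<lambda>j. (?\<theta> (v j) \<odot>\<^bsub>A\<^esub> \<one>\<^bsub>A\<^esub>) \<odot>\<^bsub>?D\<^esub> \<theta> j) m"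
      by (rule msum_cong) (use sc w in \<open>simp add: lin_smult[OF e]\<close>)
    also have "\<dots> = ?\<theta>" using 3 T by blast
    finally have ex': "e x' = e x" .
    have "e (x \<ominus>\<^bsub>W\<^esub> x') = \<zero>\<^bsub>?D\<^esub>"
      using x x' ex' T by (simp add: lin_minus[OF e W D] a_minus_def[of ?D] D.M.r_neg)
    then have "\<beta> z (x \<ominus>\<^bsub>W\<^esub> x') = \<zero>\<^bsub>K\<^esub>" using ker[OF z W.M.minus_closed[OF x x']] by simp
    then have "\<beta> z x' = \<beta> z x"
      using balD(3)[OF b z W.M.minus_closed[OF x x'] x'] x x' balD(1)[OF b z x']
      by (simp add: a_minus_def W.M.a_assoc W.M.l_neg)
    also have "\<beta> z x' = msum (regular K) (\<lambda>j. \<beta> z ((?\<theta> (v j) \<odot>\<^bsub>A\<^esub> \<one>\<^bsub>A\<^esub>) \<odot>\<^bsub>W\<^esub> w j)) m"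
      unfolding x'_def msum_restrict_scalars[of A W, symmetric]
      by (rule lin_msum[OF bal_lin_right[OF b z] KW left_module_ground_field])
        (use sc w W.smult_closed in \<open>simp add: restrict_scalars_simps\<close>)
    also have "\<dots> = msum (regular K) (\<lambda>j. ?\<theta> ((\<beta> z (w j) \<odot>\<^bsub>A\<^esub> \<one>\<^bsub>A\<^esub>) \<odot>\<^bsub>N\<^esub> v j)) m"
    proof (rule msum_cong)
      fix j assume j: "j < m"
      have "\<beta> z ((?\<theta> (v j) \<odot>\<^bsub>A\<^esub> \<one>\<^bsub>A\<^esub>) \<odot>\<^bsub>W\<^esub> w j) = ?\<theta> (v j) \<otimes>\<^bsub>K\<^esub> \<beta> z (w j)"
        using lin_smult[OF bal_lin_right[OF b z] k_dual_closed[OF T v[OF j]], of "w j"] w[OF j]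
        by (simp add: restrict_scalars_simps regular_simps)
      moreover have "?\<theta> ((\<beta> z (w j) \<odot>\<^bsub>A\<^esub> \<one>\<^bsub>A\<^esub>) \<odot>\<^bsub>N\<^esub> v j) = \<beta> z (w j) \<otimes>\<^bsub>K\<^esub> ?\<theta> (v j)"
        using lin_smult[OF k_dual_lin[OF T] balD(1)[OF b z w(1)[OF j]], of "v j"] v[OF j]
        by (simp add: restrict_scalars_simps regular_simps)
      ultimately show "\<beta> z ((?\<theta> (v j) \<odot>\<^bsub>A\<^esub> \<one>\<^bsub>A\<^esub>) \<odot>\<^bsub>W\<^esub> w j) = ?\<theta> ((\<beta> z (w j) \<odot>\<^bsub>A\<^esub> \<one>\<^bsub>A\<^esub>) \<odot>\<^bsub>N\<^esub> v j)"
        using K.m_comm[OF k_dual_closed[OF T v[OF j]] balD(1)[OF b z w(1)[OF j]]] by simp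
    qed
    also have "\<dots> = ?\<theta> (msum (restrict_scalars A N) (\<lambda>j. (\<beta> z (w j) \<odot>\<^bsub>A\<^esub> \<one>\<^bsub>A\<^esub>) \<odot>\<^bsub>N\<^esub> v j) m)"
      by (rule lin_msum[OF k_dual_lin[OF T] KN left_module_ground_field, symmetric])
        (use \<beta>c z v N.smult_closed in \<open>simp add: restrict_scalars_simps\<close>)
    finally show ?thesis by (simp add: f_def msum_restrict_scalars)
  qed
  have sep: "x = y" if "x \<in> carrier N" "y \<in> carrier N" "\<And>w. w \<in> carrier W \<Longrightarrow> e w x = e w y" for x y
  proof (rule k_dual_separates[OF N g that(1,2)])
    fix \<theta>' assume "\<theta>' \<in> carrier ?D"
    then obtain w where "w \<in> carrier W" "\<theta>' = e w" using es by (metis imageE)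
    then show "\<theta>' x = \<theta>' y" using that(3) by simp
  qed
  have eadd: "e w (x \<oplus>\<^bsub>N\<^esub> y) = e w x \<oplus>\<^bsub>K\<^esub> e w y" if "w \<in> carrier W" "x \<in> carrier N" "y \<in> carrier N" for w x y
    using lin_add[OF k_dual_lin[OF lin_closed[OF e that(1)]]] that by (simp add: restrict_scalars_simps regular_simps)
  have "lin A Z N f"
  proof (rule linI)
    fix x y assume xy: "x \<in> carrier Z" "y \<in> carrier Z"
    show "f (x \<oplus>\<^bsub>Z\<^esub> y) = f x \<oplus>\<^bsub>N\<^esub> f y"
      by (rule sep) (use xy fN in \<open>simp_all add: main[symmetric] eadd balD(2)[OF b]\<close>)
  next
    fix a x assume ax: "a \<in> carrier A" "x \<in> carrier Z"
    show "f (a \<odot>\<^bsub>Z\<^esub> x) = a \<odot>\<^bsub>N\<^esub> f x"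
    proof (rule sep)
      fix w assume w: "w \<in> carrier W"
      have "e w (f (a \<odot>\<^bsub>Z\<^esub> x)) = \<beta> x (a \<odot>\<^bsub>W\<^esub> w)"
        using ax w Z.smult_closed by (simp add: main[symmetric] balD(4)[OF b])
      also have "\<dots> = e (a \<odot>\<^bsub>W\<^esub> w) (f x)" using ax w W.smult_closed by (simp add: main)
      also have "\<dots> = e w (a \<odot>\<^bsub>N\<^esub> f x)" using ax w fN by (simp add: lin_smult[OF e] k_dual_simps(4))
      finally show "e w (f (a \<odot>\<^bsub>Z\<^esub> x)) = e w (a \<odot>\<^bsub>N\<^esub> f x)" .
    qed (use ax fN Z.smult_closed N.smult_closed in auto)
  qed (rule fN)
  then show ?thesis using main by blast
qed

lemma bal_of_lin:
  assumes N: "left_module A N" and W: "left_module (opp A) W" and e: "lin (opp A) W (k_dual K A N) e" and f: "lin A Z N f"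
  shows "bal K A Z W (\<lambda>z w. e w (f z))"
proof -
  interpret W: left_module "opp A" W by fact
  interpret N: left_module A N by fact
  note ec = lin_closed[OF e]
  note fc = lin_closed[OF f]
  have l: "e w (x \<oplus>\<^bsub>N\<^esub> y) = e w x \<oplus>\<^bsub>K\<^esub> e w y"
    if "w \<in> carrier W" "x \<in> carrier N" "y \<in> carrier N" for w x y
    using lin_add[OF k_dual_lin[OF ec[OF that(1)]], of x y] that
    by (simp add: restrict_scalars_simps regular_simps)
  have l2: "e w ((c \<odot>\<^bsub>A\<^esub> \<one>\<^bsub>A\<^esub>) \<odot>\<^bsub>N\<^esub> x) = c \<otimes>\<^bsub>K\<^esub> e w x"
    if "w \<in> carrier W" "x \<in> carrier N" "c \<in> carrier K" for w x c
    using lin_smult[OF k_dual_lin[OF ec[OF that(1)]], of c x] that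
    by (simp add: restrict_scalars_simps regular_simps)
  show ?thesis unfolding bal_def
    using k_dual_closed[OF ec] fc l l2
    by (auto simp: lin_add[OF f] lin_smult[OF f] lin_add[OF e] lin_smult[OF e] k_dual_simps(3,4) scalar_closed)
qed

text \<open>The argument in the double complex \<open>bal(Z\<^sub>a, W\<^sub>b)\<close> that computes \<open>Ext\<close> from either variable: in the relevant range
  the kernel of the composite of the two differentials is the sum of the two kernels.\<close>

lemma bal_kernel_sum:
  assumes rZ: "is_res A X Z dZ eZ" and rW: "is_res (opp A) M W dW eW"
    and hyp: "\<And>a \<beta>. \<lbrakk>Suc a < n; bal K A (Z (Suc a)) (W 0) \<beta>;
        \<forall>z\<in>carrier (Z (Suc a)). \<forall>w\<in>carrier (W (Suc 0)). \<beta> z (dW 0 w) = \<zero>\<^bsub>K\<^esub>;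
        \<forall>z\<in>carrier (Z (Suc (Suc a))). \<forall>w\<in>carrier (W 0). \<beta> (dZ (Suc a) z) w = \<zero>\<^bsub>K\<^esub>\<rbrakk> \<Longrightarrow>
      \<exists>\<gamma>. bal K A (Z a) (W 0) \<gamma> \<and>
        (\<forall>z\<in>carrier (Z a). \<forall>w\<in>carrier (W (Suc 0)). \<gamma> z (dW 0 w) = \<zero>\<^bsub>K\<^esub>) \<and>
        (\<forall>z\<in>carrier (Z (Suc a)). \<forall>w\<in>carrier (W 0). \<gamma> (dZ a z) w = \<beta> z w)"
    and ab: "Suc (a + b) < n" and b: "bal K A (Z a) (W b) \<beta>"
    and z: "\<forall>z\<in>carrier (Z (Suc a)). \<forall>w\<in>carrier (W (Suc b)). \<beta> (dZ a z) (dW b w) = \<zero>\<^bsub>K\<^esub>"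
  shows "\<exists>\<gamma>. bal K A (Z a) (W b) \<gamma> \<and>
      (\<forall>z\<in>carrier (Z (Suc a)). \<forall>w\<in>carrier (W b). \<gamma> (dZ a z) w = \<beta> (dZ a z) w) \<and>
      (\<forall>z\<in>carrier (Z a). \<forall>w\<in>carrier (W (Suc b)). \<gamma> z (dW b w) = \<zero>\<^bsub>K\<^esub>)"
  using ab b z
proof (induct b arbitrary: a \<beta>)
  case 0
  note D = is_resD[OF rZ] and D' = is_resD[OF rW]
  \<comment> \<open>The form \<beta>(dZ z, w) is killed by both differentials, which on the edge
    \<open>W 0\<close> is the situation of \<open>hyp\<close>.\<close>
  have 1: "bal K A (Z (Suc a)) (W 0) (\<lambda>z w. \<beta> (dZ a z) w)" by (rule bal_comp_left[OF 0(2) D(5)])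
  have "\<exists>\<gamma>. bal K A (Z a) (W 0) \<gamma> \<and>
        (\<forall>z\<in>carrier (Z a). \<forall>w\<in>carrier (W (Suc 0)). \<gamma> z (dW 0 w) = \<zero>\<^bsub>K\<^esub>) \<and>
        (\<forall>z\<in>carrier (Z (Suc a)). \<forall>w\<in>carrier (W 0). \<gamma> (dZ a z) w = \<beta> (dZ a z) w)"
  proof (rule hyp[OF _ 1])
    show "Suc a < n" using 0(1) by simp
    show "\<forall>z\<in>carrier (Z (Suc (Suc a))). \<forall>w\<in>carrier (W 0). \<beta> (dZ a (dZ (Suc a) z)) w = \<zero>\<^bsub>K\<^esub>"
      using lin_zero[OF bal_lin_left[OF 0(2)] left_module_restrict_scalars[OF D(3)] left_module_ground_field]
      by (simp add: is_res_dd[OF rZ] restrict_scalars_simps regular_simps)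
  qed (rule 0(3))
  then show ?case by blast
next
  case (Suc b)
  note D = is_resD[OF rZ] and D' = is_resD[OF rW]
  interpret O: fin_dim_algebra K "opp A" by (rule opp_algebra)
  note \<beta> = Suc(3)
  have zr: "\<gamma> \<zero>\<^bsub>Z i\<^esub> w = \<zero>\<^bsub>K\<^esub>" if "bal K A (Z i) (W j) \<gamma>" "w \<in> carrier (W j)" for i j w \<gamma>
    using lin_zero[OF bal_lin_left[OF that] left_module_restrict_scalars[OF D(3)] left_module_ground_field]
    by (simp add: restrict_scalars_simps regular_simps)
  have zl: "\<gamma> z \<zero>\<^bsub>W j\<^esub> = \<zero>\<^bsub>K\<^esub>" if "bal K A (Z i) (W j) \<gamma>" "z \<in> carrier (Z i)" for i j z \<gamma>
    using lin_zero[OF bal_lin_right[OF that] _ left_module_ground_field] O.left_module_restrict_scalars[OF D'(3)]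
    by (simp add: restrict_scalars_simps regular_simps)
  \<comment> \<open>One step of the staircase: \<beta>(dZ z, w) vanishes on the image of dW, so by
    exactness of W it equals \<beta>'(z, dW w) for a form \<beta>' whose first index is one higher
    and whose second is one lower. The sum of the indices is unchanged, so the induction hypothesis
    applies to \<beta>'.\<close>
  have b1: "bal K A (Z (Suc a)) (W (Suc b)) (\<lambda>z w. \<beta> (dZ a z) w)" by (rule bal_comp_left[OF \<beta> D(5)])
  have "\<exists>\<gamma>. bal K A (Z (Suc a)) (W b) \<gamma> \<and>
      (\<forall>z\<in>carrier (Z (Suc a)). \<forall>w\<in>carrier (W (Suc b)). \<gamma> z (dW b w) = \<beta> (dZ a z) w)"
  proof (rule bal_factor_right[OF D(2) D'(3) D'(3) fg_projective[OF D'(2)] D'(5) b1])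
    fix z w assume z: "z \<in> carrier (Z (Suc a))" "w \<in> carrier (W (Suc b))" "dW b w = \<zero>\<^bsub>W b\<^esub>"
    then have "w \<in> dW (Suc b) ` carrier (W (Suc (Suc b)))" unfolding D'(8) by simp
    then show "\<beta> (dZ a z) w = \<zero>\<^bsub>K\<^esub>" using Suc(4) z(1) by blast
  qed
  then obtain \<beta>' where \<beta>': "bal K A (Z (Suc a)) (W b) \<beta>'"
    and b': "\<forall>z\<in>carrier (Z (Suc a)). \<forall>w\<in>carrier (W (Suc b)). \<beta>' z (dW b w) = \<beta> (dZ a z) w" by (elim exE conjE)
  have "\<exists>\<gamma>. bal K A (Z (Suc a)) (W b) \<gamma> \<and>
      (\<forall>z\<in>carrier (Z (Suc (Suc a))). \<forall>w\<in>carrier (W b). \<gamma> (dZ (Suc a) z) w = \<beta>' (dZ (Suc a) z) w) \<and>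
      (\<forall>z\<in>carrier (Z (Suc a)). \<forall>w\<in>carrier (W (Suc b)). \<gamma> z (dW b w) = \<zero>\<^bsub>K\<^esub>)"
  proof (rule Suc(1)[OF _ \<beta>'])
    show "Suc (Suc a + b) < n" using Suc(2) by simp
    show "\<forall>z\<in>carrier (Z (Suc (Suc a))). \<forall>w\<in>carrier (W (Suc b)). \<beta>' (dZ (Suc a) z) (dW b w) = \<zero>\<^bsub>K\<^esub>"
      using b' lin_closed[OF D(5)] zr[OF \<beta>] by (simp add: is_res_dd[OF rZ])
  qed
  then obtain \<beta>2 where \<beta>2: "bal K A (Z (Suc a)) (W b) \<beta>2"
    and b21: "\<forall>z\<in>carrier (Z (Suc (Suc a))). \<forall>w\<in>carrier (W b). \<beta>2 (dZ (Suc a) z) w = \<beta>' (dZ (Suc a) z) w"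
    and b22: "\<forall>z\<in>carrier (Z (Suc a)). \<forall>w\<in>carrier (W (Suc b)). \<beta>2 z (dW b w) = \<zero>\<^bsub>K\<^esub>" by (elim exE conjE)
  \<comment> \<open>\<beta>' is split into \<beta>2, which is killed by dW, and a remainder that
    vanishes on the cycles of Z and hence has the form \<xi>(dZ z, w) with the lifting \<xi>
    obtained next. The form sought is \<xi>(z, dW w).\<close>
  let ?\<beta>1 = "\<lambda>z w. \<beta>' z w \<ominus>\<^bsub>K\<^esub> \<beta>2 z w"
  have \<beta>1: "bal K A (Z (Suc a)) (W b) ?\<beta>1" by (rule bal_diff[OF \<beta>' \<beta>2 D(3) D'(3)])
  have self: "c \<ominus>\<^bsub>K\<^esub> c = \<zero>\<^bsub>K\<^esub>" if "c \<in> carrier K" for c using that by (simp add: a_minus_def K.r_neg)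
  have szero: "c \<ominus>\<^bsub>K\<^esub> \<zero>\<^bsub>K\<^esub> = c" if "c \<in> carrier K" for c using that by (simp add: a_minus_def)
  have "\<exists>\<xi>. bal K A (Z a) (W b) \<xi> \<and> (\<forall>z\<in>carrier (Z (Suc a)). \<forall>w\<in>carrier (W b). \<xi> (dZ a z) w = ?\<beta>1 z w)"
  proof (rule bal_factor_left[OF D(3) D(3) fg_projective[OF D(2)] D(5) D'(2) \<beta>1])
    fix z w assume z: "z \<in> carrier (Z (Suc a))" "w \<in> carrier (W b)" "dZ a z = \<zero>\<^bsub>Z a\<^esub>"
    then have "z \<in> dZ (Suc a) ` carrier (Z (Suc (Suc a)))" unfolding D(8) by simp
    then have "\<beta>2 z w = \<beta>' z w" using b21 z(2) by blast
    then show "?\<beta>1 z w = \<zero>\<^bsub>K\<^esub>" using self balD(1)[OF \<beta>' z(1,2)] by simp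
  qed
  then obtain \<xi> where \<xi>: "bal K A (Z a) (W b) \<xi>"
    and x: "\<forall>z\<in>carrier (Z (Suc a)). \<forall>w\<in>carrier (W b). \<xi> (dZ a z) w = ?\<beta>1 z w" by (elim exE conjE)
  show ?case
  proof (intro exI[of _ "\<lambda>z w. \<xi> z (dW b w)"] conjI ballI)
    show "bal K A (Z a) (W (Suc b)) (\<lambda>z w. \<xi> z (dW b w))" by (rule bal_comp_right[OF \<xi> D'(5)])
    fix z w assume zw: "z \<in> carrier (Z (Suc a))" "w \<in> carrier (W (Suc b))"
    have "\<xi> (dZ a z) (dW b w) = \<beta>' z (dW b w) \<ominus>\<^bsub>K\<^esub> \<beta>2 z (dW b w)" using x zw lin_closed[OF D'(5)] by blast
    also have "\<dots> = \<beta>' z (dW b w)" using b22 zw balD(1)[OF \<beta>' zw(1) lin_closed[OF D'(5) zw(2)]] szero by simp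
    finally show "\<xi> (dZ a z) (dW b w) = \<beta> (dZ a z) w" using b' zw by simp
  next
    fix z w assume "z \<in> carrier (Z a)" "w \<in> carrier (W (Suc (Suc b)))"
    then show "\<xi> z (dW b (dW (Suc b) w)) = \<zero>\<^bsub>K\<^esub>" using zl[OF \<xi>] by (simp add: is_res_dd[OF rW])
  qed
qed

lemma dual_zero_eval: "x \<in> carrier N \<Longrightarrow> \<zero>\<^bsub>k_dual K A N\<^esub> x = \<zero>\<^bsub>K\<^esub>"
  by (simp add: k_dual_simps)

lemma k_dual_at_zero:
  assumes "left_module A N" "\<theta> \<in> carrier (k_dual K A N)" shows "\<theta> \<zero>\<^bsub>N\<^esub> = \<zero>\<^bsub>K\<^esub>"
  using lin_zero[OF k_dual_lin[OF assms(2)] left_module_restrict_scalars[OF assms(1)] left_module_ground_field]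
  by (simp add: restrict_scalars_simps regular_simps)

lemma eval_separates:
  assumes N: "left_module A N" and g: "fg A N" and es: "e ` W = carrier (k_dual K A N)"
    and xy: "x \<in> carrier N" "y \<in> carrier N" and eq: "\<And>w. w \<in> W \<Longrightarrow> e w x = e w y"
  shows "x = y"
proof (rule k_dual_separates[OF N g xy])
  fix \<theta> assume "\<theta> \<in> carrier (k_dual K A N)"
  then obtain w where "w \<in> W" "\<theta> = e w" using es by (metis imageE)
  then show "\<theta> x = \<theta> y" using eq by simp
qed

text \<open>Maps Z_a \<rightarrow> N are the forms on Z_a x W_0 killed by dW, and maps W_b
  \<rightarrow> L the forms on Z_0 x W_b killed by dZ; \<open>bal_kernel_sum\<close> carries the
  vanishing from the first edge of the double complex to the second. Over the two algebras this
  compares Ext(DL, N) with Ext(DN, L).\<close>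

lemma Ext_balance:
  assumes N: "left_module A N" and gN: "fg A N"
    and L: "left_module (opp A) L" and gL: "fg (opp A) L"
    and rZ: "is_res A (k_dual K (opp A) L) Z dZ eZ" and rW: "is_res (opp A) (k_dual K A N) W dW eW"
    and h0: "\<And>f. \<lbrakk>lin A (Z 0) N f; \<forall>x\<in>carrier (Z (Suc 0)). f (dZ 0 x) = \<zero>\<^bsub>N\<^esub>\<rbrakk> \<Longrightarrow> \<forall>x\<in>carrier (Z 0). f x = \<zero>\<^bsub>N\<^esub>"
    and hS: "\<And>i. Suc i < n \<Longrightarrow> ext_zero A Z dZ N i"
  shows "\<And>f. \<lbrakk>lin (opp A) (W 0) L f; \<forall>x\<in>carrier (W (Suc 0)). f (dW 0 x) = \<zero>\<^bsub>L\<^esub>\<rbrakk> \<Longrightarrow> \<forall>x\<in>carrier (W 0). f x = \<zero>\<^bsub>L\<^esub>"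
    and "\<And>i. Suc i < n \<Longrightarrow> ext_zero (opp A) W dW L i"
proof -
  interpret O: fin_dim_algebra K "opp A" by (rule opp_algebra)
  note D = is_resD[OF rZ] and D' = is_resD[OF rW]
  have eZ: "lin (opp (opp A)) (Z 0) (k_dual K (opp A) L) eZ" using D(4) by simp
  have Z0: "left_module (opp (opp A)) (Z 0)" using D(3) by simp
  interpret N: left_module A N by fact
  interpret L: left_module "opp A" L by fact
  \<comment> \<open>Forms on the edge \<open>W 0\<close> that both differentials kill are the
    cocycles with values in N.\<close>
  have repN: "\<exists>f. lin A (Z a) N f \<and> (\<forall>z\<in>carrier (Z a). \<forall>w\<in>carrier (W 0). \<beta> z w = eW w (f z)) \<and>
      (\<forall>z\<in>carrier (Z (Suc a)). f (dZ a z) = \<zero>\<^bsub>N\<^esub>)"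
    if b: "bal K A (Z a) (W 0) \<beta>"
      and 1: "\<forall>z\<in>carrier (Z a). \<forall>w\<in>carrier (W (Suc 0)). \<beta> z (dW 0 w) = \<zero>\<^bsub>K\<^esub>"
      and 2: "\<forall>z\<in>carrier (Z (Suc a)). \<forall>w\<in>carrier (W 0). \<beta> (dZ a z) w = \<zero>\<^bsub>K\<^esub>" for a \<beta>
  proof -
    have "\<exists>f. lin A (Z a) N f \<and> (\<forall>z\<in>carrier (Z a). \<forall>w\<in>carrier (W 0). \<beta> z w = eW w (f z))"
    proof (rule bal_represent[OF D(3) N gN D'(3) D'(4) D'(6) b])
      fix z w assume z: "z \<in> carrier (Z a)" "w \<in> carrier (W 0)" "eW w = \<zero>\<^bsub>k_dual K A N\<^esub>"
      then have "w \<in> dW 0 ` carrier (W (Suc 0))" unfolding D'(7) by simp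
      then show "\<beta> z w = \<zero>\<^bsub>K\<^esub>" using 1 z(1) by blast
    qed
    then obtain f where f: "lin A (Z a) N f" and ff: "\<forall>z\<in>carrier (Z a). \<forall>w\<in>carrier (W 0). \<beta> z w = eW w (f z)"
      by (elim exE conjE)
    have "f (dZ a z) = \<zero>\<^bsub>N\<^esub>" if z: "z \<in> carrier (Z (Suc a))" for z
    proof (rule eval_separates[OF N gN D'(6) lin_closed[OF f lin_closed[OF D(5) z]]])
      fix w assume w: "w \<in> carrier (W 0)"
      have "eW w (f (dZ a z)) = \<beta> (dZ a z) w" using ff lin_closed[OF D(5) z] w by simp
      then show "eW w (f (dZ a z)) = eW w \<zero>\<^bsub>N\<^esub>"
        using 2 z w k_dual_at_zero[OF N lin_closed[OF D'(4) w]] by simp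
    qed simp
    then show ?thesis using f ff by blast
  qed
  have hyp: "\<exists>\<gamma>. bal K A (Z a) (W 0) \<gamma> \<and>
        (\<forall>z\<in>carrier (Z a). \<forall>w\<in>carrier (W (Suc 0)). \<gamma> z (dW 0 w) = \<zero>\<^bsub>K\<^esub>) \<and>
        (\<forall>z\<in>carrier (Z (Suc a)). \<forall>w\<in>carrier (W 0). \<gamma> (dZ a z) w = \<beta> z w)"
    if an: "Suc a < n" and b: "bal K A (Z (Suc a)) (W 0) \<beta>"
      and 1: "\<forall>z\<in>carrier (Z (Suc a)). \<forall>w\<in>carrier (W (Suc 0)). \<beta> z (dW 0 w) = \<zero>\<^bsub>K\<^esub>"
      and 2: "\<forall>z\<in>carrier (Z (Suc (Suc a))). \<forall>w\<in>carrier (W 0). \<beta> (dZ (Suc a) z) w = \<zero>\<^bsub>K\<^esub>" for a \<beta>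
  proof -
    from repN[OF b 1 2] obtain f where f: "lin A (Z (Suc a)) N f"
      and ff: "\<forall>z\<in>carrier (Z (Suc a)). \<forall>w\<in>carrier (W 0). \<beta> z w = eW w (f z)"
      and fz: "\<forall>z\<in>carrier (Z (Suc (Suc a))). f (dZ (Suc a) z) = \<zero>\<^bsub>N\<^esub>" by (elim exE conjE)
    from ext_zeroD[OF hS[OF an] f fz] obtain g where g: "lin A (Z a) N g"
      and gf: "\<forall>x\<in>carrier (Z (Suc a)). f x = g (dZ a x)" by (elim exE conjE)
    have "bal K A (Z a) (W 0) (\<lambda>z w. eW w (g z))" by (rule bal_of_lin[OF N D'(3) D'(4) g])
    moreover have "eW (dW 0 w) (g z) = \<zero>\<^bsub>K\<^esub>" if "z \<in> carrier (Z a)" "w \<in> carrier (W (Suc 0))" for z w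
      using dual_zero_eval[OF lin_closed[OF g that(1)]] that by (simp add: is_res_dd[OF rW])
    ultimately show ?thesis using ff gf by (intro exI[of _ "\<lambda>z w. eW w (g z)"]) simp
  qed
  have form: "bal K A (Z 0) (W b) (\<lambda>z w. eZ z (f w))" if "lin (opp A) (W b) L f" for b f
    by (rule bal_unflip[OF O.bal_of_lin[OF L Z0 eZ that]])
  have form1: "eZ (dZ 0 z) (f w) = \<zero>\<^bsub>K\<^esub>" if "lin (opp A) (W b) L f" "z \<in> carrier (Z (Suc 0))" "w \<in> carrier (W b)" for b f z w
    using O.dual_zero_eval[OF lin_closed[OF that(1,3)]] that by (simp add: is_res_dd[OF rZ])
  have form2: "eZ z (f (dW b w)) = \<zero>\<^bsub>K\<^esub>" if "\<forall>x\<in>carrier (W (Suc b)). f (dW b x) = \<zero>\<^bsub>L\<^esub>" "z \<in> carrier (Z 0)"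
    "w \<in> carrier (W (Suc b))" for b f z w
    using O.k_dual_at_zero[OF L lin_closed[OF D(4) that(2)]] that by simp
  show "\<forall>x\<in>carrier (W 0). f x = \<zero>\<^bsub>L\<^esub>"
    if f: "lin (opp A) (W 0) L f" and c: "\<forall>x\<in>carrier (W (Suc 0)). f (dW 0 x) = \<zero>\<^bsub>L\<^esub>" for f
  proof
    fix x assume x: "x \<in> carrier (W 0)"
    have "\<exists>g. lin A (Z 0) N g \<and> (\<forall>z\<in>carrier (Z 0). \<forall>w\<in>carrier (W 0). eZ z (f w) = eW w (g z)) \<and>
      (\<forall>z\<in>carrier (Z (Suc 0)). g (dZ 0 z) = \<zero>\<^bsub>N\<^esub>)"
      using repN[OF form[OF f]] form1[OF f] form2[OF c] by simp
    then obtain g where g: "lin A (Z 0) N g" and gf: "\<forall>z\<in>carrier (Z 0). \<forall>w\<in>carrier (W 0). eZ z (f w) = eW w (g z)"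
      and gz: "\<forall>z\<in>carrier (Z (Suc 0)). g (dZ 0 z) = \<zero>\<^bsub>N\<^esub>" by (elim exE conjE)
    show "f x = \<zero>\<^bsub>L\<^esub>"
    proof (rule O.eval_separates[OF L gL D(6) lin_closed[OF f x]])
      fix z assume z: "z \<in> carrier (Z 0)"
      have "eZ z (f x) = eW x \<zero>\<^bsub>N\<^esub>" using gf z x h0[OF g gz] by simp
      then show "eZ z (f x) = eZ z \<zero>\<^bsub>L\<^esub>"
        using k_dual_at_zero[OF N lin_closed[OF D'(4) x]] O.k_dual_at_zero[OF L lin_closed[OF D(4) z]] by simp
    qed simp
  qed
  show "ext_zero (opp A) W dW L i" if i: "Suc i < n" for i
    unfolding ext_zero_def
  proof (intro allI impI)
    fix f assume f: "lin (opp A) (W (Suc i)) L f" and c: "\<forall>x\<in>carrier (W (Suc (Suc i))). f (dW (Suc i) x) = \<zero>\<^bsub>L\<^esub>"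
    have "\<exists>\<gamma>. bal K A (Z 0) (W i) \<gamma> \<and> (\<forall>z\<in>carrier (Z 0). \<forall>w\<in>carrier (W (Suc i)). \<gamma> z (dW i w) = eZ z (f w))"
    proof (rule bal_factor_right[OF D(2) D'(3) D'(3) fg_projective[OF D'(2)] D'(5) form[OF f]])
      fix z w assume z: "z \<in> carrier (Z 0)" "w \<in> carrier (W (Suc i))" "dW i w = \<zero>\<^bsub>W i\<^esub>"
      then have "w \<in> dW (Suc i) ` carrier (W (Suc (Suc i)))" unfolding D'(8) by simp
      then show "eZ z (f w) = \<zero>\<^bsub>K\<^esub>" using form2[OF c z(1)] by blast
    qed
    then obtain \<beta> where \<beta>: "bal K A (Z 0) (W i) \<beta>"
      and b: "\<forall>z\<in>carrier (Z 0). \<forall>w\<in>carrier (W (Suc i)). \<beta> z (dW i w) = eZ z (f w)" by (elim exE conjE)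
    have "\<exists>\<gamma>. bal K A (Z 0) (W i) \<gamma> \<and>
      (\<forall>z\<in>carrier (Z (Suc 0)). \<forall>w\<in>carrier (W i). \<gamma> (dZ 0 z) w = \<beta> (dZ 0 z) w) \<and>
      (\<forall>z\<in>carrier (Z 0). \<forall>w\<in>carrier (W (Suc i)). \<gamma> z (dW i w) = \<zero>\<^bsub>K\<^esub>)"
    proof (rule bal_kernel_sum[OF rZ rW hyp _ \<beta>])
      show "Suc (0 + i) < n" using i by simp
      show "\<forall>z\<in>carrier (Z (Suc 0)). \<forall>w\<in>carrier (W (Suc i)). \<beta> (dZ 0 z) (dW i w) = \<zero>\<^bsub>K\<^esub>"
        using b lin_closed[OF D(5)] form1[OF f] by simp
    qed
    then obtain \<beta>2 where \<beta>2: "bal K A (Z 0) (W i) \<beta>2"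
      and b21: "\<forall>z\<in>carrier (Z (Suc 0)). \<forall>w\<in>carrier (W i). \<beta>2 (dZ 0 z) w = \<beta> (dZ 0 z) w"
      and b22: "\<forall>z\<in>carrier (Z 0). \<forall>w\<in>carrier (W (Suc i)). \<beta>2 z (dW i w) = \<zero>\<^bsub>K\<^esub>" by (elim exE conjE)
    \<comment> \<open>The difference is killed by dZ and so comes from a map \<open>W i\<close>
      \<rightarrow> L. Since \<beta>2 vanishes on the image of dW, there the difference is still
      \<beta>, which represents f.\<close>
    let ?\<gamma> = "\<lambda>z w. \<beta> z w \<ominus>\<^bsub>K\<^esub> \<beta>2 z w"
    have \<gamma>: "bal K A (Z 0) (W i) ?\<gamma>" by (rule bal_diff[OF \<beta> \<beta>2 D(3) D'(3)])
    have "\<exists>g. lin (opp A) (W i) L g \<and> (\<forall>w\<in>carrier (W i). \<forall>z\<in>carrier (Z 0). ?\<gamma> z w = eZ z (g w))"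
    proof (rule O.bal_represent[OF D'(3) L gL Z0 eZ D(6) bal_flip[OF \<gamma>]])
      fix w z assume z: "w \<in> carrier (W i)" "z \<in> carrier (Z 0)" "eZ z = \<zero>\<^bsub>k_dual K (opp A) L\<^esub>"
      then have "z \<in> dZ 0 ` carrier (Z (Suc 0))" unfolding D(7) by simp
      then have "\<beta>2 z w = \<beta> z w" using b21 z(1) by blast
      then show "?\<gamma> z w = \<zero>\<^bsub>K\<^esub>" using balD(1)[OF \<beta> z(2,1)] by (simp add: a_minus_def K.r_neg)
    qed
    then obtain g where g: "lin (opp A) (W i) L g"
      and gf: "\<forall>w\<in>carrier (W i). \<forall>z\<in>carrier (Z 0). ?\<gamma> z w = eZ z (g w)" by (elim exE conjE)
    have "f x = g (dW i x)" if x: "x \<in> carrier (W (Suc i))" for x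
    proof (rule O.eval_separates[OF L gL D(6) lin_closed[OF f x] lin_closed[OF g lin_closed[OF D'(5) x]]])
      fix z assume z: "z \<in> carrier (Z 0)"
      have "eZ z (g (dW i x)) = \<beta> z (dW i x) \<ominus>\<^bsub>K\<^esub> \<beta>2 z (dW i x)"
        using gf z lin_closed[OF D'(5) x] by simp
      also have "\<dots> = \<beta> z (dW i x)"
        using b22 z x balD(1)[OF \<beta> z lin_closed[OF D'(5) x]] by (simp add: a_minus_def)
      finally show "eZ z (f x) = eZ z (g (dW i x))" using b z x by simp
    qed
    then show "\<exists>g. lin (opp A) (W i) L g \<and> (\<forall>x\<in>carrier (W (Suc i)). f x = g (dW i x))" using g by blast
  qed
qed

end

subsection \<open>Duals of projective modules\<close>

lemma (in abelian_group) minus_zero_right: "x \<in> carrier G \<Longrightarrow> x \<ominus> \<zero> = x"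
  using minus_equality[of \<zero> \<zero>] by (simp add: a_minus_def)

lemma A_dual_simps:
  "carrier (A_dual A M) = mod_hom A M (regular A)"
  "\<zero>\<^bsub>A_dual A M\<^esub> = (\<lambda>x\<in>carrier M. \<zero>\<^bsub>A\<^esub>)"
  "f \<oplus>\<^bsub>A_dual A M\<^esub> g = (\<lambda>x\<in>carrier M. f x \<oplus>\<^bsub>A\<^esub> g x)"
  "a \<odot>\<^bsub>A_dual A M\<^esub> f = (\<lambda>x\<in>carrier M. f x \<otimes>\<^bsub>A\<^esub> a)"
  by (simp_all add: A_dual_def)

lemma A_dual_lin: "f \<in> carrier (A_dual A M) \<Longrightarrow> lin A M (regular A) f"
  by (simp add: A_dual_simps mod_hom_lin)

lemma A_dual_closed: "f \<in> carrier (A_dual A M) \<Longrightarrow> x \<in> carrier M \<Longrightarrow> f x \<in> carrier A"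
  using lin_closed[OF A_dual_lin] by (simp add: regular_simps)

lemma A_dual_ext: "f \<in> carrier (A_dual A M) \<Longrightarrow> (\<lambda>x\<in>carrier M. f x) = f"
  by (auto simp: A_dual_simps mod_hom_def PiE_iff extensional_restrict)

lemma A_dualI: "left_module A M \<Longrightarrow> lin A M (regular A) f \<Longrightarrow> restrict f (carrier M) \<in> carrier (A_dual A M)"
  using lin_restrict by (simp add: A_dual_simps) blast

lemma A_dual_eqI:
  "f \<in> carrier (A_dual A M) \<Longrightarrow> g \<in> carrier (A_dual A M) \<Longrightarrow> (\<And>x. x \<in> carrier M \<Longrightarrow> f x = g x) \<Longrightarrow> f = g"
  by (simp add: A_dual_simps mod_hom_eqI)

context fin_dim_algebra
begin

lemma left_module_A_dual:
  assumes M: "left_module A M" shows "left_module (opp A) (A_dual A M)"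
proof -
  interpret M: left_module A M by fact
  interpret O: fin_dim_algebra K "opp A" by (rule opp_algebra)
  let ?D = "A_dual A M"
  have add: "f \<oplus>\<^bsub>?D\<^esub> g \<in> carrier ?D" if "f \<in> carrier ?D" "g \<in> carrier ?D" for f g
    using A_dualI[OF M lin_add_map[OF A_dual_lin[OF that(1)] A_dual_lin[OF that(2)] left_module_algebra]]
    by (simp add: A_dual_simps(3) regular_simps)
  have zero: "\<zero>\<^bsub>?D\<^esub> \<in> carrier ?D"
    using A_dualI[OF M lin_zero_map[OF left_module_algebra]] by (simp add: A_dual_simps(2) regular_simps)
  have cl: "f x \<in> carrier A" if "f \<in> carrier ?D" "x \<in> carrier M" for f x using A_dual_closed that .
  have sm: "a \<odot>\<^bsub>?D\<^esub> f \<in> carrier ?D" if "a \<in> carrier A" "f \<in> carrier ?D" for a f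
  proof -
    have "lin A (regular A) (regular A) (\<lambda>x. x \<otimes>\<^bsub>A\<^esub> a)"
      using that(1) by (intro linI) (auto simp: regular_simps A.l_distr A.m_assoc)
    from A_dualI[OF M lin_comp[OF A_dual_lin[OF that(2)] this]] show ?thesis by (simp add: A_dual_simps(4))
  qed
  note s = A_dual_simps(2-4)
  have z: "(\<lambda>x\<in>carrier M. \<zero>\<^bsub>A\<^esub> \<oplus>\<^bsub>A\<^esub> f x) = f" "(\<lambda>x\<in>carrier M. f x \<otimes>\<^bsub>A\<^esub> \<one>\<^bsub>A\<^esub>) = f" if "f \<in> carrier ?D" for f
    by (subst (2) A_dual_ext[OF that, symmetric], rule restrict_ext, simp add: cl that)+
  show ?thesis
  proof (rule left_moduleI)
    show "ring (opp A)" by (rule O.algebra_is_ring)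
  qed (auto simp: add zero sm, auto simp: s cl z A_dual_ext V.M.a_assoc A.l_distr A.r_distr A.m_assoc
      intro!: restrict_ext V.M.a_comm cong: restrict_cong)
qed

lemma A_dual_msum: "x \<in> carrier M \<Longrightarrow> msum (A_dual A M) f n x = msum (regular A) (\<lambda>j. f j x) n"
  by (induct n) (simp_all add: A_dual_simps regular_simps)

lemma A_dual_basis:
  assumes R: "projective_module A R"
  shows "\<exists>m u \<phi>. (\<forall>j<m. u j \<in> carrier R \<and> \<phi> j \<in> carrier (A_dual A R)) \<and>
    (\<forall>x\<in>carrier R. msum R (\<lambda>j. \<phi> j x \<odot>\<^bsub>R\<^esub> u j) m = x) \<and>
    (\<forall>f\<in>carrier (A_dual A R). msum (A_dual A R) (\<lambda>j. f (u j) \<odot>\<^bsub>A_dual A R\<^esub> \<phi> j) m = f)"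
proof -
  note RM = projective_left_module[OF R]
  interpret R: left_module A R by fact
  interpret D: left_module "opp A" "A_dual A R" by (rule left_module_A_dual[OF RM])
  obtain m u \<phi> where u\<phi>: "\<forall>j<m. u j \<in> carrier R \<and> lin A R (regular A) (\<phi> j)"
    and s: "\<forall>x\<in>carrier R. msum R (\<lambda>j. \<phi> j x \<odot>\<^bsub>R\<^esub> u j) m = x"
    using projective_dual_basis[OF algebra_is_ring R] by (elim exE conjE)
  let ?\<phi> = "\<lambda>j. restrict (\<phi> j) (carrier R)"
  have u: "u j \<in> carrier R" and \<phi>: "?\<phi> j \<in> carrier (A_dual A R)" if "j < m" for j
    using u\<phi> A_dualI[OF RM] that by auto
  have \<phi>c: "\<phi> j x \<in> carrier A" if "j < m" "x \<in> carrier R" for j x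
    using A_dual_closed[OF \<phi>] that by fastforce
  have "msum (A_dual A R) (\<lambda>j. f (u j) \<odot>\<^bsub>A_dual A R\<^esub> ?\<phi> j) m = f" (is "?L = f") if f: "f \<in> carrier (A_dual A R)" for f
  proof (rule A_dual_eqI[OF _ f])
    show "?L \<in> carrier (A_dual A R)"
      by (rule msum_closed[OF D.left_module_axioms]) (use A_dual_closed[OF f] u \<phi> D.smult_closed in simp)
    fix x assume x: "x \<in> carrier R"
    have "?L x = msum (regular A) (\<lambda>j. f (\<phi> j x \<odot>\<^bsub>R\<^esub> u j)) m"
      unfolding A_dual_msum[OF x]
      by (rule msum_cong) (use x u \<phi>c in \<open>simp add: A_dual_simps(4) lin_smult[OF A_dual_lin[OF f]] regular_simps\<close>)
    also have "\<dots> = f (msum R (\<lambda>j. \<phi> j x \<odot>\<^bsub>R\<^esub> u j) m)"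
      by (rule lin_msum[OF A_dual_lin[OF f] RM left_module_algebra, symmetric]) (use x u \<phi>c R.smult_closed in simp)
    finally show "?L x = f x" using s x by simp
  qed
  moreover have "msum R (\<lambda>j. ?\<phi> j x \<odot>\<^bsub>R\<^esub> u j) m = x" if "x \<in> carrier R" for x using s that by simp
  ultimately show ?thesis using u \<phi> by (intro exI[of _ m] exI[of _ u] exI[of _ ?\<phi>]) simp
qed

lemma projective_A_dual:
  assumes R: "projective_module A R" shows "projective_module (opp A) (A_dual A R)"
proof -
  note RM = projective_left_module[OF R]
  obtain m u \<phi> where 1: "\<forall>j<m. u j \<in> carrier R \<and> \<phi> j \<in> carrier (A_dual A R)"
    and s: "\<forall>f\<in>carrier (A_dual A R). msum (A_dual A R) (\<lambda>j. f (u j) \<odot>\<^bsub>A_dual A R\<^esub> \<phi> j) m = f"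
    using A_dual_basis[OF R] by (elim exE conjE)
  show ?thesis
  proof (rule projectiveI[OF left_module_A_dual[OF RM]])
    show "lin (opp A) (A_dual A R) (regular (opp A)) (\<lambda>f. f (u j))" if "j < m" for j
      using 1 that by (intro linI) (auto simp: A_dual_simps(3,4) regular_simps intro: A_dual_closed)
  qed (use 1 s in auto)
qed

text \<open>For a dual basis u, \<phi> of R the element is \<Sum> g(\<phi> j) u j, as one sees by
  expanding f along the \<phi> j with coefficients f(u j).\<close>

lemma A_dual_reflexive:
  assumes R: "projective_module A R" and g: "lin (opp A) (A_dual A R) (regular (opp A)) g"
  shows "\<exists>r\<in>carrier R. \<forall>f\<in>carrier (A_dual A R). g f = f r"
proof -
  note RM = projective_left_module[OF R]
  interpret R: left_module A R by fact
  interpret O: fin_dim_algebra K "opp A" by (rule opp_algebra)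
  note DM = left_module_A_dual[OF RM]
  interpret D: left_module "opp A" "A_dual A R" by (rule DM)
  obtain m u \<phi> where 1: "\<forall>j<m. u j \<in> carrier R \<and> \<phi> j \<in> carrier (A_dual A R)"
    and s: "\<forall>f\<in>carrier (A_dual A R). msum (A_dual A R) (\<lambda>j. f (u j) \<odot>\<^bsub>A_dual A R\<^esub> \<phi> j) m = f"
    using A_dual_basis[OF R] by (elim exE conjE)
  have gc: "g f \<in> carrier A" if "f \<in> carrier (A_dual A R)" for f using lin_closed[OF g that] by (simp add: regular_simps)
  define r where "r = msum R (\<lambda>j. g (\<phi> j) \<odot>\<^bsub>R\<^esub> u j) m"
  have "r \<in> carrier R" unfolding r_def by (rule msum_closed[OF RM]) (use 1 gc R.smult_closed in simp)
  moreover have "g f = f r" if f: "f \<in> carrier (A_dual A R)" for f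
  proof -
    have "g f = g (msum (A_dual A R) (\<lambda>j. f (u j) \<odot>\<^bsub>A_dual A R\<^esub> \<phi> j) m)" using s f by simp
    also have "\<dots> = msum (regular (opp A)) (\<lambda>j. g (f (u j) \<odot>\<^bsub>A_dual A R\<^esub> \<phi> j)) m"
      by (rule lin_msum[OF g DM O.left_module_algebra]) (use 1 A_dual_closed[OF f] D.smult_closed in simp)
    also have "\<dots> = msum (regular (opp A)) (\<lambda>j. f (g (\<phi> j) \<odot>\<^bsub>R\<^esub> u j)) m"
      by (rule msum_cong) (use 1 gc A_dual_closed[OF f] in \<open>simp add: lin_smult[OF g] lin_smult[OF A_dual_lin[OF f]] regular_simps\<close>)
    also have "\<dots> = msum (regular A) (\<lambda>j. f (g (\<phi> j) \<odot>\<^bsub>R\<^esub> u j)) m"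
    proof -
      have "msum (regular (opp A)) h k = msum (regular A) h k" for h k by (induct k) (simp_all add: regular_simps)
      then show ?thesis .
    qed
    also have "\<dots> = f r" unfolding r_def
      by (rule lin_msum[OF A_dual_lin[OF f] RM left_module_algebra, symmetric]) (use 1 gc R.smult_closed in simp)
    finally show ?thesis .
  qed
  ultimately show ?thesis by blast
qed

lemma A_dual_separates:
  assumes R: "projective_module A R" and r: "r \<in> carrier R" and z: "\<And>f. f \<in> carrier (A_dual A R) \<Longrightarrow> f r = \<zero>\<^bsub>A\<^esub>"
  shows "r = \<zero>\<^bsub>R\<^esub>"
proof -
  note RM = projective_left_module[OF R]
  interpret R: left_module A R by fact
  obtain m u \<phi> where 1: "\<forall>j<m. u j \<in> carrier R \<and> \<phi> j \<in> carrier (A_dual A R)"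
    and s: "\<forall>x\<in>carrier R. msum R (\<lambda>j. \<phi> j x \<odot>\<^bsub>R\<^esub> u j) m = x"
    using A_dual_basis[OF R] by (elim exE conjE)
  have "msum R (\<lambda>j. \<phi> j r \<odot>\<^bsub>R\<^esub> u j) m = msum R (\<lambda>j. \<zero>\<^bsub>R\<^esub>) m"
  proof (rule msum_cong)
    fix j assume j: "j < m"
    then have "\<phi> j r = \<zero>\<^bsub>A\<^esub>" using z 1 by blast
    then show "\<phi> j r \<odot>\<^bsub>R\<^esub> u j = \<zero>\<^bsub>R\<^esub>" using 1 j by simp
  qed
  then show ?thesis using s r by (simp add: msum_zero[OF RM])
qed

text \<open>F(a \<theta>) is a balanced form on \<Lambda> x DN. \<open>bal_represent\<close>, with
  the identity as presentation of DN, turns it into a map \<Lambda> \<rightarrow> N, whose value at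
  1 is the element sought.\<close>

lemma k_dual_reflexive:
  assumes N: "left_module A N" and g: "fg A N"
    and F: "lin K (restrict_scalars A (k_dual K A N)) (regular K) F"
  shows "\<exists>x\<in>carrier N. \<forall>\<theta>\<in>carrier (k_dual K A N). F \<theta> = \<theta> x"
proof -
  let ?D = "k_dual K A N"
  have D: "left_module (opp A) ?D" by (rule left_module_k_dual[OF N])
  interpret D: left_module "opp A" ?D by fact
  interpret N: left_module A N by fact
  have Fc: "F \<theta> \<in> carrier K" if "\<theta> \<in> carrier ?D" for \<theta>
    using lin_closed[OF F] that by (simp add: restrict_scalars_simps regular_simps)
  have Fa: "F (\<theta> \<oplus>\<^bsub>?D\<^esub> \<theta>') = F \<theta> \<oplus>\<^bsub>K\<^esub> F \<theta>'" if "\<theta> \<in> carrier ?D" "\<theta>' \<in> carrier ?D" for \<theta> \<theta>'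
    using lin_add[OF F] that by (simp add: restrict_scalars_simps regular_simps)
  have Fs: "F ((c \<odot>\<^bsub>A\<^esub> \<one>\<^bsub>A\<^esub>) \<odot>\<^bsub>?D\<^esub> \<theta>) = c \<otimes>\<^bsub>K\<^esub> F \<theta>" if "c \<in> carrier K" "\<theta> \<in> carrier ?D" for c \<theta>
    using lin_smult[OF F] that by (simp add: restrict_scalars_simps regular_simps)
  have Da: "(b \<otimes>\<^bsub>A\<^esub> a) \<odot>\<^bsub>?D\<^esub> \<theta> = a \<odot>\<^bsub>?D\<^esub> (b \<odot>\<^bsub>?D\<^esub> \<theta>)" if "a \<in> carrier A" "b \<in> carrier A" "\<theta> \<in> carrier ?D" for a b \<theta>
    using D.smult_assoc[of a b \<theta>] that by simp
  have Dc: "a \<odot>\<^bsub>?D\<^esub> \<theta> \<in> carrier ?D" if "a \<in> carrier A" "\<theta> \<in> carrier ?D" for a \<theta>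
    using D.smult_closed that by simp
  have b: "bal K A (regular A) ?D (\<lambda>a \<theta>. F (a \<odot>\<^bsub>?D\<^esub> \<theta>))"
    unfolding bal_def regular_simps
  proof (intro conjI ballI)
    show "F ((c \<odot>\<^bsub>A\<^esub> \<one>\<^bsub>A\<^esub>) \<otimes>\<^bsub>A\<^esub> a \<odot>\<^bsub>?D\<^esub> \<theta>) = c \<otimes>\<^bsub>K\<^esub> F (a \<odot>\<^bsub>?D\<^esub> \<theta>)"
      if "c \<in> carrier K" "a \<in> carrier A" "\<theta> \<in> carrier ?D" for c a \<theta>
      using that Dc scalar_closed by (simp add: scalar_central[symmetric] Da Fs)
  next
    fix a b \<theta> assume "a \<in> carrier A" "b \<in> carrier A" "\<theta> \<in> carrier ?D"
    then show "F ((a \<oplus>\<^bsub>A\<^esub> b) \<odot>\<^bsub>?D\<^esub> \<theta>) = F (a \<odot>\<^bsub>?D\<^esub> \<theta>) \<oplus>\<^bsub>K\<^esub> F (b \<odot>\<^bsub>?D\<^esub> \<theta>)"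
      using D.smult_l_distr[of a b \<theta>] by (simp add: Fa Dc)
  next
    fix a \<theta> \<theta>' assume "a \<in> carrier A" "\<theta> \<in> carrier ?D" "\<theta>' \<in> carrier ?D"
    then show "F (a \<odot>\<^bsub>?D\<^esub> (\<theta> \<oplus>\<^bsub>?D\<^esub> \<theta>')) = F (a \<odot>\<^bsub>?D\<^esub> \<theta>) \<oplus>\<^bsub>K\<^esub> F (a \<odot>\<^bsub>?D\<^esub> \<theta>')"
      using D.smult_r_distr[of a \<theta> \<theta>'] by (simp add: Fa Dc)
  qed (use Fc Dc Da in simp_all)
  have F0: "F \<zero>\<^bsub>?D\<^esub> = \<zero>\<^bsub>K\<^esub>"
    using fin_dim_algebra.left_module_restrict_scalars[OF opp_algebra D] lin_zero[OF F _ left_module_ground_field]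
    by (simp add: restrict_scalars_simps regular_simps)
  have "\<exists>f. lin A (regular A) N f \<and> (\<forall>a\<in>carrier (regular A). \<forall>\<theta>\<in>carrier ?D. F (a \<odot>\<^bsub>?D\<^esub> \<theta>) = \<theta> (f a))"
    by (rule bal_represent[OF left_module_algebra N g D lin_id _ b]) (use F0 in \<open>simp_all add: regular_simps\<close>)
  then obtain f where f: "lin A (regular A) N f"
    "\<forall>a\<in>carrier (regular A). \<forall>\<theta>\<in>carrier ?D. F (a \<odot>\<^bsub>?D\<^esub> \<theta>) = \<theta> (f a)" by (elim exE conjE)
  have "F \<theta> = \<theta> (f \<one>\<^bsub>A\<^esub>)" if "\<theta> \<in> carrier ?D" for \<theta>
    using f(2)[rule_format, of "\<one>\<^bsub>A\<^esub>" \<theta>] that D.smult_one[OF that] by (simp add: regular_simps)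
  then show ?thesis using lin_closed[OF f(1), of "\<one>\<^bsub>A\<^esub>"] by (auto simp: regular_simps)
qed

text \<open>A proper submodule H of DN is killed by a nonzero functional, which by reflexivity is
  evaluation at a nonzero x. So the common zeros of H form a nonzero submodule of the simple module
  N, hence all of N, and H is zero.\<close>

lemma simple_k_dual:
  assumes s: "simple_module A N" and g: "fg A N" and H: "submodule H (opp A) (k_dual K A N)"
  shows "H = {\<zero>\<^bsub>k_dual K A N\<^esub>} \<or> H = carrier (k_dual K A N)"
proof (rule disjCI)
  assume ne: "H \<noteq> carrier (k_dual K A N)"
  let ?D = "k_dual K A N"
  interpret O: fin_dim_algebra K "opp A" by (rule opp_algebra)
  have N: "left_module A N" using s by (simp add: simple_module_def)
  interpret N: left_module A N by fact
  have D: "left_module (opp A) ?D" by (rule left_module_k_dual[OF N])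
  interpret D: left_module "opp A" ?D by fact
  have KD: "left_module K (restrict_scalars A ?D)" using O.left_module_restrict_scalars[OF D] by simp
  have gD: "fg K (restrict_scalars A ?D)" using O.fg_restrict_iff[OF D] fg_k_dual[OF N g] by simp
  have HK: "submodule H K (restrict_scalars A ?D)" using O.submodule_restrict_scalars[OF D H] by simp
  note HD = D.submoduleD[OF H]
  obtain m b \<phi> where 1: "\<forall>j<m. b j \<in> carrier (restrict_scalars A ?D) \<and> lin K (restrict_scalars A ?D) (regular K) (\<phi> j) \<and> (\<forall>u\<in>H. \<phi> j u = \<zero>\<^bsub>K\<^esub>)"
    and 2: "\<forall>i<m. \<forall>j<m. \<phi> i (b j) = (if i = j then \<one>\<^bsub>K\<^esub> else \<zero>\<^bsub>K\<^esub>)"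
    and 3: "\<forall>x\<in>carrier (restrict_scalars A ?D). x \<ominus>\<^bsub>restrict_scalars A ?D\<^esub> msum (restrict_scalars A ?D) (\<lambda>j. \<phi> j x \<odot>\<^bsub>restrict_scalars A ?D\<^esub> b j) m \<in> H"
    using relative_basis[OF ground_field KD gD HK] by (elim exE conjE)
  have "m \<noteq> 0"
  proof
    assume m: "m = 0"
    interpret KD: left_module K "restrict_scalars A ?D" by fact
    have "x \<in> H" if "x \<in> carrier (restrict_scalars A ?D)" for x
      using bspec[OF 3 that] KD.M.minus_zero_right[OF that] by (simp add: m)
    then show False using ne HD(1) by (auto simp: restrict_scalars_simps)
  qed
  then have m: "0 < m" by simp
  from k_dual_reflexive[OF N g, of "\<phi> 0"] 1 m obtain x where x: "x \<in> carrier N"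
    and ev: "\<forall>\<theta>\<in>carrier ?D. \<phi> 0 \<theta> = \<theta> x" by blast
  have "x \<noteq> \<zero>\<^bsub>N\<^esub>"
  proof
    assume "x = \<zero>\<^bsub>N\<^esub>"
    then have "\<phi> 0 (b 0) = \<zero>\<^bsub>K\<^esub>" using ev 1 m k_dual_at_zero[OF N] by (simp add: restrict_scalars_simps)
    then show False using 2 m by simp
  qed
  let ?U = "{x \<in> carrier N. \<forall>\<theta>\<in>H. \<theta> x = \<zero>\<^bsub>K\<^esub>}"
  have Hc: "\<theta> \<in> carrier ?D" if "\<theta> \<in> H" for \<theta> using HD(1) that by blast
  have "submodule ?U A N"
  proof (rule N.submoduleI')
    fix a x assume ax: "a \<in> carrier A" "x \<in> ?U"
    have "\<theta> (a \<odot>\<^bsub>N\<^esub> x) = \<zero>\<^bsub>K\<^esub>" if "\<theta> \<in> H" for \<theta>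
    proof -
      have "(a \<odot>\<^bsub>?D\<^esub> \<theta>) x = \<zero>\<^bsub>K\<^esub>" using HD(4)[of a \<theta>] ax that by simp
      then show ?thesis using ax by (simp add: k_dual_simps(4))
    qed
    then show "a \<odot>\<^bsub>N\<^esub> x \<in> ?U" using ax N.smult_closed by simp
  next
    fix x y assume xy: "x \<in> ?U" "y \<in> ?U"
    have "\<theta> (x \<oplus>\<^bsub>N\<^esub> y) = \<zero>\<^bsub>K\<^esub>" if "\<theta> \<in> H" for \<theta>
    proof -
      have "\<theta> x = \<zero>\<^bsub>K\<^esub>" "\<theta> y = \<zero>\<^bsub>K\<^esub>" using xy that by auto
      then show ?thesis
        using lin_add[OF k_dual_lin[OF Hc[OF that]], of x y] xy by (simp add: restrict_scalars_simps regular_simps)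
    qed
    then show "x \<oplus>\<^bsub>N\<^esub> y \<in> ?U" using xy by simp
  qed (use k_dual_at_zero[OF N Hc] in auto)
  then have "?U = {\<zero>\<^bsub>N\<^esub>} \<or> ?U = carrier N" using s unfolding simple_module_def by blast
  moreover have "x \<in> ?U" using ev 1 m Hc x by auto
  ultimately have U: "?U = carrier N" using \<open>x \<noteq> \<zero>\<^bsub>N\<^esub>\<close> by blast
  have "\<theta> = \<zero>\<^bsub>?D\<^esub>" if "\<theta> \<in> H" for \<theta>
  proof -
    have "\<theta> y = \<zero>\<^bsub>?D\<^esub> y" if y: "y \<in> carrier N" for y
    proof -
      have "y \<in> ?U" unfolding U by fact
      then show ?thesis using \<open>\<theta> \<in> H\<close> dual_zero_eval[OF y] by simp
    qed
    moreover have "\<theta> \<in> mod_hom K (restrict_scalars A N) (regular K)" "\<zero>\<^bsub>?D\<^esub> \<in> mod_hom K (restrict_scalars A N) (regular K)"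
      using Hc[OF that] D.M.zero_closed by (simp_all add: k_dual_simps(1))
    ultimately show ?thesis by (intro mod_hom_eqI) (auto simp: restrict_scalars_simps)
  qed
  then show "H = {\<zero>\<^bsub>?D\<^esub>}" using HD(2) by blast
qed

end

subsection \<open>Maps from basic algebras to simple projective modules\<close>

lemma simple_hom_surj:
  assumes s: "simple_module R P" and M: "left_module R M" and f: "lin R M P f"
    and nz: "x \<in> carrier M" "f x \<noteq> \<zero>\<^bsub>P\<^esub>"
  shows "f ` carrier M = carrier P"
proof -
  have P: "left_module R P" using s by (simp add: simple_module_def)
  have "submodule (f ` carrier M) R P" by (rule submodule_image[OF f M P left_module.submodule_carrier[OF M]])
  then have "f ` carrier M = {\<zero>\<^bsub>P\<^esub>} \<or> f ` carrier M = carrier P" using s unfolding simple_module_def by blast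
  then show ?thesis using nz by blast
qed

text \<open>A nonzero map onto the simple projective P splits, so M is the direct sum of its kernel
  and a copy of P; indecomposability leaves no room for the kernel.\<close>

lemma indecomposable_hom_inj:
  fixes M :: "('a, 'm) module"
  assumes s: "simple_module R P" and Pp: "projective_module R P" and ind: "indecomposable_module R M"
    and f: "lin R M P f" and nz: "x \<in> carrier M" "f x \<noteq> \<zero>\<^bsub>P\<^esub>"
    and y: "y \<in> carrier M" "f y = \<zero>\<^bsub>P\<^esub>"
  shows "y = \<zero>\<^bsub>M\<^esub>"
proof -
  have P: "left_module R P" using s by (simp add: simple_module_def)
  have M: "left_module R M" using ind by (simp add: indecomposable_module_def)
  interpret P: left_module R P by fact
  interpret M: left_module R M by fact
  have surj: "f ` carrier M = carrier P" by (rule simple_hom_surj[OF s M f nz])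
  have "\<exists>h. lin R P M h \<and> (\<forall>x\<in>carrier P. f (h x) = x)"
    by (rule projective_lift[OF Pp M P lin_id f]) (simp add: surj)
  then obtain h where h: "lin R P M h" and fh: "\<forall>x\<in>carrier P. f (h x) = x" by (elim exE conjE)
  let ?Ker = "{x \<in> carrier M. f x = \<zero>\<^bsub>P\<^esub>}"
  let ?X = "M\<lparr>carrier := ?Ker\<rparr>" and ?Y = "M\<lparr>carrier := h ` carrier P\<rparr>"
  have X: "left_module R ?X" by (rule M.left_module_sub[OF submodule_kernel[OF f M P]])
  have Y: "left_module R ?Y" by (rule M.left_module_sub[OF submodule_image[OF h P M P.submodule_carrier]])
  have D: "left_module R (direct_sum ?X ?Y)" by (rule left_module_direct_sum[OF X Y])
  have l: "lin R (direct_sum ?X ?Y) M (\<lambda>z. fst z \<oplus>\<^bsub>M\<^esub> snd z)"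
    by (rule lin_add_map[OF _ _ M]; rule linI) (auto simp: direct_sum_simps lin_closed[OF h])
  have hc: "h (f x) \<in> carrier M" if "x \<in> carrier M" for x using lin_closed[OF h lin_closed[OF f that]] .
  have "bij_betw (\<lambda>z. fst z \<oplus>\<^bsub>M\<^esub> snd z) (carrier (direct_sum ?X ?Y)) (carrier M)"
  proof (rule bij_betwI[where g = "\<lambda>x. (x \<ominus>\<^bsub>M\<^esub> h (f x), h (f x))"])
    show "(\<lambda>z. fst z \<oplus>\<^bsub>M\<^esub> snd z) \<in> carrier (direct_sum ?X ?Y) \<rightarrow> carrier M" using lin_closed[OF l] by blast
    show "(\<lambda>x. (x \<ominus>\<^bsub>M\<^esub> h (f x), h (f x))) \<in> carrier M \<rightarrow> carrier (direct_sum ?X ?Y)"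
      using fh lin_closed[OF f] hc by (auto simp: direct_sum_simps lin_minus[OF f M P] a_minus_def[of P] P.M.r_neg)
    show "fst (x \<ominus>\<^bsub>M\<^esub> h (f x), h (f x)) \<oplus>\<^bsub>M\<^esub> snd (x \<ominus>\<^bsub>M\<^esub> h (f x), h (f x)) = x" if "x \<in> carrier M" for x
      using that hc by (simp add: a_minus_def M.M.a_assoc M.M.l_neg)
    fix z assume "z \<in> carrier (direct_sum ?X ?Y)"
    then obtain k p where z: "z = (k, h p)" "k \<in> carrier M" "f k = \<zero>\<^bsub>P\<^esub>" "p \<in> carrier P" by (auto simp: direct_sum_simps)
    have hp: "h p \<in> carrier M" using lin_closed[OF h z(4)] .
    have "f (k \<oplus>\<^bsub>M\<^esub> h p) = p" using z hp fh by (simp add: lin_add[OF f])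
    then show "((fst z \<oplus>\<^bsub>M\<^esub> snd z) \<ominus>\<^bsub>M\<^esub> h (f (fst z \<oplus>\<^bsub>M\<^esub> snd z)), h (f (fst z \<oplus>\<^bsub>M\<^esub> snd z))) = z"
      using z hp by (simp add: a_minus_def M.M.a_assoc M.M.r_neg)
  qed
  from lin_mod_iso[OF l this D] have "mod_iso R (direct_sum ?X ?Y) M" .
  then have "zero_module ?X \<or> zero_module ?Y" using ind X Y unfolding indecomposable_module_def by blast
  moreover have "\<not> zero_module ?Y"
  proof
    assume "zero_module ?Y"
    then have "h (f x) = \<zero>\<^bsub>M\<^esub>" using lin_closed[OF f nz(1)] by (auto simp: zero_module_def)
    then have "f x = f \<zero>\<^bsub>M\<^esub>" using fh lin_closed[OF f nz(1)] by metis
    then show False using nz(2) lin_zero[OF f M P] by simp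
  qed
  ultimately have "?Ker = {\<zero>\<^bsub>M\<^esub>}" by (simp add: zero_module_def)
  then show ?thesis using y by blast
qed

text \<open>Any two nonzero maps from \<open>\<Lambda>\<close> to \<open>P\<close> have the same kernel, since only one of the pairwise non-isomorphic
  indecomposable summands of \<open>\<Lambda>\<close> admits a nonzero map to \<open>P\<close>; the maps to \<open>P\<close> obtained from \<open>P\<close> and from
  \<open>Q\<close> would have different kernels.\<close>

lemma basic_hom_zero:
  assumes R: "ring R" and basic: "basic_algebra R" and s: "simple_module R P" and Pp: "projective_module R P"
    and Q: "left_module R Q" and E: "lin R (regular R) (direct_sum P Q) E"
    and bij: "bij_betw E (carrier (regular R)) (carrier (direct_sum P Q))"
    and g: "lin R Q P g" and y: "y \<in> carrier Q"
  shows "g y = \<zero>\<^bsub>P\<^esub>"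
proof (rule ccontr)
  assume ne: "g y \<noteq> \<zero>\<^bsub>P\<^esub>"
  have P: "left_module R P" using s by (simp add: simple_module_def)
  interpret P: left_module R P by fact
  interpret Q: left_module R Q by fact
  have RM: "left_module R (regular R)" by (rule left_module_regular[OF R])
  obtain m and M :: "nat \<Rightarrow> ('a, 'a) module" where ind: "\<forall>i<m. indecomposable_module R (M i)"
    and noniso: "\<forall>i<m. \<forall>j<m. i \<noteq> j \<longrightarrow> \<not> mod_iso R (M i) (M j)"
    and iso: "mod_iso R (regular R) (direct_sum_upto m M)" using basic unfolding basic_algebra_def by blast
  have M: "left_module R (M i)" if "i < m" for i using ind that by (simp add: indecomposable_module_def)
  have S: "left_module R (direct_sum_upto m M)" by (rule left_module_direct_sum_upto[OF M R])
  from mod_iso_lin[OF iso] obtain F where F: "lin R (regular R) (direct_sum_upto m M) F"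
    and Fb: "bij_betw F (carrier (regular R)) (carrier (direct_sum_upto m M))" .
  define G where "G = inv_into (carrier (regular R)) F"
  have G: "lin R (direct_sum_upto m M) (regular R) G" unfolding G_def by (rule lin_inv_into[OF F Fb RM])
  have GF: "G (F x) = x" if "x \<in> carrier (regular R)" for x using Fb that by (simp add: G_def bij_betw_def)
  let ?c = "\<lambda>h i t. h (G (upto_inj m M i t))"
  have c: "lin R (M i) P (?c h i)" if "lin R (regular R) P h" for h i
    by (rule lin_comp[OF lin_comp[OF lin_upto_inj[OF M] G] that])
  have comp: "F x i \<in> carrier (M i)" if "x \<in> carrier (regular R)" "i < m" for x i
    by (rule lin_closed[OF lin_proj[OF that(2)] lin_closed[OF F that(1)]])
  have sum: "msum P (\<lambda>i. ?c h i (F x i)) m = h x" if h: "lin R (regular R) P h" and x: "x \<in> carrier (regular R)" for h x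
  proof -
    have "msum P (\<lambda>i. ?c h i (F x i)) m = h (G (msum (direct_sum_upto m M) (\<lambda>i. upto_inj m M i (F x i)) m))"
      by (rule lin_msum[OF lin_comp[OF G h] S P, symmetric])
        (rule lin_closed[OF lin_upto_inj[OF M] comp[OF x]])
    then show ?thesis using upto_decomp[OF M R lin_closed[OF F x]] GF[OF x] by simp
  qed
  \<comment> \<open>The summands of \<Lambda> on which h is nonzero. Each is carried isomorphically
    onto P, and the summands are pairwise non-isomorphic, so there is at most one such index, common
    to all h.\<close>
  let ?nz = "\<lambda>h i. i < m \<and> (\<exists>t\<in>carrier (M i). ?c h i t \<noteq> \<zero>\<^bsub>P\<^esub>)"
  have uniq: "i = j" if h: "lin R (regular R) P h" "lin R (regular R) P h'" "?nz h i" "?nz h' j" for h h' i j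
  proof (rule ccontr)
    assume ij: "i \<noteq> j"
    have bijP: "bij_betw (?c h i) (carrier (M i)) (carrier P)" if h: "lin R (regular R) P h" "?nz h i" for h i
    proof -
      have i: "i < m" using h by blast
      obtain t where t: "t \<in> carrier (M i)" "?c h i t \<noteq> \<zero>\<^bsub>P\<^esub>" using h by blast
      have "inj_on (?c h i) (carrier (M i))"
        by (rule lin_inj_onI[OF c[OF h(1)] M[OF i] P])
          (rule indecomposable_hom_inj[OF s Pp ind[rule_format, OF i] c[OF h(1)] t])
      then show ?thesis using simple_hom_surj[OF s M[OF i] c[OF h(1)] t] by (simp add: bij_betw_def)
    qed
    have i: "i < m" and j: "j < m" using h by auto
    note b1 = bijP[OF h(1,3)] and b2 = bijP[OF h(2,4)]
    have "lin R (M i) (M j) (\<lambda>t. inv_into (carrier (M j)) (?c h' j) (?c h i t))"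
      by (rule lin_comp[OF c[OF h(1)] lin_inv_into[OF c[OF h(2)] b2 M[OF j]]])
    moreover have "bij_betw (\<lambda>t. inv_into (carrier (M j)) (?c h' j) (?c h i t)) (carrier (M i)) (carrier (M j))"
      using bij_betw_trans[OF b1 bij_betw_inv_into[OF b2]] by (simp add: comp_def)
    ultimately have "mod_iso R (M i) (M j)" by (rule lin_mod_iso[OF _ _ M[OF i]])
    then show False using noniso i j ij by blast
  qed
  have ex: "\<exists>i. ?nz h i \<and> F x i \<noteq> \<zero>\<^bsub>M i\<^esub>" if h: "lin R (regular R) P h" and x: "x \<in> carrier (regular R)" "h x \<noteq> \<zero>\<^bsub>P\<^esub>" for h x
  proof (rule ccontr)
    assume no: "\<nexists>i. ?nz h i \<and> F x i \<noteq> \<zero>\<^bsub>M i\<^esub>"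
    have "?c h i (F x i) = \<zero>\<^bsub>P\<^esub>" if i: "i < m" for i
    proof (cases "F x i = \<zero>\<^bsub>M i\<^esub>")
      case True then show ?thesis using lin_zero[OF c[OF h] M[OF i] P] by simp
    next
      case False then show ?thesis using no i comp[OF x(1) i] by blast
    qed
    then have "msum P (\<lambda>i. ?c h i (F x i)) m = msum P (\<lambda>i. \<zero>\<^bsub>P\<^esub>) m" by (intro msum_cong)
    then show False using sum[OF h x(1)] x(2) by (simp add: msum_zero[OF P])
  qed
  \<comment> \<open>At a1 below, the preimage of (g y, 0), the first map is nonzero and the second
    is zero.\<close>
  let ?h1 = "\<lambda>a. fst (E a)" and ?h2 = "\<lambda>a. g (snd (E a))"
  have h1: "lin R (regular R) P ?h1" by (rule lin_comp[OF E lin_fst])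
  have h2: "lin R (regular R) P ?h2" by (rule lin_comp[OF lin_comp[OF E lin_snd] g])
  obtain a1 where a1: "a1 \<in> carrier (regular R)" "E a1 = (g y, \<zero>\<^bsub>Q\<^esub>)"
  proof -
    have "(g y, \<zero>\<^bsub>Q\<^esub>) \<in> E ` carrier (regular R)"
      using bij lin_closed[OF g y] by (simp add: bij_betw_def direct_sum_simps)
    then show thesis using that by (metis imageE)
  qed
  obtain a2 where a2: "a2 \<in> carrier (regular R)" "E a2 = (\<zero>\<^bsub>P\<^esub>, y)"
  proof -
    have "(\<zero>\<^bsub>P\<^esub>, y) \<in> E ` carrier (regular R)" using bij y by (simp add: bij_betw_def direct_sum_simps)
    then show thesis using that by (metis imageE)
  qed
  obtain i where i: "?nz ?h1 i" "F a1 i \<noteq> \<zero>\<^bsub>M i\<^esub>" using ex[OF h1 a1(1)] a1(2) ne by auto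
  obtain j where j: "?nz ?h2 j" "F a2 j \<noteq> \<zero>\<^bsub>M j\<^esub>" using ex[OF h2 a2(1)] a2(2) ne by auto
  have ij: "i = j" by (rule uniq[OF h1 h2 i(1) j(1)])
  note j' = j(1)[folded ij]
  from j' obtain t where im: "i < m" and t: "t \<in> carrier (M i)" "?c ?h2 i t \<noteq> \<zero>\<^bsub>P\<^esub>" by (elim conjE bexE)
  \<comment> \<open>Only summand i contributes to the value of the second map at a1, which is zero.
    The map is injective on that summand, contrary to the nonzero component of a1 there.\<close>
  have "?c ?h2 i (F a1 i) = \<zero>\<^bsub>P\<^esub>"
  proof -
    have "?c ?h2 k (F a1 k) = (if k = i then ?c ?h2 i (F a1 i) else \<zero>\<^bsub>P\<^esub>)" if "k < m" for k
    proof (cases "k = i")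
      case False
      then have "\<not> ?nz ?h2 k" using uniq[OF h2 h2 _ j'] by blast
      then show ?thesis using comp[OF a1(1) that] that False by simp
    qed simp
    then have "msum P (\<lambda>k. ?c ?h2 k (F a1 k)) m = msum P (\<lambda>k. if k = i then ?c ?h2 i (F a1 i) else \<zero>\<^bsub>P\<^esub>) m"
      by (intro msum_cong)
    also have "\<dots> = ?c ?h2 i (F a1 i)" using msum_delta[OF P lin_closed[OF c[OF h2] comp[OF a1(1) im]]] im by simp
    finally show ?thesis using sum[OF h2 a1(1)] a1(2) lin_zero[OF g Q P] by simp
  qed
  from indecomposable_hom_inj[OF s Pp ind[rule_format, OF im] c[OF h2] t comp[OF a1(1) im] this]
  show False using i(2) by blast
qed

subsection \<open>A simple projective summand\<close>

text \<open>The action over \<open>opp A\<close> is right multiplication, \<open>a \<odot> w\<close>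
  standing for w a. All computations with DP and its resolution are to be read this way.\<close>

lemma opp_smult_assoc:
  assumes "left_module (opp A) W" "a \<in> carrier A" "b \<in> carrier A" "w \<in> carrier W"
  shows "a \<odot>\<^bsub>W\<^esub> (b \<odot>\<^bsub>W\<^esub> w) = (b \<otimes>\<^bsub>A\<^esub> a) \<odot>\<^bsub>W\<^esub> w"
  using left_module.smult_assoc[OF assms(1), of a b w] assms(2-4) by simp

text \<open>Basicness of \<Lambda> enters through \<open>hom_QP\<close>, which
  \<open>basic_hom_zero\<close> supplies. The isomorphism E is fixed so that the idempotents of the
  decomposition can be written down.\<close>

locale simple_projective_summand = fin_dim_algebra K A
  for K :: "'k ring" (structure) and A :: "('k, 'a) module" (structure) +
  fixes P :: "('a, 'p) module" and Q :: "('a, 'q) module" and E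
  assumes P: "left_module A P" and Q: "left_module A Q"
    and E: "lin A (regular A) (direct_sum P Q) E"
    and E_bij: "bij_betw E (carrier (regular A)) (carrier (direct_sum P Q))"
    and simple: "simple_module A P"
    and hom_QP: "\<forall>g. lin A Q P g \<longrightarrow> (\<forall>y\<in>carrier Q. g y = \<zero>\<^bsub>P\<^esub>)"
begin

sublocale P: left_module A P by (rule P)
sublocale Q: left_module A Q by (rule Q)

section \<open>The idempotents of P and Q\<close>

definition "E' = inv_into (carrier (regular A)) E"
definition "x0 = fst (E \<one>\<^bsub>A\<^esub>)"
definition "y0 = snd (E \<one>\<^bsub>A\<^esub>)"
definition "e\<^sub>P = E' (x0, \<zero>\<^bsub>Q\<^esub>)"
definition "e\<^sub>Q = E' (\<zero>\<^bsub>P\<^esub>, y0)"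

lemma E': "lin A (direct_sum P Q) (regular A) E'"
  unfolding E'_def by (rule lin_inv_into[OF E E_bij left_module_algebra])

lemma E_E': "x \<in> carrier P \<Longrightarrow> y \<in> carrier Q \<Longrightarrow> E (E' (x, y)) = (x, y)"
  using E_bij unfolding E'_def by (intro f_inv_into_f) (auto simp: bij_betw_def direct_sum_simps)

lemma E'_E: "a \<in> carrier A \<Longrightarrow> E' (E a) = a"
  using E_bij unfolding E'_def by (intro inv_into_f_f) (auto simp: bij_betw_def regular_simps)

lemma E'_closed: "x \<in> carrier P \<Longrightarrow> y \<in> carrier Q \<Longrightarrow> E' (x, y) \<in> carrier A"
  using lin_closed[OF E', of "(x, y)"] by (simp add: direct_sum_simps regular_simps)

lemma x0y0: "x0 \<in> carrier P" "y0 \<in> carrier Q"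
  using lin_closed[OF E, of "\<one>\<^bsub>A\<^esub>"] by (auto simp: x0_def y0_def direct_sum_simps regular_simps)

lemma E_eq: "a \<in> carrier A \<Longrightarrow> E a = (a \<odot>\<^bsub>P\<^esub> x0, a \<odot>\<^bsub>Q\<^esub> y0)"
  using lin_smult[OF E, of a "\<one>\<^bsub>A\<^esub>"] by (simp add: x0_def y0_def direct_sum_simps regular_simps)

text \<open>E a = (a x0, a y0), where x0 and y0 are the components of the image of 1, so an identity
  in \<Lambda> can be checked on these two vectors.\<close>

lemma E_inj:
  "\<lbrakk>a \<in> carrier A; b \<in> carrier A; a \<odot>\<^bsub>P\<^esub> x0 = b \<odot>\<^bsub>P\<^esub> x0; a \<odot>\<^bsub>Q\<^esub> y0 = b \<odot>\<^bsub>Q\<^esub> y0\<rbrakk> \<Longrightarrow> a = b"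
  using E'_E[of a] E'_E[of b] by (simp add: E_eq)

lemma E'_act:
  assumes "x \<in> carrier P" "y \<in> carrier Q"
  shows "E' (x, y) \<odot>\<^bsub>P\<^esub> x0 = x" "E' (x, y) \<odot>\<^bsub>Q\<^esub> y0 = y"
  using E_E'[OF assms] E_eq[OF E'_closed[OF assms]] by simp_all

lemma e\<^sub>P: "e\<^sub>P \<in> carrier A" "e\<^sub>P \<odot>\<^bsub>P\<^esub> x0 = x0" "e\<^sub>P \<odot>\<^bsub>Q\<^esub> y0 = \<zero>\<^bsub>Q\<^esub>"
  unfolding e\<^sub>P_def by (simp_all add: E'_closed E'_act x0y0)

lemma e\<^sub>Q: "e\<^sub>Q \<in> carrier A" "e\<^sub>Q \<odot>\<^bsub>P\<^esub> x0 = \<zero>\<^bsub>P\<^esub>" "e\<^sub>Q \<odot>\<^bsub>Q\<^esub> y0 = y0"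
  unfolding e\<^sub>Q_def by (simp_all add: E'_closed E'_act x0y0)

lemma e_sum: "e\<^sub>P \<oplus>\<^bsub>A\<^esub> e\<^sub>Q = \<one>\<^bsub>A\<^esub>"
  by (rule E_inj) (simp_all add: e\<^sub>P e\<^sub>Q P.smult_l_distr Q.smult_l_distr x0y0 P.smult_one Q.smult_one)

text \<open>The product is the value at y0 of a map Q \<rightarrow> P, namely right multiplication
  by z on the copy of Q inside \<Lambda>.\<close>

lemma e\<^sub>Q_P: assumes z: "z \<in> carrier P" shows "e\<^sub>Q \<odot>\<^bsub>P\<^esub> z = \<zero>\<^bsub>P\<^esub>"
proof -
  have "lin A Q P (\<lambda>y. E' (\<zero>\<^bsub>P\<^esub>, y) \<odot>\<^bsub>P\<^esub> z)"
    by (rule lin_comp[OF lin_comp[OF lin_inr[OF P] E'] lin_smult_elem[OF P z]])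
  from hom_QP[rule_format, OF this x0y0(2)] show ?thesis by (simp add: e\<^sub>Q_def)
qed

lemma e\<^sub>P_P: assumes z: "z \<in> carrier P" shows "e\<^sub>P \<odot>\<^bsub>P\<^esub> z = z"
  using P.smult_l_distr[OF e\<^sub>P(1) e\<^sub>Q(1) z] z by (simp add: e_sum P.smult_one e\<^sub>Q_P P.smult_closed e\<^sub>P)

lemma mult_e\<^sub>P_zero: "a \<in> carrier A \<Longrightarrow> a \<odot>\<^bsub>P\<^esub> x0 = \<zero>\<^bsub>P\<^esub> \<Longrightarrow> a \<otimes>\<^bsub>A\<^esub> e\<^sub>P = \<zero>\<^bsub>A\<^esub>"
  by (rule E_inj) (simp_all add: e\<^sub>P P.smult_assoc Q.smult_assoc x0y0)

lemma mult_e\<^sub>P_cong: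
  "\<lbrakk>a \<in> carrier A; b \<in> carrier A; a \<odot>\<^bsub>P\<^esub> x0 = b \<odot>\<^bsub>P\<^esub> x0\<rbrakk> \<Longrightarrow> a \<otimes>\<^bsub>A\<^esub> e\<^sub>P = b \<otimes>\<^bsub>A\<^esub> e\<^sub>P"
  by (rule E_inj) (simp_all add: e\<^sub>P P.smult_assoc Q.smult_assoc x0y0)

lemma e\<^sub>P_idem: "e\<^sub>P \<otimes>\<^bsub>A\<^esub> e\<^sub>P = e\<^sub>P"
  by (rule E_inj) (simp_all add: e\<^sub>P P.smult_assoc Q.smult_assoc x0y0)

text \<open>The corner \<open>e\<^sub>Q \<Lambda> e\<^sub>P\<close> is Hom(Q, P) in
  disguise.\<close>

lemma e\<^sub>Q_A_e\<^sub>P: "a \<in> carrier A \<Longrightarrow> e\<^sub>Q \<otimes>\<^bsub>A\<^esub> a \<otimes>\<^bsub>A\<^esub> e\<^sub>P = \<zero>\<^bsub>A\<^esub>"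
  by (rule mult_e\<^sub>P_zero) (simp_all add: e\<^sub>Q P.smult_assoc x0y0 e\<^sub>Q_P P.smult_closed)

lemma e\<^sub>Q_e\<^sub>P: "e\<^sub>Q \<otimes>\<^bsub>A\<^esub> e\<^sub>P = \<zero>\<^bsub>A\<^esub>"
  by (rule mult_e\<^sub>P_zero) (simp_all add: e\<^sub>Q)

lemma x0_nonzero: "x0 \<noteq> \<zero>\<^bsub>P\<^esub>"
proof
  assume "x0 = \<zero>\<^bsub>P\<^esub>"
  then have "z = \<zero>\<^bsub>P\<^esub>" if "z \<in> carrier P" for z
    using E'_act(1)[OF that Q.M.zero_closed] E'_closed[OF that Q.M.zero_closed] by simp
  then have "zero_module P" unfolding zero_module_def by blast
  then show False using simple unfolding simple_module_def by blast
qed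

lemma simple_generated:
  assumes z: "z \<in> carrier P" "z \<noteq> \<zero>\<^bsub>P\<^esub>" and x: "x \<in> carrier P"
  shows "\<exists>b\<in>carrier A. b \<odot>\<^bsub>P\<^esub> z = x"
proof -
  have 1: "\<one>\<^bsub>A\<^esub> \<in> carrier (regular A)" by (simp add: regular_simps)
  have nz: "\<one>\<^bsub>A\<^esub> \<odot>\<^bsub>P\<^esub> z \<noteq> \<zero>\<^bsub>P\<^esub>" using z by (simp add: P.smult_one)
  have "(\<lambda>b. b \<odot>\<^bsub>P\<^esub> z) ` carrier (regular A) = carrier P"
    by (rule simple_hom_surj[OF simple left_module_algebra lin_smult_elem[OF P z(1)] 1 nz])
  then show ?thesis using x unfolding regular_simps by (metis imageE)
qed

text \<open>Sending a \<open>e\<^sub>P\<close> to a x0 identifies the left ideal of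
  \<open>e\<^sub>P\<close> with P, and in a simple module every nonzero vector has x0 among its
  multiples.\<close>

lemma left_inverse:
  assumes c: "c \<in> carrier A" "c \<otimes>\<^bsub>A\<^esub> e\<^sub>P \<noteq> \<zero>\<^bsub>A\<^esub>"
  shows "\<exists>b\<in>carrier A. b \<otimes>\<^bsub>A\<^esub> (c \<otimes>\<^bsub>A\<^esub> e\<^sub>P) = e\<^sub>P"
proof -
  have "c \<odot>\<^bsub>P\<^esub> x0 \<noteq> \<zero>\<^bsub>P\<^esub>" using mult_e\<^sub>P_zero c by blast
  then obtain b where b: "b \<in> carrier A" "b \<odot>\<^bsub>P\<^esub> (c \<odot>\<^bsub>P\<^esub> x0) = x0"
    using simple_generated[OF P.smult_closed[OF c(1) x0y0(1)]] x0y0(1) by blast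
  then have "(b \<otimes>\<^bsub>A\<^esub> c) \<otimes>\<^bsub>A\<^esub> e\<^sub>P = \<one>\<^bsub>A\<^esub> \<otimes>\<^bsub>A\<^esub> e\<^sub>P"
    by (intro mult_e\<^sub>P_cong) (simp_all add: c P.smult_assoc x0y0 P.smult_one)
  then show ?thesis using b(1) c(1) by (intro bexI[of _ b]) (simp_all add: A.m_assoc e\<^sub>P)
qed

text \<open>\<open>e\<^sub>P \<Lambda> e\<^sub>P\<close> is a division ring, so left inverses are right inverses.\<close>

lemma right_inverse:
  assumes c: "c \<in> carrier A" "e\<^sub>P \<otimes>\<^bsub>A\<^esub> c = c" "c \<otimes>\<^bsub>A\<^esub> e\<^sub>P = c" "c \<noteq> \<zero>\<^bsub>A\<^esub>"
  shows "\<exists>b\<in>carrier A. c \<otimes>\<^bsub>A\<^esub> b = e\<^sub>P"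
proof -
  obtain b where b: "b \<in> carrier A" "b \<otimes>\<^bsub>A\<^esub> c = e\<^sub>P" using left_inverse[OF c(1)] c by auto
  \<comment> \<open>Cut down to the corner, the left inverse has itself a left inverse b2. Then c =
    b2 \<open>e\<^sub>P\<close>, so c b1 = b2 b1 is again \<open>e\<^sub>P\<close>.\<close>
  define b1 where "b1 = e\<^sub>P \<otimes>\<^bsub>A\<^esub> b \<otimes>\<^bsub>A\<^esub> e\<^sub>P"
  have b1: "b1 \<in> carrier A" "b1 \<otimes>\<^bsub>A\<^esub> e\<^sub>P = b1" "e\<^sub>P \<otimes>\<^bsub>A\<^esub> b1 = b1"
    using b e\<^sub>P(1) by (simp_all add: b1_def A.m_assoc e\<^sub>P_idem) (simp add: A.m_assoc[symmetric] e\<^sub>P_idem)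
  have b1c: "b1 \<otimes>\<^bsub>A\<^esub> c = e\<^sub>P" using b c e\<^sub>P(1) by (simp add: b1_def A.m_assoc e\<^sub>P_idem)
  have "e\<^sub>P \<noteq> \<zero>\<^bsub>A\<^esub>" using e\<^sub>P(2) x0_nonzero x0y0 by auto
  then have "b1 \<noteq> \<zero>\<^bsub>A\<^esub>" using b1c c(1) by auto
  then obtain b2 where b2: "b2 \<in> carrier A" "b2 \<otimes>\<^bsub>A\<^esub> b1 = e\<^sub>P" using left_inverse[OF b1(1)] b1 by auto
  have "c = b2 \<otimes>\<^bsub>A\<^esub> e\<^sub>P"
  proof -
    have "c = b2 \<otimes>\<^bsub>A\<^esub> b1 \<otimes>\<^bsub>A\<^esub> c" by (simp add: b2 c)
    also have "\<dots> = b2 \<otimes>\<^bsub>A\<^esub> e\<^sub>P" unfolding A.m_assoc[OF b2(1) b1(1) c(1)] b1c ..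
    finally show ?thesis .
  qed
  then have "c \<otimes>\<^bsub>A\<^esub> b1 = b2 \<otimes>\<^bsub>A\<^esub> (e\<^sub>P \<otimes>\<^bsub>A\<^esub> b1)" using b2 b1 e\<^sub>P(1) by (simp add: A.m_assoc)
  also have "\<dots> = e\<^sub>P" by (simp add: b1(3) b2(2))
  finally show ?thesis using b1(1) by blast
qed

lemma projective_summand:
  assumes N: "left_module A N" and i: "lin A N (direct_sum P Q) i" and r: "lin A (direct_sum P Q) N r"
    and ri: "\<And>x. x \<in> carrier N \<Longrightarrow> r (i x) = x"
  shows "projective_module A N"
proof -
  have "r (E (E' (i x))) = x" if "x \<in> carrier N" for x
    using lin_closed[OF i that] E_E'[of "fst (i x)" "snd (i x)"] ri[OF that] by (auto simp: direct_sum_simps)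
  then show ?thesis unfolding projective_module_def
    by (rule in_add_summand[OF left_module_algebra left_module_algebra N lin_comp[OF i E'] lin_comp[OF E r]])
qed

lemma projective_P: "projective_module A P"
  by (rule projective_summand[OF P lin_inl[OF Q] lin_fst]) simp

lemma projective_Q: "projective_module A Q"
  by (rule projective_summand[OF Q lin_inr[OF P] lin_snd]) simp

lemma fg_P: "fg A P" and fg_Q: "fg A Q"
  using fg_projective projective_P projective_Q by auto

text \<open>The identity of N factors through a power of \<Lambda> = P \<oplus> Q; with all maps N
  \<rightarrow> P zero, the factorization runs through the copies of Q.\<close>

lemma in_add_Q:
  assumes N: "projective_module A N" and z: "\<forall>g. lin A N P g \<longrightarrow> (\<forall>x\<in>carrier N. g x = \<zero>\<^bsub>P\<^esub>)"
  shows "in_add A Q N"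
proof -
  note NM = projective_left_module[OF N]
  obtain m \<phi> \<psi> where "add_data A (regular A) N m \<phi> \<psi>"
    using N unfolding projective_module_def in_add_iff[OF left_module_algebra] by blast
  then have lin: "\<And>j. j < m \<Longrightarrow> lin A N (regular A) (\<phi> j)" "\<And>j. j < m \<Longrightarrow> lin A (regular A) N (\<psi> j)"
    and sum: "\<And>x. x \<in> carrier N \<Longrightarrow> msum N (\<lambda>j. \<psi> j (\<phi> j x)) m = x"
    unfolding add_data_def by auto
  have "E' (\<zero>\<^bsub>P\<^esub>, snd (E (\<phi> j x))) = \<phi> j x" if j: "j < m" and x: "x \<in> carrier N" for j x
  proof -
    have "fst (E (\<phi> j x)) = \<zero>\<^bsub>P\<^esub>" using z lin_comp[OF lin_comp[OF lin(1)[OF j] E] lin_fst] x by blast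
    then have "E (\<phi> j x) = (\<zero>\<^bsub>P\<^esub>, snd (E (\<phi> j x)))" by (metis prod.collapse)
    then show ?thesis using E'_E[of "\<phi> j x"] lin_closed[OF lin(1)[OF j] x] by (simp add: regular_simps)
  qed
  then have "msum N (\<lambda>j. \<psi> j (E' (\<zero>\<^bsub>P\<^esub>, snd (E (\<phi> j x))))) m = x" if "x \<in> carrier N" for x
    using sum[OF that] that by (simp cong: msum_cong)
  then have "add_data A Q N m (\<lambda>j x. snd (E (\<phi> j x))) (\<lambda>j y. \<psi> j (E' (\<zero>\<^bsub>P\<^esub>, y)))"
    unfolding add_data_def
    using lin_comp[OF lin_comp[OF lin(1) E] lin_snd] lin_comp[OF lin_comp[OF lin_inr[OF P] E'] lin(2)] by blast
  then show ?thesis unfolding in_add_iff[OF Q] using NM by blast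
qed

section \<open>The minimal resolution of DP\<close>

abbreviation "DP \<equiv> k_dual K A P"
abbreviation "R \<equiv> mres (opp A) DP"
abbreviation "d \<equiv> mdiff (opp A) DP"
abbreviation "p \<equiv> maug (opp A) DP"

sublocale O: fin_dim_algebra K "opp A" by (rule opp_algebra)

lemma DP: "left_module (opp A) DP" "fg (opp A) DP"
  using left_module_k_dual[OF P] fg_k_dual[OF P fg_P] by auto

lemma resR: "is_res (opp A) DP R d p"
  by (rule O.minimal_resolution[OF DP])

lemmas R = is_resD[OF resR]

lemma DP_e: assumes t: "\<theta> \<in> carrier DP" shows "e\<^sub>P \<odot>\<^bsub>DP\<^esub> \<theta> = \<theta>"
proof -
  have "e\<^sub>P \<odot>\<^bsub>DP\<^esub> \<theta> = (\<lambda>x\<in>carrier P. \<theta> x)"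
    unfolding k_dual_simps(4) by (rule restrict_ext) (simp add: e\<^sub>P_P)
  then show ?thesis by (simp add: k_dual_ext[OF t])
qed

text \<open>A preimage s of a nonzero element of DP may be replaced by s \<open>e\<^sub>P\<close>,
  because \<open>e\<^sub>P\<close> acts on DP as the identity. What it generates maps onto the
  simple module DP, so by minimality it is all of R 0.\<close>

lemma R0_generator:
  "\<exists>r\<in>carrier (R 0). e\<^sub>P \<odot>\<^bsub>R 0\<^esub> r = r \<and> p r \<noteq> \<zero>\<^bsub>DP\<^esub> \<and> (\<forall>s\<in>carrier (R 0). \<exists>a\<in>carrier A. s = a \<odot>\<^bsub>R 0\<^esub> r)"
proof -
  interpret R0: left_module "opp A" "R 0" by (rule R(3))
  interpret D: left_module "opp A" DP by (rule DP)
  have "\<exists>\<theta>\<in>carrier DP. \<theta> \<noteq> \<zero>\<^bsub>DP\<^esub>"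
  proof (rule ccontr)
    assume no: "\<not> ?thesis"
    have "x0 = \<zero>\<^bsub>P\<^esub>"
    proof (rule k_dual_separates[OF P fg_P x0y0(1) P.M.zero_closed])
      fix \<theta> assume t: "\<theta> \<in> carrier DP"
      then have "\<theta> = \<zero>\<^bsub>DP\<^esub>" using no by blast
      then show "\<theta> x0 = \<theta> \<zero>\<^bsub>P\<^esub>" using dual_zero_eval[OF x0y0(1)] dual_zero_eval[OF P.M.zero_closed] by simp
    qed
    then show False using x0_nonzero by blast
  qed
  then obtain \<theta> where t: "\<theta> \<in> carrier DP" "\<theta> \<noteq> \<zero>\<^bsub>DP\<^esub>" by blast
  then obtain s where s: "s \<in> carrier (R 0)" "p s = \<theta>" using R(6) by (metis imageE)
  define r where "r = e\<^sub>P \<odot>\<^bsub>R 0\<^esub> s"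
  have r: "r \<in> carrier (R 0)" unfolding r_def using s e\<^sub>P(1) R0.smult_closed by simp
  have er: "e\<^sub>P \<odot>\<^bsub>R 0\<^esub> r = r" unfolding r_def using opp_smult_assoc[OF R(3) e\<^sub>P(1) e\<^sub>P(1) s(1)] by (simp add: e\<^sub>P_idem)
  have pr: "p r = \<theta>" unfolding r_def using s e\<^sub>P(1) t by (simp add: lin_smult[OF R(4)] DP_e)
  let ?H = "(\<lambda>a. a \<odot>\<^bsub>R 0\<^esub> r) ` carrier (regular (opp A))"
  have H: "submodule ?H (opp A) (R 0)"
    by (rule submodule_image[OF lin_smult_elem[OF R(3) r] O.left_module_algebra R(3) left_module.submodule_carrier[OF O.left_module_algebra]])
  have "p ` ?H = {\<zero>\<^bsub>DP\<^esub>} \<or> p ` ?H = carrier DP"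
    by (rule simple_k_dual[OF simple fg_P submodule_image[OF R(4) R(3) DP(1) H]])
  moreover have "\<theta> \<in> p ` ?H"
  proof -
    have "r \<in> ?H" using R0.smult_one[OF r] by (intro image_eqI[of _ _ "\<one>\<^bsub>A\<^esub>"]) (simp_all add: regular_simps)
    then show ?thesis using pr by (metis imageI)
  qed
  ultimately have "p ` ?H = carrier DP" using t(2) by blast
  from O.mres_minimal(1)[OF DP H this] have "?H = carrier (R 0)" .
  then have "\<forall>s\<in>carrier (R 0). \<exists>a\<in>carrier A. s = a \<odot>\<^bsub>R 0\<^esub> r" unfolding regular_simps opp_simps by blast
  then show ?thesis using r er pr t(2) by blast
qed

text \<open>Write w = r a with the generator r = r \<open>e\<^sub>P\<close>. Then w
  \<open>e\<^sub>P\<close> = r c with c = \<open>e\<^sub>P a e\<^sub>P\<close>. If c were nonzero,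
  it would be invertible in the division ring \<open>e\<^sub>P \<Lambda> e\<^sub>P\<close>, so r
  would be a multiple of w \<open>e\<^sub>P\<close> and p r would vanish.\<close>

lemma e\<^sub>P_kernel_p:
  assumes w: "w \<in> carrier (R 0)" "p w = \<zero>\<^bsub>DP\<^esub>" shows "e\<^sub>P \<odot>\<^bsub>R 0\<^esub> w = \<zero>\<^bsub>R 0\<^esub>"
proof (rule ccontr)
  assume ne: "e\<^sub>P \<odot>\<^bsub>R 0\<^esub> w \<noteq> \<zero>\<^bsub>R 0\<^esub>"
  interpret R0: left_module "opp A" "R 0" by (rule R(3))
  interpret D: left_module "opp A" DP by (rule DP)
  obtain r where r: "r \<in> carrier (R 0)" "e\<^sub>P \<odot>\<^bsub>R 0\<^esub> r = r" "p r \<noteq> \<zero>\<^bsub>DP\<^esub>"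
    and gen: "\<forall>s\<in>carrier (R 0). \<exists>a\<in>carrier A. s = a \<odot>\<^bsub>R 0\<^esub> r" using R0_generator by blast
  obtain a where a: "a \<in> carrier A" "w = a \<odot>\<^bsub>R 0\<^esub> r" using gen w(1) by blast
  define c where "c = e\<^sub>P \<otimes>\<^bsub>A\<^esub> a \<otimes>\<^bsub>A\<^esub> e\<^sub>P"
  have c: "c \<in> carrier A" "e\<^sub>P \<otimes>\<^bsub>A\<^esub> c = c" "c \<otimes>\<^bsub>A\<^esub> e\<^sub>P = c"
    using a e\<^sub>P(1) by (simp_all add: c_def A.m_assoc e\<^sub>P_idem) (simp add: A.m_assoc[symmetric] e\<^sub>P_idem)
  have cr: "c \<odot>\<^bsub>R 0\<^esub> r = e\<^sub>P \<odot>\<^bsub>R 0\<^esub> w"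
  proof -
    have "e\<^sub>P \<odot>\<^bsub>R 0\<^esub> w = e\<^sub>P \<odot>\<^bsub>R 0\<^esub> (a \<odot>\<^bsub>R 0\<^esub> (e\<^sub>P \<odot>\<^bsub>R 0\<^esub> r))" by (simp add: a r(2))
    also have "\<dots> = c \<odot>\<^bsub>R 0\<^esub> r" using a(1) e\<^sub>P(1) r(1) by (simp add: opp_smult_assoc[OF R(3)] c_def A.m_assoc)
    finally show ?thesis by simp
  qed
  then have "c \<noteq> \<zero>\<^bsub>A\<^esub>" using ne R0.smult_zero_left[OF r(1)] by auto
  from right_inverse[OF c this] obtain b where b: "b \<in> carrier A" "c \<otimes>\<^bsub>A\<^esub> b = e\<^sub>P" by blast
  have "b \<odot>\<^bsub>R 0\<^esub> (e\<^sub>P \<odot>\<^bsub>R 0\<^esub> w) = r"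
    unfolding cr[symmetric] using opp_smult_assoc[OF R(3) b(1) c(1) r(1)] b(2) r(2) by simp
  then have "p r = b \<odot>\<^bsub>DP\<^esub> (e\<^sub>P \<odot>\<^bsub>DP\<^esub> p w)"
    using lin_smult[OF R(4), of b "e\<^sub>P \<odot>\<^bsub>R 0\<^esub> w"] lin_smult[OF R(4), of e\<^sub>P w] b(1) e\<^sub>P(1) w(1) R0.smult_closed by simp
  then show False using r(3) w(2) b(1) e\<^sub>P(1) by simp
qed

text \<open>The image of the differential is killed by \<open>e\<^sub>P\<close>, so s and s
  \<open>e\<^sub>Q\<close> have the same image. The elements killed by \<open>e\<^sub>P\<close> form
  a submodule because \<open>e\<^sub>Q \<Lambda> e\<^sub>P = 0\<close>; it contains every s
  \<open>e\<^sub>Q\<close>, hence has the same image as the whole term, and minimality makes it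
  everything.\<close>

lemma e\<^sub>P_R_Suc: "r \<in> carrier (R (Suc i)) \<Longrightarrow> e\<^sub>P \<odot>\<^bsub>R (Suc i)\<^esub> r = \<zero>\<^bsub>R (Suc i)\<^esub>"
proof (induct i arbitrary: r)
  have step: "e\<^sub>P \<odot>\<^bsub>R (Suc i)\<^esub> r = \<zero>\<^bsub>R (Suc i)\<^esub>"
    if im: "\<And>s. s \<in> carrier (R (Suc i)) \<Longrightarrow> e\<^sub>P \<odot>\<^bsub>R i\<^esub> d i s = \<zero>\<^bsub>R i\<^esub>" and r: "r \<in> carrier (R (Suc i))" for i r
  proof -
    interpret M: left_module "opp A" "R (Suc i)" by (rule R(3))
    interpret N: left_module "opp A" "R i" by (rule R(3))
    let ?H = "{r \<in> carrier (R (Suc i)). e\<^sub>P \<odot>\<^bsub>R (Suc i)\<^esub> r = \<zero>\<^bsub>R (Suc i)\<^esub>}"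
    have dec: "x = e\<^sub>Q \<odot>\<^bsub>W\<^esub> x" if "left_module (opp A) W" "x \<in> carrier W" "e\<^sub>P \<odot>\<^bsub>W\<^esub> x = \<zero>\<^bsub>W\<^esub>" for W :: "('a, nat \<Rightarrow> 'a) module" and x
    proof -
      interpret W: left_module "opp A" W by (rule that(1))
      have "(e\<^sub>P \<oplus>\<^bsub>A\<^esub> e\<^sub>Q) \<odot>\<^bsub>W\<^esub> x = e\<^sub>P \<odot>\<^bsub>W\<^esub> x \<oplus>\<^bsub>W\<^esub> e\<^sub>Q \<odot>\<^bsub>W\<^esub> x"
        using W.smult_l_distr[of e\<^sub>P e\<^sub>Q x] that(2) e\<^sub>P(1) e\<^sub>Q(1) by simp
      then show ?thesis using that e\<^sub>Q(1) W.smult_closed[of e\<^sub>Q x] W.smult_one[of x] by (simp add: e_sum)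
    qed
    have "submodule ?H (opp A) (R (Suc i))"
    proof (rule M.submoduleI')
      fix a x assume a: "a \<in> carrier (opp A)" and x: "x \<in> ?H"
      have "e\<^sub>P \<odot>\<^bsub>R (Suc i)\<^esub> (a \<odot>\<^bsub>R (Suc i)\<^esub> x) = e\<^sub>P \<odot>\<^bsub>R (Suc i)\<^esub> (a \<odot>\<^bsub>R (Suc i)\<^esub> (e\<^sub>Q \<odot>\<^bsub>R (Suc i)\<^esub> x))"
        using dec[OF R(3), of x] x by simp
      also have "\<dots> = (e\<^sub>Q \<otimes>\<^bsub>A\<^esub> a \<otimes>\<^bsub>A\<^esub> e\<^sub>P) \<odot>\<^bsub>R (Suc i)\<^esub> x"
        using a x e\<^sub>P(1) e\<^sub>Q(1) by (simp add: opp_smult_assoc[OF R(3)])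
      finally show "a \<odot>\<^bsub>R (Suc i)\<^esub> x \<in> ?H" using a x M.smult_closed M.smult_zero_left by (simp add: e\<^sub>Q_A_e\<^sub>P)
    qed (use e\<^sub>P(1) M.smult_zero_right M.smult_r_distr in auto)
    moreover have "d i ` ?H = d i ` carrier (R (Suc i))"
    proof
      show "d i ` carrier (R (Suc i)) \<subseteq> d i ` ?H"
      proof
        fix y assume "y \<in> d i ` carrier (R (Suc i))"
        then obtain s where s: "s \<in> carrier (R (Suc i))" "y = d i s" by blast
        have h: "e\<^sub>Q \<odot>\<^bsub>R (Suc i)\<^esub> s \<in> ?H"
          using s e\<^sub>P(1) e\<^sub>Q(1) M.smult_closed M.smult_zero_left by (simp add: opp_smult_assoc[OF R(3)] e\<^sub>Q_e\<^sub>P)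
        have ds: "d i (e\<^sub>Q \<odot>\<^bsub>R (Suc i)\<^esub> s) = y"
          using dec[OF R(3) lin_closed[OF R(5) s(1)] im[OF s(1)]] s e\<^sub>Q(1) by (simp add: lin_smult[OF R(5)])
        show "y \<in> d i ` ?H" unfolding ds[symmetric] by (rule imageI[OF h])
      qed
    qed blast
    ultimately have "?H = carrier (R (Suc i))" by (rule O.mres_minimal(2)[OF DP])
    then show ?thesis using r by blast
  qed
  {
    case 0
    show ?case by (rule step[OF _ 0]) (use e\<^sub>P_kernel_p lin_closed[OF R(5)] is_res_dd(2)[OF resR] in blast)
  next
    case (Suc i)
    show ?case by (rule step[OF _ Suc(2)]) (use Suc(1) lin_closed[OF R(5)] in blast)
  }
qed

text \<open>The term \<open>P\<^sub>i\<close> of the overview; since \<open>opp (opp A)\<close> is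
  A, it is a left module over A again.\<close>

definition "PD i = A_dual (opp A) (R i)"

lemma PD: "left_module A (PD i)" "projective_module A (PD i)"
  using O.left_module_A_dual[OF R(3)] O.projective_A_dual[OF R(2)] by (simp_all add: PD_def)

lemma PD_lin: "f \<in> carrier (PD i) \<Longrightarrow> lin (opp A) (R i) (regular (opp A)) f"
  unfolding PD_def by (rule A_dual_lin)

lemma PD_closed: "f \<in> carrier (PD i) \<Longrightarrow> x \<in> carrier (R i) \<Longrightarrow> f x \<in> carrier A"
  unfolding PD_def using A_dual_closed by fastforce

lemma PD_smult: "f \<in> carrier (PD i) \<Longrightarrow> a \<in> carrier A \<Longrightarrow> x \<in> carrier (R i) \<Longrightarrow> f (a \<odot>\<^bsub>R i\<^esub> x) = f x \<otimes>\<^bsub>A\<^esub> a"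
  using lin_smult[OF PD_lin, of f i a x] by (simp add: regular_simps)

lemma lin_eval: "r \<in> carrier (R i) \<Longrightarrow> lin A (PD i) (regular A) (\<lambda>f. f r)"
  by (intro linI) (auto simp: PD_closed regular_simps PD_def A_dual_simps(3,4)
    intro: PD_closed[unfolded PD_def])

lemma PD0_iso: "\<exists>\<Theta>. lin A (PD 0) P \<Theta> \<and> bij_betw \<Theta> (carrier (PD 0)) (carrier P)"
proof -
  interpret R0: left_module "opp A" "R 0" by (rule R(3))
  interpret D: left_module "opp A" DP by (rule DP)
  obtain r where r: "r \<in> carrier (R 0)" "e\<^sub>P \<odot>\<^bsub>R 0\<^esub> r = r" "p r \<noteq> \<zero>\<^bsub>DP\<^esub>"
    and gen: "\<forall>s\<in>carrier (R 0). \<exists>a\<in>carrier A. s = a \<odot>\<^bsub>R 0\<^esub> r" using R0_generator by blast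
  \<comment> \<open>r = r \<open>e\<^sub>P\<close> places f r in the left ideal of
    \<open>e\<^sub>P\<close>, which a \<mapsto> a x0 identifies with P. Injectivity comes from r
    being a generator, surjectivity from P being simple.\<close>
  let ?T = "\<lambda>f. f r \<odot>\<^bsub>P\<^esub> x0"
  have T: "lin A (PD 0) P ?T" by (rule lin_comp[OF lin_eval[OF r(1)] lin_smult_elem[OF P x0y0(1)]])
  have fr: "f r = \<zero>\<^bsub>A\<^esub>" if f: "f \<in> carrier (PD 0)" and z: "?T f = \<zero>\<^bsub>P\<^esub>" for f
    using mult_e\<^sub>P_zero[OF PD_closed[OF f r(1)] z] PD_smult[OF f e\<^sub>P(1) r(1)] r(2) by simp
  have zero: "\<zero>\<^bsub>PD 0\<^esub> x = \<zero>\<^bsub>A\<^esub>" if "x \<in> carrier (R 0)" for x using that by (simp add: PD_def A_dual_simps)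
  interpret PD0: left_module A "PD 0" by (rule PD)
  have "inj_on ?T (carrier (PD 0))"
  proof (rule lin_inj_onI[OF T PD(1) P])
    fix f assume f: "f \<in> carrier (PD 0)" and z: "?T f = \<zero>\<^bsub>P\<^esub>"
    show "f = \<zero>\<^bsub>PD 0\<^esub>"
    proof (rule A_dual_eqI[OF f[unfolded PD_def] PD0.M.zero_closed[unfolded PD_def], folded PD_def])
      fix x assume x: "x \<in> carrier (R 0)"
      then obtain a where a: "a \<in> carrier A" "x = a \<odot>\<^bsub>R 0\<^esub> r" using gen by blast
      then show "f x = \<zero>\<^bsub>PD 0\<^esub> x" using zero[OF x] PD_smult[OF f a(1) r(1)] fr[OF f z] by simp
    qed
  qed
  moreover have "\<exists>f\<in>carrier (PD 0). ?T f \<noteq> \<zero>\<^bsub>P\<^esub>"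
  proof (rule ccontr)
    assume no: "\<not> ?thesis"
    have "r = \<zero>\<^bsub>R 0\<^esub>"
    proof (rule O.A_dual_separates[OF R(2) r(1)])
      fix f assume "f \<in> carrier (A_dual (opp A) (R 0))"
      then have f: "f \<in> carrier (PD 0)" by (simp add: PD_def)
      show "f r = \<zero>\<^bsub>opp A\<^esub>" using fr[OF f] no f by simp
    qed
    then show False using r(3) lin_zero[OF R(4) R(3) DP(1)] by simp
  qed
  then have "?T ` carrier (PD 0) = carrier P" using simple_hom_surj[OF simple PD(1) T] by blast
  ultimately show ?thesis using T by (intro exI[of _ ?T]) (simp add: bij_betw_def)
qed

text \<open>Expand f in a dual basis. The coefficients satisfy f(u j) \<open>e\<^sub>P\<close> = f(u
  j \<open>e\<^sub>P\<close>) = 0, whereas \<open>e\<^sub>P\<close> acts on P as the identity, so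
  they annihilate P.\<close>

lemma hom_PD_P:
  assumes g: "lin A (PD (Suc i)) P g" and f: "f \<in> carrier (PD (Suc i))" shows "g f = \<zero>\<^bsub>P\<^esub>"
proof -
  let ?R = "R (Suc i)" and ?D = "PD (Suc i)"
  interpret M: left_module "opp A" ?R by (rule R(3))
  interpret D: left_module A ?D by (rule PD)
  obtain m u \<phi> where 1: "\<forall>j<m. u j \<in> carrier ?R \<and> \<phi> j \<in> carrier (A_dual (opp A) ?R)"
    and s: "\<forall>f\<in>carrier (A_dual (opp A) ?R). msum (A_dual (opp A) ?R) (\<lambda>j. f (u j) \<odot>\<^bsub>A_dual (opp A) ?R\<^esub> \<phi> j) m = f"
    using O.A_dual_basis[OF R(2)[of "Suc i"]] by (elim exE conjE)
  have u: "u j \<in> carrier ?R" and \<phi>: "\<phi> j \<in> carrier ?D" if "j < m" for j using 1 that by (auto simp: PD_def)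
  have "g f = g (msum ?D (\<lambda>j. f (u j) \<odot>\<^bsub>?D\<^esub> \<phi> j) m)" using s f by (simp add: PD_def)
  also have "\<dots> = msum P (\<lambda>j. g (f (u j) \<odot>\<^bsub>?D\<^esub> \<phi> j)) m"
    by (rule lin_msum[OF g PD(1) P]) (use u \<phi> PD_closed[OF f] D.smult_closed in simp)
  also have "\<dots> = msum P (\<lambda>j. \<zero>\<^bsub>P\<^esub>) m"
  proof (rule msum_cong)
    fix j assume j: "j < m"
    have fu: "f (u j) \<in> carrier A" using PD_closed[OF f u[OF j]] .
    have gP: "g (\<phi> j) \<in> carrier P" using lin_closed[OF g \<phi>[OF j]] .
    have "f (u j) \<otimes>\<^bsub>A\<^esub> e\<^sub>P = f \<zero>\<^bsub>?R\<^esub>" using PD_smult[OF f e\<^sub>P(1) u[OF j]] e\<^sub>P_R_Suc[OF u[OF j]] by simp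
    also have "\<dots> = \<zero>\<^bsub>A\<^esub>" using lin_zero[OF PD_lin[OF f] R(3) O.left_module_algebra] by (simp add: regular_simps)
    finally have "f (u j) \<odot>\<^bsub>P\<^esub> (e\<^sub>P \<odot>\<^bsub>P\<^esub> g (\<phi> j)) = \<zero>\<^bsub>P\<^esub>"
      using fu e\<^sub>P(1) gP by (simp add: P.smult_assoc[symmetric])
    then show "g (f (u j) \<odot>\<^bsub>?D\<^esub> \<phi> j) = \<zero>\<^bsub>P\<^esub>" using fu \<phi>[OF j] gP by (simp add: lin_smult[OF g] e\<^sub>P_P)
  qed
  finally show ?thesis by (simp add: msum_zero[OF P])
qed

lemma PD_Suc_in_add: "in_add A Q (PD (Suc i))"
  by (rule in_add_Q[OF PD(2)]) (simp add: hom_PD_P)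

end

subsection \<open>The weak APR tilting module\<close>

lemma quotient_module_lemmas:
  assumes M: "left_module R M" and H: "submodule H R M"
  shows "left_module R (quotient_module M H)" "lin R M (quotient_module M H) (\<lambda>x. H +>\<^bsub>M\<^esub> x)"
    "(\<lambda>x. H +>\<^bsub>M\<^esub> x) ` carrier M = carrier (quotient_module M H)"
    "x \<in> carrier M \<Longrightarrow> H +>\<^bsub>M\<^esub> x = \<zero>\<^bsub>quotient_module M H\<^esub> \<longleftrightarrow> x \<in> H"
proof -
  interpret M: left_module R M by fact
  note HD = M.submoduleD[OF H]
  have sub: "subgroup H (add_monoid M)" using H by (simp add: submodule_def)
  interpret H: abelian_subgroup H M
    by (rule abelian_subgroupI3) (auto simp: additive_subgroup_def sub M.M.abelian_group_axioms)
  let ?N = "quotient_module M H" and ?c = "\<lambda>x. H +>\<^bsub>M\<^esub> x"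
  have mem: "y \<in> ?c x \<longleftrightarrow> (\<exists>h\<in>H. y = h \<oplus>\<^bsub>M\<^esub> x)" for x y
    unfolding a_r_coset_def r_coset_def by auto
  have car: "carrier ?N = ?c ` carrier M"
    by (auto simp: quotient_module_def A_RCOSETS_def RCOSETS_def a_r_coset_def)
  have add: "?c x \<oplus>\<^bsub>?N\<^esub> ?c y = ?c (x \<oplus>\<^bsub>M\<^esub> y)" if "x \<in> carrier M" "y \<in> carrier M" for x y
    using H.a_rcos_sum[OF that] by (simp add: quotient_module_def)
  have zero: "\<zero>\<^bsub>?N\<^esub> = ?c \<zero>\<^bsub>M\<^esub>"
    using H.a_rcos_const[OF HD(2)] by (simp add: quotient_module_def)
  \<comment> \<open>\<open>quotient_module\<close> scales a coset by a union over its members; all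
    members give the same coset, so the union collapses.\<close>
  have smult: "a \<odot>\<^bsub>?N\<^esub> ?c x = ?c (a \<odot>\<^bsub>M\<^esub> x)" if a: "a \<in> carrier R" and x: "x \<in> carrier M" for a x
  proof -
    have "?c (a \<odot>\<^bsub>M\<^esub> y) = ?c (a \<odot>\<^bsub>M\<^esub> x)" if y: "y \<in> ?c x" for y
    proof -
      obtain h where h: "h \<in> H" "y = h \<oplus>\<^bsub>M\<^esub> x" using y mem by blast
      then have hM: "h \<in> carrier M" using HD(1) by blast
      have "a \<odot>\<^bsub>M\<^esub> y \<in> ?c (a \<odot>\<^bsub>M\<^esub> x)"
        unfolding mem h(2) M.smult_r_distr[OF a hM x] using HD(4)[OF a h(1)] by blast
      from M.M.a_repr_independence[OF this M.smult_closed[OF a x] sub] show ?thesis by simp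
    qed
    then have "(\<Union>y\<in>?c x. ?c (a \<odot>\<^bsub>M\<^esub> y)) = ?c (a \<odot>\<^bsub>M\<^esub> x)" using H.a_rcos_self[OF x] by blast
    then show ?thesis by (simp add: quotient_module_def)
  qed
  show "left_module R ?N"
    by (rule left_moduleI)
      (auto simp: car zero add smult M.R.ring_axioms M.M.a_ac M.smult_closed M.smult_l_distr M.smult_r_distr
        M.smult_assoc M.smult_one)
  show "lin R M ?N ?c" by (rule linI) (simp_all add: car add smult)
  show "?c ` carrier M = carrier ?N" by (simp add: car)
  show "?c x = \<zero>\<^bsub>?N\<^esub> \<longleftrightarrow> x \<in> H" if "x \<in> carrier M"
    using H.a_rcos_self[OF that] H.a_rcos_const[of x] by (auto simp: quotient_module_def)
qed

text \<open>Terms of any carrier type are replaced by copies inside powers of T, the type that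
  \<open>has_add_coresolution\<close> fixes.\<close>

lemma has_add_coresolutionI:
  fixes T :: "('a, 't) module" and G :: "nat \<Rightarrow> ('a, 'g) module"
  assumes T: "left_module R T" and G: "\<And>i. in_add R T (G i)" and z: "\<And>i. i > m \<Longrightarrow> zero_module (G i)"
    and u: "lin R (regular R) (G 0) u" and g: "\<And>i. lin R (G i) (G (Suc i)) (g i)"
    and inj: "inj_on u (carrier (regular R))"
    and e0: "u ` carrier (regular R) = {x \<in> carrier (G 0). g 0 x = \<zero>\<^bsub>G (Suc 0)\<^esub>}"
    and e: "\<And>i. g i ` carrier (G i) = {x \<in> carrier (G (Suc i)). g (Suc i) x = \<zero>\<^bsub>G (Suc (Suc i))\<^esub>}"
  shows "has_add_coresolution R T"
proof -
  note GM = in_add_left_module[OF G]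
  have RM: "left_module R (regular R)" by (rule left_module_regular[OF left_moduleD(1)[OF T]])
  have "\<forall>i. \<exists>N h h'. in_add R T N \<and> lin R (G i) N h \<and> lin R N (G i) h' \<and>
    (\<forall>x\<in>carrier (G i). h' (h x) = x) \<and> (\<forall>y\<in>carrier (N :: ('a, nat \<Rightarrow> 't) module). h (h' y) = y)"
    using in_add_transport[OF T G] by blast
  then obtain N :: "nat \<Rightarrow> ('a, nat \<Rightarrow> 't) module" and h h' where N: "\<And>i. in_add R T (N i)"
    and h: "\<And>i. lin R (G i) (N i) (h i)" and h': "\<And>i. lin R (N i) (G i) (h' i)"
    and hh: "\<And>i x. x \<in> carrier (G i) \<Longrightarrow> h' i (h i x) = x" "\<And>i y. y \<in> carrier (N i) \<Longrightarrow> h i (h' i y) = y"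
    by metis
  note NM = in_add_left_module[OF N]
  let ?u = "restrict (\<lambda>x. h 0 (u x)) (carrier (regular R))"
  let ?g = "\<lambda>i. restrict (\<lambda>y. h (Suc i) (g i (h' i y))) (carrier (N i))"
  note hc = lin_closed[OF h] and hc' = lin_closed[OF h'] and gc = lin_closed[OF g] and uc = lin_closed[OF u]
  have img: "h' i ` carrier (N i) = carrier (G i)" for i
  proof
    show "carrier (G i) \<subseteq> h' i ` carrier (N i)" using hh(1)[symmetric] hc by blast
  qed (use hc' in blast)
  have hz: "h i y = \<zero>\<^bsub>N i\<^esub> \<longleftrightarrow> y = \<zero>\<^bsub>G i\<^esub>" if "y \<in> carrier (G i)" for i y
    using that hh lin_zero[OF h GM NM] lin_zero[OF h' NM GM] by metis
  have im: "?g i ` carrier (N i) = h (Suc i) ` g i ` carrier (G i)" for i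
    unfolding img[of i, symmetric] by (simp add: image_image)
  have ker: "h i ` {x \<in> carrier (G i). g i x = \<zero>\<^bsub>G (Suc i)\<^esub>} = a_kernel (N i) (N (Suc i)) (?g i)" for i
    unfolding a_kernel_def' using hc hc' hh gc by (force simp: image_iff hz)
  have "zero_module (N i)" if i: "i > m" for i
  proof -
    have "h i y = \<zero>\<^bsub>N i\<^esub>" if "y \<in> carrier (G i)" for y
      using that z[OF i] hz unfolding zero_module_def by blast
    then have "y = \<zero>\<^bsub>N i\<^esub>" if "y \<in> carrier (N i)" for y
      using hc'[OF that] hh(2)[OF that] by metis
    moreover have "\<zero>\<^bsub>N i\<^esub> \<in> carrier (N i)"
      using abelian_group.axioms(1)[OF left_moduleD(2)[OF NM]] by (rule abelian_monoid.zero_closed)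
    ultimately show ?thesis unfolding zero_module_def by blast
  qed
  moreover have "?u \<in> mod_hom R (regular R) (N 0)" by (rule lin_restrict[OF lin_comp[OF u h] RM])
  moreover have "?g i \<in> mod_hom R (N i) (N (Suc i))" for i
    by (rule lin_restrict[OF lin_comp[OF lin_comp[OF h' g] h] NM])
  moreover have "inj_on ?u (carrier (regular R))"
  proof (rule inj_onI)
    fix x y assume xy: "x \<in> carrier (regular R)" "y \<in> carrier (regular R)" "?u x = ?u y"
    have eq: "h 0 (u x) = h 0 (u y)" using xy by simp
    have "u x = h' 0 (h 0 (u x))" by (rule hh(1)[OF uc[OF xy(1)], symmetric])
    also have "\<dots> = u y" unfolding eq by (rule hh(1)[OF uc[OF xy(2)]])
    finally show "x = y" by (rule inj_onD[OF inj _ xy(1,2)])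
  qed
  moreover have "?u ` carrier (regular R) = a_kernel (N 0) (N (Suc 0)) (?g 0)"
    unfolding ker[symmetric] e0[symmetric] by (simp add: image_image)
  moreover have "?g i ` carrier (N i) = a_kernel (N (Suc i)) (N (Suc (Suc i))) (?g (Suc i))" for i
    unfolding im ker[symmetric] e[symmetric] ..
  ultimately show ?thesis unfolding has_add_coresolution_def using N
    by (intro exI[of _ m] exI[of _ N] exI[of _ ?u] exI[of _ ?g]) simp
qed

lemma in_add_mono:
  assumes T: "left_module R T" and Q: "left_module R Q" and N: "in_add R Q N"
    and i: "lin R Q T i" and r: "lin R T Q r" and ri: "\<And>x. x \<in> carrier Q \<Longrightarrow> r (i x) = x"
  shows "in_add R T N"
proof -
  note NM = in_add_left_module[OF N]
  obtain m \<phi> \<psi> where "add_data R Q N m \<phi> \<psi>" using N unfolding in_add_iff[OF Q] by blast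
  then have lin: "\<And>j. j < m \<Longrightarrow> lin R N Q (\<phi> j)" "\<And>j. j < m \<Longrightarrow> lin R Q N (\<psi> j)"
    and sum: "\<And>x. x \<in> carrier N \<Longrightarrow> msum N (\<lambda>j. \<psi> j (\<phi> j x)) m = x"
    unfolding add_data_def by auto
  have "msum N (\<lambda>j. \<psi> j (r (i (\<phi> j x)))) m = x" if "x \<in> carrier N" for x
  proof -
    have "msum N (\<lambda>j. \<psi> j (r (i (\<phi> j x)))) m = msum N (\<lambda>j. \<psi> j (\<phi> j x)) m"
      by (rule msum_cong) (simp add: ri lin_closed[OF lin(1)] that)
    then show ?thesis using sum[OF that] by simp
  qed
  then have "add_data R T N m (\<lambda>j x. i (\<phi> j x)) (\<lambda>j t. \<psi> j (r t))"
    unfolding add_data_def using lin_comp[OF lin(1) i] lin_comp[OF r lin(2)] by blast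
  then show ?thesis unfolding in_add_iff[OF T] using NM by blast
qed

text \<open>\<open>ex0\<close> and \<open>exS\<close> express Ext(DP, \<Lambda>) = 0 in degrees
  below n, that is, exactness at PD 0, ..., PD k of the sequence dual to the minimal resolution.
  Here k is n - 1, kept as a parameter to avoid subtraction.\<close>

locale weak_APR = simple_projective_summand K A P Q E
  for K :: "'k ring" (structure) and A :: "('k, 'a) module" (structure)
    and P :: "('a, 'p) module" and Q :: "('a, 'q) module" and E +
  fixes n k :: nat
  assumes n: "n = Suc k"
    and ex0: "\<And>f. \<lbrakk>lin (opp A) (mres (opp A) (k_dual K A P) 0) (regular (opp A)) f;
        \<forall>x\<in>carrier (mres (opp A) (k_dual K A P) (Suc 0)). f (mdiff (opp A) (k_dual K A P) 0 x) = \<zero>\<^bsub>regular (opp A)\<^esub>\<rbrakk> \<Longrightarrow>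
      \<forall>x\<in>carrier (mres (opp A) (k_dual K A P) 0). f x = \<zero>\<^bsub>regular (opp A)\<^esub>"
    and exS: "\<And>i. Suc i < n \<Longrightarrow>
      ext_zero (opp A) (mres (opp A) (k_dual K A P)) (mdiff (opp A) (k_dual K A P)) (regular (opp A)) i"
begin

definition "del i f = (\<lambda>x\<in>carrier (R (Suc i)). f (d i x))"
text \<open>\<open>0 \<rightarrow> PD 0 \<rightarrow> \<dots> \<rightarrow> PD n \<rightarrow> \<tau> \<rightarrow> 0\<close> with maps \<open>del\<close> and \<open>\<pi>\<close>; \<open>PT\<close>, \<open>dT\<close> below is the same sequence, indexed as a
  resolution of \<open>\<tau>\<close>.\<close>

definition "H = del k ` carrier (PD k)"
definition "\<tau> = quotient_module (PD n) H"
definition "\<pi> x = H +>\<^bsub>PD n\<^esub> x"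
text \<open>A zero module with the carrier type of the \<open>PD i\<close>, to fill the places
  beyond the end of a complex.\<close>

definition "Z0 = (PD 0)\<lparr>carrier := {\<zero>\<^bsub>PD 0\<^esub>}\<rparr>"

section \<open>The sequence dual to the minimal resolution\<close>

lemma PD_zero: "x \<in> carrier (R i) \<Longrightarrow> \<zero>\<^bsub>PD i\<^esub> x = \<zero>\<^bsub>A\<^esub>"
  by (simp add: PD_def A_dual_simps)

lemma PD_eqI: "f \<in> carrier (PD i) \<Longrightarrow> g \<in> carrier (PD i) \<Longrightarrow> (\<And>x. x \<in> carrier (R i) \<Longrightarrow> f x = g x) \<Longrightarrow> f = g"
  unfolding PD_def by (rule A_dual_eqI)

lemma PD_zero_closed: "\<zero>\<^bsub>PD i\<^esub> \<in> carrier (PD i)"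
  by (rule abelian_monoid.zero_closed[OF abelian_group.axioms(1)[OF left_moduleD(2)[OF PD(1)]]])

lemma del_closed: "f \<in> carrier (PD i) \<Longrightarrow> del i f \<in> carrier (PD (Suc i))"
  using A_dualI[OF R(3) lin_comp[OF R(5) PD_lin]] unfolding del_def PD_def by simp

lemma del_apply: "x \<in> carrier (R (Suc i)) \<Longrightarrow> del i f x = f (d i x)"
  by (simp add: del_def)

lemma del_lin: "lin A (PD i) (PD (Suc i)) (del i)"
  by (rule linI) (auto simp: del_closed, auto simp: PD_def A_dual_simps(3,4) del_def lin_closed[OF R(5)] intro!: restrict_ext)

lemma del_zero_iff:
  "f \<in> carrier (PD i) \<Longrightarrow> del i f = \<zero>\<^bsub>PD (Suc i)\<^esub> \<longleftrightarrow> (\<forall>x\<in>carrier (R (Suc i)). f (d i x) = \<zero>\<^bsub>A\<^esub>)"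
  using PD_eqI[OF del_closed PD_zero_closed, of f i] PD_zero[of _ "Suc i"] del_apply[of _ i f] by metis

lemma del0_inj: assumes f: "f \<in> carrier (PD 0)" "del 0 f = \<zero>\<^bsub>PD (Suc 0)\<^esub>" shows "f = \<zero>\<^bsub>PD 0\<^esub>"
proof (rule PD_eqI[OF f(1) PD_zero_closed])
  fix x assume x: "x \<in> carrier (R 0)"
  have "\<forall>x\<in>carrier (R 0). f x = \<zero>\<^bsub>regular (opp A)\<^esub>"
    by (rule ex0[OF PD_lin[OF f(1)]]) (use f del_zero_iff[OF f(1)] in \<open>simp add: regular_simps\<close>)
  then show "f x = \<zero>\<^bsub>PD 0\<^esub> x" using x by (simp add: PD_zero regular_simps)
qed

lemma ker_del:
  assumes i: "Suc i < n" shows "{f \<in> carrier (PD (Suc i)). del (Suc i) f = \<zero>\<^bsub>PD (Suc (Suc i))\<^esub>} = del i ` carrier (PD i)"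
proof (intro equalityI subsetI)
  fix f assume "f \<in> {f \<in> carrier (PD (Suc i)). del (Suc i) f = \<zero>\<^bsub>PD (Suc (Suc i))\<^esub>}"
  then have f: "f \<in> carrier (PD (Suc i))" "\<forall>x\<in>carrier (R (Suc (Suc i))). f (d (Suc i) x) = \<zero>\<^bsub>regular (opp A)\<^esub>"
    using del_zero_iff by (auto simp: regular_simps)
  from ext_zeroD[OF exS[OF i] PD_lin[OF f(1)] f(2)] obtain g where g: "lin (opp A) (R i) (regular (opp A)) g"
    "\<forall>x\<in>carrier (R (Suc i)). f x = g (d i x)" by (elim exE conjE)
  have g': "restrict g (carrier (R i)) \<in> carrier (PD i)" unfolding PD_def by (rule A_dualI[OF R(3) g(1)])
  have "f = del i (restrict g (carrier (R i)))"
    by (rule PD_eqI[OF f(1) del_closed[OF g']]) (simp add: g(2) del_apply lin_closed[OF R(5)])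
  then show "f \<in> del i ` carrier (PD i)" using g' by blast
next
  fix f assume "f \<in> del i ` carrier (PD i)"
  then obtain g where g: "g \<in> carrier (PD i)" "f = del i g" by blast
  have "f (d (Suc i) x) = \<zero>\<^bsub>A\<^esub>" if "x \<in> carrier (R (Suc (Suc i)))" for x
    using that g lin_zero[OF PD_lin[OF g(1)] R(3) O.left_module_algebra]
    by (simp add: del_apply lin_closed[OF R(5)] is_res_dd[OF resR] regular_simps)
  then show "f \<in> {f \<in> carrier (PD (Suc i)). del (Suc i) f = \<zero>\<^bsub>PD (Suc (Suc i))\<^esub>}"
    using del_zero_iff[OF del_closed[OF g(1)]] del_closed[OF g(1)] g(2) by simp
qed

lemma H: "submodule H A (PD n)"
  unfolding H_def n by (rule submodule_image[OF del_lin PD(1) PD(1) left_module.submodule_carrier[OF PD(1)]])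

lemma \<tau>: "left_module A \<tau>" "lin A (PD n) \<tau> \<pi>" "\<pi> ` carrier (PD n) = carrier \<tau>"
    "x \<in> carrier (PD n) \<Longrightarrow> \<pi> x = \<zero>\<^bsub>\<tau>\<^esub> \<longleftrightarrow> x \<in> H"
  unfolding \<tau>_def \<pi>_def using quotient_module_lemmas[OF PD(1) H] by auto

text \<open>The transpose of \<Omega>^(n-1) DP uses the covers of this syzygy and of the next one,
  and these are by construction \<open>R k\<close> and \<open>R n\<close>. So the two records are
  equal and not merely isomorphic.\<close>

lemma tau_minus_eq: "tau_minus K A n P = \<tau>"
proof -
  \<comment> \<open>The carrier type of M stays open because this is applied to DP when k = 0 and to
    a syzygy otherwise.\<close>
  have key: "transpose_module (opp A) M = \<tau>"
    if "fst (projective_cover (opp A) M) = R k" "fst (projective_cover (opp A) (syzygy (opp A) M)) = R n"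
      "snd (projective_cover (opp A) (syzygy (opp A) M)) = d k"
    for M :: "('a, 'z) module"
  proof -
    have "(\<lambda>f :: (nat \<Rightarrow> 'a) \<Rightarrow> 'a. compose (carrier (R n)) f (d k)) = del k"
      by (rule ext) (simp add: del_def compose_def n)
    then show ?thesis
      unfolding transpose_module_def case_prod_beta Let_def that \<tau>_def H_def PD_def by (rule arg_cong)
  qed
  show ?thesis
  proof (cases k)
    case 0
    have "transpose_module (opp A) DP = \<tau>"
      by (rule key)
        (simp_all add: 0 n mres_simps maug_def mdiff_def msyz_def)
    then show ?thesis by (simp add: tau_minus_def n 0)
  next
    case (Suc j)
    have "transpose_module (opp A) (msyz (opp A) DP j) = \<tau>"
      by (rule key)
        (simp_all add: Suc n mres_simps mdiff_def msyz_def)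
    then show ?thesis by (simp add: tau_minus_def n Suc msyz_def)
  qed
qed

section \<open>The projective resolution of \<tau>\<close>

definition "PT j = (if j \<le> n then PD (n - j) else Z0)"
definition "dT j = (if j < n then del (n - Suc j) else (\<lambda>x. \<zero>\<^bsub>PD 0\<^esub>))"

lemma Z0: "left_module A Z0" "zero_module Z0" "carrier Z0 = {\<zero>\<^bsub>PD 0\<^esub>}" "\<zero>\<^bsub>Z0\<^esub> = \<zero>\<^bsub>PD 0\<^esub>" "projective_module A Z0"
  using zero_submodule_simps[OF PD(1)[of 0]] in_add_zero[OF left_module_algebra]
  by (simp_all add: Z0_def projective_module_def)

lemma PT_zero: "n < j \<Longrightarrow> zero_module (PT j)"
  by (simp add: PT_def Z0)

lemma PT: "projective_module A (PT j)" "left_module A (PT j)"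
  by (simp_all add: PT_def PD Z0)

lemma dT: "lin A (PT (Suc j)) (PT j) (dT j)"
proof (cases "j < n")
  case True
  then have "n - j = Suc (n - Suc j)" by simp
  then show ?thesis using del_lin[of "n - Suc j"] True by (simp add: PT_def dT_def)
next
  case False
  have "lin A Z0 (PD 0) (\<lambda>x. \<zero>\<^bsub>PD 0\<^esub>)" by (rule lin_zero_map[OF PD(1)])
  moreover have "lin A Z0 Z0 (\<lambda>x. \<zero>\<^bsub>PD 0\<^esub>)" using lin_zero_map[OF Z0(1)] by (simp add: Z0)
  ultimately show ?thesis using False by (auto simp: PT_def dT_def)
qed

lemma res\<tau>: "is_res A \<tau> PT dT \<pi>"
  unfolding is_res_def
proof (intro conjI allI)
  show "left_module A \<tau>" by (rule \<tau>)
  show "projective_module A (PT i)" "lin A (PT (Suc i)) (PT i) (dT i)" for i by (rule PT dT)+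
  show "lin A (PT 0) \<tau> \<pi>" "\<pi> ` carrier (PT 0) = carrier \<tau>" using \<tau> by (simp_all add: PT_def)
  show "dT 0 ` carrier (PT (Suc 0)) = {x \<in> carrier (PT 0). \<pi> x = \<zero>\<^bsub>\<tau>\<^esub>}"
  proof -
    have "n - Suc 0 = k" "0 < n" "Suc 0 \<le> n" using n by auto
    then have "dT 0 ` carrier (PT (Suc 0)) = H" by (simp add: PT_def dT_def H_def)
    also have "\<dots> = {x \<in> carrier (PD n). \<pi> x = \<zero>\<^bsub>\<tau>\<^esub>}"
      using \<tau>(4) left_module.submoduleD(1)[OF PD(1) H] by blast
    finally show ?thesis by (simp add: PT_def)
  qed
  show "dT (Suc i) ` carrier (PT (Suc (Suc i))) = {x \<in> carrier (PT (Suc i)). dT i x = \<zero>\<^bsub>PT i\<^esub>}" for i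
  proof -
    \<comment> \<open>Inner terms, where \<open>ker_del\<close> applies; the last term PD 0, where
      injectivity is needed; and the zero terms beyond it.\<close>
    consider "Suc i < n" | "Suc i = n" | "Suc i > n" by linarith
    then show ?thesis
    proof cases
      case 1
      define m where "m = n - Suc (Suc i)"
      have m: "n - Suc i = Suc m" "n - i = Suc (Suc m)" "Suc m < n" using 1 by (auto simp: m_def)
      have "dT (Suc i) ` carrier (PT (Suc (Suc i))) = del m ` carrier (PD m)"
        using 1 by (simp add: PT_def dT_def m_def)
      also have "\<dots> = {f \<in> carrier (PD (Suc m)). del (Suc m) f = \<zero>\<^bsub>PD (Suc (Suc m))\<^esub>}" by (rule ker_del[OF m(3), symmetric])
      finally show ?thesis using 1 by (simp add: PT_def dT_def m)
    next
      case 2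
      then have m: "n - Suc i = 0" "n - i = Suc 0" by auto
      have "{x \<in> carrier (PD 0). del 0 x = \<zero>\<^bsub>PD (Suc 0)\<^esub>} = {\<zero>\<^bsub>PD 0\<^esub>}"
        using del0_inj PD_zero_closed lin_zero[OF del_lin PD(1) PD(1), of 0] by auto
      then show ?thesis using 2 m by (simp add: PT_def dT_def Z0)
    next
      case 3
      then show ?thesis using PD_zero_closed by (cases "i \<le> n") (auto simp: PT_def dT_def Z0)
    qed
  qed
qed

section \<open>Vanishing of Ext from \<tau>\<close>

lemma ext_\<tau>_Q: "ext_zero A PT dT Q i"
proof (cases "Suc i \<le> n")
  case False
  then show ?thesis by (intro ext_zero_trivial PT dT Q) (simp add: PT_zero)
next
  case True
  define b where "b = n - Suc i"
  have b: "PT (Suc i) = PD b" "PT i = PD (Suc b)" "dT i = del b"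
    using True by (auto simp: b_def PT_def dT_def Suc_diff_Suc)
  show ?thesis unfolding ext_zero_def b
  proof (intro allI impI)
    fix f assume f: "lin A (PD b) Q f" and c: "\<forall>x\<in>carrier (PT (Suc (Suc i))). f (dT (Suc i) x) = \<zero>\<^bsub>Q\<^esub>"
    let ?i = "\<lambda>y. E' (\<zero>\<^bsub>P\<^esub>, y)"
    have l: "lin A Q (regular A) ?i" by (rule lin_comp[OF lin_inr[OF P] E'])
    have "\<exists>r\<in>carrier (R b). \<forall>\<phi>\<in>carrier (A_dual (opp A) (R b)). ?i (f \<phi>) = \<phi> r"
      using O.A_dual_reflexive[OF R(2)] lin_comp[OF f l] by (simp add: PD_def)
    then obtain r where r: "r \<in> carrier (R b)" and ev: "\<forall>\<phi>\<in>carrier (PD b). ?i (f \<phi>) = \<phi> r"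
      unfolding PD_def by blast
    have i0: "?i \<zero>\<^bsub>Q\<^esub> = \<zero>\<^bsub>A\<^esub>" using lin_zero[OF l Q left_module_algebra] by (simp add: regular_simps)
    have "r \<in> d b ` carrier (R (Suc b))"
    proof (cases b)
      \<comment> \<open>At the last term of the resolution the cocycle condition is empty, and the
        values of f take its place: they lie in Q, hence are killed by \<open>e\<^sub>P\<close> from
        the right. So every functional vanishes at r \<open>e\<^sub>P\<close>, which is therefore
        zero, and p r = (p r) \<open>e\<^sub>P\<close> = 0.\<close>
      case 0
      have "e\<^sub>P \<odot>\<^bsub>R b\<^esub> r = \<zero>\<^bsub>R b\<^esub>"
      proof (rule O.A_dual_separates[OF R(2)])
        interpret Rb: left_module "opp A" "R b" by (rule R(3))
        show "e\<^sub>P \<odot>\<^bsub>R b\<^esub> r \<in> carrier (R b)" using r e\<^sub>P(1) Rb.smult_closed by simp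
        fix \<phi> assume "\<phi> \<in> carrier (A_dual (opp A) (R b))"
        then have \<phi>: "\<phi> \<in> carrier (PD b)" by (simp add: PD_def)
        have "\<phi> (e\<^sub>P \<odot>\<^bsub>R b\<^esub> r) = ?i (f \<phi>) \<otimes>\<^bsub>A\<^esub> e\<^sub>P" using PD_smult[OF \<phi> e\<^sub>P(1) r] ev \<phi> by simp
        also have "\<dots> = \<zero>\<^bsub>A\<^esub>" using lin_closed[OF f \<phi>] by (intro mult_e\<^sub>P_zero) (simp_all add: E'_closed E'_act)
        finally show "\<phi> (e\<^sub>P \<odot>\<^bsub>R b\<^esub> r) = \<zero>\<^bsub>opp A\<^esub>" by simp
      qed
      then have "p r = \<zero>\<^bsub>DP\<^esub>"
        using lin_smult[OF R(4), of e\<^sub>P r] e\<^sub>P(1) r DP_e[OF lin_closed[OF R(4)], of r] lin_zero[OF R(4) R(3) DP(1)] 0 by simp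
      then show ?thesis using R(7) r 0 by simp
    next
      case (Suc b')
      then have bb: "PT (Suc (Suc i)) = PD b'" "dT (Suc i) = del b'"
      proof -
        have "n - Suc (Suc i) = b'" "Suc (Suc i) \<le> n" "Suc i < n" using Suc True by (auto simp: b_def)
        then show "PT (Suc (Suc i)) = PD b'" "dT (Suc i) = del b'" by (simp_all add: PT_def dT_def)
      qed
      \<comment> \<open>The cocycle condition says that every functional vanishes at the image of r,
        and functionals separate the elements of a projective module.\<close>
      have "d b' r = \<zero>\<^bsub>R b'\<^esub>"
      proof (rule O.A_dual_separates[OF R(2)])
        show "d b' r \<in> carrier (R b')" using lin_closed[OF R(5)] r Suc by simp
        fix \<phi> assume "\<phi> \<in> carrier (A_dual (opp A) (R b'))"
        then have \<phi>: "\<phi> \<in> carrier (PD b')" by (simp add: PD_def)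
        have "\<phi> (d b' r) = ?i (f (del b' \<phi>))" using ev del_closed[OF \<phi>] r Suc by (simp add: del_apply)
        also have "\<dots> = \<zero>\<^bsub>A\<^esub>" using c \<phi> i0 by (simp add: bb)
        finally show "\<phi> (d b' r) = \<zero>\<^bsub>opp A\<^esub>" by simp
      qed
      then show ?thesis using R(8)[of b'] r Suc by simp
    qed
    then obtain s where s: "s \<in> carrier (R (Suc b))" "r = d b s" by blast
    \<comment> \<open>With r = d s, evaluation at r is evaluation at s after the dual differential,
      so evaluation at s is the factorization sought.\<close>
    have "lin A (PD (Suc b)) Q (\<lambda>\<psi>. snd (E (\<psi> s)))"
      by (rule lin_comp[OF lin_comp[OF lin_eval[OF s(1)] E] lin_snd])
    moreover have "f \<phi> = snd (E (del b \<phi> s))" if \<phi>: "\<phi> \<in> carrier (PD b)" for \<phi>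
    proof -
      have "del b \<phi> s = ?i (f \<phi>)" using bspec[OF ev \<phi>] by (simp add: del_apply[OF s(1)] s(2))
      then show ?thesis by (simp add: E_E'[OF P.M.zero_closed lin_closed[OF f \<phi>]])
    qed
    ultimately show "\<exists>g. lin A (PD (Suc b)) Q g \<and> (\<forall>x\<in>carrier (PD b). f x = g (del b x))" by blast
  qed
qed

lemma ext_\<tau>_PD: "ext_zero A PT dT (PD (Suc m)) i"
  by (rule ext_zero_in_add[OF Q PD_Suc_in_add PT(2) ext_\<tau>_Q])

definition "Img m = (PD (Suc m))\<lparr>carrier := del m ` carrier (PD m)\<rparr>"

lemma Img: "left_module A (Img m)"
  unfolding Img_def
  by (rule left_module.left_module_sub[OF PD(1) submodule_image[OF del_lin PD(1) PD(1) left_module.submodule_carrier[OF PD(1)]]])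

text \<open>Passing from (m + 1, i) to (m, i + 1) preserves n \<le> i + m. At m = 0 this puts the
  degree i + 1 beyond the length n of the resolution, where everything vanishes.
  \<open>Img m\<close> is the kernel of the map from \<open>PD (Suc m)\<close> onto
  \<open>Img (Suc m)\<close>.\<close>

lemma ext_\<tau>_Img: "m < n \<Longrightarrow> n \<le> i + m \<Longrightarrow> ext_zero A PT dT (Img m) i"
proof (induct m arbitrary: i)
  case 0
  then show ?case by (intro ext_zero_trivial PT dT Img) (simp add: PT_zero)
next
  case (Suc m)
  have "ext_zero A PT dT (Img m) (Suc i)" by (rule Suc(1)) (use Suc(2,3) in auto)
  then have "ext_zero A PT dT ((PD (Suc m))\<lparr>carrier := {y \<in> carrier (PD (Suc m)). del (Suc m) y = \<zero>\<^bsub>Img (Suc m)\<^esub>}\<rparr>) (Suc i)"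
    using ker_del[OF Suc(2)] by (simp add: Img_def)
  moreover have "lin A (PD (Suc m)) (Img (Suc m)) (del (Suc m))" using del_lin[of "Suc m"] by (auto simp: lin_def Img_def)
  moreover have "del (Suc m) ` carrier (PD (Suc m)) = carrier (Img (Suc m))" by (simp add: Img_def)
  ultimately show ?case using ext_zero_shift[OF res\<tau> PD(1) Img _ _ ext_\<tau>_PD] by blast
qed

lemma ext_\<tau>_\<tau>: "ext_zero A PT dT \<tau> i"
proof -
  have "ext_zero A PT dT (Img k) (Suc i)" by (rule ext_\<tau>_Img) (use n in auto)
  moreover have "{y \<in> carrier (PD n). \<pi> y = \<zero>\<^bsub>\<tau>\<^esub>} = del k ` carrier (PD k)"
    using \<tau>(4) left_module.submoduleD(1)[OF PD(1) H] unfolding H_def by blast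
  ultimately have "ext_zero A PT dT ((PD n)\<lparr>carrier := {y \<in> carrier (PD n). \<pi> y = \<zero>\<^bsub>\<tau>\<^esub>}\<rparr>) (Suc i)"
    by (simp add: Img_def n)
  then show ?thesis
    using ext_zero_shift[OF res\<tau> PD(1) \<tau>(1) \<tau>(2,3)] ext_\<tau>_PD[of k i] by (simp add: n)
qed

section \<open>The module T: its resolution and projective dimension\<close>

lemma n_pos: "0 < n"
  using n by simp

abbreviation "T \<equiv> direct_sum \<tau> Q"
text \<open>Q concentrated in degree 0; serves as its own resolution and again as the constant
  summand Q = Q of the coresolution.\<close>

definition "QQ i = (if i = 0 then Q else Q\<lparr>carrier := {\<zero>\<^bsub>Q\<^esub>}\<rparr>)" for i :: nat
abbreviation "S i \<equiv> direct_sum (PT i) (QQ i)"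
abbreviation "dS \<equiv> (\<lambda>i z. (dT i (fst z), \<zero>\<^bsub>Q\<^esub>))"

lemma T: "left_module A T" by (rule left_module_direct_sum[OF \<tau>(1) Q])

lemma resQ: "is_res A Q QQ (\<lambda>i x. \<zero>\<^bsub>Q\<^esub>) (\<lambda>x. x)"
  using is_res_projective[OF projective_Q] unfolding QQ_def .

lemma QQ_zero: "zero_module (QQ (Suc i))"
  using zero_submodule_simps[OF Q] by (simp add: QQ_def)

lemma resT: "is_res A T S dS (\<lambda>z. (\<pi> (fst z), snd z))"
  using is_res_direct_sum[OF res\<tau> resQ] .

lemma ext_T_T: "ext_zero A S dS T i"
proof (rule ext_zero_direct_sum_left)
  note q = is_resD[OF resQ]
  show "ext_zero A PT dT T i" by (rule ext_zero_direct_sum_right[OF ext_\<tau>_\<tau> ext_\<tau>_Q])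
  show "ext_zero A QQ (\<lambda>i x. \<zero>\<^bsub>Q\<^esub>) T i" by (rule ext_zero_trivial) (rule q(3) T q(5) QQ_zero)+
qed (rule PT(2) dT T is_resD(3,5)[OF resQ])+

lemma S_zero: assumes "n < j" shows "zero_module (S j)"
proof -
  obtain i where "j = Suc i" using assms by (cases j) auto
  then show ?thesis using PT_zero[OF assms] QQ_zero[of i] by (auto simp: zero_module_def direct_sum_simps)
qed

text \<open>The index k stands for degree k + 1 = n. The cocycle is the isomorphism PD 0 \<cong> P
  on the last term; as a coboundary it would factor through a map PD 1 \<rightarrow> P on that
  component, and such maps vanish.\<close>

lemma not_ext_T_P: "\<not> ext_zero A S dS P k"
proof
  assume z: "ext_zero A S dS P k"
  obtain \<Theta> where \<Theta>: "lin A (PD 0) P \<Theta>" "bij_betw \<Theta> (carrier (PD 0)) (carrier P)" using PD0_iso by blast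
  have pt: "PT (Suc k) = PD 0" "PT k = PD (Suc 0)" by (simp_all add: PT_def n[symmetric]) (simp add: n)
  note q = is_resD[OF resQ]
  have f: "lin A (S (Suc k)) P (\<lambda>z. \<Theta> (fst z))" unfolding pt by (rule lin_comp[OF lin_fst \<Theta>(1)])
  have "\<not> Suc k < n" using n by simp
  then have "dT (Suc k) x = \<zero>\<^bsub>PD 0\<^esub>" for x by (simp add: dT_def)
  then have "\<forall>x\<in>carrier (S (Suc (Suc k))). \<Theta> (fst (dS (Suc k) x)) = \<zero>\<^bsub>P\<^esub>"
    using lin_zero[OF \<Theta>(1) PD(1) P] by simp
  from ext_zeroD[OF z f this] obtain g where g: "lin A (S k) P g"
    and gf: "\<forall>x\<in>carrier (S (Suc k)). \<Theta> (fst x) = g (dT k (fst x), \<zero>\<^bsub>Q\<^esub>)" by (elim exE conjE)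
  have zq: "\<zero>\<^bsub>QQ k\<^esub> = \<zero>\<^bsub>Q\<^esub>" by (simp add: QQ_def)
  have g': "lin A (PD (Suc 0)) P (\<lambda>x. g (x, \<zero>\<^bsub>Q\<^esub>))"
    using lin_comp[OF lin_inl[OF q(3)] g] unfolding pt zq .
  have "\<Theta> x = \<zero>\<^bsub>P\<^esub>" if x: "x \<in> carrier (PD 0)" for x
  proof -
    have "dT k x \<in> carrier (PD (Suc 0))" using lin_closed[OF dT[of k]] x unfolding pt by blast
    from hom_PD_P[OF g' this] have "g (dT k x, \<zero>\<^bsub>Q\<^esub>) = \<zero>\<^bsub>P\<^esub>" .
    moreover have "(x, \<zero>\<^bsub>Q\<^esub>) \<in> carrier (S (Suc k))" using x unfolding pt by (simp add: direct_sum_simps QQ_def)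
    ultimately show ?thesis using gf by fastforce
  qed
  then have "\<Theta> ` carrier (PD 0) \<subseteq> {\<zero>\<^bsub>P\<^esub>}" by blast
  then have "x0 = \<zero>\<^bsub>P\<^esub>" using \<Theta>(2) x0y0(1) unfolding bij_betw_def by blast
  then show False using x0_nonzero by blast
qed

lemma proj_dim_T: "proj_dim A T = enat n"
proof (rule antisym)
  show "proj_dim A T \<le> enat n" by (rule proj_dim_le[OF resT S_zero])
  show "enat n \<le> proj_dim A T" using proj_dim_ge[OF resT P not_ext_T_P] unfolding n[symmetric] .
qed

lemma fin_dim_T: "fin_dim_module K A T"
  unfolding fin_dim_module_iff
  using T fg_direct_sum[OF \<tau>(1) Q fg_image[OF PD(1) \<tau>(1-3) fg_projective[OF PD(2)]] fg_Q] by blast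

section \<open>The coresolution of \<Lambda>\<close>

definition "G1 i = (if i < n then PD (Suc i) else Z0)"
definition "G2 i = (if i = n then \<tau> else \<tau>\<lparr>carrier := {\<zero>\<^bsub>\<tau>\<^esub>}\<rparr>)"
abbreviation "G i \<equiv> direct_sum (G1 i) (direct_sum (G2 i) (QQ i))"
text \<open>The modules PD, \<tau> and Q have different carrier types, while a family over i needs a
  single one. So each term is a sum of three: PD (i + 1) for i < n, \<tau> at i = n, and Q at i = 0,
  with zero modules elsewhere. Because of the shift, \<open>g i\<close> is
  \<open>del (Suc i)\<close> as long as i + 1 < n and \<pi> for i + 1 = n.\<close>

definition "g i z = (if Suc i < n then del (Suc i) (fst z) else \<zero>\<^bsub>PD 0\<^esub>,
    if Suc i = n then \<pi> (fst z) else \<zero>\<^bsub>\<tau>\<^esub>, \<zero>\<^bsub>Q\<^esub>)"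

lemma in_add_T:
  shows "in_add A T \<tau>" "in_add A T Q" "in_add A T (PD (Suc i))"
proof -
  show "in_add A T \<tau>" by (rule in_add_summand[OF T T \<tau>(1) lin_inl[OF Q] lin_fst]) simp
  show "in_add A T Q" by (rule in_add_summand[OF T T Q lin_inr[OF \<tau>(1)] lin_snd]) simp
  show "in_add A T (PD (Suc i))"
    by (rule in_add_mono[OF T Q PD_Suc_in_add lin_inr[OF \<tau>(1)] lin_snd]) simp
qed

lemma G12: "in_add A T (G1 i)" "in_add A T (G2 i)" "in_add A T (QQ i)" "n < i \<Longrightarrow> zero_module (G i)"
proof -
  note zt = zero_submodule_simps[OF \<tau>(1)] and zq = zero_submodule_simps[OF Q]
  show "in_add A T (G1 i)" using in_add_T(3) in_add_zero[OF T Z0(1,2)] by (simp add: G1_def)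
  show "in_add A T (G2 i)" using in_add_T(1) in_add_zero[OF T zt] by (simp add: G2_def)
  show "in_add A T (QQ i)" using in_add_T(2) in_add_zero[OF T zq] by (simp add: QQ_def)
  show "n < i \<Longrightarrow> zero_module (G i)" using zt zq Z0 by (auto simp: zero_module_def direct_sum_simps G1_def G2_def QQ_def)
qed

lemma G_zero: "\<zero>\<^bsub>G1 i\<^esub> = (if i < n then \<zero>\<^bsub>PD (Suc i)\<^esub> else \<zero>\<^bsub>PD 0\<^esub>)" "\<zero>\<^bsub>G2 i\<^esub> = \<zero>\<^bsub>\<tau>\<^esub>" "\<zero>\<^bsub>QQ i\<^esub> = \<zero>\<^bsub>Q\<^esub>"
  by (simp_all add: G1_def G2_def QQ_def Z0)

lemma g_lin: "lin A (G i) (G (Suc i)) (g i)"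
proof -
  note G1M = in_add_left_module[OF G12(1)] and G2M = in_add_left_module[OF G12(2)] and QM = in_add_left_module[OF G12(3)]
  have 1: "lin A (G1 i) (G1 (Suc i)) (\<lambda>x. if Suc i < n then del (Suc i) x else \<zero>\<^bsub>PD 0\<^esub>)"
    using del_lin[of "Suc i"] lin_zero_map[OF G1M[of "Suc i"], of "G1 i"] by (cases "Suc i < n") (simp_all add: G1_def Z0)
  have 2: "lin A (G1 i) (G2 (Suc i)) (\<lambda>x. if Suc i = n then \<pi> x else \<zero>\<^bsub>\<tau>\<^esub>)"
  proof (cases "Suc i = n")
    case True
    then have "G1 i = PD n" "G2 (Suc i) = \<tau>" by (simp_all add: G1_def G2_def)
    then show ?thesis using \<tau>(2) True by simp
  next
    case False
    then show ?thesis using lin_zero_map[OF G2M[of "Suc i"], of "G1 i"] by (simp add: G_zero)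
  qed
  have 3: "lin A (G1 i) (QQ (Suc i)) (\<lambda>x. \<zero>\<^bsub>Q\<^esub>)"
    using lin_zero_map[OF QM[of "Suc i"], of "G1 i"] by (simp add: G_zero)
  show ?thesis unfolding g_def
    by (rule lin_comp[OF lin_fst lin_pair[OF 1 lin_pair[OF 2 3]]])
qed

lemma H_eq: "H = {x \<in> carrier (PD n). \<pi> x = \<zero>\<^bsub>\<tau>\<^esub>}"
  using \<tau>(4) left_module.submoduleD(1)[OF PD(1) H] by blast

lemma G_carrier:
  "Suc i < n \<Longrightarrow> carrier (G (Suc i)) = carrier (PD (Suc (Suc i))) \<times> {\<zero>\<^bsub>\<tau>\<^esub>} \<times> {\<zero>\<^bsub>Q\<^esub>}"
  "Suc i = n \<Longrightarrow> carrier (G (Suc i)) = {\<zero>\<^bsub>PD 0\<^esub>} \<times> carrier \<tau> \<times> {\<zero>\<^bsub>Q\<^esub>}"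
  "n < Suc i \<Longrightarrow> carrier (G (Suc i)) = {\<zero>\<^bsub>PD 0\<^esub>} \<times> {\<zero>\<^bsub>\<tau>\<^esub>} \<times> {\<zero>\<^bsub>Q\<^esub>}"
  "carrier (G 0) = carrier (PD (Suc 0)) \<times> {\<zero>\<^bsub>\<tau>\<^esub>} \<times> carrier Q"
  using n_pos by (auto simp: direct_sum_simps G1_def G2_def QQ_def Z0)

lemma g_kernel:
  assumes z: "z \<in> carrier (G i)" and i: "i < n"
  shows "g i z = \<zero>\<^bsub>G (Suc i)\<^esub> \<longleftrightarrow> fst z \<in> del i ` carrier (PD i)"
proof -
  have x: "fst z \<in> carrier (PD (Suc i))" using z i by (auto simp: direct_sum_simps G1_def)
  consider "Suc i < n" | "Suc i = n" using i by linarith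
  then show ?thesis
  proof cases
    case 1
    then show ?thesis using x unfolding ker_del[OF 1, symmetric] by (simp add: g_def direct_sum_simps G_zero)
  next
    case 2
    then have ik: "i = k" using n by simp
    have "fst z \<in> H \<longleftrightarrow> \<pi> (fst z) = \<zero>\<^bsub>\<tau>\<^esub>" using x 2 unfolding H_eq by simp
    then show ?thesis using 2 by (simp add: g_def direct_sum_simps G_zero H_def ik)
  qed
qed

lemma coresolution: "has_add_coresolution A T"
proof -
  obtain \<Theta> where \<Theta>: "lin A (PD 0) P \<Theta>" "bij_betw \<Theta> (carrier (PD 0)) (carrier P)" using PD0_iso by blast
  define \<Theta>' where "\<Theta>' = inv_into (carrier (PD 0)) \<Theta>"
  have \<Theta>': "lin A P (PD 0) \<Theta>'" unfolding \<Theta>'_def by (rule lin_inv_into[OF \<Theta> PD(1)])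
  have bij': "bij_betw \<Theta>' (carrier P) (carrier (PD 0))" unfolding \<Theta>'_def by (rule bij_betw_inv_into[OF \<Theta>(2)])
  \<comment> \<open>P is embedded through its copy PD 0, followed by \<open>del 0\<close>, and Q by
    the identity. The middle component is the place of \<tau>, which is zero at index 0 since n >
    0.\<close>
  define u where "u a = (del 0 (\<Theta>' (fst (E a))), \<zero>\<^bsub>\<tau>\<^esub>, snd (E a))" for a
  have G0: "G1 0 = PD (Suc 0)" "QQ 0 = Q" using n_pos by (simp_all add: G1_def QQ_def)
  have Eimg: "E ` carrier (regular A) = carrier P \<times> carrier Q" using E_bij by (simp add: bij_betw_def direct_sum_simps)
  have u: "lin A (regular A) (G 0) u"
  proof -
    have 1: "lin A (regular A) (G1 0) (\<lambda>a. del 0 (\<Theta>' (fst (E a))))"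
      unfolding G0 by (rule lin_comp[OF lin_comp[OF lin_comp[OF E lin_fst] \<Theta>'] del_lin])
    have 2: "lin A (regular A) (G2 0) (\<lambda>a. \<zero>\<^bsub>\<tau>\<^esub>)"
      using lin_zero_map[OF in_add_left_module[OF G12(2)[of 0]], of "regular A"] by (simp add: G_zero)
    have 3: "lin A (regular A) (QQ 0) (\<lambda>a. snd (E a))" unfolding G0 by (rule lin_comp[OF E lin_snd])
    show ?thesis unfolding u_def by (rule lin_pair[OF 1 lin_pair[OF 2 3]])
  qed
  have del_inj: "inj_on (del 0) (carrier (PD 0))" by (rule lin_inj_onI[OF del_lin PD(1) PD(1) del0_inj])
  have inj: "inj_on u (carrier (regular A))"
  proof (rule inj_onI)
    fix a b assume ab: "a \<in> carrier (regular A)" "b \<in> carrier (regular A)" "u a = u b"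
    have ea: "fst (E a) \<in> carrier P" "fst (E b) \<in> carrier P"
      using lin_closed[OF E ab(1)] lin_closed[OF E ab(2)] by (auto simp: direct_sum_simps)
    have "del 0 (\<Theta>' (fst (E a))) = del 0 (\<Theta>' (fst (E b)))" "snd (E a) = snd (E b)" using ab(3) by (simp_all add: u_def)
    then have "\<Theta>' (fst (E a)) = \<Theta>' (fst (E b))"
      using inj_onD[OF del_inj _ lin_closed[OF \<Theta>' ea(1)] lin_closed[OF \<Theta>' ea(2)]] by blast
    then have "fst (E a) = fst (E b)" using bij' ea unfolding bij_betw_def by (meson inj_onD)
    then have "E a = E b" using \<open>snd (E a) = snd (E b)\<close> by (rule prod_eqI)
    then show "a = b" using E_bij ab(1,2) unfolding bij_betw_def by (meson inj_onD)
  qed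
  have uimg: "u ` carrier (regular A) = del 0 ` carrier (PD 0) \<times> {\<zero>\<^bsub>\<tau>\<^esub>} \<times> carrier Q"
  proof -
    have "u ` carrier (regular A) = (\<lambda>w. (del 0 (\<Theta>' (fst w)), \<zero>\<^bsub>\<tau>\<^esub>, snd w)) ` (carrier P \<times> carrier Q)"
      unfolding Eimg[symmetric] by (simp add: u_def image_image)
    also have "\<dots> = del 0 ` \<Theta>' ` carrier P \<times> {\<zero>\<^bsub>\<tau>\<^esub>} \<times> carrier Q" by force
    finally show ?thesis using bij' by (simp add: bij_betw_def)
  qed
  have dc: "del i ` carrier (PD i) \<subseteq> carrier (PD (Suc i))" for i using del_closed by blast
  show ?thesis
  proof (rule has_add_coresolutionI[OF T _ G12(4) u g_lin inj])
    show "in_add A T (G i)" for i by (rule in_add_direct_sum[OF T G12(1) in_add_direct_sum[OF T G12(2,3)]])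
    show "u ` carrier (regular A) = {x \<in> carrier (G 0). g 0 x = \<zero>\<^bsub>G (Suc 0)\<^esub>}"
    proof -
      have "{x \<in> carrier (G 0). g 0 x = \<zero>\<^bsub>G (Suc 0)\<^esub>} = {x \<in> carrier (G 0). fst x \<in> del 0 ` carrier (PD 0)}"
        using g_kernel[of _ 0] n by blast
      also have "\<dots> = del 0 ` carrier (PD 0) \<times> {\<zero>\<^bsub>\<tau>\<^esub>} \<times> carrier Q"
        unfolding G_carrier using dc[of 0] by auto
      finally show ?thesis using uimg by simp
    qed
    show "g i ` carrier (G i) = {x \<in> carrier (G (Suc i)). g (Suc i) x = \<zero>\<^bsub>G (Suc (Suc i))\<^esub>}" for i
    proof -
      \<comment> \<open>Putting zero in the other components shows that the projection to the first
        one is onto.\<close>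
      have ne: "\<zero>\<^bsub>G i\<^esub> \<in> carrier (G i)"
        using abelian_group.axioms(1)[OF left_moduleD(2)[OF in_add_left_module[OF in_add_direct_sum[OF T G12(1) in_add_direct_sum[OF T G12(2,3)]]]]]
        by (rule abelian_monoid.zero_closed)
      have fst_img: "fst ` carrier (G i) = carrier (G1 i)"
        using ne by (force simp: direct_sum_simps image_iff)
      consider "Suc i < n" | "Suc i = n" | "n < Suc i" by linarith
      then show ?thesis
      proof cases
        case 1
        have "g i ` carrier (G i) = (\<lambda>x. (del (Suc i) x, \<zero>\<^bsub>\<tau>\<^esub>, \<zero>\<^bsub>Q\<^esub>)) ` fst ` carrier (G i)"
          using 1 by (simp add: g_def image_image)
        also have "\<dots> = del (Suc i) ` carrier (PD (Suc i)) \<times> {\<zero>\<^bsub>\<tau>\<^esub>} \<times> {\<zero>\<^bsub>Q\<^esub>}"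
          unfolding fst_img using 1 by (auto simp: G1_def)
        also have "\<dots> = {x \<in> carrier (G (Suc i)). fst x \<in> del (Suc i) ` carrier (PD (Suc i))}"
          unfolding G_carrier(1)[OF 1] using dc[of "Suc i"] by auto
        also have "\<dots> = {x \<in> carrier (G (Suc i)). g (Suc i) x = \<zero>\<^bsub>G (Suc (Suc i))\<^esub>}"
          using g_kernel[OF _ 1] by blast
        finally show ?thesis .
      next
        case 2
        have "g i ` carrier (G i) = (\<lambda>x. (\<zero>\<^bsub>PD 0\<^esub>, \<pi> x, \<zero>\<^bsub>Q\<^esub>)) ` fst ` carrier (G i)"
          using 2 by (simp add: g_def image_image)
        also have "\<dots> = {\<zero>\<^bsub>PD 0\<^esub>} \<times> \<pi> ` carrier (PD n) \<times> {\<zero>\<^bsub>Q\<^esub>}"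
          unfolding fst_img using 2 by (auto simp: G1_def)
        also have "\<dots> = carrier (G (Suc i))" unfolding G_carrier(2)[OF 2] \<tau>(3) ..
        also have "\<dots> = {x \<in> carrier (G (Suc i)). g (Suc i) x = \<zero>\<^bsub>G (Suc (Suc i))\<^esub>}"
          using 2 by (auto simp: g_def direct_sum_simps G_zero)
        finally show ?thesis .
      next
        case 3
        have gz: "g j z = (\<zero>\<^bsub>PD 0\<^esub>, \<zero>\<^bsub>\<tau>\<^esub>, \<zero>\<^bsub>Q\<^esub>)" if "n < Suc j" for j z using that by (simp add: g_def)
        have "g i ` carrier (G i) = (\<lambda>z. (\<zero>\<^bsub>PD 0\<^esub>, \<zero>\<^bsub>\<tau>\<^esub>, \<zero>\<^bsub>Q\<^esub>)) ` carrier (G i)"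
          by (rule image_cong[OF refl gz[OF 3]])
        also have "\<dots> = {(\<zero>\<^bsub>PD 0\<^esub>, \<zero>\<^bsub>\<tau>\<^esub>, \<zero>\<^bsub>Q\<^esub>)}" by (rule image_constant[OF ne])
        finally have "g i ` carrier (G i) = {(\<zero>\<^bsub>PD 0\<^esub>, \<zero>\<^bsub>\<tau>\<^esub>, \<zero>\<^bsub>Q\<^esub>)}" .
        moreover have "g (Suc i) x = \<zero>\<^bsub>G (Suc (Suc i))\<^esub>" for x
          using gz[of "Suc i"] 3 by (simp add: direct_sum_simps G_zero)
        ultimately show ?thesis unfolding G_carrier(3)[OF 3] by auto
      qed
    qed
  qed
qed

lemma tilting_T: "tilting_module K A T"
  unfolding tilting_module_def
proof (intro conjI allI impI fin_dim_T coresolution)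
  show "proj_dim A T \<noteq> \<infinity>" by (simp add: proj_dim_T)
  fix i :: nat assume "0 < i"
  then obtain j where "i = Suc j" by (cases i) auto
  then show "zero_module (Ext A i T T)" using zero_module_Ext[OF resT T ext_T_T] by simp
qed

end

theorem theorem3p2:
  fixes K :: "'k ring" and \<Lambda> :: "('k, 'a) module"
    and P :: "('a, 'p) module" and Q :: "('a, 'q) module"
    and T :: "('a, ((nat \<Rightarrow> 'a) \<Rightarrow> 'a) set \<times> 'q) module"
    and n :: nat
  assumes "fin_dim_algebra K \<Lambda>" and "basic_algebra \<Lambda>" and "n \<ge> 1"
    and "fin_dim_module K \<Lambda> P" and "simple_module \<Lambda> P" and "projective_module \<Lambda> P"
    and "\<forall>i<n. zero_module (Ext \<Lambda> i (k_dual K (opp \<Lambda>) (regular (opp \<Lambda>))) P)"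
    and "fin_dim_module K \<Lambda> Q" and "mod_iso \<Lambda> (regular \<Lambda>) (direct_sum P Q)"
    and "T = direct_sum (tau_minus K \<Lambda> n P) Q"
  shows "tilting_module K \<Lambda> T \<and> proj_dim \<Lambda> T = enat n"
proof -
  interpret fin_dim_algebra K \<Lambda> by fact
  interpret O: fin_dim_algebra K "opp \<Lambda>" by (rule opp_algebra)
  have P: "left_module \<Lambda> P" "fg \<Lambda> P" and Q: "left_module \<Lambda> Q"
    using assms(4,8) by (simp_all add: fin_dim_module_iff)
  obtain E where E: "lin \<Lambda> (regular \<Lambda>) (direct_sum P Q) E"
    and bij: "bij_betw E (carrier (regular \<Lambda>)) (carrier (direct_sum P Q))"
    using mod_iso_lin[OF assms(9)] .
  have hom: "\<forall>g. lin \<Lambda> Q P g \<longrightarrow> (\<forall>y\<in>carrier Q. g y = \<zero>\<^bsub>P\<^esub>)"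
    using basic_hom_zero[OF algebra_is_ring assms(2,5,6) Q E bij] by blast
  interpret S: simple_projective_summand K \<Lambda> P Q E
    by (intro simple_projective_summand.intro simple_projective_summand_axioms.intro)
      (fact assms(1) P Q E bij assms(5) hom)+
  let ?L = "regular (opp \<Lambda>)"
  let ?X = "k_dual K (opp \<Lambda>) ?L"
  have gL: "fg (opp \<Lambda>) ?L"
    using fg_projective in_add_refl[OF O.left_module_algebra] unfolding projective_module_def by blast
  have X: "left_module \<Lambda> ?X" "fg \<Lambda> ?X"
    using O.left_module_k_dual[OF O.left_module_algebra] O.fg_k_dual[OF O.left_module_algebra gL] by simp_all
  \<comment> \<open>Z is the resolution that \<open>Ext\<close> selects, so the hypothesis on Ext
    becomes a statement about Z.\<close>
  obtain Z dZ eZ where Z: "projective_resolution \<Lambda> ?X Z dZ eZ"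
    and S: "\<forall>i. zero_module (Ext \<Lambda> (Suc i) ?X P) \<longleftrightarrow> ext_zero \<Lambda> Z dZ P i"
    and z: "zero_module (Ext \<Lambda> 0 ?X P) \<longrightarrow> (\<forall>f. lin \<Lambda> (Z 0) P f \<longrightarrow>
       (\<forall>x\<in>carrier (Z (Suc 0)). f (dZ 0 x) = \<zero>\<^bsub>P\<^esub>) \<longrightarrow> (\<forall>x\<in>carrier (Z 0). f x = \<zero>\<^bsub>P\<^esub>))"
    using ext_zero_Ext[OF X(1) P(1) projective_resolution_exists[OF X]] by (elim exE conjE)
  have n: "n = Suc (n - 1)" using assms(3) by simp
  have h0: "\<forall>x\<in>carrier (Z 0). f x = \<zero>\<^bsub>P\<^esub>"
    if "lin \<Lambda> (Z 0) P f" "\<forall>x\<in>carrier (Z (Suc 0)). f (dZ 0 x) = \<zero>\<^bsub>P\<^esub>" for f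
    using z assms(3,7) that by simp
  have hS: "ext_zero \<Lambda> Z dZ P i" if "Suc i < n" for i
    using spec[OF S, of i] assms(7)[rule_format, OF that] by (rule iffD1)
  \<comment> \<open>Balance with N = P and L = \<Lambda> as a right module; its conclusions are the
    assumptions \<open>ex0\<close> and \<open>exS\<close> of \<open>weak_APR\<close>.\<close>
  note bal = Ext_balance[OF P O.left_module_algebra gL projective_resolution_is_res[OF Z X(1)] S.resR, where n = n]
  interpret W: weak_APR K \<Lambda> P Q E n "n - 1"
  proof (intro weak_APR.intro weak_APR_axioms.intro)
    show "simple_projective_summand K \<Lambda> P Q E" by (rule S.simple_projective_summand_axioms)
    show "n = Suc (n - 1)" by (rule n)
    show "ext_zero (opp \<Lambda>) S.R S.d ?L i" if "Suc i < n" for i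
    proof (rule bal(2))
      show "\<forall>x\<in>carrier (Z 0). f x = \<zero>\<^bsub>P\<^esub>"
        if "lin \<Lambda> (Z 0) P f" "\<forall>x\<in>carrier (Z (Suc 0)). f (dZ 0 x) = \<zero>\<^bsub>P\<^esub>" for f by (rule h0[OF that])
      show "ext_zero \<Lambda> Z dZ P i" if "Suc i < n" for i by (rule hS[OF that])
    qed (fact that)
    show "\<forall>x\<in>carrier (S.R 0). f x = \<zero>\<^bsub>?L\<^esub>"
      if "lin (opp \<Lambda>) (S.R 0) ?L f" "\<forall>x\<in>carrier (S.R (Suc 0)). f (S.d 0 x) = \<zero>\<^bsub>?L\<^esub>" for f
    proof (rule bal(1))
      show "\<forall>x\<in>carrier (Z 0). f x = \<zero>\<^bsub>P\<^esub>"
        if "lin \<Lambda> (Z 0) P f" "\<forall>x\<in>carrier (Z (Suc 0)). f (dZ 0 x) = \<zero>\<^bsub>P\<^esub>" for f by (rule h0[OF that])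
      show "ext_zero \<Lambda> Z dZ P i" if "Suc i < n" for i by (rule hS[OF that])
    qed (fact that)+
  qed
  show ?thesis unfolding assms(10) W.tau_minus_eq using W.tilting_T W.proj_dim_T by blast
qed

end
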